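(* Let $u_1,u_3:\partial D_\zeta\to\mathbb{R}$ satisfy the Dini conditions $\int_0^1\frac{\omega(u_j,\eta)}{\eta}\,d\eta<\infty$, $j\in\{1,3\}$. Suppose that the conformal mapping $\sigma$ has a continuous contour derivative $\sigma'(T)$ on $\Gamma$ with $\sigma'(T)\ne0$ for all $T\in\Gamma$, and that $$\int_{0}^{2}\frac{\omega_{\Gamma}(\sigma',\eta)}{\eta}\,\ln\frac{3}{\eta}\,d\eta<\infty .$$ Then the following assertions are equivalent: (I) the system of integral equations $$\frac12 g_1(t)+\frac1{2\pi}\int_{-\infty}^{\infty}g_1(s)\bigl(\mathrm{Im}\,k_1(t,s)+2\,\mathrm{Re}\,k_2(t,s)\bigr)ds-\frac1\pi\int_{-\infty}^{\infty}g_3(s)\,\mathrm{Im}\,k_2(t,s)\,ds=\widetilde u_1(t),$$ $$\frac12 g_3(t)-\frac1\pi\int_{-\infty}^{\infty}g_1(s)\,\mathrm{Im}\,k_2(t,s)\,ds+\frac1{2\pi}\int_{-\infty}^{\infty}g_3(s)\bigl(\mathrm{Im}\,k_1(t,s)-2\,\mathrm{Re}\,k_2(t,s)\bigr)ds=\widetilde u_3(t),$$ for all $t\in\mathbb{R}$, where $\widetilde u_j(t):=u_j(\widetilde\tau(t))$, is solvable in real-valued functions $g_1,g_3\in C(\overline{\mathbb{R}})$; (II) there exists a solution of the (1-3)-problem with boundary data $u_1,u_3$ of the form $$\Phi(\zeta)=\frac1{2\pi i}\int_{\partial D_\zeta}\bigl(\varphi_1(\tau)e_1+\varphi_3(\tau)e_2\bigr)(\tau-\zeta)^{-1}\,d\tau\qquad\forall\,\zeta\in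 D_\zeta,$$ where $\varphi_1,\varphi_3:\partial D_\zeta\to\mathbb{R}$ satisfy $\int_0^1\frac{\omega(\varphi_j,\eta)}{\eta}\,d\eta<\infty$, $j\in\{1,3\}$; (III) there is a solution $\Phi$ of the (1-3)-problem with boundary data $u_1,u_3$ which extends continuously to the boundary $\partial D_\zeta$ and such that, for this $\Phi$, the conjugated (2-4)-problem has a solution $\Phi_*$ for which the moduli of continuity on $\partial D_\zeta$ of the components $U_1[\Phi_*]$, $U_3[\Phi_*]$ satisfy $\int_0^1\frac{\omega(U_j[\Phi_*],\eta)}{\eta}\,d\eta<\infty$, $j\in\{1,3\}$.
   Context: $\mathbb{B}$ is the commutative associative two-dimensional algebra over $\mathbb{C}$ with basis $\{e_1,e_2\}$ and multiplication $e_1^2=e_1$, $e_2e_1=e_2$, $e_2^2=e_1+2ie_2$ (so $e_1$ is the unit), with norm $\|z_1e_1+z_2e_2\|=\sqrt{|z_1|^2+|z_2|^2}$. For $a=a_1e_1+a_2ie_1+a_3e_2+a_4ie_2$ with $a_j\in\mathbb{R}$, put $U_j[a]:=a_j$. The biharmonic plane is $\mu:=\{xe_1+ye_2:x,y\in\mathbb{R}\}$; every nonzero element of $\mu$ is invertible in $\mathbb{B}$. $D$ is a bounded domain in $\mathbb{R}^2$ whose boundary $\partial D$ is a closed smooth Jordan curve; $D_\zeta:=\{xe_1+ye_2:(x,y)\in D\}\subset\mu$, with boundary $\partial D_\zeta$ in $\mu$, positively oriented; $d\tau=e_1\,dx+e_2\,dy$ along $\partial D_\zeta$. For a function $\varphi$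 on $\partial D_\zeta$, $\omega(\varphi,\varepsilon):=\sup\{\|\varphi(\tau_1)-\varphi(\tau_2)\|:\tau_1,\tau_2\in\partial D_\zeta,\ \|\tau_1-\tau_2\|\le\varepsilon\}$ (absolute value for real-valued $\varphi$). A function $\Phi:\Omega\to\mathbb{B}$ on a domain $\Omega\subset\mu$ is monogenic if at every $\zeta\in\Omega$ the limit $\Phi'(\zeta)=\lim_{h\to0,\,h\in\mu}(\Phi(\zeta+h)-\Phi(\zeta))h^{-1}$ exists. (1-3)-problem with data $u_1,u_3$: find a monogenic function $\Phi:D_\zeta\to\mathbb{B}$ whose components $U_1[\Phi]$, $U_3[\Phi]$ have boundary values (limits from $D_\zeta$) $u_1(\zeta_0)$, $u_3(\zeta_0)$ at every $\zeta_0\in\partial D_\zeta$. Conjugated (2-4)-problem (for a solution $\Phi$ of the (1-3)-problem that extends continuously to $\partial D_\zeta$): find a continuous function $\Phi_*:\mu\setminus D_\zeta\to\mathbb{B}$, monogenic in $\mu\setminus\overline{D_\zeta}$ and vanishing at infinity, with $U_2[\Phi_*(\zeta)]=U_2[\Phi(\zeta)]$ and $U_4[\Phi_*(\zeta)]=U_4[\Phi(\zeta)]$ for all $\zeta\in\partial D_\zeta$. $D_z:=\{x+iy\in\mathbb{C}:(x,y)\in D\}$. $\sigma$ is a conformal mapping of the unit disk onto $D_z$, extended to a homeomorphism of the closures; $\tau(t):=\sigma\left(\frac{t-i}{t+i}\right)$ is the corresponding conformal mapping of the upper half-plane onto $D_z$, also considered on $\overline{\mathbb{R}}:=\mathbb{R}\cup\{\infty\}$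 (one-point compactification). Write $\tau_1=\mathrm{Re}\,\tau$, $\tau_2=\mathrm{Im}\,\tau$, and $\widetilde\tau(s):=\tau_1(s)e_1+\tau_2(s)e_2$, a homeomorphism of $\overline{\mathbb{R}}$ onto $\partial D_\zeta$. $C(\overline{\mathbb{R}})$ is the space of continuous functions on $\overline{\mathbb{R}}$ with the supremum norm. $\Gamma:=\{T\in\mathbb{C}:|T|=1\}$; the contour derivative on $\Gamma$ is $\sigma'(T)=\lim_{S\to T,\,S\in\Gamma}\frac{\sigma(S)-\sigma(T)}{S-T}$; $\omega_\Gamma(\varphi,\varepsilon):=\sup\{|\varphi(t_1)-\varphi(t_2)|:t_1,t_2\in\Gamma,\ |t_1-t_2|\le\varepsilon\}$. For $t,s\in\mathbb{R}$, $s\neq t$: $$k_1(t,s):=\frac{\tau'(s)}{\tau(s)-\tau(t)}-\frac{1+st}{(s-t)(s^2+1)},\qquad k_2(t,s):=\frac{\tau'(s)\bigl(\tau_2(s)-\tau_2(t)\bigr)}{2\bigl(\tau(s)-\tau(t)\bigr)^2}-\frac{\tau_2'(s)}{2\bigl(\tau(s)-\tau(t)\bigr)}.$$ *)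

theory Defs
  imports "HOL-Complex_Analysis.Complex_Analysis"
begin

text \<open>
  The element \<open>z\<^sub>1 e\<^sub>1 + z\<^sub>2 e\<^sub>2\<close> of the biharmonic algebra is the pair \<open>(z\<^sub>1, z\<^sub>2)\<close>. The vector space
  structure and the norm \<open>sqrt (\<bar>z\<^sub>1\<bar>\<^sup>2 + \<bar>z\<^sub>2\<bar>\<^sup>2)\<close> are those of the library's product type.
\<close>

type_synonym biharm = "complex \<times> complex"

definition e1 :: biharm where "e1 = (1, 0)"
definition e2 :: biharm where "e2 = (0, 1)"

definition cscale :: "complex \<Rightarrow> biharm \<Rightarrow> biharm" where
  "cscale c a = (c * fst a, c * snd a)"

definition bmult :: "biharm \<Rightarrow> biharm \<Rightarrow> biharm" (infixl \<open>\<odot>\<close> 70) where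
  "a \<odot> b = (fst a * fst b + snd a * snd b,
            fst a * snd b + snd a * fst b + 2 * \<i> * (snd a * snd b))"

text \<open>The inverse is unspecified for non-invertible arguments.\<close>

definition binv :: "biharm \<Rightarrow> biharm" where
  "binv a = (THE b. a \<odot> b = e1)"

definition U1 :: "biharm \<Rightarrow> real" where "U1 a = Re (fst a)"
definition U2 :: "biharm \<Rightarrow> real" where "U2 a = Im (fst a)"
definition U3 :: "biharm \<Rightarrow> real" where "U3 a = Re (snd a)"
definition U4 :: "biharm \<Rightarrow> real" where "U4 a = Im (snd a)"

lemma basis_decomposition: "a = cscale (fst a) e1 + cscale (snd a) e2"
  by (simp add: cscale_def e1_def e2_def)

lemma bmult_commute: "a \<odot> b = b \<odot> a"
  by (simp add: bmult_def algebra_simps)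

lemma bmult_assoc: "(a \<odot> b) \<odot> c = a \<odot> (b \<odot> c)"
  by (simp add: bmult_def algebra_simps)

lemma bmult_add_left: "(a + b) \<odot> c = a \<odot> c + b \<odot> c"
  by (simp add: bmult_def algebra_simps)

lemma bmult_cscale_left: "cscale k a \<odot> b = cscale k (a \<odot> b)"
  by (simp add: bmult_def cscale_def algebra_simps)

lemma e1_bmult [simp]: "e1 \<odot> a = a"
  by (simp add: bmult_def e1_def)

lemma e2_bmult_e2: "e2 \<odot> e2 = e1 + cscale (2 * \<i>) e2"
  by (simp add: bmult_def e1_def e2_def cscale_def)

lemma norm_biharm: "norm (a :: biharm) = sqrt ((cmod (fst a))\<^sup>2 + (cmod (snd a))\<^sup>2)"
  by (simp add: norm_prod_def)

text \<open>The point \<open>(x, y)\<close> of the real plane is the complex number \<open>x + i y\<close> throughout, so a plane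
  domain \<open>D\<close> is the same set as \<open>D\<^sub>z\<close>, and \<open>D\<^sub>\<zeta>\<close> is its image under \<open>zet\<close>.\<close>

definition zet :: "complex \<Rightarrow> biharm" where
  "zet z = Re z *\<^sub>R e1 + Im z *\<^sub>R e2"

definition mu :: "biharm set" where
  "mu = {x *\<^sub>R e1 + y *\<^sub>R e2 | x y. True}"

definition D_zeta :: "complex set \<Rightarrow> biharm set" where
  "D_zeta D = zet ` D"

definition bd_zeta :: "complex set \<Rightarrow> biharm set" where
  "bd_zeta D = (top_of_set mu) frontier_of (D_zeta D)"

lemma bmult_binv:
  assumes "a \<in> mu" "a \<noteq> 0"
  shows "a \<odot> binv a = e1"
proof -
  obtain x y where a: "a = x *\<^sub>R e1 + y *\<^sub>R e2"
    using assms(1) by (auto simp: mu_def)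
  define w where "w = Complex x y"
  have ap: "a = (of_real x, of_real y)"
    by (simp add: a e1_def e2_def scaleR_conv_of_real)
  have w0: "w \<noteq> 0"
    using assms(2) by (auto simp: ap w_def complex_eq_iff zero_prod_def)
  have w: "w = of_real x + \<i> * of_real y"
    by (simp add: w_def complex_eq_iff)
  define b where "b = (1 / w + \<i> * of_real y / w\<^sup>2, - of_real y / w\<^sup>2)"
  have ab: "a \<odot> b = e1"
  proof -
    define Y :: complex where "Y = of_real y"
    have a': "a = (w - \<i> * Y, Y)" by (simp add: ap w Y_def)
    have "(w - \<i> * Y) * (1 / w + \<i> * Y / w\<^sup>2) + Y * (- Y / w\<^sup>2) = 1"
      using w0 by (simp add: field_simps power2_eq_square)
    moreover have "(w - \<i> * Y) * (- Y / w\<^sup>2) + Y * (1 / w + \<i> * Y / w\<^sup>2) + 2 * \<i> * (Y * (- Y / w\<^sup>2)) = 0"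
      using w0 by (simp add: field_simps power2_eq_square)
    ultimately show ?thesis
      unfolding a' b_def bmult_def e1_def Y_def[symmetric] by (simp only: fst_conv snd_conv)
  qed
  have unique: "c = b" if "a \<odot> c = e1" for c
  proof -
    have "c = (a \<odot> b) \<odot> c" by (simp add: ab)
    also have "\<dots> = (a \<odot> c) \<odot> b" by (simp only: bmult_assoc bmult_commute[of b c])
    finally show ?thesis by (simp add: that)
  qed
  have "binv a = b"
    unfolding binv_def by (rule the_equality) (fact ab, fact unique)
  then show ?thesis using ab by simp
qed

definition monogenic_on :: "biharm set \<Rightarrow> (biharm \<Rightarrow> biharm) \<Rightarrow> bool" where
  "monogenic_on \<Omega> \<Phi> \<longleftrightarrow>
     (\<forall>\<zeta>\<in>\<Omega>. \<exists>L. ((\<lambda>h. (\<Phi> (\<zeta> + h) - \<Phi> \<zeta>) \<odot> binv h) \<longlongrightarrow> L) (at 0 within mu))"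

text \<open>Moduli of continuity take values in the extended nonnegative reals, so that the supremum of an
  unbounded set is \<open>\<infinity>\<close>.\<close>

definition modulus :: "'a::metric_space set \<Rightarrow> ('a \<Rightarrow> 'b::metric_space) \<Rightarrow> real \<Rightarrow> ennreal" where
  "modulus S f \<epsilon> = (SUP (p, q) \<in> {(p, q). p \<in> S \<and> q \<in> S \<and> dist p q \<le> \<epsilon>}. ennreal (dist (f p) (f q)))"

definition dini :: "'a::metric_space set \<Rightarrow> ('a \<Rightarrow> 'b::metric_space) \<Rightarrow> bool" where
  "dini S f \<longleftrightarrow> (\<integral>\<^sup>+\<eta>\<in>{0<..1}. (modulus S f \<eta> / ennreal \<eta>) \<partial>lborel) < \<infinity>"

definition solves_13 ::
    "complex set \<Rightarrow> (biharm \<Rightarrow> real) \<Rightarrow> (biharm \<Rightarrow> real) \<Rightarrow> (biharm \<Rightarrow> biharm) \<Rightarrow> bool" where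
  "solves_13 D u1 u3 \<Phi> \<longleftrightarrow>
     monogenic_on (D_zeta D) \<Phi> \<and>
     (\<forall>\<zeta>0\<in>bd_zeta D.
        ((\<lambda>\<zeta>. U1 (\<Phi> \<zeta>)) \<longlongrightarrow> u1 \<zeta>0) (at \<zeta>0 within D_zeta D) \<and>
        ((\<lambda>\<zeta>. U3 (\<Phi> \<zeta>)) \<longlongrightarrow> u3 \<zeta>0) (at \<zeta>0 within D_zeta D))"

text \<open>Here the values of \<open>\<Phi>\<close> on the boundary are those of its continuous extension.\<close>

definition solves_conj_24 ::
    "complex set \<Rightarrow> (biharm \<Rightarrow> biharm) \<Rightarrow> (biharm \<Rightarrow> biharm) \<Rightarrow> bool" where
  "solves_conj_24 D \<Phi> \<Phi>s \<longleftrightarrow>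
     continuous_on (mu - D_zeta D) \<Phi>s \<and>
     monogenic_on (mu - closure (D_zeta D)) \<Phi>s \<and>
     (\<Phi>s \<longlongrightarrow> 0) (inf at_infinity (principal mu)) \<and>
     (\<forall>\<zeta>\<in>bd_zeta D. U2 (\<Phi>s \<zeta>) = U2 (\<Phi> \<zeta>) \<and> U4 (\<Phi>s \<zeta>) = U4 (\<Phi> \<zeta>))"

text \<open>A closed Jordan curve which is continuously differentiable with nonvanishing derivative,
  also across the common endpoint.\<close>

definition smooth_jordan_curve :: "(real \<Rightarrow> complex) \<Rightarrow> bool" where
  "smooth_jordan_curve \<gamma> \<longleftrightarrow>
     simple_path \<gamma> \<and> pathfinish \<gamma> = pathstart \<gamma> \<and>
     (\<exists>\<gamma>'. continuous_on {0..1} \<gamma>' \<and> \<gamma>' 0 = \<gamma>' 1 \<and>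
        (\<forall>t\<in>{0..1}. (\<gamma> has_vector_derivative \<gamma>' t) (at t within {0..1}) \<and> \<gamma>' t \<noteq> 0))"

definition positively_oriented_boundary :: "complex set \<Rightarrow> (real \<Rightarrow> complex) \<Rightarrow> bool" where
  "positively_oriented_boundary D \<gamma> \<longleftrightarrow>
     path_image \<gamma> = frontier D \<and> (\<forall>z\<in>D. winding_number \<gamma> z = 1)"

text \<open>Integral of \<open>F(\<tau>) d\<tau>\<close> along a path in the algebra; for a path in \<open>mu\<close> one has
  \<open>d\<tau> = e\<^sub>1 dx + e\<^sub>2 dy\<close>.\<close>

definition bcontour_integral :: "(real \<Rightarrow> biharm) \<Rightarrow> (biharm \<Rightarrow> biharm) \<Rightarrow> biharm" where
  "bcontour_integral p F =
     integral {0..1} (\<lambda>t. F (p t) \<odot> vector_derivative p (at t within {0..1}))"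

definition cauchy_type_integral ::
    "(real \<Rightarrow> complex) \<Rightarrow> (biharm \<Rightarrow> real) \<Rightarrow> (biharm \<Rightarrow> real) \<Rightarrow> biharm \<Rightarrow> biharm" where
  "cauchy_type_integral \<gamma> \<phi>1 \<phi>3 \<zeta> =
     cscale (1 / (2 * of_real pi * \<i>))
       (bcontour_integral (zet \<circ> \<gamma>) (\<lambda>\<tau>. (\<phi>1 \<tau> *\<^sub>R e1 + \<phi>3 \<tau> *\<^sub>R e2) \<odot> binv (\<tau> - \<zeta>)))"

definition conformal_disk_map :: "complex set \<Rightarrow> (complex \<Rightarrow> complex) \<Rightarrow> bool" where
  "conformal_disk_map D \<sigma> \<longleftrightarrow>
     \<sigma> holomorphic_on ball 0 1 \<and> inj_on \<sigma> (ball 0 1) \<and> \<sigma> ` ball 0 1 = D \<and>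
     (\<exists>\<rho>. homeomorphism (cball 0 1) (closure D) \<sigma> \<rho>)"

text \<open>Boundary values on the real line of the conformal map \<open>t \<mapsto> \<sigma> ((t - i) / (t + i))\<close> of the
  upper half-plane.\<close>

definition tau :: "(complex \<Rightarrow> complex) \<Rightarrow> real \<Rightarrow> complex" where
  "tau \<sigma> t = \<sigma> ((of_real t - \<i>) / (of_real t + \<i>))"

definition tau' :: "(complex \<Rightarrow> complex) \<Rightarrow> real \<Rightarrow> complex" where
  "tau' \<sigma> s = vector_derivative (tau \<sigma>) (at s)"

definition tau2 :: "(complex \<Rightarrow> complex) \<Rightarrow> real \<Rightarrow> real" where
  "tau2 \<sigma> s = Im (tau \<sigma> s)"

definition tau2' :: "(complex \<Rightarrow> complex) \<Rightarrow> real \<Rightarrow> real" where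
  "tau2' \<sigma> s = deriv (tau2 \<sigma>) s"

definition tau_tilde :: "(complex \<Rightarrow> complex) \<Rightarrow> real \<Rightarrow> biharm" where
  "tau_tilde \<sigma> s = zet (tau \<sigma> s)"

text \<open>The kernels are meant for \<open>s \<noteq> t\<close> only; the value on the diagonal is irrelevant.\<close>

definition k1 :: "(complex \<Rightarrow> complex) \<Rightarrow> real \<Rightarrow> real \<Rightarrow> complex" where
  "k1 \<sigma> t s = tau' \<sigma> s / (tau \<sigma> s - tau \<sigma> t)
              - of_real ((1 + s * t) / ((s - t) * (s\<^sup>2 + 1)))"

definition k2 :: "(complex \<Rightarrow> complex) \<Rightarrow> real \<Rightarrow> real \<Rightarrow> complex" where
  "k2 \<sigma> t s = tau' \<sigma> s * of_real (tau2 \<sigma> s - tau2 \<sigma> t) / (2 * (tau \<sigma> s - tau \<sigma> t)\<^sup>2)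
              - of_real (tau2' \<sigma> s) / (2 * (tau \<sigma> s - tau \<sigma> t))"

text \<open>The compactified real line is modelled on \<open>real option\<close>, with \<open>None\<close> as the point at
  infinity.\<close>

definition C_Rbar :: "(real option \<Rightarrow> real) set" where
  "C_Rbar = {g. continuous_map (Alexandroff_compactification euclideanreal) euclideanreal g}"

text \<open>Integrability is part of the requirement because the Bochner integral of a non-integrable
  function is 0 by convention.\<close>

definition solves_integral_system ::
    "(complex \<Rightarrow> complex) \<Rightarrow> (biharm \<Rightarrow> real) \<Rightarrow> (biharm \<Rightarrow> real)
      \<Rightarrow> (real option \<Rightarrow> real) \<Rightarrow> (real option \<Rightarrow> real) \<Rightarrow> bool" where
  "solves_integral_system \<sigma> u1 u3 g1 g3 \<longleftrightarrow> (\<forall>t::real.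
     integrable lborel (\<lambda>s. g1 (Some s) * (Im (k1 \<sigma> t s) + 2 * Re (k2 \<sigma> t s))) \<and>
     integrable lborel (\<lambda>s. g3 (Some s) * Im (k2 \<sigma> t s)) \<and>
     integrable lborel (\<lambda>s. g1 (Some s) * Im (k2 \<sigma> t s)) \<and>
     integrable lborel (\<lambda>s. g3 (Some s) * (Im (k1 \<sigma> t s) - 2 * Re (k2 \<sigma> t s))) \<and>
     1/2 * g1 (Some t)
       + 1 / (2 * pi) * (LINT s|lborel. g1 (Some s) * (Im (k1 \<sigma> t s) + 2 * Re (k2 \<sigma> t s)))
       - 1 / pi * (LINT s|lborel. g3 (Some s) * Im (k2 \<sigma> t s))
       = u1 (tau_tilde \<sigma> t) \<and>
     1/2 * g3 (Some t)
       - 1 / pi * (LINT s|lborel. g1 (Some s) * Im (k2 \<sigma> t s))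
       + 1 / (2 * pi) * (LINT s|lborel. g3 (Some s) * (Im (k1 \<sigma> t s) - 2 * Re (k2 \<sigma> t s)))
       = u3 (tau_tilde \<sigma> t))"

end

theory Submission
  imports Defs
begin

text \<open>
  In the angle \<open>x\<close> of the unit circle the boundary is \<open>S x = \<sigma> (cis x)\<close>, and the Cauchy type integral splits into
  integrals of the densities against the kernel \<open>S' x / (S x - z)\<close> and its biharmonic companion, the logarithmic
  derivative of \<open>Im (S x - z) / (S x - z)\<close>. For Dini densities, dominated convergence gives continuous boundary values
  from both sides whose difference is \<open>(\<phi>1, \<phi>3)\<close>, and the first and third components of the inner one are
  exactly the left-hand sides of the integral system: hence (II) implies (I). The logarithmic Dini condition makes
  the operators in the system map continuous functions to Dini functions, so every continuous solution of the system
  is a Dini density: (I) implies (II). The exterior Cauchy type integral solves the conjugated problem,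
  so (II) implies (III). Conversely, given \<open>\<Phi>\<close> and \<open>\<Phi>s\<close> put \<open>\<phi>\<^sub>j = u\<^sub>j - U\<^sub>j[\<Phi>s]\<close>; subtracting the Cauchy
  type integral leaves a continuous function on the plane that is monogenic off a rectifiable curve and vanishes at
  infinity. Such a function is \<open>0\<close> by a Painleve type removability argument and Liouville's theorem, applied first
  to the image under the character of the local algebra and then to the nilpotent part.
\<close>

subsection \<open>Moduli of continuity\<close>

text \<open>The singular Cauchy integral does not in general preserve a Dini condition. What rescues
  the passage from (I) to (II) is that the system contains only \<open>Im kC\<close> and
  \<open>kE\<close>. Both have the cross product of the tangent \<open>S' x\<close> with the chord
  \<open>S x - S t\<close> as numerator; tangent and chord are parallel to first order, so a kernel
  of size \<open>w r / r\<close> at distance \<open>r\<close> remains, where \<open>w\<close> is the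
  modulus of continuity of \<open>S'\<close>. Testing such an operator for a Dini condition costs
  one more integration against \<open>dh / h\<close>, and the logarithm pays for it. The full kernel
  \<open>kC\<close> keeps its pole; subtracting the density at a nearest boundary point makes the
  integrand dominated uniformly for every approach to the curve, tangential ones included, and
  leaves a term that is continuous across it. The total masses of the kernels on the curve,
  \<open>pi\<close> for \<open>Im kC\<close> and 0 for \<open>kE\<close>, then account for the
  coefficients 1/2 in the system.\<close>

lemma modulus_mono: "a \<le> b \<Longrightarrow> modulus S f a \<le> modulus S f b"
  unfolding modulus_def by (rule SUP_subset_mono) auto

text \<open>A sublevel set of a monotone function is downward closed, hence empty, the whole line,
  or a ray that is open or closed at its supremum.\<close>

lemma measurable_modulus [measurable]: "(\<lambda>\<eta>. modulus S f \<eta>) \<in> borel_measurable borel"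
proof -
  have "\<exists>y. (modulus S f -` {..a} = {..y} \<or> modulus S f -` {..a} = {..<y}) \<or>
      modulus S f -` {..a} = {} \<or> modulus S f -` {..a} = UNIV" for a
  proof -
    let ?I = "modulus S f -` {..a}"
    have down: "x \<in> ?I" if "y \<in> ?I" "x \<le> y" for x y
      using modulus_mono[of x y S f] that by auto
    show ?thesis
    proof (cases "?I = {} \<or> \<not> bdd_above ?I")
      case True
      have "?I = UNIV" if unb: "\<not> bdd_above ?I"
      proof -
        have "x \<in> ?I" for x
        proof -
          obtain y where "y \<in> ?I" "x \<le> y"
            using unb unfolding bdd_above_def by (meson nle_le)
          then show ?thesis by (rule down)
        qed
        then show ?thesis by blast
      qed
      with True show ?thesis by auto
    next
      case False
      then have ne: "?I \<noteq> {}" and bdd: "bdd_above ?I" by auto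
      have lt: "x \<in> ?I" if x: "x < Sup ?I" for x
      proof -
        obtain y where "y \<in> ?I" "x < y"
          using less_cSupD[OF ne x] by blast
        then show ?thesis using down[of y x] by simp
      qed
      have le: "x \<le> Sup ?I" if "x \<in> ?I" for x
        using cSup_upper[OF that bdd] .
      show ?thesis
      proof (cases "Sup ?I \<in> ?I")
        case True
        have "?I \<subseteq> {..Sup ?I}" using le by blast
        moreover have "{..Sup ?I} \<subseteq> ?I" using down[OF True] by blast
        ultimately show ?thesis by (metis subset_antisym)
      next
        case nin: False
        have "?I \<subseteq> {..<Sup ?I}" using le nin by (metis lessThan_iff order_le_less subsetI)
        moreover have "{..<Sup ?I} \<subseteq> ?I" using lt by blast
        ultimately show ?thesis by (metis subset_antisym)
      qed
    qed
  qed
  then have "modulus S f -` {..a} \<in> sets borel" for a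
    by (metis atMost_borel lessThan_borel sets.empty_sets sets.top space_borel)
  then show ?thesis
    by (intro borel_measurableI_le) (auto simp: vimage_def Int_def)
qed

lemma modulus_upper:
  "p \<in> S \<Longrightarrow> q \<in> S \<Longrightarrow> dist p q \<le> e \<Longrightarrow> ennreal (dist (f p) (f q)) \<le> modulus S f e"
  unfolding modulus_def by (rule SUP_upper2[of "(p, q)"]) auto

lemma modulus_least:
  "(\<And>p q. p \<in> S \<Longrightarrow> q \<in> S \<Longrightarrow> dist p q \<le> e \<Longrightarrow> ennreal (dist (f p) (f q)) \<le> c) \<Longrightarrow> modulus S f e \<le> c"
  unfolding modulus_def by (rule SUP_least) auto

lemma bounded_modulus:
  assumes "bounded (f ` S)"
  obtains B where "B > 0" "\<And>e. modulus S f e \<le> ennreal B"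
proof -
  obtain B where B: "\<And>x y. x \<in> f ` S \<Longrightarrow> y \<in> f ` S \<Longrightarrow> dist x y \<le> B"
    using assms unfolding bounded_two_points by auto
  have "modulus S f e \<le> ennreal (max B 1)" for e
    by (rule modulus_least) (use B in \<open>fastforce intro: ennreal_leI simp: le_max_iff_disj\<close>)
  then show ?thesis using that[of "max B 1"] by simp
qed

lemma nn_integral_inverse_interval:
  assumes "0 < a" "a \<le> b"
  shows "(\<integral>\<^sup>+\<eta>\<in>{a..b}. (1 / ennreal \<eta>) \<partial>lborel) = ennreal (ln (b / a))"
proof -
  have "(\<integral>\<^sup>+\<eta>\<in>{a..b}. (1 / ennreal \<eta>) \<partial>lborel) = (\<integral>\<^sup>+\<eta>\<in>{a..b}. ennreal (1 / \<eta>) \<partial>lborel)"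
    by (rule nn_integral_cong) (use assms in \<open>auto simp: indicator_def divide_ennreal[symmetric]\<close>)
  also have "\<dots> = ennreal (ln b - ln a)"
    by (rule nn_integral_FTC_Icc) (use assms in \<open>auto intro!: derivative_eq_intros\<close>)
  also have "ln b - ln a = ln (b / a)" using assms by (simp add: ln_div)
  finally show ?thesis .
qed

lemma nn_integral_inverse_infinite:
  assumes "0 < c"
  shows "(\<integral>\<^sup>+\<eta>\<in>{0<..c}. (1 / ennreal \<eta>) \<partial>lborel) = \<infinity>"
proof (rule ccontr)
  assume "\<not> ?thesis"
  then obtain r where r: "r \<ge> 0" "(\<integral>\<^sup>+\<eta>\<in>{0<..c}. (1 / ennreal \<eta>) \<partial>lborel) = ennreal r"
    by (cases "\<integral>\<^sup>+\<eta>\<in>{0<..c}. (1 / ennreal \<eta>) \<partial>lborel") auto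
  \<comment> \<open>With this left end point the integral over \<open>{a..c}\<close> is exactly
    \<open>r + 1\<close>, above the assumed value \<open>r\<close>.\<close>
  define a where "a = c * exp (- (r + 1))"
  have a: "0 < a" "a \<le> c" using assms r by (auto simp: a_def)
  have "ennreal (ln (c / a)) \<le> (\<integral>\<^sup>+\<eta>\<in>{0<..c}. (1 / ennreal \<eta>) \<partial>lborel)"
    unfolding nn_integral_inverse_interval[OF a, symmetric]
    by (rule nn_integral_mono) (use a in \<open>auto simp: indicator_def\<close>)
  moreover have "ln (c / a) = r + 1" using assms by (simp add: a_def ln_div ln_mult)
  ultimately show False using r by simp
qed

text \<open>The Dini condition only concerns small arguments: beyond \<open>c\<close> the modulus of
  a bounded function contributes at most \<open>B / c\<close> to the integrand.\<close>

lemma dini_if_local: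
  assumes bdd: "bounded (f ` S)" and c: "0 < c"
    and fin: "(\<integral>\<^sup>+\<eta>\<in>{0<..c}. (modulus S f \<eta> / ennreal \<eta>) \<partial>lborel) < \<infinity>"
  shows "dini S f"
proof -
  obtain B where B: "B > 0" "\<And>e. modulus S f e \<le> ennreal B" using bounded_modulus[OF bdd] by blast
  have "(\<integral>\<^sup>+\<eta>\<in>{0<..1}. (modulus S f \<eta> / ennreal \<eta>) \<partial>lborel)
    \<le> (\<integral>\<^sup>+\<eta>. modulus S f \<eta> / ennreal \<eta> * indicator {0<..c} \<eta> + ennreal (B / c) * indicator {0..1} \<eta> \<partial>lborel)"
  proof (rule nn_integral_mono)
    fix \<eta> :: real
    show "modulus S f \<eta> / ennreal \<eta> * indicator {0<..1} \<eta>
      \<le> modulus S f \<eta> / ennreal \<eta> * indicator {0<..c} \<eta> + ennreal (B / c) * indicator {0..1} \<eta>"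
    proof (cases "\<eta> \<in> {0<..1} \<and> c < \<eta>")
      case True
      have "modulus S f \<eta> / ennreal \<eta> \<le> ennreal B / ennreal \<eta>"
        by (rule divide_right_mono_ennreal) (rule B)
      also have "\<dots> \<le> ennreal B / ennreal c"
        using True c B by (simp add: divide_ennreal ennreal_leI frac_le)
      finally have "modulus S f \<eta> / ennreal \<eta> \<le> ennreal B / ennreal c" .
      then show ?thesis using True c B by (simp add: divide_ennreal)
    qed (auto simp: indicator_def)
  qed
  also have "\<dots> = (\<integral>\<^sup>+\<eta>\<in>{0<..c}. (modulus S f \<eta> / ennreal \<eta>) \<partial>lborel) + ennreal (B / c)"
    by (subst nn_integral_add) (use B c in \<open>auto simp: nn_integral_cmult_indicator\<close>)
  also have "\<dots> < \<infinity>" using fin by (simp add: less_top[symmetric])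
  finally show ?thesis by (simp add: dini_def)
qed

text \<open>The measure \<open>d\<eta> / \<eta>\<close> is invariant under dilations.\<close>

lemma nn_integral_modulus_scale:
  assumes "0 < L" "0 < c"
  shows "(\<integral>\<^sup>+\<eta>\<in>{0<..c}. (modulus S f (L * \<eta>) / ennreal \<eta>) \<partial>lborel)
       = (\<integral>\<^sup>+\<eta>\<in>{0<..L * c}. (modulus S f \<eta> / ennreal \<eta>) \<partial>lborel)"
proof -
  have "(\<integral>\<^sup>+\<eta>\<in>{0<..L * c}. (modulus S f \<eta> / ennreal \<eta>) \<partial>lborel)
      = ennreal \<bar>L\<bar> * (\<integral>\<^sup>+x. modulus S f (0 + L * x) / ennreal (0 + L * x) * indicator {0<..L * c} (0 + L * x) \<partial>lborel)"
    by (rule nn_integral_real_affine) (use assms in auto)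
  also have "\<dots> = (\<integral>\<^sup>+x. ennreal L * (modulus S f (L * x) / ennreal (L * x) * indicator {0<..L * c} (L * x)) \<partial>lborel)"
    using assms by (subst nn_integral_cmult) auto
  also have "\<dots> = (\<integral>\<^sup>+\<eta>\<in>{0<..c}. (modulus S f (L * \<eta>) / ennreal \<eta>) \<partial>lborel)"
  proof (rule nn_integral_cong)
    fix x :: real
    show "ennreal L * (modulus S f (L * x) / ennreal (L * x) * indicator {0<..L * c} (L * x))
        = modulus S f (L * x) / ennreal x * indicator {0<..c} x"
    proof (cases "x \<in> {0<..c}")
      case True
      then have x: "0 < x" by simp
      have "ennreal L * (m / ennreal (L * x)) = m / ennreal x" for m
      proof -
        have "ennreal L * (m / ennreal (L * x)) = m * (ennreal L / ennreal (L * x))"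
          by (simp add: ennreal_times_divide mult.commute)
        also have "ennreal L / ennreal (L * x) = 1 / ennreal x"
          using assms x by (simp add: divide_ennreal flip: ennreal_1)
        finally show ?thesis by (simp add: ennreal_times_divide)
      qed
      then show ?thesis using True assms by (simp add: indicator_def)
    next
      case False
      then show ?thesis using assms by (auto simp: indicator_def zero_less_mult_iff)
    qed
  qed
  finally show ?thesis by simp
qed

text \<open>Used in both directions between functions on the boundary curve and functions of the
  angle. Increments need only be matched at small distances, with the distance distorted by at most
  the factor \<open>L\<close>.\<close>

lemma dini_transfer:
  assumes g: "dini B g" and bdd: "bounded (f ` A)" and L: "0 < L" and d: "0 < d"
    and tr: "\<And>p q. p \<in> A \<Longrightarrow> q \<in> A \<Longrightarrow> dist p q \<le> d \<Longrightarrow>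
      \<exists>p'\<in>B. \<exists>q'\<in>B. dist p' q' \<le> L * dist p q \<and> dist (f p) (f q) \<le> dist (g p') (g q')"
  shows "dini A f"
proof -
  \<comment> \<open>The bound by \<open>d\<close> makes the matching of increments available; the
    bound by \<open>1 / L\<close> keeps the rescaled radius inside the interval on which the
    integral for \<open>g\<close> is known to be finite.\<close>
  define c where "c = min d (1 / L)"
  have c: "0 < c" "c \<le> d" "L * c \<le> 1" using L d by (auto simp: c_def min_def field_simps)
  have le: "modulus A f \<eta> \<le> modulus B g (L * \<eta>)" if le_\<eta>: "\<eta> \<le> c" for \<eta>
  proof (rule modulus_least)
    fix p q assume pq: "p \<in> A" "q \<in> A" "dist p q \<le> \<eta>"
    then obtain p' q' where *: "p' \<in> B" "q' \<in> B" "dist p' q' \<le> L * dist p q" "dist (f p) (f q) \<le> dist (g p') (g q')"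
      using tr[OF pq(1,2)] le_\<eta> c by (meson order_trans)
    have "dist p' q' \<le> L * \<eta>" using *(3) pq(3) L by (meson mult_le_cancel_left_pos order_trans)
    then show "ennreal (dist (f p) (f q)) \<le> modulus B g (L * \<eta>)"
      using modulus_upper[OF *(1,2), of "L * \<eta>" g] *(4) by (meson ennreal_leI order_trans)
  qed
  have "(\<integral>\<^sup>+\<eta>\<in>{0<..c}. (modulus A f \<eta> / ennreal \<eta>) \<partial>lborel)
      \<le> (\<integral>\<^sup>+\<eta>\<in>{0<..c}. (modulus B g (L * \<eta>) / ennreal \<eta>) \<partial>lborel)"
    by (rule nn_integral_mono) (use le in \<open>auto simp: indicator_def intro!: divide_right_mono_ennreal\<close>)
  also have "\<dots> = (\<integral>\<^sup>+\<eta>\<in>{0<..L * c}. (modulus B g \<eta> / ennreal \<eta>) \<partial>lborel)"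
    using L c by (simp add: nn_integral_modulus_scale)
  also have "\<dots> \<le> (\<integral>\<^sup>+\<eta>\<in>{0<..1}. (modulus B g \<eta> / ennreal \<eta>) \<partial>lborel)"
    by (rule nn_integral_mono) (use c in \<open>auto simp: indicator_def\<close>)
  also have "\<dots> < \<infinity>" using g by (simp add: dini_def)
  finally show ?thesis using dini_if_local[OF bdd c(1)] by blast
qed

text \<open>One estimate for sums, scalar multiples, real and imaginary parts and functions that
  agree on \<open>S\<close>; the cases with a single function take \<open>g = f\<close> and
  \<open>b = 0\<close>.\<close>

lemma dini_combine:
  assumes "dini S f" "dini S g" "0 \<le> a" "0 \<le> b"
    and le: "\<And>p q. p \<in> S \<Longrightarrow> q \<in> S \<Longrightarrow> dist (h p) (h q) \<le> a * dist (f p) (f q) + b * dist (g p) (g q)"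
  shows "dini S h"
proof -
  have "modulus S h e \<le> ennreal a * modulus S f e + ennreal b * modulus S g e" for e
  proof (rule modulus_least)
    fix p q assume pq: "p \<in> S" "q \<in> S" "dist p q \<le> e"
    have "ennreal (dist (h p) (h q)) \<le> ennreal (a * dist (f p) (f q) + b * dist (g p) (g q))"
      by (rule ennreal_leI) (rule le[OF pq(1,2)])
    also have "\<dots> = ennreal a * ennreal (dist (f p) (f q)) + ennreal b * ennreal (dist (g p) (g q))"
      using assms by (simp add: ennreal_plus ennreal_mult)
    also have "\<dots> \<le> ennreal a * modulus S f e + ennreal b * modulus S g e"
      by (intro add_mono mult_left_mono modulus_upper pq) auto
    finally show "ennreal (dist (h p) (h q)) \<le> ennreal a * modulus S f e + ennreal b * modulus S g e" .
  qed
  then have "(\<integral>\<^sup>+\<eta>\<in>{0<..1}. (modulus S h \<eta> / ennreal \<eta>) \<partial>lborel)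
    \<le> (\<integral>\<^sup>+\<eta>\<in>{0<..1}. ((ennreal a * modulus S f \<eta> + ennreal b * modulus S g \<eta>) / ennreal \<eta>) \<partial>lborel)"
    by (intro nn_integral_mono) (auto simp: indicator_def intro!: divide_right_mono_ennreal)
  also have "\<dots> = (\<integral>\<^sup>+\<eta>. ennreal a * (modulus S f \<eta> / ennreal \<eta> * indicator {0<..1} \<eta>)
      + ennreal b * (modulus S g \<eta> / ennreal \<eta> * indicator {0<..1} \<eta>) \<partial>lborel)"
    by (intro nn_integral_cong) (simp add: add_divide_distrib_ennreal distrib_right mult.assoc flip: ennreal_times_divide)
  also have "\<dots> = ennreal a * (\<integral>\<^sup>+\<eta>\<in>{0<..1}. (modulus S f \<eta> / ennreal \<eta>) \<partial>lborel)
      + ennreal b * (\<integral>\<^sup>+\<eta>\<in>{0<..1}. (modulus S g \<eta> / ennreal \<eta>) \<partial>lborel)"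
    by (subst nn_integral_add) (auto simp: nn_integral_cmult)
  also have "\<dots> < \<infinity>" using assms(1,2) by (simp add: dini_def ennreal_mult_less_top)
  finally show ?thesis by (simp add: dini_def)
qed

text \<open>A modulus that stays above some \<open>e > 0\<close> would make the Dini integral at
  least \<open>e\<close> times the divergent integral of \<open>1 / \<eta>\<close>.\<close>

lemma dini_imp_uniformly_continuous_on:
  assumes "dini S f"
  shows "uniformly_continuous_on S f"
  unfolding uniformly_continuous_on_def
proof (intro allI impI)
  fix e :: real assume e: "0 < e"
  show "\<exists>d>0. \<forall>x\<in>S. \<forall>x'\<in>S. dist x' x < d \<longrightarrow> dist (f x') (f x) < e"
  proof (rule ccontr)
    assume neg: "\<not> ?thesis"
    have ge: "ennreal e \<le> modulus S f \<eta>" if \<eta>: "0 < \<eta>" for \<eta>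
    proof -
      obtain x x' where *: "x \<in> S" "x' \<in> S" "dist x' x < \<eta>" "e \<le> dist (f x') (f x)"
        using neg \<eta> by (meson not_less)
      have "ennreal (dist (f x') (f x)) \<le> modulus S f \<eta>" by (rule modulus_upper) (use * in auto)
      then show ?thesis using ennreal_leI[OF *(4)] by (rule order_trans[rotated])
    qed
    have "\<infinity> = ennreal e * (\<integral>\<^sup>+\<eta>\<in>{0<..1}. (1 / ennreal \<eta>) \<partial>lborel)"
      using e by (subst nn_integral_inverse_infinite) (auto simp: ennreal_mult_top)
    also have "\<dots> = (\<integral>\<^sup>+\<eta>. ennreal e * (1 / ennreal \<eta> * indicator {0<..1} \<eta>) \<partial>lborel)"
      by (subst nn_integral_cmult) auto
    also have "\<dots> \<le> (\<integral>\<^sup>+\<eta>\<in>{0<..1}. (modulus S f \<eta> / ennreal \<eta>) \<partial>lborel)"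
    proof (rule nn_integral_mono)
      fix \<eta> :: real
      show "ennreal e * (1 / ennreal \<eta> * indicator {0<..1} \<eta>) \<le> modulus S f \<eta> / ennreal \<eta> * indicator {0<..1} \<eta>"
        using divide_right_mono_ennreal[OF ge, of \<eta> "ennreal \<eta>"]
        by (auto simp: indicator_def ennreal_times_divide)
    qed
    finally show False using assms by (simp add: dini_def top_unique)
  qed
qed

text \<open>Supplies the function \<open>w \<bar>u\<bar> / \<bar>u\<bar>\<close> that dominates the
  singular integrals. The Dini condition gives its integrability on \<open>[-1, 1]\<close>; on
  longer intervals the boundedness of \<open>f\<close> takes over.\<close>

lemma dini_majorant:
  fixes f :: "real \<Rightarrow> 'a::metric_space"
  assumes f: "dini UNIV f" and bdd: "bounded (range f)"
  obtains w :: "real \<Rightarrow> real" where "mono w" "\<And>x. 0 \<le> w x" "\<And>x y. dist (f x) (f y) \<le> w \<bar>x - y\<bar>"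
    "w = (\<lambda>x. enn2real (modulus UNIV f x))" "\<And>x. ennreal (w x) = modulus UNIV f x"
    "\<And>R. set_integrable lborel {-R..R} (\<lambda>u. w \<bar>u\<bar> / \<bar>u\<bar>)"
proof -
  obtain B where B: "B > 0" "\<And>e. modulus UNIV f e \<le> ennreal B" using bounded_modulus[OF bdd] by blast
  define w where "w = (\<lambda>x. enn2real (modulus UNIV f x))"
  have fin: "modulus UNIV f x < top" for x using B(2)[of x] by (simp add: le_less_trans)
  have w: "ennreal (w x) = modulus UNIV f x" for x unfolding w_def using fin[of x] by simp
  have mono: "mono w"
    unfolding mono_def w_def by (auto intro!: enn2real_mono modulus_mono fin)
  have nonneg: "0 \<le> w x" for x by (simp add: w_def)
  have wB: "w x \<le> B" for x
    using B w[of x] nonneg[of x] by (metis ennreal_le_iff less_imp_le)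
  have [measurable]: "w \<in> borel_measurable borel" using mono by (rule borel_measurable_mono)
  have le: "dist (f x) (f y) \<le> w \<bar>x - y\<bar>" for x y
  proof -
    have "ennreal (dist (f x) (f y)) \<le> ennreal (w \<bar>x - y\<bar>)"
      unfolding w by (rule modulus_upper) (auto simp: dist_real_def)
    then show ?thesis using nonneg by (simp add: ennreal_le_iff)
  qed
  have "set_integrable lborel {-R..R} (\<lambda>u. w \<bar>u\<bar> / \<bar>u\<bar>)" for R
  proof -
    have 1: "set_integrable lborel {0<..1} (\<lambda>u. w u / u)"
      unfolding set_integrable_def
    proof (rule integrableI_nonneg)
      have "(\<integral>\<^sup>+u. ennreal (indicat_real {0<..1} u *\<^sub>R (w u / u)) \<partial>lborel)
        = (\<integral>\<^sup>+\<eta>\<in>{0<..1}. (modulus UNIV f \<eta> / ennreal \<eta>) \<partial>lborel)"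
        by (rule nn_integral_cong) (auto simp: indicator_def w[symmetric] divide_ennreal nonneg)
      also have "\<dots> < \<infinity>" using f by (simp add: dini_def)
      finally show "(\<integral>\<^sup>+u. ennreal (indicat_real {0<..1} u *\<^sub>R (w u / u)) \<partial>lborel) < \<infinity>" .
    qed (auto simp: nonneg indicator_def)
    have 2: "set_integrable lborel {-1..1} (\<lambda>u. w \<bar>u\<bar> / \<bar>u\<bar>)"
    proof -
      have i: "integrable lborel (\<lambda>u. indicator {0<..1} u *\<^sub>R (w u / u))" using 1 by (simp add: set_integrable_def)
      have j: "integrable lborel (\<lambda>u. indicator {0<..1} (0 + (-1) * u) *\<^sub>R (w (0 + (-1) * u) / (0 + (-1) * u)))"
        using lborel_integrable_real_affine[OF i, of "-1" 0] by simp
      have "indicator {-1..1} u *\<^sub>R (w \<bar>u\<bar> / \<bar>u\<bar>) = indicator {0<..1} u *\<^sub>R (w u / u) +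
          indicator {0<..1} (0 + (-1) * u) *\<^sub>R (w (0 + (-1) * u) / (0 + (-1) * u))" for u :: real
        by (auto simp: indicator_def)
      then show ?thesis unfolding set_integrable_def using Bochner_Integration.integrable_add[OF i j] by simp
    qed
    have 3: "integrable lborel (\<lambda>u. indicat_real {-R..R} u * B)"
      by (intro integrable_mult_left integrable_real_indicator) (auto simp: emeasure_lborel_Icc_eq)
    have "integrable lborel (\<lambda>u. indicat_real {-1..1} u *\<^sub>R (w \<bar>u\<bar> / \<bar>u\<bar>) + indicat_real {-R..R} u * B)"
      using 2 3 by (auto simp: set_integrable_def)
    then show ?thesis unfolding set_integrable_def
    proof (rule Bochner_Integration.integrable_bound)
      show "AE u in lborel. norm (indicat_real {-R..R} u *\<^sub>R (w \<bar>u\<bar> / \<bar>u\<bar>))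
         \<le> norm (indicat_real {-1..1} u *\<^sub>R (w \<bar>u\<bar> / \<bar>u\<bar>) + indicat_real {-R..R} u * B)"
      proof (rule AE_I2)
        fix u :: real
        show "norm (indicat_real {-R..R} u *\<^sub>R (w \<bar>u\<bar> / \<bar>u\<bar>))
         \<le> norm (indicat_real {-1..1} u *\<^sub>R (w \<bar>u\<bar> / \<bar>u\<bar>) + indicat_real {-R..R} u * B)"
        proof (cases "u \<in> {-R..R} \<and> \<bar>u\<bar> > 1")
          case True
          then have "w \<bar>u\<bar> / \<bar>u\<bar> \<le> B / 1"
            using wB[of "\<bar>u\<bar>"] B nonneg[of "\<bar>u\<bar>"] by (intro frac_le) auto
          moreover have "0 \<le> w \<bar>u\<bar> / \<bar>u\<bar>" using nonneg[of "\<bar>u\<bar>"] by simp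
          ultimately show ?thesis using True by (auto simp: indicator_def)
        next
          case False
          then show ?thesis using nonneg[of "\<bar>u\<bar>"] B by (auto simp: indicator_def)
        qed
      qed
    qed auto
  qed
  then show ?thesis by (rule that[OF mono nonneg le w_def w])
qed

subsection \<open>Removability of rectifiable curves\<close>

text \<open>The integral along the counterclockwise boundary of \<open>[a, b] x [c, d]\<close>,
  split into ordinary integrals over the sides so that subdividing the rectangle is only additivity
  of the integral.\<close>

definition rect_integral :: "(complex \<Rightarrow> complex) \<Rightarrow> real \<Rightarrow> real \<Rightarrow> real \<Rightarrow> real \<Rightarrow> complex" where
  "rect_integral G a b c d =
     (integral {a..b} (\<lambda>t. G (Complex t c)) - integral {a..b} (\<lambda>t. G (Complex t d)))
     + \<i> * (integral {c..d} (\<lambda>t. G (Complex b t)) - integral {c..d} (\<lambda>t. G (Complex a t)))"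

lemma continuous_on_Complex_compose:
  assumes "continuous_on UNIV G" "continuous_on S f" "continuous_on S g"
  shows "continuous_on S (\<lambda>t. G (Complex (f t) (g t)))"
proof -
  have "continuous_on S (\<lambda>t. Complex (f t) (g t))"
    unfolding Complex_eq by (intro continuous_intros assms)
  then show ?thesis by (rule continuous_on_compose2[OF assms(1)]) auto
qed

lemma rect_integral_split1:
  assumes G: "continuous_on UNIV G" and "a \<le> m" "m \<le> b"
  shows "rect_integral G a b c d = rect_integral G a m c d + rect_integral G m b c d"
proof -
  have "integral {a..b} (\<lambda>t. G (Complex t y)) = integral {a..m} (\<lambda>t. G (Complex t y)) + integral {m..b} (\<lambda>t. G (Complex t y))" for y
    by (rule Henstock_Kurzweil_Integration.integral_combine[symmetric])
      (use assms in \<open>auto intro!: integrable_continuous_real continuous_on_Complex_compose continuous_intros\<close>)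
  then show ?thesis unfolding rect_integral_def by (simp add: algebra_simps)
qed

lemma rect_integral_split2:
  assumes G: "continuous_on UNIV G" and "c \<le> m" "m \<le> d"
  shows "rect_integral G a b c d = rect_integral G a b c m + rect_integral G a b m d"
proof -
  have "integral {c..d} (\<lambda>t. G (Complex x t)) = integral {c..m} (\<lambda>t. G (Complex x t)) + integral {m..d} (\<lambda>t. G (Complex x t))" for x
    by (rule Henstock_Kurzweil_Integration.integral_combine[symmetric])
      (use assms in \<open>auto intro!: integrable_continuous_real continuous_on_Complex_compose continuous_intros\<close>)
  then show ?thesis unfolding rect_integral_def by (simp add: algebra_simps)
qed

lemma rect_integral_grid1:
  assumes G: "continuous_on UNIV G" and X: "mono X"
  shows "rect_integral G (X 0) (X n) c d = (\<Sum>i<n. rect_integral G (X i) (X (Suc i)) c d)"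
proof (induction n)
  case (Suc n)
  have "rect_integral G (X 0) (X (Suc n)) c d = rect_integral G (X 0) (X n) c d + rect_integral G (X n) (X (Suc n)) c d"
    by (rule rect_integral_split1[OF G]) (auto intro!: monoD[OF X])
  then show ?case using Suc by simp
qed (simp add: rect_integral_def)

lemma rect_integral_grid2:
  assumes G: "continuous_on UNIV G" and Y: "mono Y"
  shows "rect_integral G a b (Y 0) (Y n) = (\<Sum>j<n. rect_integral G a b (Y j) (Y (Suc j)))"
proof (induction n)
  case (Suc n)
  have "rect_integral G a b (Y 0) (Y (Suc n)) = rect_integral G a b (Y 0) (Y n) + rect_integral G a b (Y n) (Y (Suc n))"
    by (rule rect_integral_split2[OF G]) (auto intro!: monoD[OF Y])
  then show ?case using Suc by simp
qed (simp add: rect_integral_def)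

lemma rect_integral_eq_0_if_holomorphic:
  assumes hol: "G holomorphic_on cbox (Complex a c) (Complex b d)" and ab: "a < b" and cd: "c < d"
  shows "rect_integral G a b c d = 0"
proof -
  let ?R = "cbox (Complex a c) (Complex b d)"
  have cont: "continuous_on ?R G" using hol by (rule holomorphic_on_imp_continuous_on)
  let ?z1 = "Complex a c" and ?z2 = "Complex b c" and ?z3 = "Complex b d" and ?z4 = "Complex a d"
  have inR: "?z1 \<in> ?R" "?z2 \<in> ?R" "?z3 \<in> ?R" "?z4 \<in> ?R" using ab cd by (auto simp: in_cbox_complex_iff)
  have seg: "closed_segment u v \<subseteq> ?R" if "u \<in> ?R" "v \<in> ?R" for u v
    using that by (intro closed_segment_subset) auto
  have ci: "G contour_integrable_on linepath u v" if "u \<in> ?R" "v \<in> ?R" for u v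
    by (rule contour_integrable_continuous_linepath) (meson cont continuous_on_subset seg that)
  let ?p = "linepath ?z1 ?z2 +++ linepath ?z2 ?z3 +++ linepath ?z3 ?z4 +++ linepath ?z4 ?z1"
  have "(G has_contour_integral 0) ?p"
    by (rule Cauchy_theorem_convex_simple[OF hol])
       (use seg inR in \<open>auto simp: path_image_join intro!: valid_path_join\<close>)
  moreover have "(G has_contour_integral (contour_integral (linepath ?z1 ?z2) G + (contour_integral (linepath ?z2 ?z3) G +
     (contour_integral (linepath ?z3 ?z4) G + contour_integral (linepath ?z4 ?z1) G)))) ?p"
    by (intro has_contour_integral_join has_contour_integral_integral ci inR) auto
  ultimately have "contour_integral (linepath ?z1 ?z2) G + (contour_integral (linepath ?z2 ?z3) G +
     (contour_integral (linepath ?z3 ?z4) G + contour_integral (linepath ?z4 ?z1) G)) = 0"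
    by (metis contour_integral_unique)
  moreover have "contour_integral (linepath ?z3 ?z4) G = - contour_integral (linepath ?z4 ?z3) G"
    by (rule contour_integral_reverse_linepath) (meson cont continuous_on_subset seg inR)
  moreover have "contour_integral (linepath ?z4 ?z1) G = - contour_integral (linepath ?z1 ?z4) G"
    by (rule contour_integral_reverse_linepath) (meson cont continuous_on_subset seg inR)
  moreover have "contour_integral (linepath (Complex x c) (Complex x d)) G = \<i> * integral {c..d} (\<lambda>t. G (Complex x t))" for x
    by (rule contour_integral_linepath_same_Re) (use cd in auto)
  moreover have "contour_integral (linepath (Complex a y) (Complex b y)) G = integral {a..b} (\<lambda>t. G (Complex t y))" if y: "y \<in> {c, d}" for y
  proof -
    \<comment> \<open>A horizontal side is translated to the real axis, where a contour integral is
      an integral over a real interval.\<close>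
    have "(G has_contour_integral I) (linepath (Complex a y) (Complex b y)) \<longleftrightarrow>
      ((\<lambda>w. G (w + \<i> * of_real y)) has_contour_integral I) (linepath (of_real a) (of_real b))" for I
      unfolding has_contour_integral_linepath by (simp add: linepath_def Complex_eq algebra_simps)
    moreover have "((\<lambda>w. G (w + \<i> * of_real y)) has_contour_integral I) (linepath (of_real a) (of_real b))
      \<longleftrightarrow> ((\<lambda>t. G (Complex t y)) has_integral I) {a..b}" for I
      by (subst has_contour_integral_linepath_Reals_iff) (use ab in \<open>auto simp: Complex_eq\<close>)
    moreover have "(\<lambda>t. G (Complex t y)) integrable_on {a..b}"
      unfolding Complex_eq
      by (intro integrable_continuous_real continuous_on_compose2[OF cont] continuous_intros)
         (use y cd in \<open>auto simp: in_cbox_complex_iff\<close>)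
    ultimately show ?thesis by (metis contour_integral_unique integrable_integral)
  qed
  ultimately show ?thesis unfolding rect_integral_def by (simp add: algebra_simps)
qed

text \<open>A constant \<open>w\<close> contributes 0 around a rectangle, so only the oscillation of
  \<open>G\<close> about \<open>w\<close> enters, multiplied by the perimeter.\<close>

lemma norm_rect_integral_le:
  assumes G: "continuous_on UNIV G" and "a \<le> b" "c \<le> d"
    and le: "\<And>z. z \<in> cbox (Complex a c) (Complex b d) \<Longrightarrow> norm (G z - w) \<le> e"
  shows "norm (rect_integral G a b c d) \<le> 2 * e * ((b - a) + (d - c))"
proof -
  have sub1: "integral {a..b} (\<lambda>t. G (Complex t y) - w) = integral {a..b} (\<lambda>t. G (Complex t y)) - (b - a) *\<^sub>R w" for y
    using \<open>a \<le> b\<close> by (subst Henstock_Kurzweil_Integration.integral_diff)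
      (auto intro!: integrable_continuous_real continuous_on_Complex_compose[OF G] continuous_intros)
  have sub2: "integral {c..d} (\<lambda>t. G (Complex x t) - w) = integral {c..d} (\<lambda>t. G (Complex x t)) - (d - c) *\<^sub>R w" for x
    using \<open>c \<le> d\<close> by (subst Henstock_Kurzweil_Integration.integral_diff)
      (auto intro!: integrable_continuous_real continuous_on_Complex_compose[OF G] continuous_intros)
  have b1: "norm (integral {a..b} (\<lambda>t. G (Complex t y) - w)) \<le> e * (b - a)" if "y \<in> {c..d}" for y
    by (rule integral_bound) (use assms that in \<open>auto intro!: le continuous_on_Complex_compose continuous_intros simp: in_cbox_complex_iff\<close>)
  have b2: "norm (integral {c..d} (\<lambda>t. G (Complex x t) - w)) \<le> e * (d - c)" if "x \<in> {a..b}" for x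
    by (rule integral_bound) (use assms that in \<open>auto intro!: le continuous_on_Complex_compose continuous_intros simp: in_cbox_complex_iff\<close>)
  have "rect_integral G a b c d =
     (integral {a..b} (\<lambda>t. G (Complex t c) - w) - integral {a..b} (\<lambda>t. G (Complex t d) - w))
     + \<i> * (integral {c..d} (\<lambda>t. G (Complex b t) - w) - integral {c..d} (\<lambda>t. G (Complex a t) - w))"
    unfolding rect_integral_def sub1 sub2 by simp
  also have "norm \<dots> \<le> (e * (b - a) + e * (b - a)) + (e * (d - c) + e * (d - c))"
  proof -
    have tri: "norm (p - q + \<i> * (u - v)) \<le> (norm p + norm q) + (norm u + norm v)" for p q u v :: complex
      using norm_triangle_ineq[of "p - q" "\<i> * (u - v)"] norm_triangle_ineq4[of p q] norm_triangle_ineq4[of u v]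
      by (simp add: norm_mult)
    show ?thesis by (rule order_trans[OF tri], intro add_mono b1 b2) (use assms in auto)
  qed
  finally show ?thesis by (simp add: algebra_simps)
qed

text \<open>In units of the mesh \<open>h\<close>, the index of such a cell exceeds the least one by
  at most \<open>2 * r + 1\<close>. The count is therefore bounded independently of \<open>N\<close>
  and \<open>h\<close>.\<close>

lemma card_grid_interval_le:
  fixes a h r p :: real
  assumes h: "h > 0" and r: "r \<ge> 0"
  shows "card {i::nat. i < N \<and> a + i * h - r * h \<le> p \<and> p \<le> a + Suc i * h + r * h} \<le> nat \<lceil>2 * r + 2\<rceil>"
proof -
  let ?I = "{i::nat. i < N \<and> a + i * h - r * h \<le> p \<and> p \<le> a + Suc i * h + r * h}"
  show ?thesis
  proof (cases "?I = {}")
    case False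
    have fin: "finite ?I" by auto
    define m where "m = Min ?I"
    have m: "m \<in> ?I" unfolding m_def using fin False by (rule Min_in)
    have "?I \<subseteq> {m..<m + nat \<lceil>2 * r + 2\<rceil>}"
    proof
      fix i assume i: "i \<in> ?I"
      have mi: "m \<le> i" unfolding m_def using fin i by (rule Min_le)
      have "a + i * h - r * h \<le> p" "p \<le> a + Suc m * h + r * h" using i m by blast+
      then have "a + i * h - r * h \<le> a + Suc m * h + r * h" by (rule order_trans)
      then have "real i * h \<le> (real m + 1 + 2 * r) * h" by (simp add: algebra_simps)
      then have "real i \<le> real m + 1 + 2 * r" using h by simp
      then have "real i < real m + nat \<lceil>2 * r + 2\<rceil>" using r by linarith
      then have "i < m + nat \<lceil>2 * r + 2\<rceil>" by linarith
      with mi show "i \<in> {m..<m + nat \<lceil>2 * r + 2\<rceil>}" by simp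
    qed
    then have "card ?I \<le> card {m..<m + nat \<lceil>2 * r + 2\<rceil>}" by (intro card_mono) auto
    then show ?thesis by simp
  next
    case True
    show ?thesis unfolding True by simp
  qed
qed

text \<open>The set is a union of \<open>n\<close> disks of radius \<open>r / n\<close>, so it meets only \<open>O(n)\<close> of the \<open>n\<^sup>2\<close> cells of a
  grid, and the integral along the boundary of each of these is \<open>o(1/n)\<close>.\<close>

lemma rect_integral_eq_0_if_removable:
  assumes G: "continuous_on UNIV G" and hol: "G holomorphic_on (- K)"
    and cover: "\<And>n. n > 0 \<Longrightarrow> \<exists>p. K \<subseteq> (\<Union>k<n. cball (p k) (r / real n))" and r: "r \<ge> 0"
    and ab: "a < b" and cd: "c < d"
  shows "rect_integral G a b c d = 0"
proof -
  define A where "A = b - a"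
  define B where "B = d - c"
  have AB: "A > 0" "B > 0" using ab cd by (auto simp: A_def B_def)
  \<comment> \<open>Bounds the number of cells that one disk meets: its radius \<open>r / N\<close>
    amounts to \<open>r / A\<close> cell widths \<open>A / N\<close> and to \<open>r / B\<close>
    cell heights \<open>B / N\<close>.\<close>
  define M where "M = real (nat \<lceil>2 * (r / A) + 2\<rceil>) * real (nat \<lceil>2 * (r / B) + 2\<rceil>)"
  have M: "M \<ge> 0" by (simp add: M_def)
  have small: "norm (rect_integral G a b c d) \<le> M * (2 * e * (A + B))" if e: "e > 0" for e
  proof -
    let ?R = "cbox (Complex a c) (Complex b d)"
    have "uniformly_continuous_on ?R G"
      by (rule compact_uniformly_continuous) (auto intro: continuous_on_subset[OF G])
    then obtain \<delta> where \<delta>: "\<delta> > 0" "\<And>x y. x \<in> ?R \<Longrightarrow> y \<in> ?R \<Longrightarrow> dist x y < \<delta> \<Longrightarrow> dist (G x) (G y) < e"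
      using e unfolding uniformly_continuous_on_def by metis
    \<comment> \<open>The sum of width and height of a cell, \<open>(A + B) / N\<close>, falls below
      \<open>\<delta>\<close>, so \<open>G\<close> oscillates by at most \<open>e\<close> on each
      cell.\<close>
    obtain N :: nat where N: "(A + B) / \<delta> < N" using reals_Archimedean2 by blast
    have N0: "N > 0" using N AB \<delta> by (metis divide_pos_pos add_pos_pos of_nat_0_less_iff order_less_trans)
    define X where "X = (\<lambda>i::nat. a + i * (A / N))"
    define Y where "Y = (\<lambda>j::nat. c + j * (B / N))"
    have mX: "mono X" and mY: "mono Y"
      using AB by (auto simp: X_def Y_def mono_def intro!: divide_right_mono mult_right_mono)
    have X0: "X 0 = a" "X N = b" and Y0: "Y 0 = c" "Y N = d"
      using N0 by (auto simp: X_def Y_def A_def B_def)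
    have XS: "X (Suc i) - X i = A / N" and YS: "Y (Suc i) - Y i = B / N" for i
      by (auto simp: X_def Y_def algebra_simps add_divide_distrib)
    have Xr: "a \<le> X i" "X i < X (Suc i)" "X (Suc i) \<le> b" and Yr: "c \<le> Y i" "Y i < Y (Suc i)" "Y (Suc i) \<le> d" if "i < N" for i
      using monoD[OF mX, of 0 i] monoD[OF mX, of "Suc i" N] monoD[OF mY, of 0 i] monoD[OF mY, of "Suc i" N] that X0 Y0
        XS[of i] YS[of i] AB N0 by (auto simp: algebra_simps intro!: diff_gt_0_iff_gt[THEN iffD1])
    let ?Q = "\<lambda>i j. cbox (Complex (X i) (Y j)) (Complex (X (Suc i)) (Y (Suc j)))"
    let ?I = "\<lambda>i j. rect_integral G (X i) (X (Suc i)) (Y j) (Y (Suc j))"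
    define bad where "bad = {(i, j). i < N \<and> j < N \<and> ?Q i j \<inter> K \<noteq> {}}"
    have fin: "finite bad" by (rule finite_subset[of _ "{..<N} \<times> {..<N}"]) (auto simp: bad_def)
    have "rect_integral G a b c d = (\<Sum>i<N. \<Sum>j<N. ?I i j)"
      using rect_integral_grid1[OF G mX, of N c d] rect_integral_grid2[OF G mY, of _ _ N] by (simp add: X0 Y0)
    also have "\<dots> = (\<Sum>(i, j)\<in>{..<N} \<times> {..<N}. ?I i j)"
      by (simp add: sum.cartesian_product)
    also have "\<dots> = (\<Sum>(i, j)\<in>bad. ?I i j)"
    proof (rule sum.mono_neutral_right)
      show "\<forall>q\<in>{..<N} \<times> {..<N} - bad. (case q of (i, j) \<Rightarrow> ?I i j) = 0"
      proof
        fix q assume "q \<in> {..<N} \<times> {..<N} - bad"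
        then obtain i j where ij: "i \<in> {..<N}" "j \<in> {..<N}" "(i, j) \<notin> bad" and q: "q = (i, j)" by auto
        then have "?Q i j \<subseteq> - K" by (auto simp: bad_def)
        then have "G holomorphic_on ?Q i j" using hol holomorphic_on_subset by blast
        then have "?I i j = 0"
          by (rule rect_integral_eq_0_if_holomorphic) (use Xr[of i] Yr[of j] ij in auto)
        then show "(case q of (i, j) \<Rightarrow> ?I i j) = 0" by (simp add: q)
      qed
    qed (auto simp: bad_def)
    finally have eq: "rect_integral G a b c d = (\<Sum>(i, j)\<in>bad. ?I i j)" .
    have cell: "norm (?I i j) \<le> 2 * e * (A / N + B / N)" if "i < N" "j < N" for i j
    proof -
      have "norm (G z - G (Complex (X i) (Y j))) \<le> e" if z: "z \<in> ?Q i j" for z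
      proof -
        have "norm (z - Complex (X i) (Y j)) \<le> \<bar>Re z - X i\<bar> + \<bar>Im z - Y j\<bar>"
          using cmod_le[of "z - Complex (X i) (Y j)"] by simp
        also have "\<dots> \<le> A / N + B / N"
          using z XS[of i] YS[of j] by (auto simp: in_cbox_complex_iff)
        also have "\<dots> < \<delta>" using N N0 \<delta> by (simp add: field_simps)
        finally have "dist z (Complex (X i) (Y j)) < \<delta>" by (simp add: dist_norm)
        moreover have "z \<in> ?R" "Complex (X i) (Y j) \<in> ?R"
          using z Xr[OF \<open>i < N\<close>] Yr[OF \<open>j < N\<close>] by (auto simp: in_cbox_complex_iff)
        ultimately show ?thesis using \<delta>(2) by (force simp: dist_norm)
      qed
      then have "norm (?I i j) \<le> 2 * e * ((X (Suc i) - X i) + (Y (Suc j) - Y j))"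
        by (intro norm_rect_integral_le[OF G]) (use Xr[OF \<open>i < N\<close>] Yr[OF \<open>j < N\<close>] in auto)
      then show ?thesis by (simp only: XS YS)
    qed
    obtain p where p: "K \<subseteq> (\<Union>k<N. cball (p k) (r / real N))" using cover N0 by blast
    define J1 where "J1 k = {i::nat. i < N \<and> a + i * (A / N) - (r / A) * (A / N) \<le> Re (p k) \<and> Re (p k) \<le> a + Suc i * (A / N) + (r / A) * (A / N)}" for k
    define J2 where "J2 k = {i::nat. i < N \<and> c + i * (B / N) - (r / B) * (B / N) \<le> Im (p k) \<and> Im (p k) \<le> c + Suc i * (B / N) + (r / B) * (B / N)}" for k
    have "bad \<subseteq> (\<Union>k<N. J1 k \<times> J2 k)"
    proof clarify
      fix i j assume "(i, j) \<in> bad"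
      then obtain z where ij: "i < N" "j < N" and z: "z \<in> ?Q i j" "z \<in> K" by (auto simp: bad_def)
      obtain k where k: "k < N" "dist (p k) z \<le> r / N" using p z(2) by auto
      have "\<bar>Re (p k) - Re z\<bar> \<le> r / N" "\<bar>Im (p k) - Im z\<bar> \<le> r / N"
        using k(2) abs_Re_le_cmod[of "p k - z"] abs_Im_le_cmod[of "p k - z"] by (auto simp: dist_norm)
      then have "i \<in> J1 k" "j \<in> J2 k"
        using ij z(1) AB by (auto simp: J1_def J2_def in_cbox_complex_iff X_def Y_def)
      then show "(i, j) \<in> (\<Union>k<N. J1 k \<times> J2 k)" using k by blast
    qed
    then have "card bad \<le> card (\<Union>k<N. J1 k \<times> J2 k)"
      by (rule card_mono[rotated]) (auto simp: J1_def J2_def)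
    also have "\<dots> \<le> (\<Sum>k<N. card (J1 k \<times> J2 k))" by (rule card_UN_le) simp
    finally have "real (card bad) \<le> real (\<Sum>k<N. card (J1 k \<times> J2 k))" by (rule of_nat_mono)
    also have "\<dots> = (\<Sum>k<N. real (card (J1 k)) * real (card (J2 k)))" by (simp add: card_cartesian_product)
    also have "\<dots> \<le> (\<Sum>k<N. M)"
      unfolding M_def J1_def J2_def
      by (intro sum_mono mult_mono of_nat_mono card_grid_interval_le) (use AB N0 r in auto)
    also have "\<dots> = N * M" by simp
    finally have card: "real (card bad) \<le> N * M" .
    have "norm (rect_integral G a b c d) \<le> (\<Sum>q\<in>bad. 2 * e * (A / N + B / N))"
      unfolding eq by (rule sum_norm_le) (use cell in \<open>auto simp: bad_def\<close>)
    also have "\<dots> = real (card bad) * (2 * e * (A / N + B / N))" by simp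
    also have "\<dots> \<le> (N * M) * (2 * e * (A / N + B / N))"
      using card AB e N0 by (intro mult_right_mono) auto
    also have "\<dots> = M * (2 * e * (A + B))" using N0 by (simp add: field_simps)
    finally show ?thesis .
  qed
  have "norm (rect_integral G a b c d) \<le> 0"
  proof (rule field_le_epsilon)
    fix e :: real assume e: "e > 0"
    define e' where "e' = e / (2 * (M + 1) * (A + B))"
    have e': "e' > 0" using e M AB by (simp add: e'_def)
    have "norm (rect_integral G a b c d) \<le> M * (2 * e' * (A + B))" by (rule small[OF e'])
    also have "\<dots> \<le> (M + 1) * (2 * e' * (A + B))" using e' AB by (intro mult_right_mono) auto
    also have "\<dots> = e"
    proof -
      have "M + 1 \<noteq> 0" "A + B \<noteq> 0" using AB M by auto
      then show ?thesis unfolding e'_def by (simp add: divide_simps)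
    qed
    finally show "norm (rect_integral G a b c d) \<le> 0 + e" by simp
  qed
  then show ?thesis by simp
qed

text \<open>Morera's theorem for rectangles. Integration along L-shaped paths from a corner below
  and to the left of \<open>z0\<close> gives a primitive, and the derivative of a holomorphic
  function is holomorphic.\<close>

lemma holomorphic_if_rect_integral_eq_0:
  assumes G: "continuous_on UNIV G"
    and zero: "\<And>a b c d. a < b \<Longrightarrow> c < d \<Longrightarrow> rect_integral G a b c d = 0"
  shows "G holomorphic_on UNIV"
proof -
  have "G field_differentiable at z0" for z0
  proof -
    define p where "p = Re z0 - 1"
    define q where "q = Im z0 - 1"
    define F where "F = (\<lambda>x y. integral {p..x} (\<lambda>t. G (Complex t q)) + \<i> * integral {q..y} (\<lambda>t. G (Complex x t)))"
    define U where "U = {z. p < Re z \<and> q < Im z}"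
    have U: "open U"
      unfolding U_def by (intro open_Collect_conj open_Collect_less continuous_intros)
    have intx: "((\<lambda>u. integral {p..u} (\<lambda>t. G (Complex t y))) has_vector_derivative G (Complex x y)) (at x)" if "p < x" for x y
    proof -
      have "((\<lambda>u. integral {p..u} (\<lambda>t. G (Complex t y))) has_vector_derivative G (Complex x y)) (at x within {p..x+1})"
        by (rule integral_has_vector_derivative) (use that in \<open>auto intro!: continuous_on_Complex_compose[OF G] continuous_intros\<close>)
      then show ?thesis using that by (subst (asm) at_within_interior[of x]) auto
    qed
    have inty: "((\<lambda>u. integral {q..u} (\<lambda>t. G (Complex x t))) has_vector_derivative G (Complex x y)) (at y)" if "q < y" for x y
    proof -
      have "((\<lambda>u. integral {q..u} (\<lambda>t. G (Complex x t))) has_vector_derivative G (Complex x y)) (at y within {q..y+1})"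
        by (rule integral_has_vector_derivative) (use that in \<open>auto intro!: continuous_on_Complex_compose[OF G] continuous_intros\<close>)
      then show ?thesis using that by (subst (asm) at_within_interior[of y]) auto
    qed
    \<comment> \<open>Vanishing around the rectangle allows the path to run up first and then
      across. The definition of \<open>F\<close> exhibits its derivative in \<open>y\<close>, this
      form its derivative in \<open>x\<close>; continuity of one partial derivative then gives total
      differentiability.\<close>
    have F2: "F x y = integral {p..x} (\<lambda>t. G (Complex t y)) + \<i> * integral {q..y} (\<lambda>t. G (Complex p t))" if "p < x" "q < y" for x y
      using zero[OF that] unfolding rect_integral_def F_def by (simp add: algebra_simps)
    have dF: "((\<lambda>z. F (Re z) (Im z)) has_field_derivative G z) (at z)" if z: "z \<in> U" for z
    proof -
      have xy: "p < Re z" "q < Im z" using z by (auto simp: U_def)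
      have fx: "((\<lambda>x. F x (Im z)) has_derivative (\<lambda>t. t *\<^sub>R G z)) (at (Re z) within {p<..})"
      proof -
        have "((\<lambda>x. integral {p..x} (\<lambda>t. G (Complex t (Im z))) + \<i> * integral {q..Im z} (\<lambda>t. G (Complex p t)))
           has_vector_derivative (G (Complex (Re z) (Im z)) + 0)) (at (Re z))"
          by (intro has_vector_derivative_add intx[OF xy(1)] has_vector_derivative_const)
        then have "((\<lambda>x. integral {p..x} (\<lambda>t. G (Complex t (Im z))) + \<i> * integral {q..Im z} (\<lambda>t. G (Complex p t)))
           has_derivative (\<lambda>t. t *\<^sub>R G z)) (at (Re z) within {p<..})"
          by (simp add: has_vector_derivative_def has_derivative_at_withinI)
        then show ?thesis
          by (rule has_derivative_transform[rotated 2]) (use xy F2 in auto)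
      qed
      have fy: "((\<lambda>y. F x y) has_derivative blinfun_apply (blinfun_scaleR_left (\<i> * G (Complex x y)))) (at y within {q<..})"
        if "x \<in> {p<..}" "y \<in> {q<..}" for x y
      proof -
        have "((\<lambda>y. F x y) has_vector_derivative (0 + \<i> * G (Complex x y))) (at y)"
          unfolding F_def
          by (intro has_vector_derivative_add has_vector_derivative_const has_vector_derivative_mult_right inty) (use that in auto)
        then show ?thesis by (simp add: has_vector_derivative_def has_derivative_at_withinI)
      qed
      have cont: "continuous (at (Re z, Im z) within {p<..} \<times> {q<..}) (\<lambda>(x, y). blinfun_scaleR_left (\<i> * G (Complex x y)))"
      proof -
        have "continuous_on UNIV (\<lambda>u. blinfun_scaleR_left (\<i> * G (Complex (fst u) (snd u))) :: real \<Rightarrow>\<^sub>L complex)"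
          by (intro continuous_intros continuous_on_Complex_compose[OF G])
        then show ?thesis
          by (auto simp: continuous_on_eq_continuous_within case_prod_beta' intro: continuous_at_imp_continuous_at_within)
      qed
      have D: "((\<lambda>(x, y). F x y) has_derivative (\<lambda>(tx, ty). tx *\<^sub>R G z + blinfun_apply (blinfun_scaleR_left (\<i> * G (Complex (Re z) (Im z)))) ty))
         (at (Re z, Im z) within {p<..} \<times> {q<..})"
        by (rule has_derivative_partialsI[OF fx fy cont]) (use xy in auto)
      have op: "open ({p<..} \<times> {q<..})" by (intro open_Times) auto
      have mem: "(Re z, Im z) \<in> {p<..} \<times> {q<..}" using xy by simp
      have D': "((\<lambda>(x, y). F x y) has_derivative (\<lambda>(tx, ty). tx *\<^sub>R G z + ty *\<^sub>R (\<i> * G z)))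
         (at (Re z, Im z))"
        using D unfolding at_within_open[OF mem op] by simp
      have "((\<lambda>z. (Re z, Im z)) has_derivative (\<lambda>h. (Re h, Im h))) (at z)"
        by (intro derivative_eq_intros | simp)+
      from has_derivative_compose[OF this D']
      have "((\<lambda>z. F (Re z) (Im z)) has_derivative (\<lambda>h. Re h *\<^sub>R G z + Im h *\<^sub>R (\<i> * G z))) (at z)" by simp
      moreover have "Re h *\<^sub>R G z + Im h *\<^sub>R (\<i> * G z) = G z * h" for h
        by (subst (3) complex_eq[of h]) (simp add: scaleR_conv_of_real algebra_simps)
      ultimately show ?thesis by (simp add: has_field_derivative_def)
    qed
    have "(\<lambda>z. F (Re z) (Im z)) holomorphic_on U"
      using dF U by (auto simp: holomorphic_on_open)
    then have "deriv (\<lambda>z. F (Re z) (Im z)) holomorphic_on U" using U by (rule holomorphic_deriv)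
    moreover have "deriv (\<lambda>z. F (Re z) (Im z)) z = G z" if "z \<in> U" for z
      using dF[OF that] by (rule DERIV_imp_deriv)
    ultimately have "G holomorphic_on U" by (rule holomorphic_transform)
    moreover have "z0 \<in> U" by (simp add: U_def p_def q_def)
    ultimately show ?thesis using U holomorphic_on_imp_differentiable_at by blast
  qed
  then show ?thesis by (simp add: holomorphic_on_def field_differentiable_at_within)
qed

lemma eq_0_if_holomorphic_off_curve:
  fixes G :: "complex \<Rightarrow> complex"
  assumes G: "continuous_on UNIV G" and hol: "G holomorphic_on (- K)"
    and K: "K = S ` {0..R}" and R: "0 \<le> (R::real)" and lip: "L-lipschitz_on {0..R} S"
    and lim: "(G \<longlongrightarrow> 0) at_infinity"
  shows "G z = 0"
proof -
  have L: "L \<ge> 0" using lip by (rule lipschitz_on_nonneg)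
  have cover: "\<exists>p. K \<subseteq> (\<Union>k<n. cball (p k) (L * R / real n))" if n: "n > 0" for n
  proof (intro exI subsetI)
    fix w assume "w \<in> K"
    then obtain t where t: "t \<in> {0..R}" "w = S t" using K by auto
    \<comment> \<open>At the right end point the floor would give the index \<open>n\<close>, so the
      last admissible index is taken instead.\<close>
    define k where "k = (if t = R then n - 1 else nat \<lfloor>t * n / R\<rfloor>)"
    have kk: "k < n \<and> \<bar>t - k * R / n\<bar> \<le> R / n \<and> k * R / n \<in> {0..R}"
    proof (cases "t = R")
      case True
      have "R - real (n - 1) * R / n = R / n" using n by (simp add: field_simps of_nat_diff)
      moreover have "real (n - 1) * R / n \<le> R" using n R by (simp add: divide_le_eq mult_mono mult.commute[of R])
      ultimately show ?thesis using n R True by (auto simp: k_def)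
    next
      case False
      then have R': "R > 0" "t < R" "0 \<le> t" using t by auto
      define x where "x = t * n / R"
      have x: "0 \<le> x" "x < n" using R' n by (auto simp: x_def field_simps)
      have kx: "real k \<le> x" "x < real k + 1" using x False by (auto simp: k_def x_def[symmetric] of_nat_floor)
      have tx: "t = x * R / n" using R' n by (simp add: x_def)
      have "k < n" using kx x by linarith
      moreover have "\<bar>t - k * R / n\<bar> = (x - k) * (R / n)"
      proof -
        have "t - k * R / n = (x - k) * (R / n)" by (simp add: tx left_diff_distrib diff_divide_distrib)
        moreover have "0 \<le> (x - k) * (R / n)" using kx R' by simp
        ultimately show ?thesis by (metis abs_of_nonneg)
      qed
      moreover have "\<dots> \<le> 1 * (R / n)" using kx R' by (intro mult_right_mono) auto
      moreover have "k * R / n \<le> R" using \<open>k < n\<close> R' by (simp add: field_simps)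
      ultimately show ?thesis using R' by auto
    qed
    have "dist (S (k * R / n)) w \<le> L * dist (k * R / n) t"
      unfolding t(2) by (rule lipschitz_onD[OF lip]) (use kk t in auto)
    also have "\<dots> \<le> L * (R / n)" using kk L by (intro mult_left_mono) (auto simp: dist_real_def)
    finally show "w \<in> (\<Union>k<n. cball ((\<lambda>k. S (k * R / n)) k) (L * R / real n))" using kk by auto
  qed
  have "G holomorphic_on UNIV"
    by (rule holomorphic_if_rect_integral_eq_0[OF G])
       (rule rect_integral_eq_0_if_removable[OF G hol cover], use L R in auto)
  then show ?thesis using lim by (rule Liouville_weak_0)
qed

subsection \<open>Integrals of periodic functions\<close>

lemma set_integral_shift:
  fixes F :: "real \<Rightarrow> 'a::{banach, second_countable_topology}"
  assumes "set_integrable lborel {a + c..b + c} F"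
  shows "set_integrable lborel {a..b} (\<lambda>u. F (c + u))"
    and "(LINT u:{a..b}|lborel. F (c + u)) = (LINT x:{a + c..b + c}|lborel. F x)"
proof -
  have i: "integrable lborel (\<lambda>x. indicator {a + c..b + c} x *\<^sub>R F x)"
    using assms by (simp add: set_integrable_def)
  have eq: "indicat_real {a + c..b + c} (c + 1 * u) *\<^sub>R F (c + 1 * u) = indicat_real {a..b} u *\<^sub>R F (c + u)" for u
    by (simp add: indicator_def)
  show "set_integrable lborel {a..b} (\<lambda>u. F (c + u))"
    using lborel_integrable_real_affine[OF i, of 1 c] unfolding set_integrable_def eq by simp
  show "(LINT u:{a..b}|lborel. F (c + u)) = (LINT x:{a + c..b + c}|lborel. F x)"
    using lborel_integral_real_affine[of 1 "\<lambda>x. indicator {a + c..b + c} x *\<^sub>R F x" c]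
    unfolding set_lebesgue_integral_def eq by simp
qed

lemma periodic_int:
  fixes F :: "real \<Rightarrow> 'a"
  assumes "\<And>x. F (x + p) = F x"
  shows "F (x + of_int k * p) = F x"
proof -
  have nat: "F (x + of_nat n * p) = F x" for n x
  proof (induction n)
    case (Suc n)
    have "x + of_nat (Suc n) * p = (x + of_nat n * p) + p" by (simp add: algebra_simps)
    then show ?case using assms Suc by metis
  qed simp
  show ?thesis
  proof (cases "k \<ge> 0")
    case True
    then show ?thesis using nat[of x "nat k"] by simp
  next
    case False
    then show ?thesis using nat[of "x + of_int k * p" "nat (- k)"] by simp
  qed
qed

text \<open>A multiple of the period moves \<open>b\<close> to a point \<open>b'\<close> of
  \<open>[a, a + p]\<close>; the part of \<open>[b', b' + p]\<close> beyond \<open>a + p\<close> is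
  then translated back by one period to \<open>[a, b']\<close>.\<close>

lemma set_integral_periodic:
  fixes F :: "real \<Rightarrow> 'a::euclidean_space"
  assumes per: "\<And>x. F (x + p) = F x" and p: "p > 0" and int: "set_integrable lborel {a..a + p} F"
  shows "set_integrable lborel {b..b + p} F"
    and "(LINT x:{b..b + p}|lborel. F x) = (LINT x:{a..a + p}|lborel. F x)"
proof -
  define k where "k = \<lceil>(a - b) / p\<rceil>"
  define b' where "b' = b + of_int k * p"
  have b': "a \<le> b'" "b' \<le> a + p"
  proof -
    have "(a - b) / p \<le> of_int k" "of_int k < (a - b) / p + 1" unfolding k_def by linarith+
    then show "a \<le> b'" "b' \<le> a + p" using p unfolding b'_def by (simp_all add: field_simps)
  qed
  have i1: "set_integrable lborel {a..b'} F" and i2: "set_integrable lborel {b'..a + p} F"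
    by (rule set_integrable_subset[OF int]; use b' in auto)+
  have Fp: "F (u - p) = F u" for u using per[of "u - p"] by simp
  have s: "set_integrable lborel {a + p..b' + p} F"
    and seq: "(LINT x:{a + p..b' + p}|lborel. F x) = (LINT x:{a..b'}|lborel. F x)"
    using set_integral_shift[of "a + p" "- p" "b' + p" F] i1 by (simp_all add: Fp)
  have u: "{b'..a + p} \<union> {a + p..b' + p} = {b'..b' + p}" using b' by auto
  have i3: "set_integrable lborel {b'..b' + p} F"
    using set_integrable_Un[OF i2 s] unfolding u by simp
  have "(LINT x:{b'..b' + p}|lborel. F x) = integral {b'..b' + p} F"
    using i3 by (rule set_borel_integral_eq_integral)
  also have "\<dots> = integral {b'..a + p} F + integral {a + p..b' + p} F"
    by (rule Henstock_Kurzweil_Integration.integral_combine[symmetric])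
       (use b' set_borel_integral_eq_integral(1)[OF i3] in auto)
  also have "\<dots> = integral {a..b'} F + integral {b'..a + p} F"
    using seq set_borel_integral_eq_integral(2)[OF s] set_borel_integral_eq_integral(2)[OF i1] by simp
  also have "\<dots> = integral {a..a + p} F"
    by (rule Henstock_Kurzweil_Integration.integral_combine)
       (use b' set_borel_integral_eq_integral(1)[OF int] in auto)
  also have "\<dots> = (LINT x:{a..a + p}|lborel. F x)"
    using set_borel_integral_eq_integral(2)[OF int] by simp
  finally have e: "(LINT x:{b'..b' + p}|lborel. F x) = (LINT x:{a..a + p}|lborel. F x)" .
  have Fk: "F (u + p * of_int k) = F u" for u using periodic_int[of F p, OF per, of u k] by (simp add: mult.commute)
  have "set_integrable lborel {b + of_int k * p..(b + p) + of_int k * p} F"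
    using i3 by (simp add: b'_def algebra_simps)
  from set_integral_shift[OF this] show "set_integrable lborel {b..b + p} F"
    and "(LINT x:{b..b + p}|lborel. F x) = (LINT x:{a..a + p}|lborel. F x)"
    using e by (simp_all add: Fk b'_def algebra_simps)
qed

lemma periodic_centered_integral:
  fixes F :: "real \<Rightarrow> 'a::euclidean_space"
  assumes per: "\<And>x. F (x + 2 * pi) = F x" and int: "set_integrable lborel {a..a + 2 * pi} F"
  shows "set_integrable lborel {-pi..pi} (\<lambda>u. F (t + u))"
    and "(LINT u:{-pi..pi}|lborel. F (t + u)) = (LINT x:{a..a + 2 * pi}|lborel. F x)"
proof -
  have 1: "set_integrable lborel {-pi + t..(-pi + t) + 2 * pi} F"
    and 2: "(LINT x:{-pi + t..(-pi + t) + 2 * pi}|lborel. F x) = (LINT x:{a..a + 2 * pi}|lborel. F x)"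
    by (rule set_integral_periodic[OF per _ int]; simp)+
  have e: "(-pi + t) + 2 * pi = pi + t" by simp
  show "set_integrable lborel {-pi..pi} (\<lambda>u. F (t + u))"
    using set_integral_shift(1)[of "-pi" t pi F] 1 unfolding e by simp
  show "(LINT u:{-pi..pi}|lborel. F (t + u)) = (LINT x:{a..a + 2 * pi}|lborel. F x)"
    using set_integral_shift(2)[of "-pi" t pi F] 1 2 unfolding e by simp
qed

text \<open>For a kernel singular at \<open>t\<close> integrability is first known on the period
  centred at \<open>t\<close>; from there it is carried to every other period.\<close>

lemma periodic_uncentered_integral:
  fixes F :: "real \<Rightarrow> 'a::euclidean_space"
  assumes per: "\<And>x. F (x + 2 * pi) = F x" and int: "set_integrable lborel {-pi..pi} (\<lambda>u. F (t + u))"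
  shows "set_integrable lborel {a..a + 2 * pi} F"
    and "(LINT x:{a..a + 2 * pi}|lborel. F x) = (LINT u:{-pi..pi}|lborel. F (t + u))"
proof -
  have 1: "set_integrable lborel {t - pi..(t - pi) + 2 * pi} F"
    using set_integral_shift(1)[of "t - pi" "- t" "t + pi" "\<lambda>u. F (t + u)"] int by (simp add: algebra_simps)
  show 2: "set_integrable lborel {a..a + 2 * pi} F"
    using set_integral_periodic(1)[OF per _ 1] by simp
  show "(LINT x:{a..a + 2 * pi}|lborel. F x) = (LINT u:{-pi..pi}|lborel. F (t + u))"
    using periodic_centered_integral(2)[OF per 2] by simp
qed

lemma periodic_reduce:
  assumes "\<And>x. F (x + 2 * pi) = F x"
  obtains k :: int where "x + of_int k * (2 * pi) \<in> {t - pi..t + pi}"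
    "F (x + of_int k * (2 * pi)) = F x"
proof -
  define k where "k = \<lceil>(t - pi - x) / (2 * pi)\<rceil>"
  have "(t - pi - x) / (2 * pi) \<le> of_int k" "of_int k < (t - pi - x) / (2 * pi) + 1" unfolding k_def by linarith+
  then have "x + of_int k * (2 * pi) \<in> {t - pi..t + pi}" by (simp add: field_simps)
  then show ?thesis using periodic_int[of F, OF assms] that by blast
qed

lemma bounded_range_periodic:
  fixes F :: "real \<Rightarrow> 'a::metric_space"
  assumes per: "\<And>x. F (x + 2 * pi) = F x" and cont: "continuous_on UNIV F"
  shows "bounded (range F)"
proof -
  have "range F \<subseteq> F ` {0 - pi..0 + pi}"
  proof clarify
    fix x
    obtain k :: int where "x + of_int k * (2 * pi) \<in> {0 - pi..0 + pi}" "F (x + of_int k * (2 * pi)) = F x"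
      using periodic_reduce[of F, OF per] .
    then show "F x \<in> F ` {0 - pi..0 + pi}" by (metis imageI)
  qed
  moreover have "compact (F ` {0 - pi..0 + pi})"
    by (intro compact_continuous_image continuous_on_subset[OF cont]) auto
  ultimately show ?thesis using compact_imp_bounded bounded_subset by blast
qed

subsection \<open>Curves with a logarithmic Dini tangent\<close>

lemma ln_ge_1: "1 \<le> ln (3 / x)" if "0 < x" "x \<le> (1::real)"
proof -
  have "exp 1 \<le> (3::real)" by (rule exp_le)
  also have "3 \<le> 3 / x" using that by (simp add: field_simps)
  finally show ?thesis using that by (subst ln_ge_iff) auto
qed

text \<open>Everything the boundary integrals need to know about the conformal map: a regular
  periodic parametrization by the angle, the modulus of its tangent, and the index of the curve
  about each point off it.\<close>

locale dini_curve =
  fixes S S' :: "real \<Rightarrow> complex" and D :: "complex set"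
  assumes S_periodic: "S (x + 2 * pi) = S x"
    and S'_periodic: "S' (x + 2 * pi) = S' x"
    and S_deriv: "(S has_vector_derivative S' x) (at x)"
    and S'_nonzero: "S' x \<noteq> 0"
    and S_inj: "S x = S y \<Longrightarrow> \<exists>k::int. x = y + of_int k * (2 * pi)"
    and S'_log_dini: "(\<integral>\<^sup>+\<eta>\<in>{0<..1}. (modulus UNIV S' \<eta> / ennreal \<eta> * ennreal (ln (3 / \<eta>))) \<partial>lborel) < \<infinity>"
    and D_open: "open D" and D_frontier: "frontier D = range S"
    and index: "z \<notin> range S \<Longrightarrow>
      ((\<lambda>x. S' x / (S x - z)) has_integral (if z \<in> D then 2 * of_real pi * \<i> else 0)) {0..2 * pi}"
begin

lemma S'_dini: "dini UNIV S'"
proof -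
  have "(\<integral>\<^sup>+\<eta>\<in>{0<..1}. (modulus UNIV S' \<eta> / ennreal \<eta>) \<partial>lborel)
    \<le> (\<integral>\<^sup>+\<eta>\<in>{0<..1}. (modulus UNIV S' \<eta> / ennreal \<eta> * ennreal (ln (3 / \<eta>))) \<partial>lborel)"
  proof (rule nn_integral_mono)
    fix \<eta> :: real
    have "modulus UNIV S' \<eta> / ennreal \<eta> * 1 \<le> modulus UNIV S' \<eta> / ennreal \<eta> * ennreal (ln (3 / \<eta>))"
      if "\<eta> \<in> {0<..1}" using ln_ge_1[of \<eta>] that by (intro mult_left_mono) auto
    then show "modulus UNIV S' \<eta> / ennreal \<eta> * indicator {0<..1} \<eta>
      \<le> modulus UNIV S' \<eta> / ennreal \<eta> * ennreal (ln (3 / \<eta>)) * indicator {0<..1} \<eta>"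
      by (auto simp: indicator_def)
  qed
  also have "\<dots> < \<infinity>" by (rule S'_log_dini)
  finally show ?thesis by (simp add: dini_def)
qed

lemma S'_continuous: "continuous_on UNIV S'"
  using dini_imp_uniformly_continuous_on[OF S'_dini] uniformly_continuous_imp_continuous by blast

lemma S_continuous: "continuous_on UNIV S"
  using S_deriv by (auto intro!: continuous_at_imp_continuous_on has_vector_derivative_continuous)

lemma S'_bounded: "bounded (range S')"
  by (rule bounded_range_periodic[OF S'_periodic S'_continuous])

lemma S_measurable [measurable]: "S \<in> borel_measurable borel" "S' \<in> borel_measurable borel"
  using S_continuous S'_continuous by (auto intro: borel_measurable_continuous_onI)

definition w :: "real \<Rightarrow> real" where "w = (\<lambda>x. enn2real (modulus UNIV S' x))"

lemma w_mono: "mono w" and w_nonneg: "0 \<le> w x" and S'_le_w: "norm (S' x - S' y) \<le> w \<bar>x - y\<bar>"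
  and w_eq: "ennreal (w x) = modulus UNIV S' x"
  and w_integrable: "set_integrable lborel {-R..R} (\<lambda>u. w \<bar>u\<bar> / \<bar>u\<bar>)"
proof -
  obtain v where "mono v" "\<And>x. 0 \<le> v x" "\<And>x y. dist (S' x) (S' y) \<le> v \<bar>x - y\<bar>" "v = w"
    "\<And>x. ennreal (v x) = modulus UNIV S' x" "\<And>R. set_integrable lborel {-R..R} (\<lambda>u. v \<bar>u\<bar> / \<bar>u\<bar>)"
    using dini_majorant[OF S'_dini S'_bounded] unfolding w_def by blast
  then show "mono w" "0 \<le> w x" "norm (S' x - S' y) \<le> w \<bar>x - y\<bar>" "ennreal (w x) = modulus UNIV S' x"
    "set_integrable lborel {-R..R} (\<lambda>u. w \<bar>u\<bar> / \<bar>u\<bar>)" by (auto simp: dist_norm)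
qed

lemma w_measurable [measurable]: "w \<in> borel_measurable borel"
  using w_mono by (rule borel_measurable_mono)

text \<open>A pair at distance at most \<open>2 * u\<close> is joined through its midpoint.\<close>

lemma w_double: "w (2 * u) \<le> 2 * w u"
proof -
  have "modulus UNIV S' (2 * u) \<le> ennreal (2 * w u)"
  proof (rule modulus_least)
    fix p q :: real assume "dist p q \<le> 2 * u"
    then have pq: "\<bar>p - q\<bar> \<le> 2 * u" by (simp add: dist_real_def)
    define m where "m = (p + q) / 2"
    have "\<bar>p - m\<bar> \<le> u" "\<bar>m - q\<bar> \<le> u" using pq by (auto simp: m_def field_simps abs_if)
    then have "norm (S' p - S' m) \<le> w u" "norm (S' m - S' q) \<le> w u"
      using S'_le_w monoD[OF w_mono] by (meson order_trans)+
    then have "norm (S' p - S' q) \<le> 2 * w u"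
      using norm_triangle_ineq[of "S' p - S' m" "S' m - S' q"] by simp
    then show "ennreal (dist (S' p) (S' q)) \<le> ennreal (2 * w u)" by (simp add: dist_norm ennreal_leI)
  qed
  then show ?thesis unfolding w_eq[symmetric] using w_nonneg by (subst (asm) ennreal_le_iff) auto
qed

lemma w_small:
  assumes "e > 0" obtains d where "d > 0" "w d \<le> e"
proof -
  obtain d where d: "d > 0" "\<And>x x'. dist x' x < d \<Longrightarrow> dist (S' x') (S' x) < e"
    using dini_imp_uniformly_continuous_on[OF S'_dini] assms unfolding uniformly_continuous_on_def by auto
  have "modulus UNIV S' (d / 2) \<le> ennreal e"
  proof (rule modulus_least)
    fix p q :: real assume "dist p q \<le> d / 2"
    then have "dist (S' p) (S' q) < e" using d by simp
    then show "ennreal (dist (S' p) (S' q)) \<le> ennreal e" by (intro ennreal_leI) simp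
  qed
  then have "w (d / 2) \<le> e" unfolding w_eq[symmetric] using assms by (subst (asm) ennreal_le_iff) auto
  then show ?thesis using that[of "d / 2"] d by simp
qed

text \<open>The mean value inequality for \<open>S\<close> minus its tangent line at
  \<open>s\<close>. The point of tangency may differ from both end points of the chord, which is how
  comparisons of two kernels use it.\<close>

lemma S_linearization:
  assumes "\<bar>x - s\<bar> \<le> d" "\<bar>y - s\<bar> \<le> d"
  shows "norm (S y - S x - (y - x) *\<^sub>R S' s) \<le> w d * \<bar>y - x\<bar>"
proof -
  have "norm ((\<lambda>t. S t - t *\<^sub>R S' s) y - (\<lambda>t. S t - t *\<^sub>R S' s) x) \<le> w d * norm (y - x)"
  proof (rule differentiable_bound[of "{s - d..s + d}" _ "\<lambda>t h. h *\<^sub>R (S' t - S' s)"])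
    fix t assume t: "t \<in> {s - d..s + d}"
    have "((\<lambda>t. S t - t *\<^sub>R S' s) has_vector_derivative (S' t - S' s)) (at t)"
      by (auto intro!: derivative_eq_intros S_deriv)
    then show "((\<lambda>t. S t - t *\<^sub>R S' s) has_derivative (\<lambda>h. h *\<^sub>R (S' t - S' s))) (at t within {s - d..s + d})"
      by (simp add: has_vector_derivative_def has_derivative_at_withinI)
    have "norm (S' t - S' s) \<le> w d"
      using S'_le_w[of t s] monoD[OF w_mono, of "\<bar>t - s\<bar>" d] t by (auto simp: abs_if split: if_splits)
    then show "onorm (\<lambda>h. h *\<^sub>R (S' t - S' s)) \<le> w d"
      by (subst onorm_scaleR_left) (auto simp: onorm_id bounded_linear_ident)
  qed (use assms in \<open>auto simp: abs_le_iff\<close>)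
  then show ?thesis by (simp add: algebra_simps)
qed

lemma S'_bound_ex: "\<exists>M>0. \<forall>x. norm (S' x) \<le> M"
  using S'_bounded by (auto simp: bounded_pos)

text \<open>Near the diagonal the chord follows the tangent; away from it injectivity modulo
  \<open>2 * pi\<close> and compactness give a positive minimum. The range \<open>3 * pi / 2\<close>
  lies below a full period, where \<open>S\<close> repeats, and above \<open>pi\<close>, which
  leaves room to move one point of a centred pair.\<close>

lemma S_bilipschitz_ex: "\<exists>c>0. \<forall>x y. \<bar>x - y\<bar> \<le> 3 * pi / 2 \<longrightarrow> c * \<bar>x - y\<bar> \<le> norm (S x - S y)"
proof -
  have "compact {-pi..pi}" "{-pi..pi} \<noteq> {}" "continuous_on {-pi..pi} (\<lambda>x. norm (S' x))"
    by (auto intro!: continuous_intros continuous_on_subset[OF S'_continuous])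
  then obtain x0 where x0: "\<And>x. x \<in> {-pi..pi} \<Longrightarrow> norm (S' x0) \<le> norm (S' x)"
    using continuous_attains_inf by metis
  define m where "m = norm (S' x0)"
  have m: "m > 0" using S'_nonzero by (simp add: m_def)
  have S'm: "m \<le> norm (S' x)" for x
  proof -
    obtain k :: int where "x + of_int k * (2 * pi) \<in> {0 - pi..0 + pi}" "S' (x + of_int k * (2 * pi)) = S' x"
      using periodic_reduce[of S', OF S'_periodic] .
    then show ?thesis using x0 unfolding m_def by (metis add_0 diff_0)
  qed
  obtain d where d: "d > 0" "w d \<le> m / 2" using w_small[of "m / 2"] m by auto
  have near: "(m / 2) * \<bar>x - y\<bar> \<le> norm (S x - S y)" if "\<bar>x - y\<bar> \<le> d" for x y
  proof -
    have "norm (S y - S x - (y - x) *\<^sub>R S' x) \<le> w d * \<bar>y - x\<bar>"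
      by (rule S_linearization) (use that d in auto)
    moreover have "norm ((y - x) *\<^sub>R S' x) \<ge> \<bar>y - x\<bar> * m" using S'm by (simp add: mult_left_mono)
    moreover have "norm ((y - x) *\<^sub>R S' x) \<le> norm (S y - S x) + norm (S y - S x - (y - x) *\<^sub>R S' x)"
      using norm_triangle_ineq4[of "S y - S x" "S y - S x - (y - x) *\<^sub>R S' x"] by simp
    moreover have "w d * \<bar>y - x\<bar> \<le> (m / 2) * \<bar>y - x\<bar>" using d by (intro mult_right_mono) auto
    ultimately have "\<bar>y - x\<bar> * m - (m / 2) * \<bar>y - x\<bar> \<le> norm (S y - S x)" by linarith
    then show ?thesis by (simp add: norm_minus_commute abs_minus_commute algebra_simps)
  qed
  \<comment> \<open>Periodicity moves the first parameter into \<open>[-pi, pi]\<close>; the second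
    one then has modulus at most \<open>5 * pi / 2\<close>.\<close>
  let ?C = "({-pi..pi} \<times> {- 3 * pi..3 * pi}) \<inter> {p. d \<le> \<bar>fst p - snd p\<bar> \<and> \<bar>fst p - snd p\<bar> \<le> 3 * pi / 2}"
  have cC: "compact ?C"
    by (intro compact_Int_closed compact_Times closed_Collect_conj closed_Collect_le continuous_intros) auto
  have pos: "norm (S (fst p) - S (snd p)) > 0" if "p \<in> ?C" for p
  proof -
    have "S (fst p) \<noteq> S (snd p)"
    proof
      assume "S (fst p) = S (snd p)"
      then obtain k :: int where k: "fst p = snd p + of_int k * (2 * pi)" using S_inj by blast
      then have "\<bar>of_int k * (2 * pi)\<bar> \<le> 3 * pi / 2" "k \<noteq> 0" using that d by auto
      then have "\<bar>real_of_int k\<bar> * (2 * pi) \<le> 3 * pi / 2" "1 \<le> \<bar>real_of_int k\<bar>" by (auto simp: abs_mult)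
      then have "1 * (2 * pi) \<le> 3 * pi / 2" by (meson mult_right_mono order_trans pi_ge_zero mult_nonneg_nonneg zero_le_numeral)
      then show False using pi_gt_zero by simp
    qed
    then show ?thesis by simp
  qed
  obtain m2 where m2: "m2 > 0" "\<And>p. p \<in> ?C \<Longrightarrow> m2 \<le> norm (S (fst p) - S (snd p))"
  proof (cases "?C = {}")
    case True
    then show ?thesis using that[of 1] by auto
  next
    case False
    have "continuous_on ?C (\<lambda>p. norm (S (fst p) - S (snd p)))"
      by (intro continuous_intros continuous_on_compose2[OF S_continuous]) auto
    from continuous_attains_inf[OF cC False this] obtain p0 where "p0 \<in> ?C"
      "\<And>p. p \<in> ?C \<Longrightarrow> norm (S (fst p0) - S (snd p0)) \<le> norm (S (fst p) - S (snd p))" by blast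
    then show ?thesis using that pos by blast
  qed
  define c where "c = min (m / 2) (m2 / (2 * pi))"
  have c: "c > 0" using m m2 by (simp add: c_def)
  have "c * \<bar>x - y\<bar> \<le> norm (S x - S y)" if xy: "\<bar>x - y\<bar> \<le> 3 * pi / 2" for x y
  proof (cases "\<bar>x - y\<bar> \<le> d")
    case True
    have "c * \<bar>x - y\<bar> \<le> (m / 2) * \<bar>x - y\<bar>" by (intro mult_right_mono) (auto simp: c_def)
    then show ?thesis using near[OF True] by linarith
  next
    case False
    obtain k :: int where k: "x + of_int k * (2 * pi) \<in> {0 - pi..0 + pi}" "S (x + of_int k * (2 * pi)) = S x"
      using periodic_reduce[of S, OF S_periodic] .
    have ky: "S (y + of_int k * (2 * pi)) = S y" by (rule periodic_int[of S, OF S_periodic])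
    have "(x + of_int k * (2 * pi), y + of_int k * (2 * pi)) \<in> ?C"
    proof -
      have "x - y \<le> 3 * pi / 2" "y - x \<le> 3 * pi / 2" using xy by linarith+
      then have "- 3 * pi \<le> y + of_int k * (2 * pi)" "y + of_int k * (2 * pi) \<le> 3 * pi"
        using k(1) pi_ge_zero unfolding atLeastAtMost_iff by linarith+
      then show ?thesis using k(1) xy False by simp
    qed
    from m2(2)[OF this] have "m2 \<le> norm (S x - S y)" by (simp only: fst_conv snd_conv k ky)
    moreover have "\<bar>x - y\<bar> \<le> 2 * pi" using xy pi_ge_zero by linarith
    then have "c * \<bar>x - y\<bar> \<le> (m2 / (2 * pi)) * (2 * pi)"
      using c m2 xy by (intro mult_mono) (auto simp: c_def)
    ultimately show ?thesis by simp
  qed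
  then show ?thesis using c by blast
qed

definition M :: real where "M = (SOME M. M > 0 \<and> (\<forall>x. norm (S' x) \<le> M))"
definition c :: real where "c = (SOME c. c > 0 \<and> (\<forall>x y. \<bar>x - y\<bar> \<le> 3 * pi / 2 \<longrightarrow> c * \<bar>x - y\<bar> \<le> norm (S x - S y)))"

lemma M_pos: "M > 0" and S'_le_M: "norm (S' x) \<le> M"
  using someI_ex[OF S'_bound_ex] unfolding M_def by auto

lemma c_pos: "c > 0" and S_lower: "\<bar>x - y\<bar> \<le> 3 * pi / 2 \<Longrightarrow> c * \<bar>x - y\<bar> \<le> norm (S x - S y)"
  using someI_ex[OF S_bilipschitz_ex] unfolding c_def by auto

lemma S_upper: "norm (S x - S y) \<le> M * \<bar>x - y\<bar>"
proof -
  have "norm (S x - S y) \<le> M * norm (x - y)"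
  proof (rule differentiable_bound[of UNIV _ "\<lambda>t h. h *\<^sub>R S' t"])
    show "(S has_derivative (\<lambda>h. h *\<^sub>R S' t)) (at t within UNIV)" for t
      using S_deriv by (simp add: has_vector_derivative_def)
    show "onorm (\<lambda>h. h *\<^sub>R S' t) \<le> M" for t
      using S'_le_M by (subst onorm_scaleR_left) (auto simp: onorm_id bounded_linear_ident)
  qed auto
  then show ?thesis by simp
qed

lemma range_S: "range S = S ` {0..2 * pi}"
proof -
  have "S x \<in> S ` {0..2 * pi}" for x
  proof -
    obtain k :: int where "x + of_int k * (2 * pi) \<in> {pi - pi..pi + pi}" "S (x + of_int k * (2 * pi)) = S x"
      using periodic_reduce[of S, OF S_periodic] .
    then show ?thesis by (metis add_diff_cancel diff_self imageI mult_2)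
  qed
  then show ?thesis by auto
qed

lemma compact_range_S: "compact (range S)"
  unfolding range_S by (intro compact_continuous_image continuous_on_subset[OF S_continuous]) auto

lemma S_eq_iff_centered: "\<bar>u\<bar> \<le> pi \<Longrightarrow> S (t + u) = S t \<longleftrightarrow> u = 0"
  using S_lower[of "t + u" t] c_pos pi_ge_zero by (auto simp: mult_le_0_iff)

end

subsection \<open>Boundary behaviour of the singular integrals\<close>

context dini_curve
begin

lemma S_lower_pi: "\<bar>u\<bar> \<le> pi \<Longrightarrow> c * \<bar>u\<bar> \<le> norm (S (t + u) - S t)"
  using S_lower[of "t + u" t] pi_ge_zero by simp

definition kC :: "complex \<Rightarrow> real \<Rightarrow> complex" where
  "kC z x = S' x / (S x - z)"

text \<open>The logarithmic derivative \<open>d (Im (\<tau> - z) / (\<tau> - z))\<close> along the curve; the kernel \<open>k2\<close> is \<open>- kE / 2\<close>.\<close>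

definition kE :: "complex \<Rightarrow> real \<Rightarrow> complex" where
  "kE z x = (of_real (Im (S' x)) * (S x - z) - of_real (Im (S x - z)) * S' x) / (S x - z)\<^sup>2"

text \<open>The properties of \<open>kC\<close> and \<open>kE\<close> that the dominated convergence
  arguments use. Where \<open>S x = z\<close> the bound reads \<open>2 * M / 0 = 0\<close>, so an
  admissible kernel has the value 0 at its pole.\<close>

definition admissible :: "(complex \<Rightarrow> real \<Rightarrow> complex) \<Rightarrow> bool" where
  "admissible k \<longleftrightarrow> (\<forall>z. k z \<in> borel_measurable borel) \<and> (\<forall>z x. k z (x + 2 * pi) = k z x) \<and>
     (\<forall>z x. norm (k z x) \<le> 2 * M / norm (S x - z)) \<and>
     (\<forall>z x. S x \<noteq> z \<longrightarrow> isCont (\<lambda>(z, x). k z x) (z, x))"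

lemma isCont_S: "isCont S x" and isCont_S': "isCont S' x"
  using S_continuous S'_continuous by (auto simp: continuous_on_eq_continuous_at)

lemma admissible_kC: "admissible kC"
  unfolding admissible_def
proof (intro conjI allI impI)
  fix z x
  show "kC z \<in> borel_measurable borel" unfolding kC_def by measurable
  show "kC z (x + 2 * pi) = kC z x" by (simp add: kC_def S_periodic S'_periodic)
  have "norm (kC z x) = norm (S' x) / norm (S x - z)" by (simp add: kC_def norm_divide)
  also have "\<dots> \<le> 2 * M / norm (S x - z)" using S'_le_M[of x] M_pos by (intro divide_right_mono) auto
  finally show "norm (kC z x) \<le> 2 * M / norm (S x - z)" .
  assume "S x \<noteq> z"
  then show "isCont (\<lambda>(z, x). kC z x) (z, x)"
    unfolding kC_def case_prod_beta'
    by (intro continuous_intros isCont_o2[OF _ isCont_S] isCont_o2[OF _ isCont_S']) auto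
qed

lemma admissible_kE: "admissible kE"
  unfolding admissible_def
proof (intro conjI allI impI)
  fix z x
  show "kE z \<in> borel_measurable borel" unfolding kE_def by measurable
  show "kE z (x + 2 * pi) = kE z x" by (simp add: kE_def S_periodic S'_periodic)
  have "norm (of_real (Im (S' x)) * (S x - z) - of_real (Im (S x - z)) * S' x)
     \<le> norm (of_real (Im (S' x)) * (S x - z)) + norm (of_real (Im (S x - z)) * S' x)" by (rule norm_triangle_ineq4)
  also have "\<dots> \<le> M * norm (S x - z) + norm (S x - z) * M"
    unfolding norm_mult norm_of_real real_norm_def
    by (intro add_mono mult_mono order_trans[OF abs_Im_le_cmod] S'_le_M) (use M_pos in auto)
  finally have "norm (kE z x) \<le> (M * norm (S x - z) + norm (S x - z) * M) / (norm (S x - z))\<^sup>2"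
    unfolding kE_def norm_divide norm_power by (intro divide_right_mono) auto
  also have "\<dots> = 2 * M / norm (S x - z)" by (cases "S x = z") (auto simp: power2_eq_square field_simps)
  finally show "norm (kE z x) \<le> 2 * M / norm (S x - z)" .
  assume "S x \<noteq> z"
  then show "isCont (\<lambda>(z, x). kE z x) (z, x)"
  proof -
    have cS: "isCont (\<lambda>p. S (snd p)) (z, x)" "isCont (\<lambda>p. S' (snd p)) (z, x)"
      by (intro isCont_o2[OF _ isCont_S] isCont_o2[OF _ isCont_S'] continuous_intros)+
    then have cIm: "isCont (\<lambda>p. Im (S' (snd p))) (z, x)" "isCont (\<lambda>p. Im (S (snd p) - fst p)) (z, x)"
      by (intro continuous_intros | simp)+
    show ?thesis unfolding kE_def case_prod_beta'
      by (intro continuous_intros cS cIm) (use \<open>S x \<noteq> z\<close> in auto)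
  qed
qed

lemma S_near_ex: "\<exists>t. \<forall>x. norm (z - S t) \<le> norm (z - S x)"
proof -
  have "\<exists>y\<in>range S. \<forall>v\<in>range S. dist z y \<le> dist z v"
    by (rule distance_attains_inf[of "range S" z]) (auto intro: compact_imp_closed compact_range_S)
  then show ?thesis by (auto simp: dist_norm)
qed

text \<open>An angle of a nearest boundary point, chosen without any continuity in \<open>z\<close>.
  Different choices give the same values of periodic functions as soon as they name the same
  boundary point.\<close>

definition near :: "complex \<Rightarrow> real" where
  "near z = (SOME t. \<forall>x. norm (z - S t) \<le> norm (z - S x))"

lemma near: "norm (z - S (near z)) \<le> norm (z - S x)"
  using someI_ex[OF S_near_ex[of z]] unfolding near_def by auto

lemma S_near_S [simp]: "S (near (S t)) = S t"
  using near[of "S t" t] by simp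

text \<open>Subtracting \<open>f t\<close> removes the leading part of the singularity, so the
  integral also makes sense at \<open>z = S t\<close>. With \<open>t = near z\<close> it yields
  \<open>P\<close>, a function on the whole plane that turns out to be continuous at every point of
  the curve.\<close>

definition G :: "(real \<Rightarrow> complex) \<Rightarrow> (complex \<Rightarrow> real \<Rightarrow> complex) \<Rightarrow> complex \<Rightarrow> real \<Rightarrow> complex" where
  "G f k z t = (LINT u:{-pi..pi}|lborel. (f (t + u) - f t) * k z (t + u))"

definition P :: "(real \<Rightarrow> complex) \<Rightarrow> (complex \<Rightarrow> real \<Rightarrow> complex) \<Rightarrow> complex \<Rightarrow> complex" where
  "P f k z = G f k z (near z)"

lemma G_eq_if_S_eq:
  assumes f: "\<And>x. f (x + 2 * pi) = f x" and k: "admissible k" and e: "S s = S t"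
  shows "G f k z s = G f k z t" "f s = f t"
proof -
  obtain n :: int where n: "s = t + of_int n * (2 * pi)" using S_inj[OF e] by blast
  have "f (s + u) = f (t + u)" for u
    using periodic_int[of f "2 * pi", OF f, of "t + u" n] unfolding n by (simp add: algebra_simps)
  note fu = this
  have ku: "k z (s + u) = k z (t + u)" for u
    using periodic_int[of "k z" "2 * pi" "t + u" n] k unfolding n admissible_def by (simp add: algebra_simps)
  show fs: "f s = f t" using fu[of 0] by simp
  show "G f k z s = G f k z t" unfolding G_def fu ku fs ..
qed

lemma P_at_S:
  assumes f: "\<And>x. f (x + 2 * pi) = f x" and k: "admissible k"
  shows "P f k (S t) = G f k (S t) t"
  unfolding P_def by (rule G_eq_if_S_eq(1)[where f = f, OF f k]) simp

text \<open>Since \<open>S t\<close> is nearest to \<open>z\<close>, \<open>\<bar>S (t + u) - z\<bar>\<close> is at least half of \<open>\<bar>S (t + u) - S t\<bar>\<close>, which gives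
  a dominating function independent of \<open>z\<close>.\<close>

lemma G_bound:
  assumes k: "admissible k" and near: "\<And>x. norm (z - S t) \<le> norm (z - S x)" and u: "\<bar>u\<bar> \<le> pi"
    and f: "\<And>x y. norm (f x - f y) \<le> v \<bar>x - y\<bar>"
  shows "norm ((f (t + u) - f t) * k z (t + u)) \<le> (4 * M / c) * (v \<bar>u\<bar> / \<bar>u\<bar>)"
proof (cases "u = 0")
  case False
  have "norm (S (t + u) - S t) \<le> norm (S (t + u) - z) + norm (z - S t)"
    using norm_triangle_ineq[of "S (t + u) - z" "z - S t"] by simp
  also have "\<dots> \<le> 2 * norm (S (t + u) - z)" using near[of "t + u"] by (simp add: norm_minus_commute)
  finally have "c * \<bar>u\<bar> \<le> 2 * norm (S (t + u) - z)" using S_lower_pi[OF u, of t] by simp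
  then have l: "(c / 2) * \<bar>u\<bar> \<le> norm (S (t + u) - z)" by simp
  have cu: "(c / 2) * \<bar>u\<bar> > 0" using c_pos False by simp
  have "norm (k z (t + u)) \<le> 2 * M / norm (S (t + u) - z)" using k unfolding admissible_def by blast
  also have "\<dots> \<le> 2 * M / ((c / 2) * \<bar>u\<bar>)" using l cu M_pos by (intro divide_left_mono) (auto intro!: mult_pos_pos order_less_le_trans[OF cu l])
  finally have "norm (f (t + u) - f t) * norm (k z (t + u)) \<le> v \<bar>u\<bar> * (2 * M / ((c / 2) * \<bar>u\<bar>))"
    using f[of "t + u" t] order_trans[OF norm_ge_zero f[of "t + u" t]] by (intro mult_mono) auto
  also have "\<dots> = (4 * M / c) * (v \<bar>u\<bar> / \<bar>u\<bar>)" using False c_pos by (simp add: field_simps)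
  finally show ?thesis by (simp add: norm_mult)
qed simp

context
  fixes f :: "real \<Rightarrow> complex"
  assumes f_periodic: "\<And>x. f (x + 2 * pi) = f x" and f_dini: "dini UNIV f"
begin

lemma f_continuous: "continuous_on UNIV f"
  using dini_imp_uniformly_continuous_on[OF f_dini] uniformly_continuous_imp_continuous by blast

lemma f_measurable [measurable]: "f \<in> borel_measurable borel"
  using f_continuous by (rule borel_measurable_continuous_onI)

lemma f_bounded: "bounded (range f)"
  by (rule bounded_range_periodic[OF f_periodic f_continuous])

lemma G_integrable:
  assumes k: "admissible k" and near: "\<And>x. norm (z - S t) \<le> norm (z - S x)"
  shows "set_integrable lborel {-pi..pi} (\<lambda>u. (f (t + u) - f t) * k z (t + u))"
proof -
  obtain v where v: "mono v" "\<And>x y. dist (f x) (f y) \<le> v \<bar>x - y\<bar>" "\<And>R. set_integrable lborel {-R..R} (\<lambda>u. v \<bar>u\<bar> / \<bar>u\<bar>)"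
    using dini_majorant[OF f_dini f_bounded] by metis
  have [measurable]: "k z \<in> borel_measurable borel" using k by (simp add: admissible_def)
  have i: "set_integrable lborel {-pi..pi} (\<lambda>u. (4 * M / c) * (v \<bar>u\<bar> / \<bar>u\<bar>))"
    by (intro set_integrable_mult_right v)
  show ?thesis
  proof (rule set_integrable_bound[OF i])
    show "set_borel_measurable lborel {-pi..pi} (\<lambda>u. (f (t + u) - f t) * k z (t + u))"
      unfolding set_borel_measurable_def by measurable
    show "AE u in lborel. u \<in> {-pi..pi} \<longrightarrow>
        norm ((f (t + u) - f t) * k z (t + u)) \<le> norm ((4 * M / c) * (v \<bar>u\<bar> / \<bar>u\<bar>))"
    proof (intro AE_I2 impI)
      fix u assume "u \<in> {-pi..pi}"
      then have "norm ((f (t + u) - f t) * k z (t + u)) \<le> (4 * M / c) * (v \<bar>u\<bar> / \<bar>u\<bar>)"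
        by (intro G_bound[OF k near]) (use v in \<open>auto simp: dist_norm abs_le_iff\<close>)
      then show "norm ((f (t + u) - f t) * k z (t + u)) \<le> norm ((4 * M / c) * (v \<bar>u\<bar> / \<bar>u\<bar>))"
        unfolding real_norm_def by (rule order_trans[OF _ abs_ge_self])
    qed
  qed
qed

text \<open>Dominated convergence: the bound from \<open>G_bound\<close> depends neither on
  \<open>z n\<close> nor on \<open>t n\<close>, and pointwise convergence can fail only at the null
  set \<open>u = 0\<close>.\<close>

lemma G_tendsto:
  assumes k: "admissible k" and near: "\<And>n x. norm (z n - S (t n)) \<le> norm (z n - S x)"
    and z: "z \<longlonglongrightarrow> S t0" and t: "t \<longlonglongrightarrow> t0"
  shows "(\<lambda>n. G f k (z n) (t n)) \<longlonglongrightarrow> G f k (S t0) t0"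
proof -
  obtain v where v: "mono v" "\<And>x y. dist (f x) (f y) \<le> v \<bar>x - y\<bar>" "\<And>R. set_integrable lborel {-R..R} (\<lambda>u. v \<bar>u\<bar> / \<bar>u\<bar>)"
    using dini_majorant[OF f_dini f_bounded] by metis
  have [measurable]: "k z \<in> borel_measurable borel" for z using k by (simp add: admissible_def)
  have contf: "isCont f x" for x using f_continuous by (simp add: continuous_on_eq_continuous_at)
  show ?thesis
    unfolding G_def set_lebesgue_integral_def
  proof (rule integral_dominated_convergence)
    show "integrable lborel (\<lambda>u. indicator {-pi..pi} u *\<^sub>R ((4 * M / c) * (v \<bar>u\<bar> / \<bar>u\<bar>)))"
      unfolding set_integrable_def[symmetric] by (intro set_integrable_mult_right v)
    show "AE u in lborel. (\<lambda>n. indicat_real {-pi..pi} u *\<^sub>R ((f (t n + u) - f (t n)) * k (z n) (t n + u)))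
        \<longlonglongrightarrow> indicat_real {-pi..pi} u *\<^sub>R ((f (t0 + u) - f t0) * k (S t0) (t0 + u))"
    proof (rule AE_mp[OF AE_lborel_singleton[of 0]], intro AE_I2 impI)
      fix u :: real assume u: "u \<noteq> 0"
      show "(\<lambda>n. indicat_real {-pi..pi} u *\<^sub>R ((f (t n + u) - f (t n)) * k (z n) (t n + u)))
        \<longlonglongrightarrow> indicat_real {-pi..pi} u *\<^sub>R ((f (t0 + u) - f t0) * k (S t0) (t0 + u))"
      proof (cases "u \<in> {-pi..pi}")
        case True
        then have "S (t0 + u) \<noteq> S t0" using S_eq_iff_centered[of u t0] u by (auto simp: abs_le_iff)
        then have "isCont (\<lambda>(z, x). k z x) (S t0, t0 + u)" using k unfolding admissible_def by blast
        moreover have "(\<lambda>n. (z n, t n + u)) \<longlonglongrightarrow> (S t0, t0 + u)" by (intro tendsto_intros z t)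
        ultimately have "(\<lambda>n. k (z n) (t n + u)) \<longlonglongrightarrow> k (S t0) (t0 + u)"
          using isCont_tendsto_compose by fastforce
        then show ?thesis
          by (intro tendsto_intros isCont_tendsto_compose[OF contf] t)
      qed simp
    qed
    show "AE u in lborel. norm (indicat_real {-pi..pi} u *\<^sub>R ((f (t n + u) - f (t n)) * k (z n) (t n + u)))
       \<le> indicator {-pi..pi} u *\<^sub>R ((4 * M / c) * (v \<bar>u\<bar> / \<bar>u\<bar>))" for n
    proof (rule AE_I2)
      fix u :: real
      show "norm (indicat_real {-pi..pi} u *\<^sub>R ((f (t n + u) - f (t n)) * k (z n) (t n + u)))
       \<le> indicator {-pi..pi} u *\<^sub>R ((4 * M / c) * (v \<bar>u\<bar> / \<bar>u\<bar>))"
      proof (cases "u \<in> {-pi..pi}")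
        case True
        then have "norm ((f (t n + u) - f (t n)) * k (z n) (t n + u)) \<le> (4 * M / c) * (v \<bar>u\<bar> / \<bar>u\<bar>)"
          by (intro G_bound[OF k near]) (use v in \<open>auto simp: dist_norm abs_le_iff\<close>)
        then show ?thesis using True by simp
      qed simp
    qed
  qed measurable
qed

text \<open>The values \<open>near (z n)\<close> may jump by periods. After a shift into the period
  centred at \<open>t0\<close> the lower bound for chords gives
  \<open>\<bar>t n - t0\<bar> \<le> (2 / c) * norm (z n - S t0)\<close>.\<close>

lemma near_sequence:
  assumes z: "z \<longlonglongrightarrow> S t0"
  obtains t where "t \<longlonglongrightarrow> t0" "\<And>n. S (t n) = S (near (z n))"
proof -
  have "\<exists>s. s \<in> {t0 - pi..t0 + pi} \<and> S s = S (near (z n))" for n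
    using periodic_reduce[of S, OF S_periodic] by metis
  then obtain t where t: "\<And>n. t n \<in> {t0 - pi..t0 + pi}" "\<And>n. S (t n) = S (near (z n))" by metis
  have "c * \<bar>t n - t0\<bar> \<le> 2 * norm (z n - S t0)" for n
  proof -
    have "c * \<bar>t n - t0\<bar> \<le> norm (S (t n) - S t0)"
      using t(1)[of n] S_lower_pi[of "t n - t0" t0] by (simp add: abs_le_iff)
    also have "\<dots> \<le> norm (z n - S (t n)) + norm (z n - S t0)"
      using norm_triangle_ineq4[of "z n - S t0" "z n - S (t n)"] by simp
    also have "\<dots> \<le> 2 * norm (z n - S t0)" using near[of "z n" t0] t(2)[of n] by simp
    finally show ?thesis .
  qed
  then have le: "norm (t n - t0) \<le> (2 / c) * norm (z n - S t0)" for n using c_pos by (simp add: field_simps)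
  have "(\<lambda>n. (2 / c) * norm (z n - S t0)) \<longlonglongrightarrow> (2 / c) * norm (S t0 - S t0)"
    by (intro tendsto_intros z)
  then have lim: "(\<lambda>n. (2 / c) * norm (z n - S t0)) \<longlonglongrightarrow> 0" by simp
  have "(\<lambda>n. t n - t0) \<longlonglongrightarrow> 0"
    by (rule Lim_null_comparison[OF always_eventually lim]) (rule allI, rule le)
  then have "t \<longlonglongrightarrow> t0" by (simp add: LIM_zero_iff)
  then show ?thesis using that t(2) by blast
qed

lemma isCont_P:
  assumes k: "admissible k"
  shows "isCont (P f k) (S t0)"
  unfolding continuous_at_sequentially
proof (intro allI impI)
  fix z assume z: "z \<longlonglongrightarrow> S t0"
  obtain t where t: "t \<longlonglongrightarrow> t0" "\<And>n. S (t n) = S (near (z n))" using near_sequence[OF z] by blast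
  have "P f k (z n) = G f k (z n) (t n)" for n
    unfolding P_def by (rule G_eq_if_S_eq(1)[where f = f, OF f_periodic k]) (simp add: t)
  moreover have "(\<lambda>n. G f k (z n) (t n)) \<longlonglongrightarrow> G f k (S t0) t0"
    by (rule G_tendsto[OF k _ z t(1)]) (simp add: t near)
  ultimately show "(P f k \<circ> z) \<longlonglongrightarrow> P f k (S t0)"
    by (simp add: o_def P_at_S[where f = f, OF f_periodic k])
qed

lemma isCont_f_near: "isCont (\<lambda>z. f (near z)) (S t0)"
  unfolding continuous_at_sequentially
proof (intro allI impI)
  fix z assume z: "z \<longlonglongrightarrow> S t0"
  obtain t where t: "t \<longlonglongrightarrow> t0" "\<And>n. S (t n) = S (near (z n))" using near_sequence[OF z] by blast
  have "f (near (z n)) = f (t n)" for n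
    by (rule G_eq_if_S_eq(2)[where f = f, OF f_periodic admissible_kC]) (simp add: t)
  moreover have "f (near (S t0)) = f t0"
    by (rule G_eq_if_S_eq(2)[where f = f, OF f_periodic admissible_kC]) simp
  moreover have "(\<lambda>n. f (t n)) \<longlonglongrightarrow> f t0"
    using f_continuous t(1) by (simp add: continuous_on_eq_continuous_at isCont_tendsto_compose)
  ultimately show "((\<lambda>z. f (near z)) \<circ> z) \<longlonglongrightarrow> f (near (S t0))" by (simp add: o_def)
qed

end

lemma f_near_S:
  assumes "\<And>x. f (x + 2 * pi) = f x"
  shows "f (near (S t)) = f t"
proof -
  obtain n :: int where "near (S t) = t + of_int n * (2 * pi)" using S_inj[of "near (S t)" t] by auto
  then show ?thesis using periodic_int[of f "2 * pi", OF assms] by simp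
qed

lemma continuous_kernel:
  assumes k: "admissible k" and z: "z \<notin> range S"
  shows "continuous_on UNIV (k z)"
proof -
  have "isCont (\<lambda>(z, x). k z x) (z, x)" for x
  proof -
    have "S x \<noteq> z" using z by auto
    then show ?thesis using k unfolding admissible_def by blast
  qed
  note kk = this
  have "isCont (k z) x" for x
  proof -
    have "isCont (\<lambda>x::real. (z, x)) x" by (intro continuous_intros)
    from isCont_o2[OF this kk] show ?thesis by simp
  qed
  then show ?thesis by (simp add: continuous_on_eq_continuous_at)
qed

section \<open>Integrals at points off the curve and their splitting into a jump and a continuous
  part\<close>

definition I :: "(real \<Rightarrow> complex) \<Rightarrow> (complex \<Rightarrow> real \<Rightarrow> complex) \<Rightarrow> complex \<Rightarrow> complex" where
  "I f k z = integral {0..2 * pi} (\<lambda>x. f x * k z x)"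

lemma I_eq_centered:
  assumes f: "\<And>x. f (x + 2 * pi) = f x" "continuous_on UNIV f" and k: "admissible k" and z: "z \<notin> range S"
  shows "set_integrable lborel {-pi..pi} (\<lambda>u. f (t + u) * k z (t + u))"
    and "(LINT u:{-pi..pi}|lborel. f (t + u) * k z (t + u)) = I f k z"
proof -
  have "set_integrable lborel {0..0 + 2 * pi} (\<lambda>x. f x * k z x)"
    by (rule borel_integrable_atLeastAtMost')
       (intro continuous_intros continuous_on_subset[OF f(2)] continuous_on_subset[OF continuous_kernel[OF k z]] subset_UNIV)
  note 1 = this
  have per: "f (x + 2 * pi) * k z (x + 2 * pi) = f x * k z x" for x
    using f k by (simp add: admissible_def)
  show "set_integrable lborel {-pi..pi} (\<lambda>u. f (t + u) * k z (t + u))"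
    by (rule periodic_centered_integral(1)[OF per 1])
  show "(LINT u:{-pi..pi}|lborel. f (t + u) * k z (t + u)) = I f k z"
    using periodic_centered_integral(2)[OF per 1, of t] set_borel_integral_eq_integral(2)[OF 1]
    by (simp add: I_def)
qed

lemma G_eq_I:
  assumes f: "\<And>x. f (x + 2 * pi) = f x" "continuous_on UNIV f" and k: "admissible k" and z: "z \<notin> range S"
  shows "G f k z t = I f k z - f t * I (\<lambda>_. 1) k z"
proof -
  have i1: "set_integrable lborel {-pi..pi} (\<lambda>u. f (t + u) * k z (t + u))"
    and e1: "(LINT u:{-pi..pi}|lborel. f (t + u) * k z (t + u)) = I f k z"
    using I_eq_centered[of f, OF f k z] by auto
  have i2: "set_integrable lborel {-pi..pi} (\<lambda>u. 1 * k z (t + u))"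
    and e2: "(LINT u:{-pi..pi}|lborel. 1 * k z (t + u)) = I (\<lambda>_. 1) k z"
    using I_eq_centered[of "\<lambda>_. 1", OF _ _ k z, of t] by auto
  have "G f k z t = (LINT u:{-pi..pi}|lborel. f (t + u) * k z (t + u) - f t * (1 * k z (t + u)))"
    unfolding G_def by (simp add: left_diff_distrib)
  also have "\<dots> = (LINT u:{-pi..pi}|lborel. f (t + u) * k z (t + u)) - (LINT u:{-pi..pi}|lborel. f t * (1 * k z (t + u)))"
    by (rule set_integral_diff(2)[OF i1 set_integrable_mult_right]) (rule i2)
  also have "\<dots> = I f k z - f t * I (\<lambda>_. 1) k z"
    using e1 e2 by simp
  finally show ?thesis .
qed

lemma I_kC_1: "z \<notin> range S \<Longrightarrow> I (\<lambda>_. 1) kC z = (if z \<in> D then 2 * of_real pi * \<i> else 0)"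
  using index[of z] unfolding I_def kC_def by (simp add: integral_unique)

lemma kE_antiderivative:
  assumes "S x \<noteq> z"
  shows "((\<lambda>x. of_real (Im (S x - z)) / (S x - z)) has_vector_derivative kE z x) (at x)"
proof -
  have d: "((\<lambda>x. S x - z) has_vector_derivative S' x) (at x)"
    by (auto intro!: derivative_eq_intros S_deriv)
  have "((\<lambda>x. Im (S x - z)) has_real_derivative Im (S' x)) (at x)"
    by (rule has_field_derivative_Im[OF d])
  then have dI: "((\<lambda>x. of_real (Im (S x - z)) :: complex) has_vector_derivative of_real (Im (S' x))) (at x)"
    by (rule has_vector_derivative_of_real)
  have d2: "((\<lambda>x. inverse (S x - z)) has_vector_derivative (S' x * - (inverse (S x - z) * inverse (S x - z)))) (at x)"
  proof -
    have "(inverse has_field_derivative - (inverse (S x - z) * inverse (S x - z))) (at (S x - z))"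
      by (rule derivative_eq_intros) (use assms in \<open>auto simp: power2_eq_square\<close>)
    from field_vector_diff_chain_at[OF d this] show ?thesis by (simp add: o_def)
  qed
  have "((\<lambda>x. of_real (Im (S x - z)) * inverse (S x - z)) has_vector_derivative
      of_real (Im (S x - z)) * (S' x * - (inverse (S x - z) * inverse (S x - z))) + of_real (Im (S' x)) * inverse (S x - z)) (at x)"
    by (rule has_vector_derivative_mult[OF dI d2])
  moreover have "of_real (Im (S x - z)) * (S' x * - (inverse (S x - z) * inverse (S x - z))) + of_real (Im (S' x)) * inverse (S x - z) = kE z x"
  proof -
    have "b * (d * - (inverse v * inverse v)) + a * inverse v = (a * v - b * d) / v\<^sup>2" if "v \<noteq> 0" for a b d v :: complex
      using that by (simp add: field_simps power2_eq_square)
    then show ?thesis using assms unfolding kE_def by simp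
  qed
  ultimately show ?thesis by (simp add: divide_inverse)
qed

text \<open>\<open>kE z\<close> is the derivative of a periodic function and so has integral 0 over
  a period; this is why the kernel \<open>kE\<close> produces no jump.\<close>

lemma I_kE_1:
  assumes "z \<notin> range S"
  shows "I (\<lambda>_. 1) kE z = 0"
proof -
  have "(kE z has_integral (of_real (Im (S (2 * pi) - z)) / (S (2 * pi) - z) - of_real (Im (S 0 - z)) / (S 0 - z))) {0..2 * pi}"
  proof (rule fundamental_theorem_of_calculus)
    fix x :: real
    have "S x \<noteq> z" using assms by blast
    show "((\<lambda>x. of_real (Im (S x - z)) / (S x - z)) has_vector_derivative kE z x) (at x within {0..2 * pi})"
      by (rule has_vector_derivative_at_within[OF kE_antiderivative[OF \<open>S x \<noteq> z\<close>]])
  qed simp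
  then show ?thesis using S_periodic[of 0] by (simp add: I_def integral_unique)
qed

text \<open>The whole discontinuity across the curve sits in the first summand, since
  \<open>P\<close> is continuous at the points of the curve.\<close>

lemma kC_limits:
  assumes f: "\<And>x. f (x + 2 * pi) = f x" "dini UNIV f" and z: "z \<notin> range S"
  shows "I f kC z = (if z \<in> D then 2 * of_real pi * \<i> * f (near z) else 0) + P f kC z"
  using G_eq_I[of f, OF f(1) f_continuous[OF f] admissible_kC z, of "near z"] I_kC_1[OF z]
  by (simp add: P_def)

lemma kE_limits:
  assumes f: "\<And>x. f (x + 2 * pi) = f x" "dini UNIV f" and z: "z \<notin> range S"
  shows "I f kE z = P f kE z"
  using G_eq_I[of f, OF f(1) f_continuous[OF f] admissible_kE z, of "near z"] I_kE_1[OF z]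
  by (simp add: P_def)

end

lemma nn_integral_abs_le:
  fixes F :: "real \<Rightarrow> ennreal"
  assumes [measurable]: "F \<in> borel_measurable borel"
  shows "(\<integral>\<^sup>+u. F \<bar>u\<bar> \<partial>lborel) \<le> 2 * (\<integral>\<^sup>+u\<in>{0..}. F u \<partial>lborel)"
proof -
  have "(\<integral>\<^sup>+u. F \<bar>u\<bar> \<partial>lborel) \<le> (\<integral>\<^sup>+u. F u * indicator {0..} u + F (- u) * indicator {0..} (- u) \<partial>lborel)"
    by (rule nn_integral_mono) (auto simp: indicator_def abs_if)
  also have "\<dots> = (\<integral>\<^sup>+u\<in>{0..}. F u \<partial>lborel) + (\<integral>\<^sup>+u. F (- u) * indicator {0..} (- u) \<partial>lborel)"
    by (rule nn_integral_add) measurable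
  also have "(\<integral>\<^sup>+u. F (- u) * indicator {0..} (- u) \<partial>lborel) = (\<integral>\<^sup>+u\<in>{0..}. F u \<partial>lborel)"
    using nn_integral_real_affine[of "\<lambda>u. F u * indicator {0..} u" "-1" 0] by simp
  finally show ?thesis by (simp add: mult_2)
qed

subsection \<open>Weakly singular kernels\<close>

text \<open>The cross product of plane vectors. It ignores multiples of its first argument added to
  the second, and this is the source of all cancellation in the kernels.\<close>

definition cr :: "complex \<Rightarrow> complex \<Rightarrow> real" where
  "cr a b = Re a * Im b - Im a * Re b"

lemma abs_cr_le: "\<bar>cr a b\<bar> \<le> norm a * norm b"
proof -
  have "cr a b = Im (cnj a * b)" by (simp add: cr_def)
  then show ?thesis using abs_Im_le_cmod[of "cnj a * b"] by (simp add: norm_mult)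
qed

lemma cr_diff: "cr a (b - d) = cr a b - cr a d"
  by (simp add: cr_def algebra_simps)

lemma cr_shift: "cr a (b - r *\<^sub>R a) = cr a b"
  by (simp add: cr_def algebra_simps)

text \<open>Abstracts from \<open>- 1 / z\<^sup>2\<close> and \<open>- 1 / (norm z)\<^sup>2\<close>,
  so that \<open>kE\<close> and \<open>Im kC\<close> are estimated together. Since
  \<open>1 / 0 = 0\<close>, the size bound forces the value 0 at 0.\<close>

definition good_multiplier :: "(complex \<Rightarrow> complex) \<Rightarrow> bool" where
  "good_multiplier m \<longleftrightarrow> m \<in> borel_measurable borel \<and> (\<forall>z. norm (m z) \<le> 1 / (norm z)\<^sup>2) \<and>
     (\<forall>y z. y \<noteq> 0 \<longrightarrow> z \<noteq> 0 \<longrightarrow> norm (m y - m z) \<le> norm (y - z) * (norm y + norm z) / ((norm y)\<^sup>2 * (norm z)\<^sup>2))"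

lemma good_multiplier_square: "good_multiplier (\<lambda>z. - 1 / z\<^sup>2)"
  unfolding good_multiplier_def
proof (intro conjI allI impI)
  show "(\<lambda>z::complex. - 1 / z\<^sup>2) \<in> borel_measurable borel" by measurable
  show "norm (- 1 / z\<^sup>2) \<le> 1 / (norm z)\<^sup>2" for z :: complex by (simp add: norm_divide norm_power)
  fix y z :: complex assume "y \<noteq> 0" "z \<noteq> 0"
  then have "- 1 / y\<^sup>2 - - 1 / z\<^sup>2 = (y - z) * (y + z) / (y\<^sup>2 * z\<^sup>2)"
    by (simp add: field_simps power2_eq_square)
  then have "norm (- 1 / y\<^sup>2 - - 1 / z\<^sup>2) = norm (y - z) * norm (y + z) / ((norm y)\<^sup>2 * (norm z)\<^sup>2)"
    by (simp add: norm_mult norm_divide norm_power)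
  then show "norm (- 1 / y\<^sup>2 - - 1 / z\<^sup>2) \<le> norm (y - z) * (norm y + norm z) / ((norm y)\<^sup>2 * (norm z)\<^sup>2)"
    by (auto intro!: divide_right_mono mult_left_mono norm_triangle_ineq)
qed

lemma good_multiplier_norm: "good_multiplier (\<lambda>z. of_real (- 1 / (norm z)\<^sup>2))"
  unfolding good_multiplier_def
proof (intro conjI allI impI)
  show "(\<lambda>z::complex. of_real (- 1 / (norm z)\<^sup>2) :: complex) \<in> borel_measurable borel" by measurable
  show "norm (of_real (- 1 / (norm z)\<^sup>2) :: complex) \<le> 1 / (norm z)\<^sup>2" for z :: complex
    unfolding norm_of_real by simp
  fix y z :: complex assume yz: "y \<noteq> 0" "z \<noteq> 0"
  let ?a = "norm y" and ?b = "norm z"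
  have "- 1 / ?a\<^sup>2 - - 1 / ?b\<^sup>2 = (?a - ?b) * (?a + ?b) / (?a\<^sup>2 * ?b\<^sup>2)"
    using yz by (simp add: field_simps power2_eq_square)
  then have "norm (of_real (- 1 / ?a\<^sup>2) - of_real (- 1 / ?b\<^sup>2) :: complex) = \<bar>?a - ?b\<bar> * (?a + ?b) / (?a\<^sup>2 * ?b\<^sup>2)"
    unfolding of_real_diff[symmetric] norm_of_real by (simp add: abs_mult)
  also have "\<dots> \<le> norm (y - z) * (?a + ?b) / (?a\<^sup>2 * ?b\<^sup>2)"
    by (intro divide_right_mono mult_right_mono norm_triangle_ineq3) auto
  finally show "norm (of_real (- 1 / ?a\<^sup>2) - of_real (- 1 / ?b\<^sup>2) :: complex) \<le> norm (y - z) * (?a + ?b) / (?a\<^sup>2 * ?b\<^sup>2)" .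
qed

context dini_curve
begin

definition K :: "(complex \<Rightarrow> complex) \<Rightarrow> real \<Rightarrow> real \<Rightarrow> complex" where
  "K m t x = of_real (cr (S' x) (S x - S t)) * m (S x - S t)"

text \<open>The imaginary parts of the two terms in the numerator of \<open>kE\<close> cancel; what
  remains is real and equal to minus the cross product.\<close>

lemma kE_eq_K: "kE (S t) x = K (\<lambda>z. - 1 / z\<^sup>2) t x"
proof -
  have "of_real (Im a) * v - of_real (Im v) * a = - of_real (cr a v)" for a v :: complex
    by (simp add: cr_def complex_eq_iff)
  note e = this
  show ?thesis unfolding kE_def K_def e by simp
qed

lemma Im_kC_eq_K: "of_real (Im (kC (S t) x)) = K (\<lambda>z. of_real (- 1 / (norm z)\<^sup>2)) t x"
proof -
  have "Im (a / v) = cr a v * (- 1 / (norm v)\<^sup>2)" for a v :: complex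
    by (simp add: Im_divide cr_def cmod_power2 divide_simps)
  then show ?thesis unfolding kC_def K_def by simp
qed

lemma K_periodic: "K m t (x + 2 * pi) = K m t x" "K m (t + 2 * pi) x = K m t x"
  by (simp_all add: K_def S_periodic S'_periodic)

lemma K_measurable:
  assumes "good_multiplier m"
  shows "K m t \<in> borel_measurable borel"
proof -
  have [measurable]: "m \<in> borel_measurable borel" using assms by (simp add: good_multiplier_def)
  show ?thesis unfolding K_def cr_def by measurable
qed

text \<open>The multiple \<open>s - t\<close> of the tangent at \<open>x\<close> may be subtracted
  from the chord without changing the cross product; the remainder is controlled by the
  linearization.\<close>

lemma cr_S_le:
  assumes "\<bar>x - t\<bar> \<le> d" "\<bar>x - s\<bar> \<le> d"
  shows "\<bar>cr (S' x) (S s - S t)\<bar> \<le> M * (w d * \<bar>s - t\<bar>)"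
proof -
  have "\<bar>cr (S' x) (S s - S t)\<bar> = \<bar>cr (S' x) (S s - S t - (s - t) *\<^sub>R S' x)\<bar>" by (simp add: cr_shift)
  also have "\<dots> \<le> norm (S' x) * norm (S s - S t - (s - t) *\<^sub>R S' x)" by (rule abs_cr_le)
  also have "\<dots> \<le> M * (w d * \<bar>s - t\<bar>)"
    by (intro mult_mono S'_le_M S_linearization) (use assms M_pos in \<open>auto simp: abs_minus_commute\<close>)
  finally show ?thesis .
qed

text \<open>The chord in the denominator gives \<open>1 / r\<^sup>2\<close> and the numerator gives
  \<open>w r * r\<close>: weakly singular, one factor \<open>w r\<close> better than a Cauchy
  kernel.\<close>

lemma K_bound:
  assumes m: "good_multiplier m" and u: "\<bar>x - t\<bar> \<le> 3 * pi / 2"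
  shows "norm (K m t x) \<le> (M / c\<^sup>2) * (w \<bar>x - t\<bar> / \<bar>x - t\<bar>)"
proof (cases "x = t")
  case True
  then show ?thesis by (simp add: K_def cr_def)
next
  case False
  let ?r = "\<bar>x - t\<bar>"
  have r: "?r > 0" using False by simp
  have l: "c * ?r \<le> norm (S x - S t)" using u by (rule S_lower)
  have cr: "c * ?r > 0" using c_pos r by simp
  have "norm (m (S x - S t)) \<le> 1 / (norm (S x - S t))\<^sup>2" using m unfolding good_multiplier_def by blast
  also have "\<dots> \<le> 1 / (c * ?r)\<^sup>2"
    using l cr by (intro divide_left_mono power_mono) (auto intro!: mult_pos_pos)
  finally have mm: "norm (m (S x - S t)) \<le> 1 / (c * ?r)\<^sup>2" .
  have "norm (K m t x) = \<bar>cr (S' x) (S x - S t)\<bar> * norm (m (S x - S t))"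
    by (simp add: K_def norm_mult)
  also have "\<dots> \<le> (M * (w ?r * ?r)) * (1 / (c * ?r)\<^sup>2)"
    by (intro mult_mono mm cr_S_le) (use M_pos w_nonneg in auto)
  also have "\<dots> = (M / c\<^sup>2) * (w ?r / ?r)"
  proof -
    have "(M * (v * r)) * (1 / (c * r)\<^sup>2) = (M / c\<^sup>2) * (v / r)" if "r > 0" for v r :: real
      using that c_pos by (simp add: power2_eq_square)
    then show ?thesis using r by blast
  qed
  finally show ?thesis .
qed

text \<open>Change first the numerator and then the multiplier. The condition
  \<open>2 * h \<le> r\<close> keeps \<open>\<bar>x - s\<bar>\<close> between \<open>r / 2\<close>
  and \<open>2 * r\<close>, and \<open>h \<le> 1/3\<close> keeps it below \<open>3 * pi / 2\<close>,
  the range of the lower bound for chords.\<close>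

lemma K_diff_bound:
  assumes m: "good_multiplier m" and r: "\<bar>x - t\<bar> = r" "2 * h \<le> r" "r \<le> pi" and st: "\<bar>s - t\<bar> \<le> h" and h: "0 < h" "h \<le> 1/3"
  shows "norm (K m t x - K m s x) \<le> (M / c\<^sup>2 + 12 * M\<^sup>2 / c ^ 3) * (h * w (2 * r) / r\<^sup>2)"
proof -
  let ?y = "S x - S t" and ?z = "S x - S s"
  have r0: "r > 0" using r h by linarith
  have xs: "r / 2 \<le> \<bar>x - s\<bar>" "\<bar>x - s\<bar> \<le> 2 * r" "\<bar>x - s\<bar> \<le> 3 * pi / 2" "\<bar>x - t\<bar> \<le> 3 * pi / 2"
    using r st h pi_gt3 by linarith+
  have ly: "c * r \<le> norm ?y" using S_lower[OF xs(4)] r by simp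
  have lz: "c * r / 2 \<le> norm ?z" using S_lower[OF xs(3)] xs(1) c_pos mult_left_mono[OF xs(1), of c] by linarith
  have cr0: "c * r > 0" using c_pos r0 by simp
  have yz: "norm ?y > 0" "norm ?z > 0" using ly lz cr0 by linarith+
  have d1: "\<bar>cr (S' x) (S s - S t)\<bar> \<le> M * (w (2 * r) * h)"
  proof -
    have "\<bar>cr (S' x) (S s - S t)\<bar> \<le> M * (w (2 * r) * \<bar>s - t\<bar>)"
      by (rule cr_S_le) (use r xs r0 in auto)
    also have "\<dots> \<le> M * (w (2 * r) * h)" using st M_pos w_nonneg by (intro mult_left_mono) auto
    finally show ?thesis .
  qed
  have d2: "\<bar>cr (S' x) ?z\<bar> \<le> M * (w (2 * r) * (2 * r))"
  proof -
    have "\<bar>cr (S' x) (S x - S s)\<bar> \<le> M * (w (2 * r) * \<bar>x - s\<bar>)"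
      by (rule cr_S_le) (use xs r0 in auto)
    also have "\<dots> \<le> M * (w (2 * r) * (2 * r))" using xs M_pos w_nonneg by (intro mult_left_mono) auto
    finally show ?thesis .
  qed
  have m1: "norm (m ?y) \<le> 1 / (c * r)\<^sup>2"
  proof -
    have "norm (m ?y) \<le> 1 / (norm ?y)\<^sup>2" using m unfolding good_multiplier_def by blast
    also have "\<dots> \<le> 1 / (c * r)\<^sup>2"
      using ly cr0 yz by (intro divide_left_mono power_mono) (auto intro!: mult_pos_pos)
    finally show ?thesis .
  qed
  \<comment> \<open>The two reciprocals contribute \<open>4 / (c * r) ^ 3\<close> and
    \<open>2 / (c * r) ^ 3\<close>, because \<open>norm ?z\<close> is only known to be at least
    \<open>c * r / 2\<close>.\<close>
  have m2: "norm (m ?y - m ?z) \<le> 6 * M * h / (c * r) ^ 3"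
  proof -
    have "norm (m ?y - m ?z) \<le> norm (?y - ?z) * (norm ?y + norm ?z) / ((norm ?y)\<^sup>2 * (norm ?z)\<^sup>2)"
    proof -
      have "?y \<noteq> 0" "?z \<noteq> 0" using yz by auto
      then show ?thesis using m unfolding good_multiplier_def by blast
    qed
    also have "\<dots> = norm (?y - ?z) * (1 / (norm ?y * (norm ?z)\<^sup>2) + 1 / ((norm ?y)\<^sup>2 * norm ?z))"
      using yz by (simp add: field_simps power2_eq_square)
    also have "\<dots> \<le> (M * h) * (1 / ((c * r) * (c * r / 2)\<^sup>2) + 1 / ((c * r)\<^sup>2 * (c * r / 2)))"
    proof (intro mult_mono add_mono)
      have "norm (?y - ?z) = norm (S s - S t)" by (simp add: norm_minus_commute)
      also have "\<dots> \<le> M * \<bar>s - t\<bar>" by (rule S_upper)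
      also have "\<dots> \<le> M * h" using st M_pos by (intro mult_left_mono) auto
      finally show "norm (?y - ?z) \<le> M * h" .
      show "1 / (norm ?y * (norm ?z)\<^sup>2) \<le> 1 / ((c * r) * (c * r / 2)\<^sup>2)"
        using ly lz cr0 yz by (intro divide_left_mono mult_mono power_mono) (auto intro!: mult_pos_pos)
      show "1 / ((norm ?y)\<^sup>2 * norm ?z) \<le> 1 / ((c * r)\<^sup>2 * (c * r / 2))"
        using ly lz cr0 yz by (intro divide_left_mono mult_mono power_mono) (auto intro!: mult_pos_pos)
    qed (use M_pos h in auto)
    also have "\<dots> = 6 * M * h / (c * r) ^ 3"
      using cr0 by (simp add: field_simps power2_eq_square power3_eq_cube)
    finally show ?thesis .
  qed
  have e: "cr (S' x) ?y = cr (S' x) ?z + cr (S' x) (S s - S t)"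
    using cr_diff[of "S' x" ?y ?z] by simp
  have "of_real (p + q) * a - of_real p * b = of_real q * a + of_real p * (a - b)" for p q :: real and a b :: complex
    by (simp add: algebra_simps)
  then have "K m t x - K m s x = of_real (cr (S' x) (S s - S t)) * m ?y + of_real (cr (S' x) ?z) * (m ?y - m ?z)"
    unfolding K_def e by blast
  then have "norm (K m t x - K m s x) \<le> \<bar>cr (S' x) (S s - S t)\<bar> * norm (m ?y) + \<bar>cr (S' x) ?z\<bar> * norm (m ?y - m ?z)"
    using norm_triangle_ineq[of "of_real (cr (S' x) (S s - S t)) * m ?y" "of_real (cr (S' x) ?z) * (m ?y - m ?z)"]
    by (simp add: norm_mult)
  also have "\<dots> \<le> (M * (w (2 * r) * h)) * (1 / (c * r)\<^sup>2) + (M * (w (2 * r) * (2 * r))) * (6 * M * h / (c * r) ^ 3)"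
    by (intro add_mono mult_mono d1 d2 m1 m2) (use M_pos w_nonneg h r0 in auto)
  also have "\<dots> = (M / c\<^sup>2 + 12 * M\<^sup>2 / c ^ 3) * (h * w (2 * r) / r\<^sup>2)"
    using c_pos r0 by (simp add: field_simps power2_eq_square power3_eq_cube)
  finally show ?thesis .
qed

section \<open>The weakly singular operators and the modulus of continuity of their values\<close>

definition T :: "(real \<Rightarrow> complex) \<Rightarrow> (complex \<Rightarrow> complex) \<Rightarrow> real \<Rightarrow> complex" where
  "T g m t = (LINT u:{-pi..pi}|lborel. g (t + u) * K m t (t + u))"

lemma T_bound:
  assumes m: "good_multiplier m" and g: "\<And>x. norm (g x) \<le> B" "g \<in> borel_measurable borel"
  shows "set_integrable lborel {-pi..pi} (\<lambda>u. g (t + u) * K m t (t + u))"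
    and "norm (T g m t) \<le> (LINT u:{-pi..pi}|lborel. B * ((M / c\<^sup>2) * (w \<bar>u\<bar> / \<bar>u\<bar>)))"
proof -
  have [measurable]: "g \<in> borel_measurable borel" "K m t \<in> borel_measurable borel" using g K_measurable[OF m] by auto
  have i: "set_integrable lborel {-pi..pi} (\<lambda>u. B * ((M / c\<^sup>2) * (w \<bar>u\<bar> / \<bar>u\<bar>)))"
    by (intro set_integrable_mult_right w_integrable)
  have B: "B \<ge> 0" using g(1)[of 0] norm_ge_zero order_trans by blast
  have le: "norm (g (t + u) * K m t (t + u)) \<le> B * ((M / c\<^sup>2) * (w \<bar>u\<bar> / \<bar>u\<bar>))" if "u \<in> {-pi..pi}" for u
  proof -
    have "\<bar>u\<bar> \<le> pi" using that by (auto simp: abs_le_iff)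
    then have "\<bar>(t + u) - t\<bar> \<le> 3 * pi / 2" using pi_ge_zero by simp
    from K_bound[OF m this] have "norm (K m t (t + u)) \<le> (M / c\<^sup>2) * (w \<bar>u\<bar> / \<bar>u\<bar>)" by simp
    then show ?thesis unfolding norm_mult using g B by (intro mult_mono) auto
  qed
  show i2: "set_integrable lborel {-pi..pi} (\<lambda>u. g (t + u) * K m t (t + u))"
  proof (rule set_integrable_bound[OF i])
    show "set_borel_measurable lborel {-pi..pi} (\<lambda>u. g (t + u) * K m t (t + u))"
      unfolding set_borel_measurable_def by measurable
    show "AE u in lborel. u \<in> {-pi..pi} \<longrightarrow> norm (g (t + u) * K m t (t + u)) \<le> norm (B * ((M / c\<^sup>2) * (w \<bar>u\<bar> / \<bar>u\<bar>)))"
      unfolding real_norm_def by (intro AE_I2 impI order_trans[OF _ abs_ge_self] le)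
  qed
  have "norm (T g m t) \<le> (LINT u:{-pi..pi}|lborel. norm (g (t + u) * K m t (t + u)))"
    unfolding T_def by (rule set_integral_norm_bound[OF i2])
  also have "\<dots> \<le> (LINT u:{-pi..pi}|lborel. B * ((M / c\<^sup>2) * (w \<bar>u\<bar> / \<bar>u\<bar>)))"
    by (rule set_integral_mono[OF set_integrable_norm[OF i2] i le])
  finally show "norm (T g m t) \<le> (LINT u:{-pi..pi}|lborel. B * ((M / c\<^sup>2) * (w \<bar>u\<bar> / \<bar>u\<bar>)))" .
qed

text \<open>\<open>A\<close> collects the kernels close to their singularities, where each is
  estimated by itself; \<open>H\<close> collects the difference of two kernels far from
  them.\<close>

definition A :: "real \<Rightarrow> ennreal" where
  "A R = (\<integral>\<^sup>+u. ennreal (w \<bar>u\<bar> / \<bar>u\<bar>) * indicator {..R} \<bar>u\<bar> \<partial>lborel)"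

definition H :: "real \<Rightarrow> ennreal" where
  "H h = (\<integral>\<^sup>+u. ennreal (h * w (2 * \<bar>u\<bar>) / \<bar>u\<bar>\<^sup>2) * indicator {2 * h<..pi} \<bar>u\<bar> \<partial>lborel)"

text \<open>By periodicity both integrals are taken over the period centred at \<open>t\<close>. For
  \<open>\<bar>u\<bar> \<le> 2 * h\<close> the distances to both singularities \<open>t\<close> and
  \<open>s\<close> are at most \<open>3 * h\<close>, whence the two terms with
  \<open>A (3 * h)\<close>; the remaining \<open>u\<close> fall under
  \<open>K_diff_bound\<close>.\<close>

lemma T_diff_bound:
  assumes m: "good_multiplier m" and g: "\<And>x. g (x + 2 * pi) = g x" "\<And>x. norm (g x) \<le> B" "g \<in> borel_measurable borel"
    and st: "\<bar>s - t\<bar> \<le> h" and h: "0 < h" "h \<le> 1/3"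
  shows "ennreal (norm (T g m t - T g m s)) \<le> ennreal (B * (M / c\<^sup>2)) * A (3 * h) + ennreal (B * (M / c\<^sup>2)) * A (3 * h)
     + ennreal (B * (M / c\<^sup>2 + 12 * M\<^sup>2 / c ^ 3)) * H h"
proof -
  let ?C1 = "M / c\<^sup>2" and ?C2 = "M / c\<^sup>2 + 12 * M\<^sup>2 / c ^ 3"
  have C: "?C1 \<ge> 0" "?C2 \<ge> 0" using M_pos c_pos by auto
  have B: "B \<ge> 0" using g(2)[of 0] norm_ge_zero order_trans by blast
  have [measurable]: "g \<in> borel_measurable borel" "K m t \<in> borel_measurable borel" for t using g K_measurable[OF m] by auto
  have gK: "g (x + 2 * pi) * K m s (x + 2 * pi) = g x * K m s x" for x by (simp add: g K_periodic)
  have i1: "set_integrable lborel {-pi..pi} (\<lambda>u. g (t + u) * K m t (t + u))" by (rule T_bound(1)[OF m g(2,3)])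
  have i0: "set_integrable lborel {0..0 + 2 * pi} (\<lambda>x. g x * K m s x)"
    by (rule periodic_uncentered_integral(1)[of "\<lambda>x. g x * K m s x" s, OF gK T_bound(1)[OF m g(2,3)]])
  have i2: "set_integrable lborel {-pi..pi} (\<lambda>u. g (t + u) * K m s (t + u))"
    by (rule periodic_centered_integral(1)[OF gK i0])
  have "T g m s = (LINT u:{-pi..pi}|lborel. g (t + u) * K m s (t + u))"
    unfolding T_def periodic_centered_integral(2)[of "\<lambda>x. g x * K m s x", OF gK i0, of t]
    by (rule periodic_centered_integral(2)[OF gK i0])
  then have "T g m t - T g m s = (LINT u:{-pi..pi}|lborel. g (t + u) * K m t (t + u) - g (t + u) * K m s (t + u))"
    unfolding T_def by (simp add: set_integral_diff(2)[OF i1 i2])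
  then have "ennreal (norm (T g m t - T g m s))
    \<le> (\<integral>\<^sup>+u. ennreal (norm (indicat_real {-pi..pi} u *\<^sub>R (g (t + u) * K m t (t + u) - g (t + u) * K m s (t + u)))) \<partial>lborel)"
    unfolding set_lebesgue_integral_def
    using integral_norm_bound_ennreal[of lborel "\<lambda>u. indicat_real {-pi..pi} u *\<^sub>R (g (t + u) * K m t (t + u) - g (t + u) * K m s (t + u))"]
      set_integral_diff(1)[OF i1 i2] by (simp add: set_integrable_def)
  also have "\<dots> \<le> (\<integral>\<^sup>+u. ennreal (B * ?C1) * (ennreal (w \<bar>u\<bar> / \<bar>u\<bar>) * indicator {..3 * h} \<bar>u\<bar>)
     + ennreal (B * ?C1) * (ennreal (w \<bar>(t - s) + 1 * u\<bar> / \<bar>(t - s) + 1 * u\<bar>) * indicator {..3 * h} \<bar>(t - s) + 1 * u\<bar>)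
     + ennreal (B * ?C2) * (ennreal (h * w (2 * \<bar>u\<bar>) / \<bar>u\<bar>\<^sup>2) * indicator {2 * h<..pi} \<bar>u\<bar>) \<partial>lborel)"
  proof (rule nn_integral_mono)
    fix u :: real
    let ?L = "ennreal (norm (indicat_real {-pi..pi} u *\<^sub>R (g (t + u) * K m t (t + u) - g (t + u) * K m s (t + u))))"
    let ?R1 = "ennreal (B * ?C1) * (ennreal (w \<bar>u\<bar> / \<bar>u\<bar>) * indicator {..3 * h} \<bar>u\<bar>)"
    let ?R2 = "ennreal (B * ?C1) * (ennreal (w \<bar>(t - s) + 1 * u\<bar> / \<bar>(t - s) + 1 * u\<bar>) * indicator {..3 * h} \<bar>(t - s) + 1 * u\<bar>)"
    let ?R3 = "ennreal (B * ?C2) * (ennreal (h * w (2 * \<bar>u\<bar>) / \<bar>u\<bar>\<^sup>2) * indicator {2 * h<..pi} \<bar>u\<bar>)"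
    show "?L \<le> ?R1 + ?R2 + ?R3"
    proof (cases "u \<in> {-pi..pi}")
      case True
      then have u: "\<bar>u\<bar> \<le> pi" by (auto simp: abs_le_iff)
      have "norm (g (t + u) * K m t (t + u) - g (t + u) * K m s (t + u)) = norm (g (t + u)) * norm (K m t (t + u) - K m s (t + u))"
        by (simp add: norm_mult[symmetric] right_diff_distrib)
      also have "\<dots> \<le> B * norm (K m t (t + u) - K m s (t + u))" by (intro mult_right_mono g) auto
      finally have L: "?L \<le> ennreal (B * norm (K m t (t + u) - K m s (t + u)))" using True by (auto intro: ennreal_leI)
      show ?thesis
      proof (cases "\<bar>u\<bar> \<le> 2 * h")
        case True
        have 1: "\<bar>(t + u) - t\<bar> \<le> 3 * pi / 2" "\<bar>(t + u) - s\<bar> \<le> 3 * pi / 2" using True st h pi_gt3 by linarith+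
        have 2: "\<bar>u\<bar> \<le> 3 * h" "\<bar>(t - s) + 1 * u\<bar> \<le> 3 * h" using True st h by linarith+
        have e: "(t + u) - s = (t - s) + 1 * u" by simp
        have "norm (K m t (t + u) - K m s (t + u)) \<le> ?C1 * (w \<bar>u\<bar> / \<bar>u\<bar>) + ?C1 * (w \<bar>(t - s) + 1 * u\<bar> / \<bar>(t - s) + 1 * u\<bar>)"
          using K_bound[OF m 1(1)] K_bound[OF m 1(2), unfolded e] norm_triangle_ineq4[of "K m t (t + u)" "K m s (t + u)"] by simp
        then have "B * norm (K m t (t + u) - K m s (t + u)) \<le> B * ?C1 * (w \<bar>u\<bar> / \<bar>u\<bar>) + B * ?C1 * (w \<bar>(t - s) + 1 * u\<bar> / \<bar>(t - s) + 1 * u\<bar>)"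
          using mult_left_mono[OF _ B] by (fastforce simp: distrib_left mult.assoc)
        then have "?L \<le> ennreal (B * ?C1 * (w \<bar>u\<bar> / \<bar>u\<bar>) + B * ?C1 * (w \<bar>(t - s) + 1 * u\<bar> / \<bar>(t - s) + 1 * u\<bar>))"
          using L ennreal_leI order_trans by blast
        also have "\<dots> = ?R1 + ?R2"
        proof -
          have lin: "ennreal (p * x + p * y) = ennreal p * ennreal x + ennreal p * ennreal y"
            if "0 \<le> p" "0 \<le> x" "0 \<le> y" for p x y :: real
            using that by (simp add: ennreal_plus ennreal_mult)
          have "0 \<le> B * ?C1" by (rule mult_nonneg_nonneg[OF B C(1)])
          from lin[OF this, of "w \<bar>u\<bar> / \<bar>u\<bar>" "w \<bar>(t - s) + 1 * u\<bar> / \<bar>(t - s) + 1 * u\<bar>"]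
          show ?thesis using 2 w_nonneg by (simp only: zero_le_divide_iff abs_ge_zero simp_thms indicator_simps atMost_iff mult_1_right)
        qed
        finally show ?thesis by (simp add: add_increasing2)
      next
        case False
        have "norm (K m t (t + u) - K m s (t + u)) \<le> ?C2 * (h * w (2 * \<bar>u\<bar>) / \<bar>u\<bar>\<^sup>2)"
          by (rule K_diff_bound[OF m _ _ _ st h]) (use False u in auto)
        then have "B * norm (K m t (t + u) - K m s (t + u)) \<le> B * ?C2 * (h * w (2 * \<bar>u\<bar>) / \<bar>u\<bar>\<^sup>2)"
          using mult_left_mono[OF _ B] by (fastforce simp: mult.assoc)
        then have "?L \<le> ennreal (B * ?C2 * (h * w (2 * \<bar>u\<bar>) / \<bar>u\<bar>\<^sup>2))"
          using L ennreal_leI order_trans by blast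
        also have "\<dots> = ?R3" using False u B C h w_nonneg by (simp add: ennreal_mult[symmetric])
        finally show ?thesis by (simp add: add_increasing)
      qed
    qed simp
  qed
  also have "\<dots> = ennreal (B * ?C1) * A (3 * h)
     + ennreal (B * ?C1) * (\<integral>\<^sup>+u. (ennreal (w \<bar>(t - s) + 1 * u\<bar> / \<bar>(t - s) + 1 * u\<bar>) * indicator {..3 * h} \<bar>(t - s) + 1 * u\<bar>) \<partial>lborel)
     + ennreal (B * ?C2) * H h"
    unfolding A_def H_def by (simp add: nn_integral_add nn_integral_cmult)
  also have "(\<integral>\<^sup>+u. (ennreal (w \<bar>(t - s) + 1 * u\<bar> / \<bar>(t - s) + 1 * u\<bar>) * indicator {..3 * h} \<bar>(t - s) + 1 * u\<bar>) \<partial>lborel) = A (3 * h)"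
    unfolding A_def
    using nn_integral_real_affine[of "\<lambda>u. ennreal (w \<bar>u\<bar> / \<bar>u\<bar>) * indicator {..3 * h} \<bar>u\<bar>" 1 "t - s"] by simp
  finally show ?thesis .
qed

text \<open>Interchanging the integrations produces the logarithm in the hypothesis on \<open>S'\<close>.\<close>

lemma A_finite: "(\<integral>\<^sup>+h\<in>{0<..1/3}. (A (3 * h) / ennreal h) \<partial>lborel) < \<infinity>"
proof -
  have "(\<integral>\<^sup>+h\<in>{0<..1/3}. (A (3 * h) / ennreal h) \<partial>lborel)
     = (\<integral>\<^sup>+h. \<integral>\<^sup>+u. ennreal (w \<bar>u\<bar> / \<bar>u\<bar>) * indicator {..3 * h} \<bar>u\<bar> * (indicator {0<..1/3} h * (1 / ennreal h)) \<partial>lborel \<partial>lborel)"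
  proof (rule nn_integral_cong)
    fix h :: real
    have "A (3 * h) / ennreal h * indicator {0<..1/3} h = A (3 * h) * (indicator {0<..1/3} h * (1 / ennreal h))"
      by (simp add: indicator_def ennreal_times_divide)
    also have "\<dots> = (\<integral>\<^sup>+u. ennreal (w \<bar>u\<bar> / \<bar>u\<bar>) * indicator {..3 * h} \<bar>u\<bar> * (indicator {0<..1/3} h * (1 / ennreal h)) \<partial>lborel)"
      unfolding A_def by (rule nn_integral_multc[symmetric]) measurable
    finally show "A (3 * h) / ennreal h * indicator {0<..1/3} h = \<dots>" .
  qed
  also have "\<dots> = (\<integral>\<^sup>+u. \<integral>\<^sup>+h. ennreal (w \<bar>u\<bar> / \<bar>u\<bar>) * indicator {..3 * h} \<bar>u\<bar> * (indicator {0<..1/3} h * (1 / ennreal h)) \<partial>lborel \<partial>lborel)"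
    unfolding indicator_def of_bool_def atMost_iff greaterThanAtMost_iff
    by (rule lborel_pair.Fubini') measurable
  also have "\<dots> \<le> (\<integral>\<^sup>+u. (ennreal (w \<bar>u\<bar> / \<bar>u\<bar>) * ennreal (ln (3 / \<bar>u\<bar>)) * indicator {0<..1} \<bar>u\<bar>) \<partial>lborel)"
  proof (rule nn_integral_mono)
    fix u :: real
    show "(\<integral>\<^sup>+h. ennreal (w \<bar>u\<bar> / \<bar>u\<bar>) * indicator {..3 * h} \<bar>u\<bar> * (indicator {0<..1/3} h * (1 / ennreal h)) \<partial>lborel)
       \<le> ennreal (w \<bar>u\<bar> / \<bar>u\<bar>) * ennreal (ln (3 / \<bar>u\<bar>)) * indicator {0<..1} \<bar>u\<bar>"
    proof (cases "u = 0 \<or> \<bar>u\<bar> > 1")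
      case True
      then have "ennreal (w \<bar>u\<bar> / \<bar>u\<bar>) * indicator {..3 * h} \<bar>u\<bar> * (indicator {0<..1/3} h * (1 / ennreal h)) = 0" for h
        by (auto simp: indicator_def)
      note e = this
      show ?thesis by (simp only: e) simp
    next
      case False
      then have u: "0 < \<bar>u\<bar>" "\<bar>u\<bar> \<le> 1" by auto
      have "(\<integral>\<^sup>+h. ennreal (w \<bar>u\<bar> / \<bar>u\<bar>) * indicator {..3 * h} \<bar>u\<bar> * (indicator {0<..1/3} h * (1 / ennreal h)) \<partial>lborel)
        \<le> (\<integral>\<^sup>+h. ennreal (w \<bar>u\<bar> / \<bar>u\<bar>) * (1 / ennreal h * indicator {\<bar>u\<bar>/3..1/3} h) \<partial>lborel)"
        by (rule nn_integral_mono) (auto simp: indicator_def)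
      also have "\<dots> = ennreal (w \<bar>u\<bar> / \<bar>u\<bar>) * ennreal (ln ((1/3) / (\<bar>u\<bar>/3)))"
        using u by (subst nn_integral_cmult) (auto simp: nn_integral_inverse_interval)
      also have "\<dots> \<le> ennreal (w \<bar>u\<bar> / \<bar>u\<bar>) * ennreal (ln (3 / \<bar>u\<bar>))"
        using u by (intro mult_left_mono ennreal_leI) (auto simp: divide_right_mono)
      finally show ?thesis using u by simp
    qed
  qed
  also have "\<dots> \<le> 2 * (\<integral>\<^sup>+u\<in>{0..}. (ennreal (w u / u) * ennreal (ln (3 / u)) * indicator {0<..1} u) \<partial>lborel)"
    by (rule nn_integral_abs_le) measurable
  also have "(\<integral>\<^sup>+u\<in>{0..}. (ennreal (w u / u) * ennreal (ln (3 / u)) * indicator {0<..1} u) \<partial>lborel)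
     = (\<integral>\<^sup>+\<eta>\<in>{0<..1}. (modulus UNIV S' \<eta> / ennreal \<eta> * ennreal (ln (3 / \<eta>))) \<partial>lborel)"
    by (rule nn_integral_cong) (auto simp: indicator_def w_eq[symmetric] divide_ennreal w_nonneg)
  also have "2 * \<dots> < \<infinity>" using S'_log_dini by (simp add: ennreal_mult_less_top)
  finally show ?thesis .
qed

text \<open>The factor \<open>h\<close> in \<open>H\<close> cancels \<open>1 / h\<close>. For fixed
  \<open>u\<close> the variable \<open>h\<close> then runs only up to
  \<open>\<bar>u\<bar> / 2\<close>, which cancels one power of \<open>\<bar>u\<bar>\<close> in the
  denominator and leaves the plain Dini integral of \<open>w\<close>.\<close>

lemma H_finite: "(\<integral>\<^sup>+h\<in>{0<..1/3}. (H h / ennreal h) \<partial>lborel) < \<infinity>"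
proof -
  have "(\<integral>\<^sup>+h\<in>{0<..1/3}. (H h / ennreal h) \<partial>lborel)
     = (\<integral>\<^sup>+h. \<integral>\<^sup>+u. ennreal (w (2 * \<bar>u\<bar>) / \<bar>u\<bar>\<^sup>2) * indicator {2 * h<..pi} \<bar>u\<bar> * indicator {0<..1/3} h \<partial>lborel \<partial>lborel)"
  proof (rule nn_integral_cong)
    fix h :: real
    show "H h / ennreal h * indicator {0<..1/3} h
       = (\<integral>\<^sup>+u. ennreal (w (2 * \<bar>u\<bar>) / \<bar>u\<bar>\<^sup>2) * indicator {2 * h<..pi} \<bar>u\<bar> * indicator {0<..1/3} h \<partial>lborel)"
    proof (cases "h \<in> {0<..1/3}")
      case True
      have "H h = (\<integral>\<^sup>+u. ennreal h * (ennreal (w (2 * \<bar>u\<bar>) / \<bar>u\<bar>\<^sup>2) * indicator {2 * h<..pi} \<bar>u\<bar>) \<partial>lborel)"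
        unfolding H_def using True w_nonneg by (intro nn_integral_cong) (simp add: mult.assoc[symmetric] ennreal_mult[symmetric])
      also have "\<dots> = ennreal h * (\<integral>\<^sup>+u. (ennreal (w (2 * \<bar>u\<bar>) / \<bar>u\<bar>\<^sup>2) * indicator {2 * h<..pi} \<bar>u\<bar>) \<partial>lborel)"
        by (rule nn_integral_cmult) measurable
      finally have "H h / ennreal h = (\<integral>\<^sup>+u. (ennreal (w (2 * \<bar>u\<bar>) / \<bar>u\<bar>\<^sup>2) * indicator {2 * h<..pi} \<bar>u\<bar>) \<partial>lborel)"
        using True by (simp add: mult_divide_eq_ennreal mult.commute[of "ennreal h"])
      then show ?thesis using True by simp
    qed simp
  qed
  also have "\<dots> = (\<integral>\<^sup>+u. \<integral>\<^sup>+h. ennreal (w (2 * \<bar>u\<bar>) / \<bar>u\<bar>\<^sup>2) * indicator {2 * h<..pi} \<bar>u\<bar> * indicator {0<..1/3} h \<partial>lborel \<partial>lborel)"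
    unfolding indicator_def of_bool_def atMost_iff greaterThanAtMost_iff
    by (rule lborel_pair.Fubini') measurable
  also have "\<dots> \<le> (\<integral>\<^sup>+u. ennreal (indicat_real {-pi..pi} u *\<^sub>R (w \<bar>u\<bar> / \<bar>u\<bar>)) \<partial>lborel)"
  proof (rule nn_integral_mono)
    fix u :: real
    show "(\<integral>\<^sup>+h. ennreal (w (2 * \<bar>u\<bar>) / \<bar>u\<bar>\<^sup>2) * indicator {2 * h<..pi} \<bar>u\<bar> * indicator {0<..1/3} h \<partial>lborel)
      \<le> ennreal (indicat_real {-pi..pi} u *\<^sub>R (w \<bar>u\<bar> / \<bar>u\<bar>))"
    proof (cases "\<bar>u\<bar> \<le> pi \<and> u \<noteq> 0")
      case True
      have "(\<integral>\<^sup>+h. ennreal (w (2 * \<bar>u\<bar>) / \<bar>u\<bar>\<^sup>2) * indicator {2 * h<..pi} \<bar>u\<bar> * indicator {0<..1/3} h \<partial>lborel)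
        \<le> (\<integral>\<^sup>+h. ennreal (w (2 * \<bar>u\<bar>) / \<bar>u\<bar>\<^sup>2) * indicator {0..\<bar>u\<bar>/2} h \<partial>lborel)"
        by (rule nn_integral_mono) (auto simp: indicator_def)
      also have "\<dots> = ennreal (w (2 * \<bar>u\<bar>) / \<bar>u\<bar>\<^sup>2) * ennreal (\<bar>u\<bar>/2)"
        by (subst nn_integral_cmult_indicator) auto
      also have "\<dots> = ennreal (w (2 * \<bar>u\<bar>) / \<bar>u\<bar>\<^sup>2 * (\<bar>u\<bar>/2))"
        by (rule ennreal_mult[symmetric]) (use w_nonneg in auto)
      also have "\<dots> \<le> ennreal (2 * w \<bar>u\<bar> / \<bar>u\<bar>\<^sup>2 * (\<bar>u\<bar>/2))"
        by (intro ennreal_leI mult_right_mono divide_right_mono w_double) auto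
      also have "2 * w \<bar>u\<bar> / \<bar>u\<bar>\<^sup>2 * (\<bar>u\<bar>/2) = w \<bar>u\<bar> / \<bar>u\<bar>"
      proof -
        have e: "2 * a / r\<^sup>2 * (r / 2) = a / r" if "r \<noteq> 0" for a r :: real using that by (simp add: power2_eq_square)
        show ?thesis by (rule e) (use True in simp)
      qed
      finally show ?thesis using True by (simp add: indicator_def abs_le_iff)
    next
      case False
      then have "ennreal (w (2 * \<bar>u\<bar>) / \<bar>u\<bar>\<^sup>2) * indicator {2 * h<..pi} \<bar>u\<bar> * indicator {0<..1/3} h = 0" for h
        by (auto simp: indicator_def)
      note e = this
      show ?thesis by (simp only: e) simp
    qed
  qed
  also have "\<dots> = (\<integral>\<^sup>+u. ennreal (norm (indicat_real {-pi..pi} u *\<^sub>R (w \<bar>u\<bar> / \<bar>u\<bar>))) \<partial>lborel)"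
    by (intro nn_integral_cong) (simp add: w_nonneg)
  also have "\<dots> < \<infinity>" using w_integrable[of pi] by (simp add: set_integrable_def integrable_iff_bounded)
  finally show ?thesis .
qed

lemma A_H_measurable [measurable]: "A \<in> borel_measurable borel" "H \<in> borel_measurable borel"
  unfolding A_def H_def indicator_def of_bool_def atMost_iff greaterThanAtMost_iff by measurable

lemma dini_T:
  assumes m: "good_multiplier m" and g: "\<And>x. g (x + 2 * pi) = g x" "continuous_on UNIV g"
  shows "dini UNIV (T g m)"
proof -
  obtain B where B: "\<And>x. norm (g x) \<le> B"
    using bounded_range_periodic[of g, OF g] by (auto simp: bounded_iff)
  have gm: "g \<in> borel_measurable borel" using g(2) by (rule borel_measurable_continuous_onI)
  have bdd: "bounded (range (T g m))"
    unfolding bounded_iff using T_bound(2)[OF m B gm] by blast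
  let ?c1 = "ennreal (B * (M / c\<^sup>2))" and ?c2 = "ennreal (B * (M / c\<^sup>2 + 12 * M\<^sup>2 / c ^ 3))"
  have le: "modulus UNIV (T g m) h \<le> ?c1 * A (3 * h) + ?c1 * A (3 * h) + ?c2 * H h" if "h \<in> {0<..1/3}" for h
  proof (rule modulus_least)
    fix p q :: real assume "dist p q \<le> h"
    then have "\<bar>q - p\<bar> \<le> h" by (simp add: dist_real_def abs_minus_commute)
    from T_diff_bound[OF m g(1) B gm this] that
    show "ennreal (dist (T g m p) (T g m q)) \<le> ?c1 * A (3 * h) + ?c1 * A (3 * h) + ?c2 * H h"
      by (simp add: dist_norm)
  qed
  have "(\<integral>\<^sup>+h\<in>{0<..1/3}. (modulus UNIV (T g m) h / ennreal h) \<partial>lborel)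
     \<le> (\<integral>\<^sup>+h. ?c1 * (A (3 * h) / ennreal h * indicator {0<..1/3} h) + ?c1 * (A (3 * h) / ennreal h * indicator {0<..1/3} h)
        + ?c2 * (H h / ennreal h * indicator {0<..1/3} h) \<partial>lborel)"
  proof (rule nn_integral_mono)
    fix h :: real
    show "modulus UNIV (T g m) h / ennreal h * indicator {0<..1/3} h
      \<le> ?c1 * (A (3 * h) / ennreal h * indicator {0<..1/3} h) + ?c1 * (A (3 * h) / ennreal h * indicator {0<..1/3} h)
        + ?c2 * (H h / ennreal h * indicator {0<..1/3} h)"
    proof (cases "h \<in> {0<..1/3}")
      case True
      have "modulus UNIV (T g m) h / ennreal h \<le> (?c1 * A (3 * h) + ?c1 * A (3 * h) + ?c2 * H h) / ennreal h"
        by (rule divide_right_mono_ennreal[OF le[OF True]])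
      also have "\<dots> = ?c1 * (A (3 * h) / ennreal h) + ?c1 * (A (3 * h) / ennreal h) + ?c2 * (H h / ennreal h)"
        by (simp only: add_divide_distrib_ennreal ennreal_times_divide)
      finally show ?thesis using True by simp
    qed simp
  qed
  also have "\<dots> = ?c1 * (\<integral>\<^sup>+h\<in>{0<..1/3}. (A (3 * h) / ennreal h) \<partial>lborel) + ?c1 * (\<integral>\<^sup>+h\<in>{0<..1/3}. (A (3 * h) / ennreal h) \<partial>lborel)
      + ?c2 * (\<integral>\<^sup>+h\<in>{0<..1/3}. (H h / ennreal h) \<partial>lborel)"
    by (simp add: nn_integral_add nn_integral_cmult)
  also have "\<dots> < \<infinity>" using A_finite H_finite by (simp add: ennreal_mult_less_top)
  finally show ?thesis by (rule dini_if_local[OF bdd, rotated]) simp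
qed

end

subsection \<open>The singular integrals of constants\<close>

lemma has_vector_derivative_within_imp_tendsto:
  fixes f :: "real \<Rightarrow> 'a::real_normed_vector"
  assumes "(f has_vector_derivative D) (at x within S)"
  shows "((\<lambda>y. (f y - f x) /\<^sub>R (y - x)) \<longlongrightarrow> D) (at x within S)"
proof -
  have "((\<lambda>y. norm ((f y - f x) - (y - x) *\<^sub>R D) / norm (y - x)) \<longlongrightarrow> 0) (at x within S)"
    using assms by (simp add: has_vector_derivative_def has_derivative_iff_norm)
  then have "((\<lambda>y. norm ((f y - f x) /\<^sub>R (y - x) - D)) \<longlongrightarrow> 0) (at x within S)"
  proof (rule Lim_transform_eventually)
    have "norm (v - h *\<^sub>R D) / norm h = norm (v /\<^sub>R h - D)" if "h \<noteq> 0" for h :: real and v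
    proof -
      have "v /\<^sub>R h - D = (v - h *\<^sub>R D) /\<^sub>R h" using that by (simp add: scaleR_diff_right)
      then show ?thesis by (simp add: divide_inverse mult.commute)
    qed
    then show "\<forall>\<^sub>F y in at x within S. norm ((f y - f x) - (y - x) *\<^sub>R D) / norm (y - x) = norm ((f y - f x) /\<^sub>R (y - x) - D)"
      unfolding eventually_at_filter by (intro always_eventually allI impI) simp
  qed
  then show ?thesis by (rule LIM_zero_cancel[OF tendsto_norm_zero_cancel])
qed

context dini_curve
begin

lemma kE_singular_integrable: "set_integrable lborel {-pi..pi} (\<lambda>u. kE (S t) (t + u))"
  using T_bound(1)[OF good_multiplier_square, of "\<lambda>_. 1" 1 t] by (simp add: kE_eq_K)

lemma Im_kC_singular_integrable: "set_integrable lborel {-pi..pi} (\<lambda>u. of_real (Im (kC (S t) (t + u))) :: complex)"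
  using T_bound(1)[OF good_multiplier_norm, of "\<lambda>_. 1" 1 t] unfolding Im_kC_eq_K by simp

text \<open>The primitive \<open>q\<close> of the kernel is unaffected by real factors of the chord,
  so it has the same limit \<open>Im (S' t) / S' t\<close> on both sides of its singularity. It is
  also periodic; hence the integral outside \<open>(-h, h)\<close> is \<open>q (- h) - q h\<close>,
  which tends to 0.\<close>

lemma integral_kE_singular: "(LINT u:{-pi..pi}|lborel. kE (S t) (t + u)) = 0"
proof -
  let ?F = "\<lambda>u. kE (S t) (t + u)"
  define q where "q = (\<lambda>u. of_real (Im (S (t + u) - S t)) / (S (t + u) - S t) :: complex)"
  define \<phi> where "\<phi> = (\<lambda>x. integral {-pi..x} ?F)"
  have int: "?F integrable_on {-pi..pi}" by (rule set_borel_integral_eq_integral(1)[OF kE_singular_integrable])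
  have cont: "continuous_on {-pi..pi} \<phi>" unfolding \<phi>_def by (rule indefinite_integral_continuous_1[OF int])
  have isc: "isCont \<phi> 0"
    using cont by (rule continuous_on_interior) (simp add: pi_gt_zero)
  have d: "(q has_vector_derivative ?F u) (at u)" if "u \<noteq> 0" "\<bar>u\<bar> \<le> pi" for u
  proof -
    have "S (t + u) \<noteq> S t" using S_eq_iff_centered[OF that(2)] that(1) by simp
    from kE_antiderivative[OF this]
    have 1: "((\<lambda>x. of_real (Im (S x - S t)) / (S x - S t)) has_vector_derivative kE (S t) (t + u)) (at (t + u))" .
    have 2: "((\<lambda>u. t + u) has_vector_derivative 1) (at u)" by (auto intro!: derivative_eq_intros)
    from vector_diff_chain_at[OF 2 1] show ?thesis by (simp add: o_def q_def)
  qed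
  have ev: "\<phi> (- h) + (\<phi> pi - \<phi> h) = q (- h) - q h" if h: "0 < h" "h < pi" for h
  proof -
    have "(?F has_integral (q (- h) - q (- pi))) {- pi..- h}"
      by (rule fundamental_theorem_of_calculus[OF _ has_vector_derivative_at_within[OF d]]) (use h in \<open>auto simp: abs_le_iff\<close>)
    then have 1: "\<phi> (- h) = q (- h) - q (- pi)" by (simp add: \<phi>_def integral_unique)
    have "(?F has_integral (q pi - q h)) {h..pi}"
      by (rule fundamental_theorem_of_calculus[OF _ has_vector_derivative_at_within[OF d]]) (use h in \<open>auto simp: abs_le_iff\<close>)
    then have "integral {h..pi} ?F = q pi - q h" by (rule integral_unique)
    moreover have "integral {-pi..h} ?F + integral {h..pi} ?F = integral {-pi..pi} ?F"
      by (rule Henstock_Kurzweil_Integration.integral_combine) (use h int in auto)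
    ultimately have 2: "\<phi> pi - \<phi> h = q pi - q h" unfolding \<phi>_def by (metis add_diff_cancel_left')
    have "S (t + pi) = S (t + - pi)" using S_periodic[of "t + - pi"] by (simp add: algebra_simps)
    then have "q pi = q (- pi)" unfolding q_def by (simp only:)
    then show ?thesis using 1 2 by simp
  qed
  let ?Q = "of_real (Im (S' t)) / S' t :: complex"
  have q: "(q \<longlongrightarrow> ?Q) (at 0)"
  proof -
    have der: "((\<lambda>h. (S (t + h) - S t) /\<^sub>R h) \<longlongrightarrow> S' t) (at 0)"
      using LIM_offset_zero[OF has_vector_derivative_within_imp_tendsto[OF S_deriv]] by simp
    have "((\<lambda>h. of_real (Im ((S (t + h) - S t) /\<^sub>R h)) / ((S (t + h) - S t) /\<^sub>R h)) \<longlongrightarrow> ?Q) (at 0)"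
      by (intro tendsto_intros der S'_nonzero)
    then show ?thesis
    proof (rule Lim_transform_eventually)
      show "\<forall>\<^sub>F h in at 0. of_real (Im ((S (t + h) - S t) /\<^sub>R h)) / ((S (t + h) - S t) /\<^sub>R h) = q h"
      proof -
        have "of_real (Im (v /\<^sub>R h)) / (v /\<^sub>R h) = of_real (Im v) / v" if "h \<noteq> 0" for h :: real and v :: complex
        proof -
          have "of_real (Im (v /\<^sub>R h)) / (v /\<^sub>R h) = (of_real (inverse h) * of_real (Im v)) / (of_real (inverse h) * v)"
            by (simp only: scaleR_complex.sel of_real_mult) (simp only: scaleR_conv_of_real)
          also have "\<dots> = of_real (Im v) / v" using that by (intro mult_divide_mult_cancel_left) simp
          finally show ?thesis .
        qed
        then show ?thesis unfolding eventually_at_filter q_def by (intro always_eventually allI impI)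
      qed
    qed
  qed
  define e where "e = (\<lambda>n::nat. inverse (real (Suc n)))"
  have e: "e \<longlonglongrightarrow> 0" "\<And>n. 0 < e n" "\<And>n. e n < pi"
  proof -
    show "e \<longlonglongrightarrow> 0" unfolding e_def by (rule LIMSEQ_inverse_real_of_nat)
    show "0 < e n" for n by (simp add: e_def)
    have "e n \<le> 1" for n by (simp add: e_def inverse_le_1_iff)
    then show "e n < pi" for n using pi_gt3 by (smt (verit))
  qed
  have q1: "(\<lambda>n. q (e n)) \<longlonglongrightarrow> ?Q"
    by (rule filterlim_compose[OF q]) (use e in \<open>auto simp: filterlim_at intro!: always_eventually less_imp_neq[symmetric]\<close>)
  have em: "(\<lambda>n. - e n) \<longlonglongrightarrow> 0" using tendsto_minus[OF e(1)] by simp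
  have q2: "(\<lambda>n. q (- e n)) \<longlonglongrightarrow> ?Q"
    by (rule filterlim_compose[OF q]) (use e em in \<open>auto simp: filterlim_at intro!: always_eventually less_imp_neq[symmetric]\<close>)
  have "(\<lambda>n. \<phi> (- e n) + (\<phi> pi - \<phi> (e n))) \<longlonglongrightarrow> \<phi> 0 + (\<phi> pi - \<phi> 0)"
    by (intro tendsto_intros isCont_tendsto_compose[OF isc] e em)
  moreover have "(\<lambda>n. \<phi> (- e n) + (\<phi> pi - \<phi> (e n))) \<longlonglongrightarrow> ?Q - ?Q"
    unfolding ev[OF e(2,3)] by (intro tendsto_diff q1 q2)
  ultimately have "\<phi> 0 + (\<phi> pi - \<phi> 0) = ?Q - ?Q" by (rule LIMSEQ_unique)
  then have "\<phi> pi = 0" by simp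
  then show ?thesis using set_borel_integral_eq_integral(2)[OF kE_singular_integrable, of t] by (simp add: \<phi>_def)
qed

text \<open>Compare the kernel at points of the normal at \<open>S t\<close> on both sides of the curve with the kernel
  \<open>1 / (u - \<i>\<epsilon>)\<close> of a straight line. The index is 0 or 1 off the curve, and it changes by
  \<open>1\<close> across the curve.\<close>

lemma normal_lower_ex:
  "\<exists>c'>0. \<exists>\<epsilon>0>0. \<forall>\<epsilon> u. \<bar>\<epsilon>\<bar> \<le> \<epsilon>0 \<longrightarrow> \<bar>u\<bar> \<le> pi \<longrightarrow>
     c' * norm (Complex u (- \<epsilon>)) \<le> norm (S (t + u) - (S t + \<i> * of_real \<epsilon> * S' t))"
proof -
  define m0 where "m0 = norm (S' t)"
  have m0: "m0 > 0" using S'_nonzero by (simp add: m0_def)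
  obtain d where d: "d > 0" "w d \<le> m0 / 4" using w_small[of "m0 / 4"] m0 by auto
  \<comment> \<open>For \<open>\<bar>u\<bar> > d\<close> the chord is at least \<open>c * d\<close>,
    and \<open>\<epsilon>0\<close> limits the shift along the normal to half of that. In
    \<open>c'\<close> the first entry is what the tangent leaves after an error of
    \<open>m0 / 4\<close>; the second is \<open>c * d / 2\<close> over the bound
    \<open>pi + 1\<close> for \<open>norm (Complex u (- \<epsilon>))\<close>.\<close>
  define \<epsilon>0 where "\<epsilon>0 = min (c * d / (2 * m0)) 1"
  define c' where "c' = min (3 / 4 * m0) (c * d / (2 * (pi + 1)))"
  have pos: "\<epsilon>0 > 0" "c' > 0" using c_pos d m0 pi_gt_zero by (auto simp: \<epsilon>0_def c'_def intro!: divide_pos_pos add_pos_pos)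
  have "c' * norm (Complex u (- \<epsilon>)) \<le> norm (S (t + u) - (S t + \<i> * of_real \<epsilon> * S' t))"
    if e: "\<bar>\<epsilon>\<bar> \<le> \<epsilon>0" and u: "\<bar>u\<bar> \<le> pi" for \<epsilon> u
  proof (cases "\<bar>u\<bar> \<le> d")
    case True
    have "norm (S (t + u) - S t - u *\<^sub>R S' t) \<le> w d * \<bar>u\<bar>"
      using S_linearization[of t t d "t + u"] True d by simp
    also have "\<dots> \<le> m0 / 4 * norm (Complex u (- \<epsilon>))"
      using d m0 abs_Re_le_cmod[of "Complex u (- \<epsilon>)"] w_nonneg by (intro mult_mono) auto
    finally have e1: "norm (S (t + u) - S t - u *\<^sub>R S' t) \<le> m0 / 4 * norm (Complex u (- \<epsilon>))" .
    have eq: "Complex u (- \<epsilon>) * S' t = (S (t + u) - (S t + \<i> * of_real \<epsilon> * S' t)) - (S (t + u) - S t - u *\<^sub>R S' t)"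
      by (simp add: Complex_eq scaleR_conv_of_real algebra_simps)
    have "m0 * norm (Complex u (- \<epsilon>)) = norm (Complex u (- \<epsilon>) * S' t)" by (simp add: norm_mult m0_def)
    also have "\<dots> \<le> norm (S (t + u) - (S t + \<i> * of_real \<epsilon> * S' t)) + norm (S (t + u) - S t - u *\<^sub>R S' t)"
      unfolding eq by (rule norm_triangle_ineq4)
    finally have "3 / 4 * m0 * norm (Complex u (- \<epsilon>)) \<le> norm (S (t + u) - (S t + \<i> * of_real \<epsilon> * S' t))" using e1 by simp
    moreover have "c' * norm (Complex u (- \<epsilon>)) \<le> 3 / 4 * m0 * norm (Complex u (- \<epsilon>))"
      unfolding c'_def by (intro mult_right_mono min.cobounded1) simp
    ultimately show ?thesis by linarith
  next
    case False
    have "c * d \<le> c * \<bar>u\<bar>" using False c_pos by simp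
    also have "\<dots> \<le> norm (S (t + u) - S t)" by (rule S_lower_pi[OF u])
    also have "\<dots> \<le> norm (S (t + u) - (S t + \<i> * of_real \<epsilon> * S' t)) + norm (\<i> * of_real \<epsilon> * S' t)"
      using norm_triangle_ineq[of "S (t + u) - (S t + \<i> * of_real \<epsilon> * S' t)" "\<i> * of_real \<epsilon> * S' t"] by (simp add: algebra_simps)
    also have "norm (\<i> * of_real \<epsilon> * S' t) = \<bar>\<epsilon>\<bar> * m0" by (simp add: norm_mult m0_def)
    also have "\<bar>\<epsilon>\<bar> * m0 \<le> (c * d / (2 * m0)) * m0" using e m0 by (intro mult_right_mono) (auto simp: \<epsilon>0_def)
    also have "\<dots> = c * d / 2" using m0 by simp
    finally have 1: "c * d / 2 \<le> norm (S (t + u) - (S t + \<i> * of_real \<epsilon> * S' t))" by simp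
    have "norm (Complex u (- \<epsilon>)) \<le> \<bar>u\<bar> + \<bar>\<epsilon>\<bar>" using cmod_le[of "Complex u (- \<epsilon>)"] by simp
    also have "\<dots> \<le> pi + 1" using u e by (auto simp: \<epsilon>0_def)
    finally have "c' * norm (Complex u (- \<epsilon>)) \<le> (c * d / (2 * (pi + 1))) * (pi + 1)"
      using pos c_pos d pi_gt_zero by (intro mult_mono) (auto simp: c'_def)
    also have "\<dots> = c * d / 2"
    proof -
      have "x / (2 * y) * y = x / 2" if "y \<noteq> 0" for x y :: real using that by simp
      moreover have "pi + 1 \<noteq> 0" using pi_gt_zero by linarith
      ultimately show ?thesis by blast
    qed
    finally show ?thesis using 1 by linarith
  qed
  then show ?thesis using pos by blast
qed

lemma integral_arctan_kernel:
  assumes "\<epsilon> \<noteq> 0"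
  shows "set_integrable lborel {-pi..pi} (\<lambda>u. \<epsilon> / (u\<^sup>2 + \<epsilon>\<^sup>2))"
    and "(LINT u:{-pi..pi}|lborel. \<epsilon> / (u\<^sup>2 + \<epsilon>\<^sup>2)) = 2 * arctan (pi / \<epsilon>)"
proof -
  have p: "u\<^sup>2 + \<epsilon>\<^sup>2 \<noteq> 0" for u :: real using assms by (simp add: sum_power2_eq_zero_iff)
  show i: "set_integrable lborel {-pi..pi} (\<lambda>u. \<epsilon> / (u\<^sup>2 + \<epsilon>\<^sup>2))"
    by (rule borel_integrable_atLeastAtMost') (auto intro!: continuous_intros simp: p assms)
  have "((\<lambda>u. \<epsilon> / (u\<^sup>2 + \<epsilon>\<^sup>2)) has_integral (arctan (pi / \<epsilon>) - arctan (- pi / \<epsilon>))) {-pi..pi}"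
  proof (rule fundamental_theorem_of_calculus)
    fix u :: real
    have "((\<lambda>u. arctan (u / \<epsilon>)) has_real_derivative (\<epsilon> / (u\<^sup>2 + \<epsilon>\<^sup>2))) (at u within {-pi..pi})"
    proof (rule derivative_eq_intros refl)+
      show "inverse (1 + (u / \<epsilon>)\<^sup>2) * (1 / \<epsilon>) = \<epsilon> / (u\<^sup>2 + \<epsilon>\<^sup>2)"
        using assms p[of u] by (simp add: divide_simps power2_eq_square add.commute)
    qed (use assms in auto)
    then show "((\<lambda>u. arctan (u / \<epsilon>)) has_vector_derivative \<epsilon> / (u\<^sup>2 + \<epsilon>\<^sup>2)) (at u within {-pi..pi})"
      by (simp add: has_real_derivative_iff_has_vector_derivative)
  qed simp
  then have "integral {-pi..pi} (\<lambda>u. \<epsilon> / (u\<^sup>2 + \<epsilon>\<^sup>2)) = 2 * arctan (pi / \<epsilon>)"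
    by (simp add: integral_unique arctan_minus)
  then show "(LINT u:{-pi..pi}|lborel. \<epsilon> / (u\<^sup>2 + \<epsilon>\<^sup>2)) = 2 * arctan (pi / \<epsilon>)"
    using set_borel_integral_eq_integral(2)[OF i] by simp
qed

text \<open>Which side of the curve is inside is left open. On either side the difference between
  the kernel and that of the straight line is dominated by a multiple of
  \<open>w \<bar>u\<bar> / \<bar>u\<bar>\<close>, while the straight line contributes
  \<open>2 * arctan (pi / e n)\<close>, which tends to \<open>\<sigma> * pi\<close>.\<close>

lemma integral_Im_kC_normal:
  assumes \<sigma>: "\<sigma> = 1 \<or> \<sigma> = (-1::real)"
  shows "(LINT u:{-pi..pi}|lborel. Im (kC (S t) (t + u))) + \<sigma> * pi \<in> {0, 2 * pi}"
proof -
  obtain c' \<epsilon>0 where c': "c' > 0" and \<epsilon>0: "\<epsilon>0 > 0"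
    and low: "\<And>\<epsilon> u. \<bar>\<epsilon>\<bar> \<le> \<epsilon>0 \<Longrightarrow> \<bar>u\<bar> \<le> pi \<Longrightarrow>
     c' * norm (Complex u (- \<epsilon>)) \<le> norm (S (t + u) - (S t + \<i> * of_real \<epsilon> * S' t))"
    using normal_lower_ex[of t] by blast
  define e where "e = (\<lambda>n::nat. \<sigma> * (\<epsilon>0 / (real n + 1)))"
  define z where "z = (\<lambda>n. S t + \<i> * of_real (e n) * S' t)"
  have e_nz: "e n \<noteq> 0" and e_le: "\<bar>e n\<bar> \<le> \<epsilon>0" for n
    using \<sigma> \<epsilon>0 by (auto simp: e_def abs_mult divide_le_eq)
  have e_lim: "e \<longlonglongrightarrow> 0"
  proof -
    have "(\<lambda>n. \<sigma> * (\<epsilon>0 * inverse (real (Suc n)))) \<longlonglongrightarrow> \<sigma> * (\<epsilon>0 * 0)"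
      by (intro tendsto_intros LIMSEQ_inverse_real_of_nat)
    then show ?thesis by (simp add: e_def divide_inverse add.commute)
  qed
  have z_lim: "z \<longlonglongrightarrow> S t"
  proof -
    have "z \<longlonglongrightarrow> S t + \<i> * of_real 0 * S' t" unfolding z_def by (intro tendsto_intros e_lim)
    then show ?thesis by simp
  qed
  have nz: "Complex u (- e n) \<noteq> 0" for u n using e_nz[of n] by (simp add: complex_eq_iff)
  have off0: "S (t + u) \<noteq> z n" if "\<bar>u\<bar> \<le> pi" for u n
  proof -
    have "0 < c' * norm (Complex u (- e n))" using c' nz[of u n] by simp
    also have "\<dots> \<le> norm (S (t + u) - z n)" unfolding z_def by (rule low[OF e_le that])
    finally show ?thesis by auto
  qed
  have off: "z n \<notin> range S" for n
  proof
    assume "z n \<in> range S"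
    then obtain x where x: "z n = S x" by auto
    obtain k :: int where k: "x + of_int k * (2 * pi) \<in> {t - pi..t + pi}" "S (x + of_int k * (2 * pi)) = S x"
      using periodic_reduce[of S, OF S_periodic] .
    have "\<bar>x + of_int k * (2 * pi) - t\<bar> \<le> pi" using k(1) unfolding abs_le_iff atLeastAtMost_iff by linarith
    from off0[OF this, of n] show False using k(2) x by simp
  qed
  have ImI: "Im (I (\<lambda>_. 1) kC (z n)) \<in> {0, 2 * pi}" for n using I_kC_1[OF off[of n]] by auto
  let ?s = "\<lambda>n u. Im (kC (z n) (t + u)) - e n / (u\<^sup>2 + (e n)\<^sup>2)"
  have sint: "(LINT u:{-pi..pi}|lborel. ?s n u) = Im (I (\<lambda>_. 1) kC (z n)) - 2 * arctan (pi / e n)" for n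
  proof -
    have i1: "set_integrable lborel {-pi..pi} (\<lambda>u. kC (z n) (t + u))"
      and e1: "(LINT u:{-pi..pi}|lborel. kC (z n) (t + u)) = I (\<lambda>_. 1) kC (z n)"
      using I_eq_centered[of "\<lambda>_. 1", OF _ _ admissible_kC off[of n], of t] by auto
    have i2: "set_integrable lborel {-pi..pi} (\<lambda>u. Im (kC (z n) (t + u)))"
      using integrable_Im[OF i1[unfolded set_integrable_def]] by (simp add: set_integrable_def)
    have "(LINT u:{-pi..pi}|lborel. Im (kC (z n) (t + u))) = Im (I (\<lambda>_. 1) kC (z n))"
      unfolding e1[symmetric] set_lebesgue_integral_def
      using integral_Im[OF i1[unfolded set_integrable_def]] by simp
    then show ?thesis
      by (simp add: set_integral_diff(2)[OF i2 integral_arctan_kernel(1)[OF e_nz]] integral_arctan_kernel(2)[OF e_nz])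
  qed
  have Im_line: "Im (1 / Complex u (- \<epsilon>)) = \<epsilon> / (u\<^sup>2 + \<epsilon>\<^sup>2)" for u \<epsilon> by (simp add: Im_divide)
  have bound: "norm (?s n u) \<le> (2 / c') * (w \<bar>u\<bar> / \<bar>u\<bar>)" if u: "u \<in> {-pi..pi}" "u \<noteq> 0" for n u
  proof -
    have u': "\<bar>u\<bar> \<le> pi" using u by (auto simp: abs_le_iff)
    let ?l = "Complex u (- e n)" and ?v = "S (t + u) - z n" and ?a = "S' (t + u)"
    have v: "?v \<noteq> 0" using off0[OF u'] by simp
    have l: "?l \<noteq> 0" by (rule nz)
    have lu: "\<bar>u\<bar> \<le> norm ?l" using abs_Re_le_cmod[of ?l] by simp
    have vl: "c' * norm ?l \<le> norm ?v" unfolding z_def by (rule low[OF e_le u'])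
    have "?s n u = Im (kC (z n) (t + u) - 1 / ?l)" by (simp add: Im_line)
    then have "norm (?s n u) \<le> norm (kC (z n) (t + u) - 1 / ?l)" by (metis abs_Im_le_cmod real_norm_def)
    also have "kC (z n) (t + u) - 1 / ?l = (?a * ?l - ?v) / (?v * ?l)"
      \<comment> \<open>In the combined numerator the terms of zero order cancel: what remains is a
        difference of tangents times the line coordinate, minus a linearization error.\<close>
      unfolding kC_def using v l by (simp add: divide_simps)
    also have "?a * ?l - ?v = (?a - S' t) * ?l - (S (t + u) - S t - u *\<^sub>R S' t)"
      unfolding z_def by (simp add: Complex_eq scaleR_conv_of_real algebra_simps)
    also have "norm (\<dots> / (?v * ?l)) = norm ((?a - S' t) * ?l - (S (t + u) - S t - u *\<^sub>R S' t)) / (norm ?v * norm ?l)"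
      by (simp add: norm_divide norm_mult)
    also have "\<dots> \<le> (2 * w \<bar>u\<bar> * norm ?l) / (norm ?v * norm ?l)"
    proof (rule divide_right_mono)
      have "norm (?a - S' t) \<le> w \<bar>u\<bar>" using S'_le_w[of "t + u" t] by simp
      then have "norm ((?a - S' t) * ?l) \<le> w \<bar>u\<bar> * norm ?l" unfolding norm_mult by (rule mult_right_mono) simp
      moreover have "norm (S (t + u) - S t - u *\<^sub>R S' t) \<le> w \<bar>u\<bar> * \<bar>u\<bar>"
        using S_linearization[of t t "\<bar>u\<bar>" "t + u"] by simp
      moreover have "w \<bar>u\<bar> * \<bar>u\<bar> \<le> w \<bar>u\<bar> * norm ?l" using lu w_nonneg by (rule mult_left_mono)
      ultimately show "norm ((?a - S' t) * ?l - (S (t + u) - S t - u *\<^sub>R S' t)) \<le> 2 * w \<bar>u\<bar> * norm ?l"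
        using norm_triangle_ineq4[of "(?a - S' t) * ?l" "S (t + u) - S t - u *\<^sub>R S' t"] by linarith
    qed simp
    also have "\<dots> = 2 * w \<bar>u\<bar> / norm ?v" using l by simp
    also have "\<dots> \<le> 2 * w \<bar>u\<bar> / (c' * \<bar>u\<bar>)"
    proof (rule divide_left_mono)
      show "c' * \<bar>u\<bar> \<le> norm ?v" using vl lu c' by (meson mult_left_mono less_imp_le order_trans)
      show "0 < norm ?v * (c' * \<bar>u\<bar>)" using v c' u by simp
    qed (use w_nonneg in simp)
    also have "\<dots> = (2 / c') * (w \<bar>u\<bar> / \<bar>u\<bar>)" by simp
    finally show ?thesis .
  qed
  have [measurable]: "kC z \<in> borel_measurable borel" for z using admissible_kC by (simp add: admissible_def)
  have lim: "(\<lambda>n. LINT u:{-pi..pi}|lborel. ?s n u) \<longlonglongrightarrow> (LINT u:{-pi..pi}|lborel. Im (kC (S t) (t + u)))"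
    unfolding set_lebesgue_integral_def
  proof (rule integral_dominated_convergence)
    show "integrable lborel (\<lambda>u. indicat_real {-pi..pi} u *\<^sub>R ((2 / c') * (w \<bar>u\<bar> / \<bar>u\<bar>)))"
      unfolding set_integrable_def[symmetric] by (intro set_integrable_mult_right w_integrable)
    show "AE u in lborel. norm (indicat_real {-pi..pi} u *\<^sub>R ?s n u) \<le> indicat_real {-pi..pi} u *\<^sub>R ((2 / c') * (w \<bar>u\<bar> / \<bar>u\<bar>))" for n
    proof (rule AE_mp[OF AE_lborel_singleton[of 0]], intro AE_I2 impI)
      fix u :: real assume "u \<noteq> 0"
      then show "norm (indicat_real {-pi..pi} u *\<^sub>R ?s n u) \<le> indicat_real {-pi..pi} u *\<^sub>R ((2 / c') * (w \<bar>u\<bar> / \<bar>u\<bar>))"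
        using bound[of u n] by (cases "u \<in> {-pi..pi}") simp_all
    qed
    show "AE u in lborel. (\<lambda>n. indicat_real {-pi..pi} u *\<^sub>R ?s n u) \<longlonglongrightarrow> indicat_real {-pi..pi} u *\<^sub>R Im (kC (S t) (t + u))"
    proof (rule AE_mp[OF AE_lborel_singleton[of 0]], intro AE_I2 impI)
      fix u :: real assume u: "u \<noteq> 0"
      show "(\<lambda>n. indicat_real {-pi..pi} u *\<^sub>R ?s n u) \<longlonglongrightarrow> indicat_real {-pi..pi} u *\<^sub>R Im (kC (S t) (t + u))"
      proof (cases "u \<in> {-pi..pi}")
        case True
        then have "S (t + u) \<noteq> S t" using S_eq_iff_centered[of u t] u by (auto simp: abs_le_iff)
        then have "(\<lambda>n. kC (z n) (t + u)) \<longlonglongrightarrow> kC (S t) (t + u)"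
          unfolding kC_def by (intro tendsto_intros z_lim) simp
        then have "(\<lambda>n. ?s n u) \<longlonglongrightarrow> Im (kC (S t) (t + u)) - 0 / (u\<^sup>2 + 0\<^sup>2)"
          by (intro tendsto_intros e_lim) (use u in auto)
        then show ?thesis using True by simp
      qed simp
    qed
  qed measurable
  have at: "(\<lambda>n. 2 * arctan (pi / e n)) \<longlonglongrightarrow> \<sigma> * pi"
  proof -
    have "filterlim (\<lambda>n. (pi / \<epsilon>0) * (real n + 1)) at_top sequentially"
      by (intro filterlim_tendsto_pos_mult_at_top[OF tendsto_const])
         (use \<epsilon>0 pi_gt_zero in \<open>auto intro!: filterlim_tendsto_add_at_top[OF tendsto_const] filterlim_real_sequentially simp: add.commute\<close>)
    then have "(\<lambda>n. arctan ((pi / \<epsilon>0) * (real n + 1))) \<longlonglongrightarrow> pi / 2"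
      by (rule filterlim_compose[OF tendsto_arctan_at_top])
    then have "(\<lambda>n. 2 * \<sigma> * arctan ((pi / \<epsilon>0) * (real n + 1))) \<longlonglongrightarrow> 2 * \<sigma> * (pi / 2)"
      by (intro tendsto_intros)
    moreover have "2 * arctan (pi / e n) = 2 * \<sigma> * arctan ((pi / \<epsilon>0) * (real n + 1))" for n
      using \<sigma> by (auto simp: e_def arctan_minus)
    ultimately show ?thesis by (simp add: mult.assoc)
  qed
  have "(\<lambda>n. (LINT u:{-pi..pi}|lborel. ?s n u) + 2 * arctan (pi / e n))
     \<longlonglongrightarrow> (LINT u:{-pi..pi}|lborel. Im (kC (S t) (t + u))) + \<sigma> * pi"
    by (intro tendsto_add lim at)
  then have "(\<lambda>n. Im (I (\<lambda>_. 1) kC (z n))) \<longlonglongrightarrow> (LINT u:{-pi..pi}|lborel. Im (kC (S t) (t + u))) + \<sigma> * pi"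
    by (simp add: sint)
  \<comment> \<open>All approximating values lie in the closed set \<open>{0, 2 * pi}\<close>, and
    so does the limit.\<close>
  then show ?thesis
    by (rule Lim_in_closed_set[rotated 3]) (use ImI in \<open>auto intro!: always_eventually\<close>)
qed

text \<open>One normal direction leaves the values \<open>- pi\<close> and \<open>pi\<close>, the
  other one \<open>pi\<close> and \<open>3 * pi\<close>.\<close>

lemma integral_Im_kC_singular: "(LINT u:{-pi..pi}|lborel. Im (kC (S t) (t + u))) = pi"
  using integral_Im_kC_normal[of 1 t] integral_Im_kC_normal[of "-1" t] pi_gt_zero by auto

end

subsection \<open>The biharmonic algebra and monogenic functions\<close>

lemma zet_eq: "zet z = (of_real (Re z), of_real (Im z))"
  by (simp add: zet_def e1_def e2_def scaleR_conv_of_real)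

lemma linear_zet: "linear zet"
  by (rule linearI) (auto simp: zet_def scaleR_add_left scaleR_diff_left algebra_simps)

lemma zet_add: "zet (a + b) = zet a + zet b" and zet_diff: "zet (a - b) = zet a - zet b" and zet_0 [simp]: "zet 0 = 0"
  by (simp_all add: linear_add[OF linear_zet] linear_diff[OF linear_zet] linear_0[OF linear_zet])

lemma norm_zet [simp]: "norm (zet z) = norm z"
  by (simp add: zet_eq norm_biharm cmod_def)

lemma dist_zet [simp]: "dist (zet a) (zet b) = dist a b"
  by (simp add: dist_norm zet_diff[symmetric])

lemma zet_inject [simp]: "zet a = zet b \<longleftrightarrow> a = b"
  by (auto simp: zet_eq complex_eq_iff)

lemma inj_zet: "inj zet" by (simp add: inj_def)

lemma mu_eq: "mu = range zet"
proof -
  have "x *\<^sub>R e1 + y *\<^sub>R e2 \<in> range zet" for x y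
    using rangeI[of zet "Complex x y"] by (simp add: zet_def)
  moreover have "zet z \<in> mu" for z unfolding mu_def zet_def by blast
  ultimately show ?thesis unfolding mu_def by blast
qed

lemma continuous_on_zet: "continuous_on S zet"
  using linear_zet by (rule linear_continuous_on[OF linear_conv_bounded_linear[THEN iffD1]])

lemma closure_D_zeta: "closure (D_zeta D) = zet ` closure D"
  unfolding D_zeta_def using closure_injective_linear_image[OF linear_zet inj_zet] by metis

lemma bd_zeta_eq: "bd_zeta D = zet ` frontier D"
proof -
  have cl: "(top_of_set mu) closure_of (zet ` A) = zet ` closure A" for A
  proof -
    have "(top_of_set mu) closure_of (zet ` A) = mu \<inter> closure (mu \<inter> zet ` A)"
      by (simp add: closure_of_subtopology)
    also have "mu \<inter> zet ` A = zet ` A" by (auto simp: mu_eq)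
    also have "closure (zet ` A) = zet ` closure A" using closure_D_zeta by (simp add: D_zeta_def)
    also have "mu \<inter> zet ` closure A = zet ` closure A" by (auto simp: mu_eq)
    finally show ?thesis .
  qed
  have compl: "topspace (top_of_set mu) - zet ` D = zet ` (- D)" by (auto simp: mu_eq)
  have "zet ` closure D \<inter> zet ` closure (- D) = zet ` (closure D \<inter> closure (- D))"
    using inj_zet by (simp add: image_Int)
  then show ?thesis unfolding bd_zeta_def D_zeta_def frontier_of_closures compl cl by (simp add: frontier_closures)
qed

text \<open>One has \<open>zet w = w e1 + Im w (e2 - \<i> e1)\<close>, and
  \<open>e2 - \<i> e1\<close> squares to 0, so the geometric series for the inverse stops after its
  second term.\<close>

definition pinv :: "complex \<Rightarrow> biharm" where
  "pinv w = (1 / w + \<i> * of_real (Im w) / w\<^sup>2, - of_real (Im w) / w\<^sup>2)"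

text \<open>The algebra is local: \<open>e1 + \<i> e2\<close> is nilpotent, and \<open>hom\<close> is the character that annihilates it.\<close>

definition hom :: "biharm \<Rightarrow> complex" where
  "hom a = fst a + \<i> * snd a"

lemma hom_bmult: "hom (a \<odot> b) = hom a * hom b"
  by (simp add: hom_def bmult_def algebra_simps)

lemma hom_diff: "hom (a - b) = hom a - hom b" and hom_zet [simp]: "hom (zet z) = z"
  by (auto simp: hom_def zet_eq algebra_simps complex_eq_iff)

lemma hom_pinv [simp]: "hom (pinv w) = 1 / w"
  by (simp add: hom_def pinv_def)

text \<open>The kernel of \<open>hom\<close> is spanned by the nilpotent
  \<open>e2 - \<i> e1\<close>, on which multiplication by \<open>b\<close> acts as the scalar
  \<open>hom b\<close>.\<close>

lemma snd_bmult_if_hom_eq_0: "hom a = 0 \<Longrightarrow> snd (a \<odot> b) = snd a * hom b"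
proof -
  assume "hom a = 0"
  then have "fst a = - \<i> * snd a" by (simp add: hom_def eq_neg_iff_add_eq_0)
  then show ?thesis by (simp add: bmult_def hom_def algebra_simps)
qed

lemma zet_bmult_pinv: "w \<noteq> 0 \<Longrightarrow> zet w \<odot> pinv w = e1"
proof -
  assume w: "w \<noteq> 0"
  define y where "y = (of_real (Im w) :: complex)"
  have z: "zet w = (w - \<i> * y, y)" by (simp add: zet_eq y_def complex_eq_iff)
  show ?thesis
    unfolding z pinv_def y_def[symmetric] bmult_def e1_def using w
    by (auto simp: field_simps power2_eq_square)
qed

lemma binv_zet: "w \<noteq> 0 \<Longrightarrow> binv (zet w) = pinv w"
proof -
  assume w: "w \<noteq> 0"
  have "zet w \<odot> binv (zet w) = e1"
    by (rule bmult_binv) (use w in \<open>auto simp: mu_eq zet_inject[of _ 0, simplified]\<close>)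
  then have "pinv w \<odot> (zet w \<odot> binv (zet w)) = pinv w" by (metis bmult_commute e1_bmult)
  then show ?thesis by (metis bmult_assoc bmult_commute e1_bmult zet_bmult_pinv[OF w])
qed

lemma bmult_diff_left: "(a - b) \<odot> c = a \<odot> c - b \<odot> c"
  by (simp add: bmult_def algebra_simps)

lemma bounded_linear_bmult_right: "bounded_linear (\<lambda>a. a \<odot> b)"
proof -
  have "linear (\<lambda>a. a \<odot> b)"
    by (rule linearI) (auto simp: bmult_def algebra_simps scaleR_conv_of_real)
  then show ?thesis by (simp add: linear_conv_bounded_linear)
qed

lemma bounded_linear_cscale: "bounded_linear (cscale k)"
proof -
  have "linear (cscale k)"
    by (rule linearI) (auto simp: cscale_def algebra_simps scaleR_conv_of_real)
  then show ?thesis by (simp add: linear_conv_bounded_linear)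
qed

lemma continuous_on_bmult [continuous_intros]:
  "continuous_on S f \<Longrightarrow> continuous_on S g \<Longrightarrow> continuous_on S (\<lambda>x. f x \<odot> g x)"
  unfolding bmult_def by (intro continuous_intros)

lemma continuous_on_pinv:
  assumes "continuous_on S f" "\<And>x. x \<in> S \<Longrightarrow> f x \<noteq> 0"
  shows "continuous_on S (\<lambda>x. pinv (f x))"
  unfolding pinv_def by (intro continuous_intros assms) (use assms(2) in auto)

lemma tendsto_zet_iff:
  "((\<lambda>h. F h) \<longlongrightarrow> L) (at 0 within mu) \<longleftrightarrow> ((\<lambda>h. F (zet h)) \<longlongrightarrow> L) (at 0)"
proof -
  have "(\<forall>\<^sub>F h in at 0 within mu. P h) \<longleftrightarrow> (\<forall>\<^sub>F h in at 0. P (zet h))" for P :: "biharm \<Rightarrow> bool"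
    unfolding eventually_at mu_eq by (auto simp: dist_norm zet_inject[of _ 0, simplified])
  then show ?thesis unfolding tendsto_def by simp
qed

lemma monogenic_on_zet_iff:
  "monogenic_on (zet ` \<Omega>) \<Phi> \<longleftrightarrow>
    (\<forall>z\<in>\<Omega>. \<exists>L. ((\<lambda>h. (\<Phi> (zet (z + h)) - \<Phi> (zet z)) \<odot> pinv h) \<longlongrightarrow> L) (at 0))"
proof -
  have "((\<lambda>h. (\<Phi> (zet z + h) - \<Phi> (zet z)) \<odot> binv h) \<longlongrightarrow> L) (at 0 within mu) \<longleftrightarrow>
     ((\<lambda>h. (\<Phi> (zet (z + h)) - \<Phi> (zet z)) \<odot> pinv h) \<longlongrightarrow> L) (at 0)" for z L
    unfolding tendsto_zet_iff
    by (rule filterlim_cong[OF refl refl]) (auto simp: eventually_at_filter zet_add binv_zet)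
  then show ?thesis unfolding monogenic_on_def by simp
qed

lemma monogenic_on_diff:
  assumes "monogenic_on (zet ` \<Omega>) \<Phi>" "monogenic_on (zet ` \<Omega>) \<Psi>"
  shows "monogenic_on (zet ` \<Omega>) (\<lambda>\<zeta>. \<Phi> \<zeta> - \<Psi> \<zeta>)"
  unfolding monogenic_on_zet_iff
proof
  fix z assume "z \<in> \<Omega>"
  then obtain L1 where L1: "((\<lambda>h. (\<Phi> (zet (z + h)) - \<Phi> (zet z)) \<odot> pinv h) \<longlongrightarrow> L1) (at 0)"
    using assms(1) unfolding monogenic_on_zet_iff by blast
  obtain L2 where L2: "((\<lambda>h. (\<Psi> (zet (z + h)) - \<Psi> (zet z)) \<odot> pinv h) \<longlongrightarrow> L2) (at 0)"
    using assms(2) \<open>z \<in> \<Omega>\<close> unfolding monogenic_on_zet_iff by blast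
  have "((\<lambda>h. ((\<Phi> (zet (z + h)) - \<Psi> (zet (z + h))) - (\<Phi> (zet z) - \<Psi> (zet z))) \<odot> pinv h) \<longlongrightarrow> L1 - L2) (at 0)"
  proof -
    have "(a - b) \<odot> q - (a' - b') \<odot> q = ((a - a') - (b - b')) \<odot> q" for a b a' b' q :: biharm
      by (simp add: bmult_def algebra_simps)
    then show ?thesis using tendsto_diff[OF L1 L2] by simp
  qed
  then show "\<exists>L. ((\<lambda>h. ((\<Phi> (zet (z + h)) - \<Psi> (zet (z + h))) - (\<Phi> (zet z) - \<Psi> (zet z))) \<odot> pinv h) \<longlongrightarrow> L) (at 0)" by blast
qed

lemma monogenic_on_cong:
  assumes "open \<Omega>" and eq: "\<And>z. z \<in> \<Omega> \<Longrightarrow> \<Phi> (zet z) = \<Psi> (zet z)" and mono: "monogenic_on (zet ` \<Omega>) \<Phi>"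
  shows "monogenic_on (zet ` \<Omega>) \<Psi>"
  unfolding monogenic_on_zet_iff
proof
  fix z assume z: "z \<in> \<Omega>"
  then obtain L where L: "((\<lambda>h. (\<Phi> (zet (z + h)) - \<Phi> (zet z)) \<odot> pinv h) \<longlongrightarrow> L) (at 0)"
    using mono unfolding monogenic_on_zet_iff by blast
  obtain r where r: "r > 0" "ball z r \<subseteq> \<Omega>" using assms(1) z open_contains_ball by blast
  have "((\<lambda>h. (\<Psi> (zet (z + h)) - \<Psi> (zet z)) \<odot> pinv h) \<longlongrightarrow> L) (at 0)"
  proof (rule Lim_transform_within[OF L r(1)])
    fix h :: complex assume "0 < dist h 0" "dist h 0 < r"
    then have "z + h \<in> \<Omega>" using r by (auto simp: dist_norm)
    then show "(\<Phi> (zet (z + h)) - \<Phi> (zet z)) \<odot> pinv h = (\<Psi> (zet (z + h)) - \<Psi> (zet z)) \<odot> pinv h"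
      by (simp add: eq z)
  qed
  then show "\<exists>L. ((\<lambda>h. (\<Psi> (zet (z + h)) - \<Psi> (zet z)) \<odot> pinv h) \<longlongrightarrow> L) (at 0)" by blast
qed

lemma tendsto_hom: "(f \<longlongrightarrow> a) F \<Longrightarrow> ((\<lambda>x. hom (f x)) \<longlongrightarrow> hom a) F"
  unfolding hom_def by (intro tendsto_intros)

text \<open>\<open>hom\<close> is multiplicative and sends \<open>zet h\<close> to \<open>h\<close>,
  so it turns the quotient in the algebra into an ordinary complex difference quotient.\<close>

lemma holomorphic_hom_if_monogenic:
  assumes "monogenic_on (zet ` \<Omega>) \<Phi>"
  shows "(\<lambda>z. hom (\<Phi> (zet z))) holomorphic_on \<Omega>"
proof (unfold holomorphic_on_def, rule ballI)
  fix z assume "z \<in> \<Omega>"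
  then obtain L where "((\<lambda>h. (\<Phi> (zet (z + h)) - \<Phi> (zet z)) \<odot> pinv h) \<longlongrightarrow> L) (at 0)"
    using assms unfolding monogenic_on_zet_iff by blast
  from tendsto_hom[OF this]
  have "((\<lambda>h. (hom (\<Phi> (zet (z + h))) - hom (\<Phi> (zet z))) / h) \<longlongrightarrow> hom L) (at 0)"
    by (simp add: hom_bmult hom_diff)
  then have "((\<lambda>z. hom (\<Phi> (zet z))) has_field_derivative hom L) (at z)" by (simp add: DERIV_def)
  then show "(\<lambda>z. hom (\<Phi> (zet z))) field_differentiable at z within \<Omega>"
    using field_differentiable_at_within field_differentiable_def by blast
qed

text \<open>Once the image under \<open>hom\<close> is 0, all increments of the function are
  multiples of the nilpotent element, and division by \<open>zet h\<close> acts on their coefficient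
  as division by \<open>h\<close>.\<close>

lemma holomorphic_snd_if_monogenic:
  assumes "open \<Omega>" "monogenic_on (zet ` \<Omega>) \<Phi>" and hom0: "\<And>z. z \<in> \<Omega> \<Longrightarrow> hom (\<Phi> (zet z)) = 0"
  shows "(\<lambda>z. snd (\<Phi> (zet z))) holomorphic_on \<Omega>"
proof (unfold holomorphic_on_def, rule ballI)
  fix z assume z: "z \<in> \<Omega>"
  then obtain L where "((\<lambda>h. (\<Phi> (zet (z + h)) - \<Phi> (zet z)) \<odot> pinv h) \<longlongrightarrow> L) (at 0)"
    using assms unfolding monogenic_on_zet_iff by blast
  from tendsto_snd[OF this]
  have lim: "((\<lambda>h. snd ((\<Phi> (zet (z + h)) - \<Phi> (zet z)) \<odot> pinv h)) \<longlongrightarrow> snd L) (at 0)" .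
  obtain r where r: "r > 0" "ball z r \<subseteq> \<Omega>" using assms(1) z open_contains_ball by blast
  have "((\<lambda>h. (snd (\<Phi> (zet (z + h))) - snd (\<Phi> (zet z))) / h) \<longlongrightarrow> snd L) (at 0)"
  proof (rule Lim_transform_within[OF lim r(1)])
    fix h :: complex assume h: "0 < dist h 0" "dist h 0 < r"
    then have "z + h \<in> \<Omega>" using r by (auto simp: dist_norm)
    then have "hom (\<Phi> (zet (z + h)) - \<Phi> (zet z)) = 0" by (simp add: hom_diff hom0 z)
    then show "snd ((\<Phi> (zet (z + h)) - \<Phi> (zet z)) \<odot> pinv h) = (snd (\<Phi> (zet (z + h))) - snd (\<Phi> (zet z))) / h"
      by (simp add: snd_bmult_if_hom_eq_0)
  qed
  then have "((\<lambda>z. snd (\<Phi> (zet z))) has_field_derivative snd L) (at z)" by (simp add: DERIV_def)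
  then show "(\<lambda>z. snd (\<Phi> (zet z))) field_differentiable at z within \<Omega>"
    using field_differentiable_at_within field_differentiable_def by blast
qed

lemma eq_0_if_monogenic_off_curve:
  assumes cont: "continuous_on UNIV (\<lambda>z. \<Phi> (zet z))" and mono: "monogenic_on (zet ` (- K)) \<Phi>"
    and K: "K = S ` {0..R}" "0 \<le> (R::real)" "L-lipschitz_on {0..R} S"
    and lim: "((\<lambda>z. \<Phi> (zet z)) \<longlongrightarrow> 0) at_infinity"
  shows "\<Phi> (zet z) = 0"
proof -
  have "compact K" unfolding K(1)
    by (intro compact_continuous_image lipschitz_on_continuous_on[OF K(3)]) auto
  then have op: "open (- K)" by (simp add: compact_imp_closed open_Compl)
  have h0: "hom (\<Phi> (zet z)) = 0" for z
  proof (rule eq_0_if_holomorphic_off_curve[where G = "\<lambda>z. hom (\<Phi> (zet z))", OF _ _ K])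
    show "continuous_on UNIV (\<lambda>z. hom (\<Phi> (zet z)))" unfolding hom_def by (intro continuous_intros cont)
    show "((\<lambda>z. hom (\<Phi> (zet z))) \<longlongrightarrow> 0) at_infinity" using tendsto_hom[OF lim] by (simp add: hom_def)
  qed (rule holomorphic_hom_if_monogenic[OF mono])
  have s0: "snd (\<Phi> (zet z)) = 0" for z
  proof (rule eq_0_if_holomorphic_off_curve[where G = "\<lambda>z. snd (\<Phi> (zet z))", OF _ _ K])
    show "continuous_on UNIV (\<lambda>z. snd (\<Phi> (zet z)))" by (intro continuous_intros cont)
    show "((\<lambda>z. snd (\<Phi> (zet z))) \<longlongrightarrow> 0) at_infinity" using tendsto_snd[OF lim] by simp
  qed (rule holomorphic_snd_if_monogenic[OF op mono h0])
  from h0[of z] s0[of z] show ?thesis by (simp add: hom_def prod_eq_iff)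
qed

subsection \<open>The Cauchy type integral\<close>

lemma bmult_left_commute: "a \<odot> (b \<odot> c) = b \<odot> (a \<odot> c)"
  by (metis bmult_assoc bmult_commute)

context dini_curve
begin

definition \<Psi> :: "(real \<Rightarrow> real) \<Rightarrow> (real \<Rightarrow> real) \<Rightarrow> complex \<Rightarrow> biharm" where
  "\<Psi> \<phi>1 \<phi>3 z = cscale (1 / (2 * of_real pi * \<i>))
     (integral {0..2 * pi} (\<lambda>x. (of_real (\<phi>1 x), of_real (\<phi>3 x)) \<odot> pinv (S x - z) \<odot> zet (S' x)))"

text \<open>The image of the density under the character \<open>hom\<close>; multiplying the density
  by the nilpotent \<open>e2 - \<i> e1\<close> retains only this combination.\<close>

definition dens :: "(real \<Rightarrow> real) \<Rightarrow> (real \<Rightarrow> real) \<Rightarrow> real \<Rightarrow> complex" where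
  "dens \<phi>1 \<phi>3 x = of_real (\<phi>1 x) + \<i> * of_real (\<phi>3 x)"

text \<open>The exterior formula for \<open>\<Psi>\<close> with \<open>P\<close> in place of
  \<open>I\<close>, so that it has values on the curve as well and is continuous there;
  \<open>\<Psi>in\<close> adds the jump, read off at a nearest boundary point.\<close>

definition \<Psi>out :: "(real \<Rightarrow> real) \<Rightarrow> (real \<Rightarrow> real) \<Rightarrow> complex \<Rightarrow> biharm" where
  "\<Psi>out \<phi>1 \<phi>3 z = cscale (1 / (2 * of_real pi * \<i>))
     (P (\<lambda>x. of_real (\<phi>1 x)) kC z - \<i> * P (dens \<phi>1 \<phi>3) kE z,
      P (\<lambda>x. of_real (\<phi>3 x)) kC z + P (dens \<phi>1 \<phi>3) kE z)"

definition \<Psi>in :: "(real \<Rightarrow> real) \<Rightarrow> (real \<Rightarrow> real) \<Rightarrow> complex \<Rightarrow> biharm" where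
  "\<Psi>in \<phi>1 \<phi>3 z = (of_real (\<phi>1 (near z)), of_real (\<phi>3 (near z))) + \<Psi>out \<phi>1 \<phi>3 z"

text \<open>The left-hand sides of the integral system in the angular variable.\<close>

definition L1 :: "(real \<Rightarrow> real) \<Rightarrow> (real \<Rightarrow> real) \<Rightarrow> real \<Rightarrow> real" where
  "L1 \<phi>1 \<phi>3 t = \<phi>1 t / 2 + 1 / (2 * pi) *
     (Re (T (\<lambda>x. of_real (\<phi>1 x)) (\<lambda>z. of_real (- 1 / (norm z)\<^sup>2)) t)
      - Re (T (\<lambda>x. of_real (\<phi>1 x)) (\<lambda>z. - 1 / z\<^sup>2) t) + Im (T (\<lambda>x. of_real (\<phi>3 x)) (\<lambda>z. - 1 / z\<^sup>2) t))"

definition L3 :: "(real \<Rightarrow> real) \<Rightarrow> (real \<Rightarrow> real) \<Rightarrow> real \<Rightarrow> real" where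
  "L3 \<phi>1 \<phi>3 t = \<phi>3 t / 2 + 1 / (2 * pi) *
     (Im (T (\<lambda>x. of_real (\<phi>1 x)) (\<lambda>z. - 1 / z\<^sup>2) t)
      + Re (T (\<lambda>x. of_real (\<phi>3 x)) (\<lambda>z. of_real (- 1 / (norm z)\<^sup>2)) t) + Re (T (\<lambda>x. of_real (\<phi>3 x)) (\<lambda>z. - 1 / z\<^sup>2) t))"

text \<open>Expanding \<open>pinv (S x - z)\<close> and \<open>zet (S' x)\<close> along
  \<open>e1\<close> and the nilpotent \<open>e2 - \<i> e1\<close>, the coefficients of the product
  are \<open>kC z x\<close> and \<open>kE z x\<close>. Multiplication of the nilpotent by
  \<open>(a, b)\<close> is multiplication by \<open>a + \<i> * b\<close>.\<close>

lemma cauchy_integrand_eq: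
  assumes "S x \<noteq> z"
  shows "(a, b) \<odot> pinv (S x - z) \<odot> zet (S' x)
    = (a * kC z x - \<i> * ((a + \<i> * b) * kE z x), b * kC z x + (a + \<i> * b) * kE z x)"
proof -
  have gen: "(a, b) \<odot> (1 / v + \<i> * y / v\<^sup>2, - y / v\<^sup>2) \<odot> (s - \<i> * q, q)
     = (a * (s / v) - \<i> * ((a + \<i> * b) * ((q * v - y * s) / v\<^sup>2)), b * (s / v) + (a + \<i> * b) * ((q * v - y * s) / v\<^sup>2))"
    if "v \<noteq> 0" for v y s q :: complex
    using that unfolding bmult_def by (simp add: field_simps power2_eq_square)
  have z: "zet w = (w - \<i> * of_real (Im w), of_real (Im w))" for w by (simp add: zet_eq complex_eq_iff)
  show ?thesis unfolding pinv_def z kC_def kE_def by (rule gen) (use assms in simp)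
qed

context
  fixes \<phi>1 \<phi>3 :: "real \<Rightarrow> real"
  assumes per: "\<And>x. \<phi>1 (x + 2 * pi) = \<phi>1 x" "\<And>x. \<phi>3 (x + 2 * pi) = \<phi>3 x"
    and cont: "continuous_on UNIV \<phi>1" "continuous_on UNIV \<phi>3"
begin

lemma dens_periodic: "dens \<phi>1 \<phi>3 (x + 2 * pi) = dens \<phi>1 \<phi>3 x"
  by (simp add: dens_def per)

lemma dens_continuous: "continuous_on UNIV (dens \<phi>1 \<phi>3)"
  unfolding dens_def by (intro continuous_intros cont)

lemma continuous_cauchy_integrand:
  assumes "z \<notin> range S"
  shows "continuous_on UNIV (\<lambda>x. (of_real (\<phi>1 x), of_real (\<phi>3 x)) \<odot> pinv (S x - z) \<odot> zet (S' x))"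
proof -
  have "continuous_on UNIV (\<lambda>x. zet (S' x))"
    by (rule continuous_on_compose2[OF continuous_on_zet S'_continuous]) auto
  then show ?thesis
    by (intro continuous_intros continuous_on_pinv cont S_continuous) (use assms in auto)
qed

lemma \<Psi>_eq_I:
  assumes z: "z \<notin> range S"
  shows "\<Psi> \<phi>1 \<phi>3 z = cscale (1 / (2 * of_real pi * \<i>))
     (I (\<lambda>x. of_real (\<phi>1 x)) kC z - \<i> * I (dens \<phi>1 \<phi>3) kE z,
      I (\<lambda>x. of_real (\<phi>3 x)) kC z + I (dens \<phi>1 \<phi>3) kE z)"
proof -
  let ?F = "\<lambda>x. (of_real (\<phi>1 x), of_real (\<phi>3 x)) \<odot> pinv (S x - z) \<odot> zet (S' x)"
  have "continuous_on {0..2 * pi} ?F"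
    by (rule continuous_on_subset[OF continuous_cauchy_integrand[OF z]]) simp
  then have int: "?F integrable_on {0..2 * pi}" by (rule integrable_continuous_real)
  have F: "?F x = (of_real (\<phi>1 x) * kC z x - \<i> * (dens \<phi>1 \<phi>3 x * kE z x), of_real (\<phi>3 x) * kC z x + dens \<phi>1 \<phi>3 x * kE z x)" for x
  proof -
    have "S x \<noteq> z" using z by blast
    from cauchy_integrand_eq[OF this] show ?thesis unfolding dens_def by blast
  qed
  have i: "(\<lambda>x. f x * k z x) integrable_on {0..2 * pi}" if "continuous_on UNIV f" "admissible k" for f k
    by (intro integrable_continuous_real continuous_intros continuous_on_subset[OF that(1)]
        continuous_on_subset[OF continuous_kernel[OF that(2) z]] subset_UNIV)
  have c1: "continuous_on UNIV (\<lambda>x. of_real (\<phi>1 x) :: complex)" and c3: "continuous_on UNIV (\<lambda>x. of_real (\<phi>3 x) :: complex)"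
    by (intro continuous_intros cont)+
  have "fst (integral {0..2 * pi} ?F) = integral {0..2 * pi} (fst \<circ> ?F)"
    by (rule integral_linear[OF int bounded_linear_fst, symmetric])
  also have "\<dots> = integral {0..2 * pi} (\<lambda>x. of_real (\<phi>1 x) * kC z x - \<i> * (dens \<phi>1 \<phi>3 x * kE z x))"
    unfolding o_def F by simp
  also have "\<dots> = I (\<lambda>x. of_real (\<phi>1 x)) kC z - \<i> * I (dens \<phi>1 \<phi>3) kE z"
    unfolding I_def
    by (subst Henstock_Kurzweil_Integration.integral_diff) (auto intro!: i c1 dens_continuous admissible_kC admissible_kE integrable_on_mult_right)
  finally have 1: "fst (integral {0..2 * pi} ?F) = I (\<lambda>x. of_real (\<phi>1 x)) kC z - \<i> * I (dens \<phi>1 \<phi>3) kE z" .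
  have "snd (integral {0..2 * pi} ?F) = integral {0..2 * pi} (snd \<circ> ?F)"
    by (rule integral_linear[OF int bounded_linear_snd, symmetric])
  also have "\<dots> = integral {0..2 * pi} (\<lambda>x. of_real (\<phi>3 x) * kC z x + dens \<phi>1 \<phi>3 x * kE z x)"
    unfolding o_def F by simp
  also have "\<dots> = I (\<lambda>x. of_real (\<phi>3 x)) kC z + I (dens \<phi>1 \<phi>3) kE z"
    unfolding I_def
    by (subst Henstock_Kurzweil_Integration.integral_add) (auto intro!: i c3 dens_continuous admissible_kC admissible_kE)
  finally have 2: "snd (integral {0..2 * pi} ?F) = I (\<lambda>x. of_real (\<phi>3 x)) kC z + I (dens \<phi>1 \<phi>3) kE z" .
  show ?thesis unfolding \<Psi>_def by (rule arg_cong[where f = "cscale _"]) (simp add: prod_eq_iff 1 2)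
qed

text \<open>The difference quotient of the kernel is itself a product of kernels, by the resolvent identity.\<close>

lemma \<Psi>_monogenic: "monogenic_on (zet ` (- range S)) (\<lambda>\<zeta>. \<Psi> \<phi>1 \<phi>3 (inv zet \<zeta>))"
  unfolding monogenic_on_zet_iff inv_f_f[OF inj_zet]
proof
  fix z assume z: "z \<in> - range S"
  have op: "open (- range S)" by (simp add: compact_imp_closed compact_range_S open_Compl)
  obtain r where r: "r > 0" "ball z r \<subseteq> - range S" using op z open_contains_ball by blast
  let ?p = "\<lambda>x. (of_real (\<phi>1 x), of_real (\<phi>3 x)) :: biharm"
  \<comment> \<open>The integrand of the difference quotient after division by \<open>h\<close>; it
    is jointly continuous up to \<open>h = 0\<close>, where its integral is the derivative.\<close>
  define Q where "Q = (\<lambda>h x. ?p x \<odot> pinv (S x - z - h) \<odot> pinv (S x - z) \<odot> zet (S' x))"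
  have nz: "S x - z - h \<noteq> 0" if "h \<in> ball 0 r" for x h
  proof -
    have "z + h \<in> ball z r" using that by (simp add: dist_norm)
    then have "z + h \<noteq> S x" using r by blast
    then show ?thesis by (metis add_diff_cancel_left' diff_diff_eq eq_iff_diff_eq_0)
  qed
  have nz0: "S x - z \<noteq> 0" for x using nz[of 0 x] r by simp
  have cQ: "continuous_on (ball 0 r \<times> cbox 0 (2 * pi)) (\<lambda>(h, x). Q h x)"
    unfolding Q_def case_prod_beta'
    by (intro continuous_intros continuous_on_pinv continuous_on_compose2[OF continuous_on_zet]
        continuous_on_compose2[OF S_continuous] continuous_on_compose2[OF S'_continuous]
        continuous_on_compose2[OF cont(1)] continuous_on_compose2[OF cont(2)]) (use nz nz0 in auto)
  define J where "J = (\<lambda>h. cscale (1 / (2 * of_real pi * \<i>)) (integral {0..2 * pi} (Q h)))"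
  have "continuous_on (ball 0 r) (\<lambda>h. integral (cbox 0 (2 * pi)) (Q h))"
    by (rule integral_continuous_on_param[OF cQ])
  then have "continuous_on (ball 0 r) J"
    unfolding J_def cbox_interval
    by (rule bounded_linear.continuous_on[OF bounded_linear_cscale])
  then have "isCont J 0" by (rule continuous_on_interior) (use r in simp)
  then have lim: "(J \<longlongrightarrow> J 0) (at 0)" by (simp add: isCont_def)
  have "((\<lambda>h. (\<Psi> \<phi>1 \<phi>3 (z + h) - \<Psi> \<phi>1 \<phi>3 z) \<odot> pinv h) \<longlongrightarrow> J 0) (at 0)"
  proof (rule Lim_transform_within[OF lim r(1)])
    fix h :: complex assume h: "0 < dist h 0" "dist h 0 < r"
    then have h0: "h \<noteq> 0" and hb: "h \<in> ball 0 r" by (auto simp: dist_norm)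
    have zh: "z + h \<notin> range S" "z \<notin> range S"
    proof -
      show "z + h \<notin> range S"
      proof
        assume "z + h \<in> range S"
        then obtain x where "S x = z + h" by force
        then show False using nz[OF hb, of x] by simp
      qed
    qed (use z in blast)
    let ?F = "\<lambda>z x. ?p x \<odot> pinv (S x - z) \<odot> zet (S' x)"
    have int: "?F z integrable_on {0..2 * pi}" if "z \<notin> range S" for z
      by (rule integrable_continuous_real, rule continuous_on_subset[OF continuous_cauchy_integrand[OF that]]) simp
    have Q: "(?F (z + h) x - ?F z x) \<odot> pinv h = Q h x" for x
    proof -
      let ?a = "pinv (S x - z - h)" and ?b = "pinv (S x - z)"
      have a: "zet (S x - z - h) \<odot> ?a = e1" by (rule zet_bmult_pinv[OF nz[OF hb]])
      have b: "zet (S x - z) \<odot> ?b = e1" by (rule zet_bmult_pinv[OF nz0])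
      have hh: "zet h \<odot> pinv h = e1" by (rule zet_bmult_pinv[OF h0])
      have "zet h = zet (S x - z) - zet (S x - z - h)" by (simp add: zet_diff[symmetric])
      then have "zet h \<odot> (?a \<odot> ?b) = zet (S x - z) \<odot> (?a \<odot> ?b) - zet (S x - z - h) \<odot> (?a \<odot> ?b)"
        by (simp add: bmult_diff_left)
      also have "zet (S x - z) \<odot> (?a \<odot> ?b) = ?a" using b by (metis bmult_assoc bmult_commute e1_bmult)
      also have "zet (S x - z - h) \<odot> (?a \<odot> ?b) = ?b" using a by (metis bmult_assoc e1_bmult)
      finally have ab: "?a - ?b = zet h \<odot> (?a \<odot> ?b)" by simp
      have "(?F (z + h) x - ?F z x) \<odot> pinv h = (?p x \<odot> (?a - ?b) \<odot> zet (S' x)) \<odot> pinv h"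
        by (simp add: bmult_diff_left bmult_commute[of "?p x"] diff_diff_eq)
      also have "\<dots> = (zet h \<odot> pinv h) \<odot> (?p x \<odot> ?a \<odot> ?b \<odot> zet (S' x))"
        unfolding ab by (simp only: bmult_assoc bmult_commute bmult_left_commute)
      finally show ?thesis unfolding hh Q_def by simp
    qed
    have "(\<Psi> \<phi>1 \<phi>3 (z + h) - \<Psi> \<phi>1 \<phi>3 z) \<odot> pinv h
      = cscale (1 / (2 * of_real pi * \<i>)) (integral {0..2 * pi} (?F (z + h)) - integral {0..2 * pi} (?F z)) \<odot> pinv h"
      unfolding \<Psi>_def by (simp add: linear_diff[OF bounded_linear.linear[OF bounded_linear_cscale]])
    also have "integral {0..2 * pi} (?F (z + h)) - integral {0..2 * pi} (?F z) = integral {0..2 * pi} (\<lambda>x. ?F (z + h) x - ?F z x)"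
      by (rule Henstock_Kurzweil_Integration.integral_diff[symmetric]) (intro int zh)+
    also have "cscale (1 / (2 * of_real pi * \<i>)) \<dots> \<odot> pinv h
      = cscale (1 / (2 * of_real pi * \<i>)) (integral {0..2 * pi} (\<lambda>x. ?F (z + h) x - ?F z x) \<odot> pinv h)"
      by (rule bmult_cscale_left)
    also have "integral {0..2 * pi} (\<lambda>x. ?F (z + h) x - ?F z x) \<odot> pinv h
       = integral {0..2 * pi} ((\<lambda>a. a \<odot> pinv h) \<circ> (\<lambda>x. ?F (z + h) x - ?F z x))"
      by (rule integral_linear[OF _ bounded_linear_bmult_right, symmetric])
         (intro Henstock_Kurzweil_Integration.integrable_diff int zh)
    also have "\<dots> = integral {0..2 * pi} (Q h)"
      unfolding o_def Q ..
    finally show "J h = (\<Psi> \<phi>1 \<phi>3 (z + h) - \<Psi> \<phi>1 \<phi>3 z) \<odot> pinv h" unfolding J_def by simp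
  qed
  then show "\<exists>L. ((\<lambda>h. (\<Psi> \<phi>1 \<phi>3 (z + h) - \<Psi> \<phi>1 \<phi>3 z) \<odot> pinv h) \<longlongrightarrow> L) (at 0)" by blast
qed

end

lemma I_tendsto_0:
  assumes f: "\<And>x. f (x + 2 * pi) = f x" "continuous_on UNIV f" and k: "admissible k"
  shows "((\<lambda>z. I f k z) \<longlongrightarrow> 0) at_infinity"
proof -
  obtain B where B: "B > 0" "\<And>x. norm (f x) \<le> B"
    using bounded_range_periodic[of f, OF f] by (auto simp: bounded_pos)
  obtain R where R: "R > 0" "\<And>x. norm (S x) \<le> R"
    using compact_imp_bounded[OF compact_range_S] by (auto simp: bounded_pos)
  have le: "norm (I f k z) \<le> (B * (2 * M) * (2 * pi)) / (norm z - R)" if z: "norm z > R" for z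
  proof -
    have zS: "z \<notin> range S"
    proof
      assume "z \<in> range S"
      then obtain x where "z = S x" by blast
      then show False using R(2)[of x] z by simp
    qed
    have "norm (I f k z) \<le> (B * (2 * M / (norm z - R))) * (2 * pi - 0)"
      unfolding I_def
    proof (rule integral_bound)
      show "continuous_on {0..2 * pi} (\<lambda>x. f x * k z x)"
        by (intro continuous_intros continuous_on_subset[OF f(2)] continuous_on_subset[OF continuous_kernel[OF k zS]] subset_UNIV)
      fix x :: real
      have d: "norm z - R \<le> norm (S x - z)" using R(2)[of x] norm_triangle_ineq2[of z "S x"] by (simp add: norm_minus_commute)
      have "norm (k z x) \<le> 2 * M / norm (S x - z)" using k unfolding admissible_def by blast
      also have "\<dots> \<le> 2 * M / (norm z - R)" using d z M_pos by (intro divide_left_mono mult_pos_pos) linarith+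
      finally show "norm (f x * k z x) \<le> B * (2 * M / (norm z - R))"
        unfolding norm_mult using B by (intro mult_mono) auto
    qed simp
    then show ?thesis by simp
  qed
  have lim: "((\<lambda>z::complex. (B * (2 * M) * (2 * pi)) / (norm z - R)) \<longlongrightarrow> 0) at_infinity"
  proof (rule tendsto_divide_0[OF tendsto_const])
    have "filterlim (\<lambda>z::complex. norm z - R) at_top at_infinity"
      unfolding diff_conv_add_uminus add.commute[of _ "- R"]
      by (rule filterlim_tendsto_add_at_top[OF tendsto_const filterlim_norm_at_top])
    then show "filterlim (\<lambda>z::complex. norm z - R) at_infinity at_infinity"
      by (rule filterlim_mono) (auto simp: at_top_le_at_infinity)
  qed
  show ?thesis
  proof (rule Lim_null_comparison[OF _ lim])
    show "\<forall>\<^sub>F z in at_infinity. norm (I f k z) \<le> B * (2 * M) * (2 * pi) / (norm z - R)"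
      unfolding eventually_at_infinity by (rule exI[of _ "R + 1"]) (use le in auto)
  qed
qed

lemma D_cases: "z \<in> closure D \<Longrightarrow> z \<notin> D \<Longrightarrow> z \<in> range S" "z \<in> range S \<Longrightarrow> z \<in> closure D" "z \<in> range S \<Longrightarrow> z \<notin> D"
  using D_open by (auto simp: frontier_def interior_open simp flip: D_frontier)

section \<open>Boundary values, jump and decay of the Cauchy type integral with Dini
  densities\<close>

context
  fixes \<phi>1 \<phi>3 :: "real \<Rightarrow> real"
  assumes per: "\<And>x. \<phi>1 (x + 2 * pi) = \<phi>1 x" "\<And>x. \<phi>3 (x + 2 * pi) = \<phi>3 x"
    and dini: "dini UNIV \<phi>1" "dini UNIV \<phi>3"
begin

lemma dini_cont: "continuous_on UNIV \<phi>1" "continuous_on UNIV \<phi>3"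
  using dini dini_imp_uniformly_continuous_on uniformly_continuous_imp_continuous by blast+

lemma dini_of_real: "dini UNIV (\<lambda>x. of_real (\<phi>1 x) :: complex)" "dini UNIV (\<lambda>x. of_real (\<phi>3 x) :: complex)"
  "dini UNIV (dens \<phi>1 \<phi>3)"
proof -
  show "dini UNIV (\<lambda>x. of_real (\<phi>1 x) :: complex)"
    by (rule dini_combine[OF dini(1,1), of 1 0]) (auto simp: dist_norm norm_of_real simp flip: of_real_diff)
  show "dini UNIV (\<lambda>x. of_real (\<phi>3 x) :: complex)"
    by (rule dini_combine[OF dini(2,2), of 1 0]) (auto simp: dist_norm norm_of_real simp flip: of_real_diff)
  show "dini UNIV (dens \<phi>1 \<phi>3)"
  proof (rule dini_combine[OF dini, of 1 1])
    fix p q :: real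
    have "dens \<phi>1 \<phi>3 p - dens \<phi>1 \<phi>3 q = of_real (\<phi>1 p - \<phi>1 q) + \<i> * of_real (\<phi>3 p - \<phi>3 q)"
      by (simp add: dens_def algebra_simps)
    also have "norm \<dots> \<le> \<bar>\<phi>1 p - \<phi>1 q\<bar> + \<bar>\<phi>3 p - \<phi>3 q\<bar>"
      using norm_triangle_ineq[of "of_real (\<phi>1 p - \<phi>1 q)" "\<i> * of_real (\<phi>3 p - \<phi>3 q)"]
      by (simp only: norm_mult norm_of_real norm_ii mult_1)
    finally show "dist (dens \<phi>1 \<phi>3 p) (dens \<phi>1 \<phi>3 q) \<le> 1 * dist (\<phi>1 p) (\<phi>1 q) + 1 * dist (\<phi>3 p) (\<phi>3 q)"
      by (simp add: dist_norm)
  qed auto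
qed

lemma of_real_periodic: "(of_real (\<phi>1 (x + 2 * pi)) :: complex) = of_real (\<phi>1 x)" "(of_real (\<phi>3 (x + 2 * pi)) :: complex) = of_real (\<phi>3 x)"
  by (simp_all add: per)

lemmas dens_per = dens_periodic[where ?\<phi>1.0 = \<phi>1 and ?\<phi>3.0 = \<phi>3, OF per dini_cont]

lemma \<Psi>_eq_out: "z \<notin> closure D \<Longrightarrow> \<Psi> \<phi>1 \<phi>3 z = \<Psi>out \<phi>1 \<phi>3 z"
  and \<Psi>_eq_in: "z \<in> D \<Longrightarrow> \<Psi> \<phi>1 \<phi>3 z = \<Psi>in \<phi>1 \<phi>3 z"
proof -
  have e: "\<Psi> \<phi>1 \<phi>3 z = cscale (1 / (2 * of_real pi * \<i>))
     (I (\<lambda>x. of_real (\<phi>1 x)) kC z - \<i> * I (dens \<phi>1 \<phi>3) kE z,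
      I (\<lambda>x. of_real (\<phi>3 x)) kC z + I (dens \<phi>1 \<phi>3) kE z)" if "z \<notin> range S" for z
    by (rule \<Psi>_eq_I[OF per dini_cont that])
  note C1 = kC_limits[of "\<lambda>x. of_real (\<phi>1 x)", OF of_real_periodic(1) dini_of_real(1)]
  note C3 = kC_limits[of "\<lambda>x. of_real (\<phi>3 x)", OF of_real_periodic(2) dini_of_real(2)]
  note E = kE_limits[of "dens \<phi>1 \<phi>3", OF dens_per dini_of_real(3)]
  { assume z: "z \<notin> closure D"
    then have "z \<notin> range S" "z \<notin> D" using D_frontier closure_subset by (auto simp: frontier_def simp flip: D_frontier)
    then show "\<Psi> \<phi>1 \<phi>3 z = \<Psi>out \<phi>1 \<phi>3 z" by (simp add: e \<Psi>out_def C1 C3 E) }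
  { assume z: "z \<in> D"
    then have "z \<notin> range S" using D_open by (auto simp: frontier_def interior_open simp flip: D_frontier)
    then show "\<Psi> \<phi>1 \<phi>3 z = \<Psi>in \<phi>1 \<phi>3 z"
      using z by (simp add: e \<Psi>in_def \<Psi>out_def C1 C3 E cscale_def field_simps) }
qed

lemma isCont_\<Psi>out: "isCont (\<Psi>out \<phi>1 \<phi>3) (S t)"
  unfolding \<Psi>out_def cscale_def fst_conv snd_conv
  by (intro continuous_intros isCont_P[of "\<lambda>x. of_real (\<phi>1 x)", OF of_real_periodic(1) dini_of_real(1) admissible_kC]
      isCont_P[of "\<lambda>x. of_real (\<phi>3 x)", OF of_real_periodic(2) dini_of_real(2) admissible_kC]
      isCont_P[of "dens \<phi>1 \<phi>3", OF dens_per dini_of_real(3) admissible_kE])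

lemma isCont_\<Psi>in: "isCont (\<Psi>in \<phi>1 \<phi>3) (S t)"
  unfolding \<Psi>in_def
  by (intro continuous_intros isCont_\<Psi>out isCont_f_near[of "\<lambda>x. of_real (\<phi>1 x)", OF of_real_periodic(1) dini_of_real(1)]
      isCont_f_near[of "\<lambda>x. of_real (\<phi>3 x)", OF of_real_periodic(2) dini_of_real(2)])

text \<open>Multiplying the convergent quotient by \<open>zet h\<close> recovers the increment,
  which therefore tends to 0.\<close>

lemma isCont_\<Psi>:
  assumes "z \<notin> range S"
  shows "isCont (\<Psi> \<phi>1 \<phi>3) z"
proof -
  have "((\<lambda>h. (\<Psi> \<phi>1 \<phi>3 (z + h) - \<Psi> \<phi>1 \<phi>3 z) \<odot> pinv h) \<longlongrightarrow> L) (at 0) \<Longrightarrow> isCont (\<Psi> \<phi>1 \<phi>3) z" for L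
  proof -
    assume L: "((\<lambda>h. (\<Psi> \<phi>1 \<phi>3 (z + h) - \<Psi> \<phi>1 \<phi>3 z) \<odot> pinv h) \<longlongrightarrow> L) (at 0)"
    have z0: "(zet \<longlongrightarrow> zet 0) (at 0)"
      using continuous_on_zet[of UNIV] unfolding continuous_on_eq_continuous_at[OF open_UNIV] isCont_def by blast
    have "((\<lambda>h. ((\<Psi> \<phi>1 \<phi>3 (z + h) - \<Psi> \<phi>1 \<phi>3 z) \<odot> pinv h) \<odot> zet h) \<longlongrightarrow> L \<odot> zet 0) (at 0)"
      unfolding bmult_def by (intro tendsto_intros L[unfolded bmult_def] z0)
    then have "((\<lambda>h. \<Psi> \<phi>1 \<phi>3 (z + h) - \<Psi> \<phi>1 \<phi>3 z) \<longlongrightarrow> L \<odot> zet 0) (at 0)"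
    proof (rule Lim_transform_within[OF _ zero_less_one])
      fix h :: complex assume "0 < dist h 0"
      then have "h \<noteq> 0" by auto
      then show "((\<Psi> \<phi>1 \<phi>3 (z + h) - \<Psi> \<phi>1 \<phi>3 z) \<odot> pinv h) \<odot> zet h = \<Psi> \<phi>1 \<phi>3 (z + h) - \<Psi> \<phi>1 \<phi>3 z"
        by (metis bmult_assoc bmult_commute e1_bmult zet_bmult_pinv)
    qed
    then have "((\<lambda>h. \<Psi> \<phi>1 \<phi>3 (z + h) - \<Psi> \<phi>1 \<phi>3 z) \<longlongrightarrow> 0) (at 0)" by (simp add: bmult_def zero_prod_def)
    then have "((\<lambda>h. \<Psi> \<phi>1 \<phi>3 (z + h)) \<longlongrightarrow> \<Psi> \<phi>1 \<phi>3 z) (at 0)" by (rule LIM_zero_cancel)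
    then show ?thesis by (simp add: isCont_iff)
  qed
  then show ?thesis using \<Psi>_monogenic[OF per dini_cont] assms
    unfolding monogenic_on_zet_iff inv_f_f[OF inj_zet] by blast
qed

lemma continuous_on_\<Psi>in: "continuous_on (closure D) (\<Psi>in \<phi>1 \<phi>3)"
  unfolding continuous_on_eq_continuous_within
proof
  fix z assume z: "z \<in> closure D"
  show "continuous (at z within closure D) (\<Psi>in \<phi>1 \<phi>3)"
  proof (cases "z \<in> D")
    case True
    have "isCont (\<Psi>in \<phi>1 \<phi>3) z \<longleftrightarrow> isCont (\<Psi> \<phi>1 \<phi>3) z"
      by (rule isCont_cong) (use \<Psi>_eq_in eventually_nhds_in_open[OF D_open True] in \<open>auto elim!: eventually_mono\<close>)
    then have "isCont (\<Psi>in \<phi>1 \<phi>3) z" using isCont_\<Psi> True D_cases(3) by blast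
    then show ?thesis by (rule continuous_at_imp_continuous_at_within)
  next
    case False
    then obtain t where "z = S t" using z D_cases(1) by blast
    then show ?thesis using isCont_\<Psi>in continuous_at_imp_continuous_at_within by blast
  qed
qed

lemma continuous_on_\<Psi>out: "continuous_on (- D) (\<Psi>out \<phi>1 \<phi>3)"
  unfolding continuous_on_eq_continuous_within
proof
  fix z assume z: "z \<in> - D"
  show "continuous (at z within - D) (\<Psi>out \<phi>1 \<phi>3)"
  proof (cases "z \<in> closure D")
    case False
    have "isCont (\<Psi>out \<phi>1 \<phi>3) z \<longleftrightarrow> isCont (\<Psi> \<phi>1 \<phi>3) z"
      by (rule isCont_cong)
         (use \<Psi>_eq_out eventually_nhds_in_open[of "- closure D" z] False in \<open>auto elim!: eventually_mono simp: open_Compl\<close>)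
    then have "isCont (\<Psi>out \<phi>1 \<phi>3) z" using isCont_\<Psi> False D_cases(2) by blast
    then show ?thesis by (rule continuous_at_imp_continuous_at_within)
  next
    case True
    then obtain t where "z = S t" using z D_cases(1) by blast
    then show ?thesis using isCont_\<Psi>out continuous_at_imp_continuous_at_within by blast
  qed
qed

text \<open>Both entries of the jump are real, so the components \<open>U2\<close> and
  \<open>U4\<close> agree on the two sides of the curve.\<close>

lemma \<Psi>_jump: "\<Psi>in \<phi>1 \<phi>3 (S t) - \<Psi>out \<phi>1 \<phi>3 (S t) = (of_real (\<phi>1 t), of_real (\<phi>3 t))"
  using f_near_S[of \<phi>1, OF per(1)] f_near_S[of \<phi>3, OF per(2)] by (simp add: \<Psi>in_def)

lemma \<Psi>_tendsto_0: "(\<Psi> \<phi>1 \<phi>3 \<longlongrightarrow> 0) at_infinity"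
proof -
  let ?C = "\<lambda>z. cscale (1 / (2 * of_real pi * \<i>))
     (I (\<lambda>x. of_real (\<phi>1 x)) kC z - \<i> * I (dens \<phi>1 \<phi>3) kE z,
      I (\<lambda>x. of_real (\<phi>3 x)) kC z + I (dens \<phi>1 \<phi>3) kE z)"
  have c: "continuous_on UNIV (\<lambda>x. of_real (\<phi>1 x) :: complex)" "continuous_on UNIV (\<lambda>x. of_real (\<phi>3 x) :: complex)"
    by (intro continuous_intros dini_cont)+
  note l = I_tendsto_0[of "\<lambda>x. of_real (\<phi>1 x)", OF of_real_periodic(1) c(1) admissible_kC]
     I_tendsto_0[of "\<lambda>x. of_real (\<phi>3 x)", OF of_real_periodic(2) c(2) admissible_kC]
     I_tendsto_0[of "dens \<phi>1 \<phi>3", OF dens_per dens_continuous[OF per dini_cont] admissible_kE]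
  have "(?C \<longlongrightarrow> cscale (1 / (2 * of_real pi * \<i>)) (0 - \<i> * 0, 0 + 0)) at_infinity"
    unfolding cscale_def fst_conv snd_conv by (intro tendsto_intros l)
  then have lim: "(?C \<longlongrightarrow> 0) at_infinity" by (simp add: cscale_def zero_prod_def)
  obtain R where R: "R > 0" "\<And>x. norm (S x) \<le> R"
    using compact_imp_bounded[OF compact_range_S] by (auto simp: bounded_pos)
  show ?thesis
  proof (rule Lim_transform_eventually[OF lim])
    show "\<forall>\<^sub>F z in at_infinity. ?C z = \<Psi> \<phi>1 \<phi>3 z"
      unfolding eventually_at_infinity
    proof (intro exI[of _ "R + 1"] allI impI)
      fix z :: complex assume z: "R + 1 \<le> norm z"
      have "z \<notin> range S"
      proof
        assume "z \<in> range S"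
        then obtain x where "z = S x" by blast
        then show False using R(2)[of x] z by simp
      qed
      from \<Psi>_eq_I[OF per dini_cont this] show "?C z = \<Psi> \<phi>1 \<phi>3 z" by simp
    qed
  qed
qed

text \<open>The subtraction inside \<open>P\<close> costs the density at \<open>t\<close> times the
  mass of the kernel: \<open>pi\<close> for \<open>Im kC\<close> and 0 for \<open>kE\<close>. After
  division by \<open>2 * pi\<close> this takes half of the jump away, which explains the terms
  \<open>\<phi>1 t / 2\<close> and \<open>\<phi>3 t / 2\<close>.\<close>

lemma U_\<Psi>in: "U1 (\<Psi>in \<phi>1 \<phi>3 (S t)) = L1 \<phi>1 \<phi>3 t" "U3 (\<Psi>in \<phi>1 \<phi>3 (S t)) = L3 \<phi>1 \<phi>3 t"
proof -
  let ?m1 = "\<lambda>z::complex. - 1 / z\<^sup>2" and ?m2 = "\<lambda>z::complex. of_real (- 1 / (norm z)\<^sup>2) :: complex"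
  have cont: "continuous_on UNIV (\<lambda>x. of_real (\<phi>1 x) :: complex)" "continuous_on UNIV (\<lambda>x. of_real (\<phi>3 x) :: complex)"
    by (intro continuous_intros dini_cont)+
  have PC: "Im (P (\<lambda>x. of_real (\<phi> x)) kC (S t)) = Re (T (\<lambda>x. of_real (\<phi> x)) ?m2 t) - pi * \<phi> t"
    if p: "\<And>x. \<phi> (x + 2 * pi) = \<phi> x" "continuous_on UNIV \<phi>" and d: "dini UNIV (\<lambda>x. of_real (\<phi> x) :: complex)" for \<phi>
  proof -
    have p': "(of_real (\<phi> (x + 2 * pi)) :: complex) = of_real (\<phi> x)" for x by (simp add: p)
    have cp: "continuous_on UNIV (\<lambda>x. of_real (\<phi> x) :: complex)" by (intro continuous_intros p)
    obtain B where B: "\<And>x. norm (of_real (\<phi> x) :: complex) \<le> B"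
      using bounded_range_periodic[of "\<lambda>x. of_real (\<phi> x) :: complex", OF p' cp] by (auto simp: bounded_iff)
    have i: "set_integrable lborel {-pi..pi} (\<lambda>u. (of_real (\<phi> (t + u)) - of_real (\<phi> t)) * kC (S t) (t + u))"
      by (rule G_integrable[of "\<lambda>x. of_real (\<phi> x)", OF p' d admissible_kC]) simp
    have i1: "set_integrable lborel {-pi..pi} (\<lambda>u. of_real (\<phi> (t + u)) * K ?m2 t (t + u))"
      by (rule T_bound(1)[OF good_multiplier_norm B borel_measurable_continuous_onI[OF cp]])
    have i2: "set_integrable lborel {-pi..pi} (\<lambda>u. Im (kC (S t) (t + u)))"
      using integrable_Re[OF Im_kC_singular_integrable[of t, unfolded set_integrable_def]]
      by (simp add: set_integrable_def)
    have i1': "set_integrable lborel {-pi..pi} (\<lambda>u. \<phi> (t + u) * Im (kC (S t) (t + u)))"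
      using integrable_Re[OF i1[unfolded set_integrable_def, folded Im_kC_eq_K]]
      by (simp add: set_integrable_def)
    have "Im (P (\<lambda>x. of_real (\<phi> x)) kC (S t)) = Im (LINT u:{-pi..pi}|lborel. (of_real (\<phi> (t + u)) - of_real (\<phi> t)) * kC (S t) (t + u))"
      using P_at_S[of "\<lambda>x. of_real (\<phi> x)", OF p' admissible_kC, of t] by (simp add: G_def)
    also have "\<dots> = (LINT u:{-pi..pi}|lborel. Im ((of_real (\<phi> (t + u)) - of_real (\<phi> t)) * kC (S t) (t + u)))"
      unfolding set_lebesgue_integral_def using integral_Im[OF i[unfolded set_integrable_def]] by simp
    also have "\<dots> = (LINT u:{-pi..pi}|lborel. \<phi> (t + u) * Im (kC (S t) (t + u)) - \<phi> t * Im (kC (S t) (t + u)))"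
      by (simp add: left_diff_distrib flip: of_real_diff)
    also have "\<dots> = (LINT u:{-pi..pi}|lborel. \<phi> (t + u) * Im (kC (S t) (t + u))) - (LINT u:{-pi..pi}|lborel. \<phi> t * Im (kC (S t) (t + u)))"
      by (rule set_integral_diff(2)[OF i1' set_integrable_mult_right[OF i2]])
    also have "(LINT u:{-pi..pi}|lborel. \<phi> t * Im (kC (S t) (t + u))) = \<phi> t * pi"
      by (simp add: integral_Im_kC_singular)
    also have "(LINT u:{-pi..pi}|lborel. \<phi> (t + u) * Im (kC (S t) (t + u))) = Re (T (\<lambda>x. of_real (\<phi> x)) ?m2 t)"
      unfolding T_def set_lebesgue_integral_def Im_kC_eq_K[symmetric]
      using integral_Re[OF i1[unfolded set_integrable_def, folded Im_kC_eq_K]] by simp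
    finally show ?thesis by simp
  qed
  have dper: "dens \<phi>1 \<phi>3 (x + 2 * pi) = dens \<phi>1 \<phi>3 x" for x by (rule dens_per)
  have cd: "continuous_on UNIV (dens \<phi>1 \<phi>3)" by (rule dens_continuous[OF per dini_cont])
  have i: "set_integrable lborel {-pi..pi} (\<lambda>u. f (t + u) * kE (S t) (t + u))"
    if f: "\<And>x. f (x + 2 * pi) = f x" "continuous_on UNIV f" for f :: "real \<Rightarrow> complex"
  proof -
    obtain B where "\<And>x. norm (f x) \<le> B" using bounded_range_periodic[of f, OF f] by (auto simp: bounded_iff)
    from T_bound(1)[OF good_multiplier_square this borel_measurable_continuous_onI[OF f(2)]]
    show ?thesis by (simp add: kE_eq_K)
  qed
  have PE: "P (dens \<phi>1 \<phi>3) kE (S t) = T (\<lambda>x. of_real (\<phi>1 x)) ?m1 t + \<i> * T (\<lambda>x. of_real (\<phi>3 x)) ?m1 t"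
  proof -
    have "P (dens \<phi>1 \<phi>3) kE (S t) = (LINT u:{-pi..pi}|lborel. (dens \<phi>1 \<phi>3 (t + u) - dens \<phi>1 \<phi>3 t) * kE (S t) (t + u))"
      using P_at_S[of "dens \<phi>1 \<phi>3", OF dper admissible_kE, of t] by (simp add: G_def)
    also have "\<dots> = (LINT u:{-pi..pi}|lborel. dens \<phi>1 \<phi>3 (t + u) * kE (S t) (t + u) - dens \<phi>1 \<phi>3 t * kE (S t) (t + u))"
      by (simp add: left_diff_distrib)
    also have "\<dots> = (LINT u:{-pi..pi}|lborel. dens \<phi>1 \<phi>3 (t + u) * kE (S t) (t + u)) - (LINT u:{-pi..pi}|lborel. dens \<phi>1 \<phi>3 t * kE (S t) (t + u))"
      by (rule set_integral_diff(2)[OF i[OF dper cd] set_integrable_mult_right[OF kE_singular_integrable]])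
    also have "(LINT u:{-pi..pi}|lborel. dens \<phi>1 \<phi>3 t * kE (S t) (t + u)) = 0" by (simp add: integral_kE_singular)
    also have "(LINT u:{-pi..pi}|lborel. dens \<phi>1 \<phi>3 (t + u) * kE (S t) (t + u))
       = (LINT u:{-pi..pi}|lborel. of_real (\<phi>1 (t + u)) * kE (S t) (t + u) + \<i> * (of_real (\<phi>3 (t + u)) * kE (S t) (t + u)))"
      by (simp add: dens_def algebra_simps)
    also have "\<dots> = (LINT u:{-pi..pi}|lborel. of_real (\<phi>1 (t + u)) * kE (S t) (t + u)) + (LINT u:{-pi..pi}|lborel. \<i> * (of_real (\<phi>3 (t + u)) * kE (S t) (t + u)))"
      by (rule set_integral_add(2)[OF i[OF of_real_periodic(1) cont(1)] set_integrable_mult_right[OF i[OF of_real_periodic(2) cont(2)]]])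
    finally show ?thesis by (simp add: T_def kE_eq_K)
  qed
  have Re2: "Re (x / (2 * of_real pi * \<i>)) = Im x / (2 * pi)" for x
    by (simp add: Re_divide power2_eq_square)
  have n: "\<phi>1 (near (S t)) = \<phi>1 t" "\<phi>3 (near (S t)) = \<phi>3 t"
    using f_near_S[of \<phi>1, OF per(1)] f_near_S[of \<phi>3, OF per(2)] by auto
  note C1 = PC[OF per(1) dini_cont(1) dini_of_real(1)] and C3 = PC[OF per(2) dini_cont(2) dini_of_real(2)]
  have "U1 (\<Psi>in \<phi>1 \<phi>3 (S t)) = \<phi>1 t + Re ((P (\<lambda>x. of_real (\<phi>1 x)) kC (S t) - \<i> * P (dens \<phi>1 \<phi>3) kE (S t)) / (2 * of_real pi * \<i>))"
    by (simp add: U1_def \<Psi>in_def \<Psi>out_def cscale_def n)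
  also have "\<dots> = L1 \<phi>1 \<phi>3 t"
    unfolding Re2 PE L1_def using C1 by (simp add: field_simps)
  finally show "U1 (\<Psi>in \<phi>1 \<phi>3 (S t)) = L1 \<phi>1 \<phi>3 t" .
  have "U3 (\<Psi>in \<phi>1 \<phi>3 (S t)) = \<phi>3 t + Re ((P (\<lambda>x. of_real (\<phi>3 x)) kC (S t) + P (dens \<phi>1 \<phi>3) kE (S t)) / (2 * of_real pi * \<i>))"
    by (simp add: U3_def \<Psi>in_def \<Psi>out_def cscale_def n)
  also have "\<dots> = L3 \<phi>1 \<phi>3 t"
    unfolding Re2 PE L3_def using C3 by (simp add: field_simps)
  finally show "U3 (\<Psi>in \<phi>1 \<phi>3 (S t)) = L3 \<phi>1 \<phi>3 t" .
qed

end

end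

subsection \<open>The boundary curve of a conformal map\<close>

lemma cis_has_vector_derivative: "(cis has_vector_derivative (\<i> * cis x)) (at x within A)"
proof -
  have "((\<lambda>t. \<i> * of_real t) has_vector_derivative \<i> * of_real 1) (at x)"
    by (intro has_vector_derivative_mult_right has_vector_derivative_of_real DERIV_ident)
  from field_vector_diff_chain_at[OF this DERIV_exp]
  have "(cis has_vector_derivative (\<i> * cis x)) (at x)" by (simp add: o_def cis_conv_exp[abs_def])
  then show ?thesis by (rule has_vector_derivative_at_within)
qed

lemma norm_cis_diff_le: "norm (cis x - cis y) \<le> \<bar>x - y\<bar>"
proof -
  have "norm (cis x - cis y) \<le> 1 * norm (x - y)"
  proof (rule differentiable_bound[of UNIV _ "\<lambda>t h. h *\<^sub>R (\<i> * cis t)"])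
    show "(cis has_derivative (\<lambda>h. h *\<^sub>R (\<i> * cis t))) (at t within UNIV)" for t
      using cis_has_vector_derivative[of t UNIV] by (simp add: has_vector_derivative_def)
    show "onorm (\<lambda>h. h *\<^sub>R (\<i> * cis t)) \<le> 1" for t
      by (subst onorm_scaleR_left) (auto simp: onorm_id bounded_linear_ident norm_mult)
  qed auto
  then show ?thesis by simp
qed

lemma cis_eq_cisD: "cis x = cis y \<Longrightarrow> \<exists>k::int. x = y + of_int k * (2 * pi)"
proof -
  assume "cis x = cis y"
  then have "exp (\<i> * of_real x) = exp (\<i> * of_real y)" by (simp add: cis_conv_exp)
  then obtain n :: int where "\<i> * of_real x = \<i> * of_real y + (of_int (2 * n) * pi) * \<i>"
    unfolding exp_eq by blast
  then have "\<i> * of_real x = \<i> * of_real (y + of_int n * (2 * pi))" by (simp add: algebra_simps)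
  then have "x = y + of_int n * (2 * pi)" by (metis complex_i_not_zero mult_left_cancel of_real_eq_iff)
  then show ?thesis by blast
qed

lemma range_cis: "range cis = sphere 0 1"
proof -
  have "z \<in> range cis" if "norm z = 1" for z :: complex
  proof -
    have "z \<noteq> 0" using that by auto
    then have "z = cis (Arg z)" using that cis_Arg[of z] by (simp add: sgn_eq)
    then show ?thesis by (rule range_eqI)
  qed
  then show ?thesis by (auto simp: dist_norm)
qed

text \<open>Needed because \<open>S'\<close> is \<open>\<sigma>'\<close> times a factor that is
  Lipschitz in the angle. That factor adds a multiple of \<open>\<eta>\<close> to the modulus, and
  after division by \<open>\<eta>\<close> the logarithm alone has to be integrable.\<close>

lemma nn_integral_ln_finite: "(\<integral>\<^sup>+\<eta>\<in>{0<..1}. ennreal (ln (3 / \<eta>)) \<partial>lborel) < \<infinity>"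
proof -
  have le: "ln (3 / \<eta>) \<le> 4 * \<eta> powr (- 1/2)" if "0 < \<eta>" for \<eta> :: real
  proof -
    have "ln (3 / \<eta>) = 2 * ln (sqrt (3 / \<eta>))" using that by (simp add: ln_sqrt)
    also have "ln (sqrt (3 / \<eta>)) \<le> sqrt (3 / \<eta>)" using that ln_le_minus_one[of "sqrt (3 / \<eta>)"] by simp
    also have "sqrt (3 / \<eta>) \<le> sqrt (4 / \<eta>)" using that by (simp add: divide_right_mono)
    also have "sqrt (4 / \<eta>) = 2 * \<eta> powr (- 1/2)"
    proof -
      have "\<eta> powr (- 1/2) = inverse (sqrt \<eta>)"
        using powr_minus[of \<eta> "1/2"] powr_half_sqrt[of \<eta>] that by simp
      moreover have "sqrt (4 / \<eta>) = 2 * inverse (sqrt \<eta>)"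
        by (simp only: real_sqrt_divide real_sqrt_four divide_inverse[of 2])
      ultimately show ?thesis by metis
    qed
    finally show ?thesis by simp
  qed
  have "((\<lambda>\<eta>. \<eta> powr (- 1/2)) has_integral (1 powr (-1/2 + 1) / (-1/2 + 1))) {0..1::real}"
    by (rule has_integral_powr_from_0) auto
  from has_integral_mult_right[OF this, of 4]
  have "((\<lambda>\<eta>. 4 * \<eta> powr (- 1/2)) has_integral 8) {0..1::real}" by simp
  then have I: "((\<lambda>\<eta>. if \<eta> \<in> {0..1} then 4 * \<eta> powr (- 1/2) else 0) has_integral 8) (UNIV :: real set)"
    by (simp only: has_integral_restrict_UNIV)
  have "(\<integral>\<^sup>+\<eta>\<in>{0<..1}. ennreal (ln (3 / \<eta>)) \<partial>lborel) \<le> (\<integral>\<^sup>+\<eta>. ennreal (if \<eta> \<in> {0..1} then 4 * \<eta> powr (- 1/2) else 0) \<partial>lborel)"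
    by (rule nn_integral_mono) (use le in \<open>auto simp: indicator_def intro!: ennreal_leI\<close>)
  also have "\<dots> = ennreal 8"
    by (rule nn_integral_has_integral_lborel[OF _ _ I]) auto
  also have "\<dots> < \<infinity>" by simp
  finally show ?thesis .
qed

lemma periodic_integral_eq:
  fixes F :: "real \<Rightarrow> 'a::euclidean_space"
  assumes per: "\<And>x. F (x + 2 * pi) = F x" and cont: "continuous_on UNIV F"
  shows "integral {b..b + 2 * pi} F = integral {0..2 * pi} F"
proof -
  have si: "set_integrable lborel {x..y} F" for x y
    by (rule borel_integrable_atLeastAtMost') (rule continuous_on_subset[OF cont], simp)
  show ?thesis
    using set_integral_periodic(2)[of F "2 * pi" 0 b, OF per] si
      set_borel_integral_eq_integral(2)[OF si[of b "b + 2 * pi"]] set_borel_integral_eq_integral(2)[OF si[of 0 "2 * pi"]] by simp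
qed

lemma periodic_integral_multiple:
  fixes F :: "real \<Rightarrow> complex"
  assumes per: "\<And>x. F (x + 2 * pi) = F x" and cont: "continuous_on UNIV F"
  shows "integral {a..a + real n * (2 * pi)} F = of_nat n * integral {0..2 * pi} F"
proof (induction n)
  case (Suc n)
  have int: "F integrable_on {x..y}" for x y by (intro integrable_continuous_real continuous_on_subset[OF cont]) auto
  have one: "integral {b..b + 2 * pi} F = integral {0..2 * pi} F" for b
    by (rule periodic_integral_eq[of F, OF per cont])
  define b where "b = a + real n * (2 * pi)"
  have ab: "a + real (Suc n) * (2 * pi) = b + 2 * pi" by (simp add: b_def algebra_simps)
  have split: "integral {a..b + 2 * pi} F = integral {a..b} F + integral {b..b + 2 * pi} F"
    by (rule Henstock_Kurzweil_Integration.integral_combine[symmetric]) (auto simp: int b_def)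
  show ?case unfolding ab split one Suc[folded b_def] by (simp add: distrib_right)
qed simp

locale conformal_boundary =
  fixes D :: "complex set" and \<sigma> \<sigma>' \<rho> :: "complex \<Rightarrow> complex"
  assumes D: "open D" "connected D" "D \<noteq> {}" "bounded D"
    and hol: "\<sigma> holomorphic_on ball 0 1" and inj_ball: "inj_on \<sigma> (ball 0 1)" and image: "\<sigma> ` ball 0 1 = D"
    and homeo: "homeomorphism (cball 0 1) (closure D) \<sigma> \<rho>"
    and deriv: "\<And>T. T \<in> sphere 0 1 \<Longrightarrow> (\<sigma> has_field_derivative \<sigma>' T) (at T within sphere 0 1)"
    and cont': "continuous_on (sphere 0 1) \<sigma>'"
    and nz: "\<And>T. T \<in> sphere 0 1 \<Longrightarrow> \<sigma>' T \<noteq> 0"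
    and log_dini: "(\<integral>\<^sup>+\<eta>\<in>{0<..2}. (modulus (sphere 0 1) \<sigma>' \<eta> / ennreal \<eta> * ennreal (ln (3 / \<eta>))) \<partial>lborel) < \<infinity>"
begin

definition S :: "real \<Rightarrow> complex" where "S x = \<sigma> (cis x)"
definition S' :: "real \<Rightarrow> complex" where "S' x = \<i> * cis x * \<sigma>' (cis x)"

lemma inj_cball: "inj_on \<sigma> (cball 0 1)"
  using homeo by (metis homeomorphism_def inj_on_inverseI)

lemma sigma_cont: "continuous_on (cball 0 1) \<sigma>"
  using homeo by (simp add: homeomorphism_def)

lemma closure_D: "closure D = \<sigma> ` cball 0 1"
  using homeo by (simp add: homeomorphism_def)

lemma frontier_D: "frontier D = \<sigma> ` sphere 0 1"
proof -
  have "frontier D = \<sigma> ` cball 0 1 - \<sigma> ` ball 0 1"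
    using D by (simp add: frontier_def interior_open closure_D image)
  also have "\<dots> = \<sigma> ` (cball 0 1 - ball 0 1)"
    by (rule inj_on_image_set_diff[OF inj_cball, symmetric]) auto
  also have "cball 0 1 - ball 0 1 = (sphere 0 1 :: complex set)" by auto
  finally show ?thesis .
qed

lemma range_S: "range S = frontier D"
  unfolding frontier_D range_cis[symmetric] S_def by auto

lemma S_has_deriv: "(S has_vector_derivative S' x) (at x)"
proof -
  have 1: "(cis has_vector_derivative (\<i> * cis x)) (at x within UNIV)"
    by (rule cis_has_vector_derivative)
  have "(\<sigma> has_field_derivative \<sigma>' (cis x)) (at (cis x) within range cis)"
    unfolding range_cis by (rule deriv) (simp add: dist_norm)
  from field_vector_diff_chain_within[OF 1 this] show ?thesis by (simp add: S_def[abs_def] S'_def o_def)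
qed

lemma S'_log: "(\<integral>\<^sup>+\<eta>\<in>{0<..1}. (modulus UNIV S' \<eta> / ennreal \<eta> * ennreal (ln (3 / \<eta>))) \<partial>lborel) < \<infinity>"
proof -
  obtain B where B: "B > 0" "\<And>T. T \<in> sphere 0 1 \<Longrightarrow> norm (\<sigma>' T) \<le> B"
    using compact_imp_bounded[OF compact_continuous_image[OF cont' compact_sphere]] by (auto simp: bounded_pos)
  have le: "modulus UNIV S' \<eta> \<le> ennreal B * ennreal \<eta> + modulus (sphere 0 1) \<sigma>' \<eta>" for \<eta>
  proof (rule modulus_least)
    fix p q :: real assume pq: "dist p q \<le> \<eta>"
    have d: "norm (cis p - cis q) \<le> \<eta>" using norm_cis_diff_le[of p q] pq by (simp add: dist_real_def)
    \<comment> \<open>The product rule for increments: one term is Lipschitz, the other is an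
      increment of \<open>\<sigma>'\<close> between points of the circle at distance at most
      \<open>\<eta>\<close>.\<close>
    have "S' p - S' q = \<i> * ((cis p - cis q) * \<sigma>' (cis p) + cis q * (\<sigma>' (cis p) - \<sigma>' (cis q)))"
      by (simp add: S'_def algebra_simps)
    then have "norm (S' p - S' q) = norm ((cis p - cis q) * \<sigma>' (cis p) + cis q * (\<sigma>' (cis p) - \<sigma>' (cis q)))"
      by (simp add: norm_mult)
    also have "\<dots> \<le> norm ((cis p - cis q) * \<sigma>' (cis p)) + norm (cis q * (\<sigma>' (cis p) - \<sigma>' (cis q)))"
      by (rule norm_triangle_ineq)
    also have "\<dots> \<le> \<eta> * B + dist (\<sigma>' (cis p)) (\<sigma>' (cis q))"
      unfolding norm_mult using d B by (intro add_mono mult_mono) (auto simp: dist_norm intro: order_trans[OF norm_ge_zero])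
    finally have "ennreal (dist (S' p) (S' q)) \<le> ennreal (\<eta> * B + dist (\<sigma>' (cis p)) (\<sigma>' (cis q)))"
      by (simp add: dist_norm ennreal_leI)
    also have "\<dots> = ennreal B * ennreal \<eta> + ennreal (dist (\<sigma>' (cis p)) (\<sigma>' (cis q)))"
      using B order_trans[OF zero_le_dist pq] by (simp add: ennreal_plus ennreal_mult mult.commute)
    also have "\<dots> \<le> ennreal B * ennreal \<eta> + modulus (sphere 0 1) \<sigma>' \<eta>"
      by (intro add_left_mono modulus_upper) (use d in \<open>auto simp: dist_norm\<close>)
    finally show "ennreal (dist (S' p) (S' q)) \<le> ennreal B * ennreal \<eta> + modulus (sphere 0 1) \<sigma>' \<eta>" .
  qed
  have "(\<integral>\<^sup>+\<eta>\<in>{0<..1}. (modulus UNIV S' \<eta> / ennreal \<eta> * ennreal (ln (3 / \<eta>))) \<partial>lborel)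
    \<le> (\<integral>\<^sup>+\<eta>. ennreal B * (ennreal (ln (3 / \<eta>)) * indicator {0<..1} \<eta>)
        + modulus (sphere 0 1) \<sigma>' \<eta> / ennreal \<eta> * ennreal (ln (3 / \<eta>)) * indicator {0<..2} \<eta> \<partial>lborel)"
  proof (rule nn_integral_mono)
    fix \<eta> :: real
    show "modulus UNIV S' \<eta> / ennreal \<eta> * ennreal (ln (3 / \<eta>)) * indicator {0<..1} \<eta>
      \<le> ennreal B * (ennreal (ln (3 / \<eta>)) * indicator {0<..1} \<eta>)
        + modulus (sphere 0 1) \<sigma>' \<eta> / ennreal \<eta> * ennreal (ln (3 / \<eta>)) * indicator {0<..2} \<eta>"
    proof (cases "\<eta> \<in> {0<..1}")
      case True
      then have e: "ennreal B * ennreal \<eta> / ennreal \<eta> = ennreal B"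
        by (simp add: mult_divide_eq_ennreal)
      have "modulus UNIV S' \<eta> / ennreal \<eta> \<le> (ennreal B * ennreal \<eta> + modulus (sphere 0 1) \<sigma>' \<eta>) / ennreal \<eta>"
        by (rule divide_right_mono_ennreal[OF le])
      also have "\<dots> = ennreal B + modulus (sphere 0 1) \<sigma>' \<eta> / ennreal \<eta>"
        by (simp add: add_divide_distrib_ennreal e)
      finally have "modulus UNIV S' \<eta> / ennreal \<eta> * ennreal (ln (3 / \<eta>)) \<le> (ennreal B + modulus (sphere 0 1) \<sigma>' \<eta> / ennreal \<eta>) * ennreal (ln (3 / \<eta>))"
        by (rule mult_right_mono) simp
      then show ?thesis using True by (simp add: distrib_right)
    qed simp
  qed
  also have "\<dots> = ennreal B * (\<integral>\<^sup>+\<eta>\<in>{0<..1}. ennreal (ln (3 / \<eta>)) \<partial>lborel)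
     + (\<integral>\<^sup>+\<eta>\<in>{0<..2}. (modulus (sphere 0 1) \<sigma>' \<eta> / ennreal \<eta> * ennreal (ln (3 / \<eta>))) \<partial>lborel)"
    by (simp add: nn_integral_add nn_integral_cmult)
  also have "\<dots> < \<infinity>" using log_dini nn_integral_ln_finite by (simp add: ennreal_mult_less_top)
  finally show ?thesis .
qed

section \<open>The winding number of the boundary curve\<close>

definition p :: "real \<Rightarrow> complex" where "p t = S (2 * pi * t)"

lemma p_eq: "p = \<sigma> \<circ> circlepath 0 1"
  by (rule ext) (simp add: p_def S_def circlepath cis_conv_exp mult.commute mult.left_commute)

lemma path_circle_image: "path (\<sigma> \<circ> circlepath 0 r)" if "0 \<le> r" "r \<le> 1"
  by (rule path_continuous_image[OF path_circlepath continuous_on_subset[OF sigma_cont]]) (use that in auto)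

text \<open>The straight homotopy between concentric circles moves radially and stays in the closed
  annulus, on which \<open>\<sigma>\<close> is continuous; its image avoids
  \<open>z\<close>.\<close>

lemma winding_circle:
  assumes r: "0 \<le> r" "r \<le> 1" and z: "z \<notin> \<sigma> ` (cball 0 1 - ball 0 r)"
  shows "winding_number p z = winding_number (\<sigma> \<circ> circlepath 0 r) z"
  unfolding p_eq
proof (rule winding_number_homotopic_loops)
  have "homotopic_loops (cball 0 1 - ball 0 r) (circlepath 0 1) (circlepath 0 r)"
  proof (rule homotopic_loops_linear)
    fix t :: real
    show "closed_segment (circlepath 0 1 t) (circlepath 0 r t) \<subseteq> cball 0 1 - ball 0 r"
    proof
      fix x assume "x \<in> closed_segment (circlepath 0 1 t) (circlepath 0 r t)"
      then obtain u where u: "0 \<le> u" "u \<le> 1" "x = (1 - u) *\<^sub>R circlepath 0 1 t + u *\<^sub>R circlepath 0 r t"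
        unfolding in_segment by blast
      let ?e = "exp (2 * of_real pi * \<i> * of_real t)"
      have "x = of_real ((1 - u) + u * r) * ?e"
        by (simp add: u(3) circlepath scaleR_conv_of_real algebra_simps)
      moreover have "norm ?e = 1" by (simp add: norm_exp_eq_Re)
      ultimately have "norm x = \<bar>(1 - u) + u * r\<bar>" by (simp add: norm_mult del: of_real_add of_real_diff of_real_mult)
      moreover have "r \<le> (1 - u) + u * r" "(1 - u) + u * r \<le> 1"
        using mult_right_mono[of u 1 "1 - r"] mult_left_mono[of r 1 u] u r by (auto simp: algebra_simps)
      ultimately show "x \<in> cball 0 1 - ball 0 r" using r by auto
    qed
  qed auto
  then have "homotopic_loops (\<sigma> ` (cball 0 1 - ball 0 r)) (\<sigma> \<circ> circlepath 0 1) (\<sigma> \<circ> circlepath 0 r)"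
    by (rule homotopic_loops_continuous_image) (auto intro: continuous_on_subset[OF sigma_cont])
  then show "homotopic_loops (- {z}) (\<sigma> \<circ> circlepath 0 1) (\<sigma> \<circ> circlepath 0 r)"
    by (rule homotopic_loops_subset) (use z in auto)
qed

lemma winding_outside:
  assumes "z \<notin> closure D"
  shows "winding_number p z = 0"
proof -
  \<comment> \<open>With radius 0 the homotopy contracts the boundary curve to the point
    \<open>\<sigma> 0\<close>.\<close>
  have "winding_number p z = winding_number (\<sigma> \<circ> circlepath 0 0) z"
    by (rule winding_circle) (use assms closure_D in auto)
  also have "\<sigma> \<circ> circlepath 0 0 = linepath (\<sigma> 0) (\<sigma> 0)"
    by (rule ext) (simp add: circlepath linepath_def flip: scaleR_add_left)
  also have "winding_number \<dots> z = 0"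
    by (rule winding_number_trivial) (use assms closure_D in auto)
  finally show ?thesis .
qed

text \<open>The boundary is contracted to the image of a small circle, which is replaced by the
  circle with the linear part \<open>d * h\<close> of \<open>\<sigma>\<close>: the remainder is
  smaller than the distance of that circle from its centre \<open>\<sigma> 0\<close>.\<close>

lemma winding_center: "winding_number p (\<sigma> 0) = 1"
proof -
  define d where "d = deriv \<sigma> 0"
  have d0: "d \<noteq> 0" unfolding d_def
    using holomorphic_injective_imp_regular[OF hol _ inj_ball, of 0] by simp
  have "(\<sigma> has_field_derivative d) (at 0)"
    unfolding d_def using hol by (rule holomorphic_derivI) auto
  then have "(\<lambda>h. (\<sigma> (0 + h) - \<sigma> 0) / h) \<midarrow>0\<rightarrow> d" by (simp add: DERIV_def)
  then obtain s where s: "s > 0" "\<And>h. h \<noteq> 0 \<Longrightarrow> norm h < s \<Longrightarrow> norm ((\<sigma> h - \<sigma> 0) / h - d) < norm d"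
    using d0 unfolding LIM_def by (auto simp: dist_norm dest!: spec[of _ "norm d"])
  define r where "r = min (s / 2) (1 / 2)"
  have r: "r > 0" "r < s" "r < 1" using s by (auto simp: r_def)
  let ?g = "\<lambda>t. \<sigma> 0 + d * circlepath 0 r t"
  have inner: "\<sigma> 0 \<notin> \<sigma> ` (cball 0 1 - ball 0 r)"
  proof
    assume "\<sigma> 0 \<in> \<sigma> ` (cball 0 1 - ball 0 r)"
    then obtain x where "x \<in> cball 0 1 - ball 0 r" "\<sigma> x = \<sigma> 0" by force
    then show False using inj_onD[OF inj_cball, of x 0] r by auto
  qed
  have "winding_number p (\<sigma> 0) = winding_number (\<sigma> \<circ> circlepath 0 r) (\<sigma> 0)"
    by (rule winding_circle) (use r inner in auto)
  also have "\<dots> = winding_number ?g (\<sigma> 0)"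
  proof (rule winding_number_nearby_loops_eq)
    show "path ?g" unfolding path_def
      by (intro continuous_intros continuous_on_subset[OF path_circlepath[unfolded path_def]]) auto
    show "path (\<sigma> \<circ> circlepath 0 r)" by (rule path_circle_image) (use r in auto)
    fix t :: real
    define h where "h = circlepath 0 r t"
    have h: "norm h = r" using r by (simp add: h_def circlepath norm_mult norm_exp_eq_Re)
    then have h0: "h \<noteq> 0" using r by auto
    have "norm ((\<sigma> h - \<sigma> 0) / h - d) < norm d" using s(2)[OF h0] h r by simp
    then have "norm ((\<sigma> h - \<sigma> 0) / h - d) * norm h < norm d * norm h" using h r by simp
    also have "norm ((\<sigma> h - \<sigma> 0) / h - d) * norm h = norm (\<sigma> h - \<sigma> 0 - d * h)"
    proof -
      have "(v / h - d) * h = v - d * h" for v using h0 by (simp add: left_diff_distrib)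
      then show ?thesis unfolding norm_mult[symmetric] by simp
    qed
    finally show "norm ((\<sigma> \<circ> circlepath 0 r) t - ?g t) < norm (?g t - \<sigma> 0)"
      by (simp add: h_def[symmetric] norm_mult diff_diff_eq)
  qed (auto simp: pathfinish_def pathstart_def circlepath)
  also have "\<dots> = winding_number (\<lambda>t. ?g t - \<sigma> 0) 0" by (rule winding_number_offset)
  \<comment> \<open>An explicit logarithm of the circle, increasing by \<open>2 * pi * \<i>\<close>
    over the unit interval.\<close>
  also have "(\<lambda>t. ?g t - \<sigma> 0) = exp \<circ> (\<lambda>t. Ln (d * of_real r) + 2 * of_real pi * \<i> * of_real t)"
    using d0 r by (auto simp: circlepath exp_add)
  also have "winding_number \<dots> 0 = 1"
    by (subst winding_number_compose_exp) (auto simp: path_def pathfinish_def pathstart_def intro!: continuous_intros)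
  finally show ?thesis .
qed

lemma path_p: "path p" "pathfinish p = pathstart p" "path_image p = range S"
proof -
  show "path p" unfolding p_eq by (rule path_circle_image) auto
  show "pathfinish p = pathstart p" unfolding p_eq by (simp add: pathfinish_def pathstart_def circlepath)
  have "path_image p = \<sigma> ` path_image (circlepath 0 1)" unfolding p_eq by (simp add: path_image_compose)
  then show "path_image p = range S" by (simp add: range_S frontier_D)
qed

lemma D_disjoint: "D \<inter> range S = {}"
  unfolding range_S using D(1) by (auto simp: frontier_def interior_open)

lemma winding_inside:
  assumes "z \<in> D"
  shows "winding_number p z = 1"
proof -
  have "winding_number p constant_on D"
    by (rule winding_number_constant) (use path_p D D_disjoint in auto)
  moreover have "\<sigma> 0 \<in> D" using image by auto
  ultimately show ?thesis using assms winding_center unfolding constant_on_def by metis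
qed

lemma S'_cont: "continuous_on UNIV S'"
proof -
  have "continuous_on UNIV (\<lambda>x. \<sigma>' (cis x))"
    by (rule continuous_on_compose2[OF cont']) (auto intro!: continuous_intros simp: dist_norm)
  then show ?thesis unfolding S'_def[abs_def] by (intro continuous_intros)
qed

lemma S_cont: "continuous_on UNIV S"
  by (meson S_has_deriv continuous_at_imp_continuous_on has_vector_derivative_continuous)

lemma S_index:
  assumes z: "z \<notin> range S"
  shows "((\<lambda>x. S' x / (S x - z)) has_integral (if z \<in> D then 2 * of_real pi * \<i> else 0)) {0..2 * pi}"
proof -
  let ?F = "\<lambda>x. S' x / (S x - z)"
  have cont: "continuous_on UNIV ?F" by (intro continuous_intros S_cont S'_cont) (use z in auto)
  have dp: "(p has_vector_derivative (2 * pi) *\<^sub>R S' (2 * pi * t)) (at t)" for t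
  proof -
    have "((\<lambda>t. 2 * pi * t) has_vector_derivative 2 * pi) (at t)"
      by (auto intro!: derivative_eq_intros simp flip: has_real_derivative_iff_has_vector_derivative)
    from vector_diff_chain_at[OF this S_has_deriv] show ?thesis by (simp add: p_def[abs_def] o_def)
  qed
  have valid: "valid_path p"
    unfolding valid_path_def
  proof (rule C1_differentiable_imp_piecewise)
    show "p C1_differentiable_on {0..1}"
      unfolding C1_differentiable_on_def using dp
      by (intro exI[of _ "\<lambda>t. (2 * pi) *\<^sub>R S' (2 * pi * t)"]) (auto intro!: continuous_intros continuous_on_compose2[OF S'_cont])
  qed
  have wn: "winding_number p z = (if z \<in> D then 1 else 0)"
  proof (cases "z \<in> D")
    case False
    then have "z \<notin> closure D" using z D(1) by (simp add: range_S frontier_def interior_open)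
    then show ?thesis using winding_outside False by simp
  qed (simp add: winding_inside)
  have "((\<lambda>w. 1 / (w - z)) has_contour_integral (2 * pi * \<i> * winding_number p z)) p"
    by (rule has_contour_integral_winding_number[OF valid]) (use z path_p in auto)
  then have "((\<lambda>t. 1 / (p t - z) * vector_derivative p (at t within {0..1})) has_integral (2 * pi * \<i> * winding_number p z)) {0..1}"
    by (simp add: has_contour_integral_def)
  then have A: "((\<lambda>t. (2 * pi) *\<^sub>R ?F (2 * pi * t)) has_integral (2 * pi * \<i> * winding_number p z)) {0..1}"
  proof (rule has_integral_eq[rotated])
    fix t :: real assume "t \<in> {0..1}"
    then have "vector_derivative p (at t within {0..1}) = (2 * pi) *\<^sub>R S' (2 * pi * t)"
      by (intro vector_derivative_at_within_ivl[OF dp]) auto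
    then show "1 / (p t - z) * vector_derivative p (at t within {0..1}) = (2 * pi) *\<^sub>R ?F (2 * pi * t)"
      by (simp add: p_def scaleR_conv_of_real)
  qed
  have "((\<lambda>t. (2 * pi) *\<^sub>R ?F (2 * pi * t)) has_integral (integral {2 * pi * 0..2 * pi * 1} ?F)) {0..1}"
    by (rule has_integral_substitution[where c = 0 and d = "2 * pi" and g = "\<lambda>t. 2 * pi * t"])
       (auto intro!: derivative_eq_intros continuous_on_subset[OF cont])
  then have "integral {0..2 * pi} ?F = 2 * pi * \<i> * winding_number p z"
    using has_integral_unique[OF A] by simp
  moreover have "?F integrable_on {0..2 * pi}" by (intro integrable_continuous_real continuous_on_subset[OF cont]) auto
  ultimately show ?thesis by (auto simp: has_integral_iff wn)
qed

sublocale dini_curve S S' D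
proof
  show "S (x + 2 * pi) = S x" "S' (x + 2 * pi) = S' x" for x by (simp_all add: S_def S'_def cis_mult[symmetric])
  show "(S has_vector_derivative S' x) (at x)" for x by (rule S_has_deriv)
  show "S' x \<noteq> 0" for x using nz[of "cis x"] by (simp add: S'_def dist_norm)
  show "\<exists>k::int. x = y + of_int k * (2 * pi)" if "S x = S y" for x y
    using inj_onD[OF inj_cball, of "cis x" "cis y"] that by (intro cis_eq_cisD) (auto simp: S_def dist_norm)
  show "open D" by (rule D)
  show "frontier D = range S" by (simp add: range_S)
qed (fact S'_log S_index)+

text \<open>Any positively oriented smooth parametrization of the boundary is \<open>S \<circ> h\<close> for a lift \<open>h\<close>; the
  winding number shows that \<open>h\<close> increases by exactly \<open>2 \<pi>\<close>.\<close>

lemma reparametrization: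
  assumes \<gamma>: "path \<gamma>" "pathfinish \<gamma> = pathstart \<gamma>" "path_image \<gamma> = frontier D"
    and d\<gamma>: "continuous_on {0..1} \<gamma>'" "\<And>t. t \<in> {0..1} \<Longrightarrow> (\<gamma> has_vector_derivative \<gamma>' t) (at t within {0..1})"
    and wn: "\<And>z. z \<in> D \<Longrightarrow> winding_number \<gamma> z = 1"
  obtains h h' where "\<And>t. t \<in> {0..1} \<Longrightarrow> \<gamma> t = S (h t)" "continuous_on {0..1} h"
    "\<And>t. t \<in> {0..1} \<Longrightarrow> (h has_field_derivative h' t) (at t within {0..1})"
    "\<And>t. t \<in> {0..1} \<Longrightarrow> \<gamma>' t = h' t *\<^sub>R S' (h t)" "h 1 = h 0 + 2 * pi"
proof -
  have \<gamma>D: "\<gamma> t \<in> frontier D" if "t \<in> {0..1}" for t using \<gamma>(3) that by (auto simp: path_image_def)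
  have \<rho>: "continuous_on (closure D) \<rho>" "\<And>x. x \<in> cball 0 1 \<Longrightarrow> \<rho> (\<sigma> x) = x" using homeo by (auto simp: homeomorphism_def)
  have \<rho>\<gamma>: "norm (\<rho> (\<gamma> t)) = 1" "\<sigma> (\<rho> (\<gamma> t)) = \<gamma> t" if t: "t \<in> {0..1}" for t
  proof -
    obtain x where "x \<in> sphere 0 1" "\<gamma> t = \<sigma> x" using \<gamma>D[OF t] unfolding frontier_D by auto
    then show "norm (\<rho> (\<gamma> t)) = 1" "\<sigma> (\<rho> (\<gamma> t)) = \<gamma> t" using \<rho>(2)[of x] by auto
  qed
  have "continuous_on {0..1} (\<lambda>t. \<rho> (\<gamma> t))"
    by (rule continuous_on_compose2[OF \<rho>(1) \<gamma>(1)[unfolded path_def]]) (use \<gamma>D in \<open>auto simp: frontier_def\<close>)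
  moreover have "contractible {0..1::real}" by (intro convex_imp_contractible) auto
  moreover have "\<rho> (\<gamma> t) \<noteq> 0" if "t \<in> {0..1}" for t using \<rho>\<gamma>(1)[OF that] by auto
  \<comment> \<open>The imaginary part of a continuous logarithm of the curve, pulled back to the
    unit circle, is the lift; the real part is 0 since the pulled back curve has modulus 1.\<close>
  ultimately obtain g where g: "continuous_on {0..1} g" "\<And>t. t \<in> {0..1} \<Longrightarrow> \<rho> (\<gamma> t) = exp (g t)"
    using continuous_logarithm_on_contractible by metis
  define h where "h = (\<lambda>t. Im (g t))"
  have ch: "continuous_on {0..1} h" unfolding h_def by (intro continuous_intros g)
  have \<gamma>h: "\<gamma> t = S (h t)" if t: "t \<in> {0..1}" for t
  proof -
    have "norm (exp (g t)) = 1" using \<rho>\<gamma>(1)[OF t] g(2)[OF t] by simp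
    then have "Re (g t) = 0" by simp
    then have "exp (g t) = cis (h t)" by (simp add: exp_eq_polar h_def)
    then show ?thesis using \<rho>\<gamma>(2)[OF t] g(2)[OF t] by (simp add: S_def)
  qed
  define h' where "h' = (\<lambda>t. Re (\<gamma>' t / S' (h t)))"
  have dh: "(h has_field_derivative h' t) (at t within {0..1}) \<and> \<gamma>' t = h' t *\<^sub>R S' (h t)" if t: "t \<in> {0..1}" for t
  proof -
    \<comment> \<open>The difference quotient of \<open>S\<close> at \<open>h t\<close>, completed
      by its limit. With it \<open>\<gamma> s - \<gamma> t\<close> equals \<open>h s - h t\<close>
      times \<open>q (h s)\<close> even if \<open>h s = h t\<close>, so dividing by
      \<open>q (h s)\<close> isolates the difference quotient of \<open>h\<close>.\<close>
    define q where "q = (\<lambda>u. if u = h t then S' (h t) else (S u - S (h t)) /\<^sub>R (u - h t))"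
    have q: "isCont q (h t)"
    proof -
      have "((\<lambda>u. (S u - S (h t)) /\<^sub>R (u - h t)) \<longlongrightarrow> S' (h t)) (at (h t))"
        by (rule has_vector_derivative_within_imp_tendsto[OF S_has_deriv])
      then have "(q \<longlongrightarrow> S' (h t)) (at (h t))"
        by (rule Lim_transform_eventually) (auto simp: eventually_at_filter q_def)
      then show ?thesis by (simp add: isCont_def q_def)
    qed
    have "(h \<longlongrightarrow> h t) (at t within {0..1})" using ch t by (simp add: continuous_on_def)
    then have qh: "((\<lambda>s. q (h s)) \<longlongrightarrow> S' (h t)) (at t within {0..1})"
      using isCont_tendsto_compose[OF q] by (simp add: q_def)
    have "((\<lambda>s. ((\<gamma> s - \<gamma> t) /\<^sub>R (s - t)) / q (h s)) \<longlongrightarrow> \<gamma>' t / S' (h t)) (at t within {0..1})"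
      by (intro tendsto_divide has_vector_derivative_within_imp_tendsto d\<gamma>(2) t qh S'_nonzero)
    then have lim: "((\<lambda>s. of_real ((h s - h t) / (s - t))) \<longlongrightarrow> \<gamma>' t / S' (h t)) (at t within {0..1})"
    proof (rule Lim_transform_eventually)
      have "\<forall>\<^sub>F s in at t within {0..1}. q (h s) \<noteq> 0"
        using qh S'_nonzero by (rule tendsto_imp_eventually_ne)
      moreover have "\<forall>\<^sub>F s in at t within {0..1}. s \<in> {0..1} \<and> s \<noteq> t" by (simp add: eventually_at_filter)
      ultimately show "\<forall>\<^sub>F s in at t within {0..1}. ((\<gamma> s - \<gamma> t) /\<^sub>R (s - t)) / q (h s) = of_real ((h s - h t) / (s - t))"
      proof eventually_elim
        case (elim s)
        have "\<gamma> s - \<gamma> t = (h s - h t) *\<^sub>R q (h s)"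
          using elim \<gamma>h[of s] \<gamma>h[OF t] by (simp add: q_def)
        then have "((\<gamma> s - \<gamma> t) /\<^sub>R (s - t)) = ((h s - h t) / (s - t)) *\<^sub>R q (h s)"
          by (simp add: divide_inverse mult.commute)
        then show ?case using elim by (simp add: scaleR_conv_of_real)
      qed
    qed
    have nb: "at t within {0..1} \<noteq> bot" using t by (auto simp: trivial_limit_within islimpt_Icc)
    have "((\<lambda>s. Im (of_real ((h s - h t) / (s - t)))) \<longlongrightarrow> Im (\<gamma>' t / S' (h t))) (at t within {0..1})"
      by (rule tendsto_Im[OF lim])
    \<comment> \<open>A limit of real numbers is real: the velocity of \<open>\<gamma>\<close> is a
      real multiple of the tangent \<open>S' (h t)\<close>.\<close>
    then have "Im (\<gamma>' t / S' (h t)) = 0" using tendsto_unique[OF nb _ tendsto_const[of "0::real"]] by auto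
    then have "\<gamma>' t / S' (h t) = of_real (h' t)" by (simp add: h'_def complex_eq_iff)
    then have "\<gamma>' t = h' t *\<^sub>R S' (h t)" using S'_nonzero[of "h t"] by (simp add: scaleR_conv_of_real divide_eq_eq)
    moreover have "((\<lambda>s. (h s - h t) / (s - t)) \<longlongrightarrow> h' t) (at t within {0..1})"
      using tendsto_Re[OF lim] by (simp add: h'_def)
    ultimately show ?thesis by (simp add: has_field_derivative_iff)
  qed
  have "S (h 1) = S (h 0)" using \<gamma>h[of 0] \<gamma>h[of 1] \<gamma>(2) by (simp add: pathfinish_def pathstart_def)
  then obtain n :: int where n: "h 1 = h 0 + of_int n * (2 * pi)" using S_inj by blast
  obtain z where z: "z \<in> D" using D(3) by blast
  then have zS: "z \<notin> range S" using D_disjoint by blast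
  let ?F = "\<lambda>x. S' x / (S x - z)"
  have cF: "continuous_on UNIV ?F" by (intro continuous_intros S_cont S'_cont) (use zS in auto)
  have pF: "?F (x + 2 * pi) = ?F x" for x by (simp add: S_periodic S'_periodic)
  have IF: "integral {0..2 * pi} ?F = 2 * of_real pi * \<i>" using S_index[OF zS] z by (simp add: integral_unique)
  have valid: "valid_path \<gamma>"
    unfolding valid_path_def piecewise_C1_differentiable_on_def
  proof (intro conjI exI[of _ "{0, 1::real}"])
    show "continuous_on {0..1} \<gamma>" using \<gamma>(1) by (simp add: path_def)
    show "\<gamma> C1_differentiable_on {0..1} - {0, 1}"
      unfolding C1_differentiable_on_def
    proof (intro exI[of _ \<gamma>'] conjI ballI)
      fix t :: real assume t: "t \<in> {0..1} - {0, 1}"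
      then have "t \<in> interior {0..1}" by auto
      then have "at t within {0..1} = at t" by (rule at_within_interior)
      then show "(\<gamma> has_vector_derivative \<gamma>' t) (at t)" using d\<gamma>(2)[of t] t by auto
    qed (auto intro: continuous_on_subset[OF d\<gamma>(1)])
  qed simp
  have "((\<lambda>w. 1 / (w - z)) has_contour_integral (2 * pi * \<i> * winding_number \<gamma> z)) \<gamma>"
    by (rule has_contour_integral_winding_number[OF valid]) (use zS \<gamma>(3) D_frontier in auto)
  then have "((\<lambda>t. 1 / (\<gamma> t - z) * vector_derivative \<gamma> (at t within {0..1})) has_integral (2 * pi * \<i>)) {0..1}"
    by (simp add: has_contour_integral_def wn[OF z])
  then have A: "((\<lambda>t. h' t *\<^sub>R ?F (h t)) has_integral (2 * pi * \<i>)) {0..1}"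
  proof (rule has_integral_eq[rotated])
    fix t :: real assume t: "t \<in> {0..1}"
    then have "vector_derivative \<gamma> (at t within {0..1}) = h' t *\<^sub>R S' (h t)"
      using vector_derivative_within_cbox[of 0 1 t \<gamma> "\<gamma>' t"] d\<gamma>(2)[OF t] t dh[OF t] by simp
    then show "1 / (\<gamma> t - z) * vector_derivative \<gamma> (at t within {0..1}) = h' t *\<^sub>R ?F (h t)"
      using \<gamma>h[OF t] by (simp add: scaleR_conv_of_real)
  qed
  obtain R where R: "\<And>t. t \<in> {0..1} \<Longrightarrow> \<bar>h t\<bar> \<le> R"
  proof -
    have "bounded (h ` {0..1})" by (rule compact_imp_bounded[OF compact_continuous_image[OF ch]]) simp
    then obtain B where "\<And>y. y \<in> h ` {0..1} \<Longrightarrow> norm y \<le> B" unfolding bounded_iff by blast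
    then show ?thesis using that[of B] by simp
  qed
  \<comment> \<open>The difference is the oriented integral from \<open>h 0\<close> to
    \<open>h 1\<close>: over an interval with reversed end points the integral is 0. Monotonicity of
    \<open>h\<close> does not enter.\<close>
  have "((\<lambda>t. h' t *\<^sub>R ?F (h t)) has_integral (integral {h 0..h 1} ?F - integral {h 1..h 0} ?F)) {0..1}"
  proof (rule has_integral_substitution_general[where s = "{}" and c = "- R" and d = R])
    have "h t \<in> {- R..R}" if "t \<in> {0..1}" for t using R[OF that] by (simp add: abs_le_iff minus_le_iff)
    then show "h ` {0..1} \<subseteq> {- R..R}" by blast
    show "continuous_on {- R..R} ?F" by (rule continuous_on_subset[OF cF]) simp
  qed (use ch dh in auto)
  then have eq: "integral {h 0..h 1} ?F - integral {h 1..h 0} ?F = 2 * pi * \<i>"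
    using has_integral_unique[OF A] by simp
  \<comment> \<open>Each period contributes \<open>2 * pi * \<i>\<close>, so the number
    \<open>n\<close> of periods covered by \<open>h\<close> is the winding number of
    \<open>\<gamma>\<close> about \<open>z\<close>, which positive orientation makes 1.\<close>
  have "integral {h 0..h 1} ?F - integral {h 1..h 0} ?F = of_int n * (2 * pi * \<i>)"
  proof (cases "n \<ge> 0")
    case True
    have "h 1 = h 0 + real (nat n) * (2 * pi)" using n True by simp
    then have "integral {h 0..h 1} ?F = of_nat (nat n) * (2 * pi * \<i>)"
      using periodic_integral_multiple[of ?F "h 0" "nat n", OF pF cF] IF by simp
    moreover have "integral {h 1..h 0} ?F = 0"
    proof -
      have "h 0 \<le> h 1" using n True by simp
      then show ?thesis by (cases "h 0 = h 1") auto
    qed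
    ultimately show ?thesis using True by simp
  next
    case False
    have "h 0 = h 1 + real (nat (- n)) * (2 * pi)" using n False by simp
    then have "integral {h 1..h 0} ?F = of_nat (nat (- n)) * (2 * pi * \<i>)"
      using periodic_integral_multiple[of ?F "h 1" "nat (- n)", OF pF cF] IF by simp
    moreover have "integral {h 0..h 1} ?F = 0"
    proof -
      have "h 1 < h 0" using n False by (simp add: mult_neg_pos)
      then show ?thesis by simp
    qed
    ultimately show ?thesis using False by simp
  qed
  then have "of_int n * (2 * pi * \<i>) = 1 * (2 * pi * \<i>)" using eq by simp
  then have "of_int n = (1::complex)" by (subst (asm) mult_right_cancel) auto
  then have "n = 1" by simp
  with that[OF \<gamma>h ch] dh n show ?thesis by auto
qed

end

section \<open>Limits on the biharmonic plane and continuity on the compactified line\<close>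

lemma tendsto_zet_within_iff:
  "((\<lambda>\<zeta>. F \<zeta>) \<longlongrightarrow> L) (at (zet z) within zet ` A) \<longleftrightarrow> ((\<lambda>x. F (zet x)) \<longlongrightarrow> L) (at z within A)"
proof -
  have "(\<forall>\<^sub>F \<zeta> in at (zet z) within zet ` A. Q \<zeta>) \<longleftrightarrow> (\<forall>\<^sub>F x in at z within A. Q (zet x))" for Q :: "biharm \<Rightarrow> bool"
    unfolding eventually_at by auto
  then show ?thesis unfolding tendsto_def by simp
qed

lemma tendsto_zet_infinity_iff:
  "((\<lambda>\<zeta>. F \<zeta>) \<longlongrightarrow> L) (inf at_infinity (principal mu)) \<longleftrightarrow> ((\<lambda>x. F (zet x)) \<longlongrightarrow> L) at_infinity"
proof -
  have "(\<forall>\<^sub>F \<zeta> in inf at_infinity (principal mu). Q \<zeta>) \<longleftrightarrow> (\<forall>\<^sub>F x in at_infinity. Q (zet x))" for Q :: "biharm \<Rightarrow> bool"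
    unfolding eventually_inf_principal eventually_at_infinity mu_eq
    by (intro arg_cong[where f = Ex] ext) (auto simp del: split_paired_All)
  then show ?thesis unfolding tendsto_def by simp
qed

lemma continuous_on_zet_image_iff:
  "continuous_on (zet ` A) F \<longleftrightarrow> continuous_on A (\<lambda>x. F (zet x))"
  unfolding continuous_on_def by (simp add: tendsto_zet_within_iff)

text \<open>The neighbourhoods of \<open>None\<close> are the complements of compact sets of reals,
  that is, they contain all numbers of large modulus.\<close>

lemma C_Rbar_iff:
  "g \<in> C_Rbar \<longleftrightarrow> continuous_on UNIV (\<lambda>s. g (Some s)) \<and> ((\<lambda>s. g (Some s)) \<longlongrightarrow> g None) at_infinity"
proof
  assume "g \<in> C_Rbar"
  then have "continuous_map (Alexandroff_compactification euclideanreal) euclideanreal g" by (simp add: C_Rbar_def)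
  moreover have "{x \<in> topspace (Alexandroff_compactification euclideanreal). g x \<in> V} = g -` V" for V
    by auto (metis not_Some_eq rangeI)
  ultimately have pre: "openin (Alexandroff_compactification euclideanreal) (g -` V)" if "open V" for V
    using that unfolding continuous_map_def by (metis open_openin)
  have "open ((\<lambda>s. g (Some s)) -` V)" if "open V" for V
    using pre[OF that] unfolding openin_Alexandroff_compactification
  proof (elim disjE exE conjE)
    fix U assume "openin euclideanreal U" "g -` V = Some ` U"
    moreover from this(2) have "(\<lambda>s. g (Some s)) -` V = U" by auto
    ultimately show ?thesis by simp
  next
    fix C assume "closedin euclideanreal C" "g -` V = insert None (Some ` (topspace euclideanreal - C))"
    moreover from this(2) have "(\<lambda>s. g (Some s)) -` V = - C" by auto
    ultimately show ?thesis by (simp add: open_Compl)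
  qed
  then have "continuous_on UNIV (\<lambda>s. g (Some s))" by (simp add: continuous_on_open_vimage)
  moreover have "((\<lambda>s. g (Some s)) \<longlongrightarrow> g None) at_infinity"
  proof (rule topological_tendstoI)
    fix V assume V: "open V" "g None \<in> V"
    from pre[OF V(1)] show "\<forall>\<^sub>F s in at_infinity. g (Some s) \<in> V"
      unfolding openin_Alexandroff_compactification
    proof (elim disjE exE conjE)
      fix U assume "g -` V = Some ` U"
      then show ?thesis using V(2) by auto
    next
      fix C assume C: "compactin euclideanreal C" "g -` V = insert None (Some ` (topspace euclideanreal - C))"
      then obtain B where B: "\<And>x. x \<in> C \<Longrightarrow> norm x \<le> B"
        using compact_imp_bounded[of C] by (auto simp: bounded_iff)
      have "g (Some s) \<in> V" if "B + 1 \<le> norm s" for s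
      proof -
        have "s \<notin> C" using B[of s] that by auto
        then have "Some s \<in> g -` V" using C(2) by auto
        then show ?thesis by simp
      qed
      then show ?thesis unfolding eventually_at_infinity by blast
    qed
  qed
  ultimately show "continuous_on UNIV (\<lambda>s. g (Some s)) \<and> ((\<lambda>s. g (Some s)) \<longlongrightarrow> g None) at_infinity" ..
next
  assume g: "continuous_on UNIV (\<lambda>s. g (Some s)) \<and> ((\<lambda>s. g (Some s)) \<longlongrightarrow> g None) at_infinity"
  have "openin (Alexandroff_compactification euclideanreal) (g -` V)" if V: "open V" for V
  proof -
    have op: "open ((\<lambda>s. g (Some s)) -` V)" using g V by (simp add: continuous_on_open_vimage)
    show ?thesis
    proof (cases "g None \<in> V")
      case False
      have "g -` V = Some ` ((\<lambda>s. g (Some s)) -` V)"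
      proof (rule set_eqI)
        fix x show "x \<in> g -` V \<longleftrightarrow> x \<in> Some ` ((\<lambda>s. g (Some s)) -` V)" using False by (cases x) auto
      qed
      then show ?thesis using op by simp
    next
      case True
      let ?C = "- ((\<lambda>s. g (Some s)) -` V)"
      have "\<forall>\<^sub>F s in at_infinity. g (Some s) \<in> V" by (rule topological_tendstoD[OF conjunct2[OF g] V True])
      then obtain B where "\<And>s. B \<le> norm s \<Longrightarrow> g (Some s) \<in> V" unfolding eventually_at_infinity by blast
      then have "norm s \<le> B" if "s \<in> ?C" for s using that by (meson ComplD linear vimageI)
      then have "bounded ?C" unfolding bounded_iff by blast
      moreover have "closed ?C" using op by (simp add: closed_Compl)
      ultimately have C: "compact ?C" "closed ?C" by (auto simp: compact_eq_bounded_closed)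
      have "g -` V = insert None (Some ` (topspace euclideanreal - ?C))"
      proof (rule set_eqI)
        fix x show "x \<in> g -` V \<longleftrightarrow> x \<in> insert None (Some ` (topspace euclideanreal - ?C))" using True by (cases x) auto
      qed
      then show ?thesis unfolding openin_Alexandroff_compactification using C
        by (intro disjI2 exI[of _ ?C]) simp
    qed
  qed
  moreover have "{x \<in> topspace (Alexandroff_compactification euclideanreal). g x \<in> V} = g -` V" for V
    by auto (metis not_Some_eq rangeI)
  ultimately show "g \<in> C_Rbar"
    unfolding C_Rbar_def continuous_map_def mem_Collect_eq by (simp only: open_openin[symmetric] topspace_euclidean) simp
qed

subsection \<open>The angular variable on the real line\<close>

text \<open>The angle in \<open>(0, 2 * pi)\<close> of the Cayley image
  \<open>(s - \<i>) / (s + \<i>)\<close>. Both ends of the line go to the ends of the period, hence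
  to the same point of the circle.\<close>

definition ang :: "real \<Rightarrow> real" where "ang s = pi + 2 * arctan s"

lemma ang_deriv: "(ang has_field_derivative 2 / (1 + s\<^sup>2)) (at s within A)"
  unfolding ang_def by (auto intro!: derivative_eq_intros simp: divide_inverse)

lemma ang_bounds: "0 < ang s" "ang s < 2 * pi"
  using arctan_bounded[of s] by (auto simp: ang_def)

lemma inj_ang: "inj ang" by (auto simp: inj_def ang_def arctan_eq_iff)

lemma range_ang: "range ang = {0<..<2 * pi}"
proof -
  have "x \<in> range ang" if "0 < x" "x < 2 * pi" for x
  proof -
    have "ang (tan ((x - pi) / 2)) = x"
      using arctan_tan[of "(x - pi) / 2"] that by (simp add: ang_def field_simps)
    then show ?thesis by (metis rangeI)
  qed
  then show ?thesis using ang_bounds by auto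
qed

lemma ang_continuous: "continuous_on A ang"
  unfolding ang_def by (intro continuous_intros)

lemma cis_ang: "cis (ang s) = (of_real s - \<i>) / (of_real s + \<i>)"
proof -
  have 1: "cis (arctan s) = (1 + \<i> * of_real s) / of_real (sqrt (1 + s\<^sup>2))"
    by (simp add: complex_eq_iff cos_arctan sin_arctan)
  have sq: "(of_real (sqrt (1 + s\<^sup>2)) :: complex)\<^sup>2 = of_real (1 + s\<^sup>2)"
    by (simp flip: of_real_power add: add_nonneg_nonneg)
  have n: "(of_real s + \<i> :: complex) \<noteq> 0" "(1 + s\<^sup>2 :: real) \<noteq> 0"
    by (auto simp: complex_eq_iff) (metis add_pos_nonneg less_irrefl zero_le_power2 zero_less_one)
  have "cis (ang s) = cis pi * (cis (arctan s))\<^sup>2"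
    by (simp only: ang_def cis_mult power2_eq_square mult_2)
  also have "\<dots> = - (1 + \<i> * of_real s)\<^sup>2 / of_real (1 + s\<^sup>2)"
    unfolding 1 power_divide sq by simp
  also have "\<dots> = (of_real s - \<i>) / (of_real s + \<i>)"
  proof -
    have "of_real (1 + s\<^sup>2) = (of_real s + \<i>) * (of_real s - \<i> :: complex)" by (simp add: algebra_simps power2_eq_square)
    moreover have "- (1 + \<i> * of_real s)\<^sup>2 = (of_real s - \<i> :: complex) * (of_real s - \<i>)"
      by (simp add: algebra_simps power2_eq_square)
    moreover have "(of_real s - \<i> :: complex) \<noteq> 0" by (simp add: complex_eq_iff)
    ultimately show ?thesis by simp
  qed
  finally show ?thesis .
qed

text \<open>The singular kernels are merely integrable, so the substitution is the one for
  absolutely integrable functions. Borel measurability of the integrand brings the result from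
  Lebesgue measure back to \<open>lborel\<close>.\<close>

lemma integral_ang:
  fixes F :: "real \<Rightarrow> real"
  assumes F: "set_integrable lborel {0..2 * pi} F" and [measurable]: "F \<in> borel_measurable borel"
  shows "integrable lborel (\<lambda>s. 2 / (1 + s\<^sup>2) * F (ang s))"
    and "(LINT s|lborel. 2 / (1 + s\<^sup>2) * F (ang s)) = (LINT x:{0..2 * pi}|lborel. F x)"
proof -
  have [measurable]: "ang \<in> borel_measurable borel" using ang_continuous by (rule borel_measurable_continuous_onI)
  have Fo: "set_integrable lborel {0<..<2 * pi} F" by (rule set_integrable_subset[OF F]) auto
  have ab: "F absolutely_integrable_on {0<..<2 * pi}"
    using Fo unfolding set_integrable_def by (subst integrable_completion) auto
  have pos: "\<bar>2 / (1 + s\<^sup>2)\<bar> = 2 / (1 + s\<^sup>2)" for s :: real by (simp add: add_nonneg_nonneg)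
  have cv: "(\<lambda>s. 2 / (1 + s\<^sup>2) * F (ang s)) absolutely_integrable_on UNIV \<and>
     integral UNIV (\<lambda>s. 2 / (1 + s\<^sup>2) * F (ang s)) = integral {0<..<2 * pi} F"
    using has_absolute_integral_change_of_variables_1'[of UNIV ang "\<lambda>s. 2 / (1 + s\<^sup>2)" F "integral {0<..<2 * pi} F"]
      ang_deriv inj_ang ab unfolding pos range_ang by simp
  have meas: "(\<lambda>s. 2 / (1 + s\<^sup>2) * F (ang s)) \<in> borel_measurable lborel" by measurable
  have "integrable (completion lborel) (\<lambda>s. 2 / (1 + s\<^sup>2) * F (ang s))"
    using cv by (simp add: set_integrable_def)
  then show i: "integrable lborel (\<lambda>s. 2 / (1 + s\<^sup>2) * F (ang s))"
    by (subst (asm) integrable_completion[OF meas])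
  have "(LINT s|lborel. 2 / (1 + s\<^sup>2) * F (ang s)) = integral UNIV (\<lambda>s. 2 / (1 + s\<^sup>2) * F (ang s))"
    using has_integral_integral_lborel[OF i] by (simp add: integral_unique)
  also have "\<dots> = integral {0..2 * pi} F" using cv by (simp add: integral_open_interval_real)
  also have "\<dots> = (LINT x:{0..2 * pi}|lborel. F x)" using set_borel_integral_eq_integral(2)[OF F] by simp
  finally show "(LINT s|lborel. 2 / (1 + s\<^sup>2) * F (ang s)) = (LINT x:{0..2 * pi}|lborel. F x)" .
qed

text \<open>On the circle, the point at infinity corresponds to the angles with \<open>sin (x / 2) = 0\<close>.\<close>

definition circ :: "(real option \<Rightarrow> real) \<Rightarrow> real \<Rightarrow> real" where
  "circ g x = (if sin (x / 2) = 0 then g None else g (Some (- cos (x / 2) / sin (x / 2))))"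

lemma circ_periodic: "circ g (x + 2 * pi) = circ g x"
  by (simp add: circ_def add_divide_distrib)

lemma circ_ang: "circ g (ang s) = g (Some s)"
proof -
  have a: "ang s / 2 = arctan s + pi / 2" by (simp add: ang_def add_divide_distrib)
  have "sin (ang s / 2) = cos (arctan s)" "cos (ang s / 2) = - sin (arctan s)"
    unfolding a by (simp_all add: sin_add cos_add)
  moreover have "cos (arctan s) \<noteq> 0" by (rule cos_arctan_not_zero)
  moreover have "sin (arctan s) / cos (arctan s) = s" using tan_arctan[of s] by (simp add: tan_def)
  ultimately show ?thesis by (simp add: circ_def)
qed

lemma circ_continuous:
  assumes g: "g \<in> C_Rbar"
  shows "continuous_on UNIV (circ g)"
proof -
  have gc: "isCont (\<lambda>s. g (Some s)) s" and gl: "((\<lambda>s. g (Some s)) \<longlongrightarrow> g None) at_infinity" for s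
    using g by (auto simp: C_Rbar_iff continuous_on_eq_continuous_at)
  have "isCont (circ g) x" for x
  proof (cases "sin (x / 2) = 0")
    case False
    have op: "open {y :: real. sin (y / 2) \<noteq> 0}" by (intro open_Collect_neq continuous_intros) auto
    have "isCont (\<lambda>y. g (Some (- cos (y / 2) / sin (y / 2)))) x"
      by (rule isCont_o2[OF _ gc]) (use False in simp)
    moreover have "\<forall>\<^sub>F y in nhds x. sin (y / 2) \<noteq> 0"
      using eventually_nhds_in_open[OF op, of x] False by simp
    then have "\<forall>\<^sub>F y in nhds x. circ g y = g (Some (- cos (y / 2) / sin (y / 2)))"
      by eventually_elim (simp add: circ_def)
    ultimately show ?thesis using isCont_cong by fast
  next
    case True
    have c: "- cos (x / 2) \<noteq> 0" using True sin_cos_squared_add[of "x / 2"] by auto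
    have "((\<lambda>y. circ g y) \<longlongrightarrow> g None) (at x)"
    proof (rule topological_tendstoI)
      fix V assume V: "open V" "g None \<in> V"
      then obtain B where B: "\<And>s. B \<le> norm s \<Longrightarrow> g (Some s) \<in> V"
        using topological_tendstoD[OF gl V] unfolding eventually_at_infinity by blast
      \<comment> \<open>The limit is positive because sine and cosine do not vanish together; near
        \<open>x\<close> the quotient of cosine and sine therefore has modulus at least
        \<open>\<bar>B\<bar>\<close>.\<close>
      have l1: "((\<lambda>y. norm (cos (y / 2)) - \<bar>B\<bar> * norm (sin (y / 2))) \<longlongrightarrow> norm (cos (x / 2)) - \<bar>B\<bar> * norm (sin (x / 2))) (at x)"
        by (intro tendsto_intros) simp_all
      have "\<forall>\<^sub>F y in at x. 0 < norm (cos (y / 2)) - \<bar>B\<bar> * norm (sin (y / 2))"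
        by (rule order_tendstoD(1)[OF l1]) (use True c in simp)
      then show "\<forall>\<^sub>F y in at x. circ g y \<in> V"
      proof eventually_elim
        case (elim y)
        show ?case
        proof (cases "sin (y / 2) = 0")
          case False
          then have "\<bar>B\<bar> \<le> norm (- cos (y / 2) / sin (y / 2))" using elim by (simp add: field_simps)
          then show ?thesis using False B by (simp add: circ_def)
        qed (use V in \<open>simp add: circ_def\<close>)
      qed
    qed
    moreover have "circ g x = g None" using True by (simp add: circ_def)
    ultimately show ?thesis by (simp add: isCont_def)
  qed
  then show ?thesis by (simp add: continuous_on_eq_continuous_at)
qed

text \<open>The limits at the two ends of the line are \<open>f (2 * pi)\<close> and
  \<open>f 0\<close>, which periodicity identifies.\<close>

lemma C_Rbar_of_circle:
  assumes per: "\<And>x. f (x + 2 * pi) = f x" and cont: "continuous_on UNIV (f :: real \<Rightarrow> real)"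
  shows "case_option (f 0) (\<lambda>s. f (ang s)) \<in> C_Rbar"
proof -
  have fc: "isCont f x" for x using cont by (simp add: continuous_on_eq_continuous_at)
  have "((\<lambda>s. f (ang s)) \<longlongrightarrow> f (pi + 2 * (pi / 2))) at_top"
    unfolding ang_def by (intro isCont_tendsto_compose[OF fc] tendsto_intros tendsto_arctan_at_top)
  moreover have "((\<lambda>s. f (ang s)) \<longlongrightarrow> f (pi + 2 * (- (pi / 2)))) at_bot"
    unfolding ang_def by (intro isCont_tendsto_compose[OF fc] tendsto_intros tendsto_arctan_at_bot)
  ultimately have "((\<lambda>s. f (ang s)) \<longlongrightarrow> f 0) at_infinity"
    using per[of 0] by (simp add: at_infinity_eq_at_top_bot filterlim_sup)
  moreover have "continuous_on UNIV (\<lambda>s. f (ang s))" by (rule continuous_on_compose2[OF cont ang_continuous]) simp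
  ultimately show ?thesis by (simp add: C_Rbar_iff)
qed

section \<open>The integral system and the Cauchy type integral in the angular variable\<close>

lemma bmult_scaleR_right: "a \<odot> (r *\<^sub>R b) = r *\<^sub>R (a \<odot> b)"
  by (simp add: bmult_def scaleR_conv_of_real algebra_simps)

context dini_curve
begin

lemma T_periodic:
  assumes "\<And>x. g (x + 2 * pi) = g x"
  shows "T g m (t + 2 * pi) = T g m t"
proof -
  have a: "t + 2 * pi + u = (t + u) + 2 * pi" for u by simp
  show ?thesis unfolding T_def a K_periodic assms ..
qed

lemma integral_ang_kernel:
  assumes m: "good_multiplier m" and \<phi>: "\<And>x. \<phi> (x + 2 * pi) = \<phi> x" "continuous_on UNIV (\<phi> :: real \<Rightarrow> real)"
  shows "integrable lborel (\<lambda>s. 2 / (1 + s\<^sup>2) * (\<phi> (ang s) * Re (K m t (ang s))))"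
    and "(LINT s|lborel. 2 / (1 + s\<^sup>2) * (\<phi> (ang s) * Re (K m t (ang s)))) = Re (T (\<lambda>x. of_real (\<phi> x)) m t)"
    and "integrable lborel (\<lambda>s. 2 / (1 + s\<^sup>2) * (\<phi> (ang s) * Im (K m t (ang s))))"
    and "(LINT s|lborel. 2 / (1 + s\<^sup>2) * (\<phi> (ang s) * Im (K m t (ang s)))) = Im (T (\<lambda>x. of_real (\<phi> x)) m t)"
proof -
  let ?F = "\<lambda>x. of_real (\<phi> x) * K m t x"
  have p: "(of_real (\<phi> (x + 2 * pi)) :: complex) = of_real (\<phi> x)" for x by (simp add: \<phi>)
  have c: "continuous_on UNIV (\<lambda>x. of_real (\<phi> x) :: complex)" by (intro continuous_intros \<phi>)
  obtain B where B: "\<And>x. norm (of_real (\<phi> x) :: complex) \<le> B"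
    using bounded_range_periodic[of "\<lambda>x. of_real (\<phi> x) :: complex", OF p c] by (auto simp: bounded_iff)
  have [measurable]: "\<phi> \<in> borel_measurable borel" "K m t \<in> borel_measurable borel"
    using \<phi> K_measurable[OF m] by (auto intro: borel_measurable_continuous_onI)
  have perF: "?F (x + 2 * pi) = ?F x" for x by (simp add: \<phi> K_periodic)
  have i0: "set_integrable lborel {-pi..pi} (\<lambda>u. ?F (t + u))"
    by (rule T_bound(1)[OF m B borel_measurable_continuous_onI[OF c]])
  have i: "set_integrable lborel {0..2 * pi} ?F" and e: "(LINT x:{0..2 * pi}|lborel. ?F x) = T (\<lambda>x. of_real (\<phi> x)) m t"
    using periodic_uncentered_integral[of ?F t 0, OF perF i0] by (simp_all add: T_def)
  have re: "set_integrable lborel {0..2 * pi} (\<lambda>x. \<phi> x * Re (K m t x))"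
    "(LINT x:{0..2 * pi}|lborel. \<phi> x * Re (K m t x)) = Re (T (\<lambda>x. of_real (\<phi> x)) m t)"
    using integrable_Re[OF i[unfolded set_integrable_def]] integral_Re[OF i[unfolded set_integrable_def]] e
    by (simp_all add: set_integrable_def set_lebesgue_integral_def)
  have im: "set_integrable lborel {0..2 * pi} (\<lambda>x. \<phi> x * Im (K m t x))"
    "(LINT x:{0..2 * pi}|lborel. \<phi> x * Im (K m t x)) = Im (T (\<lambda>x. of_real (\<phi> x)) m t)"
    using integrable_Im[OF i[unfolded set_integrable_def]] integral_Im[OF i[unfolded set_integrable_def]] e
    by (simp_all add: set_integrable_def set_lebesgue_integral_def)
  show "integrable lborel (\<lambda>s. 2 / (1 + s\<^sup>2) * (\<phi> (ang s) * Re (K m t (ang s))))"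
    "(LINT s|lborel. 2 / (1 + s\<^sup>2) * (\<phi> (ang s) * Re (K m t (ang s)))) = Re (T (\<lambda>x. of_real (\<phi> x)) m t)"
    using integral_ang[OF re(1)] re(2) by simp_all
  show "integrable lborel (\<lambda>s. 2 / (1 + s\<^sup>2) * (\<phi> (ang s) * Im (K m t (ang s))))"
    "(LINT s|lborel. 2 / (1 + s\<^sup>2) * (\<phi> (ang s) * Im (K m t (ang s)))) = Im (T (\<lambda>x. of_real (\<phi> x)) m t)"
    using integral_ang[OF im(1)] im(2) by simp_all
qed

lemma bd_zeta_S: "bd_zeta D = (\<lambda>x. zet (S x)) ` UNIV"
  unfolding bd_zeta_eq D_frontier by auto

lemma dini_on_circle:
  fixes \<phi> :: "biharm \<Rightarrow> real"
  assumes "dini (bd_zeta D) \<phi>"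
  shows "dini UNIV (\<lambda>x. \<phi> (zet (S x)))"
proof -
  have "compact (bd_zeta D)"
    unfolding bd_zeta_eq D_frontier by (intro compact_continuous_image continuous_on_zet compact_range_S)
  moreover have "continuous_on (bd_zeta D) \<phi>"
    using dini_imp_uniformly_continuous_on[OF assms] by (rule uniformly_continuous_imp_continuous)
  ultimately have "bounded (\<phi> ` bd_zeta D)" using compact_continuous_image compact_imp_bounded by blast
  then have "bounded (range (\<lambda>x. \<phi> (zet (S x))))" by (rule bounded_subset) (auto simp: bd_zeta_S)
  then show ?thesis
  proof (rule dini_transfer[OF assms _ M_pos zero_less_one])
    fix p q :: real
    show "\<exists>p'\<in>bd_zeta D. \<exists>q'\<in>bd_zeta D. dist p' q' \<le> M * dist p q \<and> dist (\<phi> (zet (S p))) (\<phi> (zet (S q))) \<le> dist (\<phi> p') (\<phi> q')"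
    proof (intro bexI conjI)
      show "dist (zet (S p)) (zet (S q)) \<le> M * dist p q" using S_upper[of p q] unfolding dist_zet by (simp add: dist_norm)
    qed (auto simp: bd_zeta_S)
  qed
qed

text \<open>Two boundary points are lifted to angles at most \<open>pi\<close> apart, where the
  lower bound for chords makes the inverse of the parametrization Lipschitz.\<close>

lemma dini_on_boundary:
  fixes \<phi> :: "biharm \<Rightarrow> real"
  assumes d: "dini UNIV (\<lambda>x. \<phi> (zet (S x)))"
  shows "dini (bd_zeta D) \<phi>"
proof -
  have per: "\<phi> (zet (S (x + 2 * pi))) = \<phi> (zet (S x))" for x by (simp add: S_periodic)
  have "bounded (range (\<lambda>x. \<phi> (zet (S x))))"
    by (rule bounded_range_periodic[of "\<lambda>x. \<phi> (zet (S x))", OF per])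
       (rule uniformly_continuous_imp_continuous[OF dini_imp_uniformly_continuous_on[OF d]])
  then have "bounded (\<phi> ` bd_zeta D)" by (simp add: bd_zeta_S image_image)
  then show ?thesis
  proof (rule dini_transfer[OF d, of _ _ "1 / c" 1])
    fix p q assume "p \<in> bd_zeta D" "q \<in> bd_zeta D"
    then obtain x y where xy: "p = zet (S x)" "q = zet (S y)" by (auto simp: bd_zeta_S)
    obtain k :: int where k: "y + of_int k * (2 * pi) \<in> {x - pi..x + pi}" "S (y + of_int k * (2 * pi)) = S y"
      using periodic_reduce[of S, OF S_periodic] .
    let ?y = "y + of_int k * (2 * pi)"
    have "\<bar>?y - x\<bar> \<le> pi" using k(1) unfolding abs_le_iff atLeastAtMost_iff by linarith
    then have "c * \<bar>?y - x\<bar> \<le> norm (S y - S x)" using S_lower_pi[of "?y - x" x] k(2) by simp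
    then have "dist x ?y \<le> 1 / c * dist p q"
      unfolding xy dist_zet using c_pos by (simp add: dist_norm norm_minus_commute abs_minus_commute field_simps)
    then show "\<exists>p'\<in>UNIV. \<exists>q'\<in>UNIV. dist p' q' \<le> 1 / c * dist p q \<and> dist (\<phi> p) (\<phi> q) \<le> dist (\<phi> (zet (S p'))) (\<phi> (zet (S q')))"
      using k(2) by (intro bexI[of _ x] bexI[of _ ?y]) (auto simp: xy)
  qed (use c_pos in auto)
qed

end

context conformal_boundary
begin

lemma tau_eq: "tau \<sigma> s = S (ang s)"
  by (simp add: tau_def S_def cis_ang)

lemma tau_deriv: "(tau \<sigma> has_vector_derivative (2 / (1 + s\<^sup>2)) *\<^sub>R S' (ang s)) (at s)"
proof -
  have "(ang has_vector_derivative 2 / (1 + s\<^sup>2)) (at s)"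
    using ang_deriv by (simp add: has_real_derivative_iff_has_vector_derivative)
  from vector_diff_chain_at[OF this S_has_deriv] show ?thesis
    by (simp add: tau_eq[abs_def] o_def)
qed

lemma tau'_eq: "tau' \<sigma> s = (2 / (1 + s\<^sup>2)) *\<^sub>R S' (ang s)"
  unfolding tau'_def by (rule vector_derivative_at[OF tau_deriv])

lemma tau2'_eq: "tau2' \<sigma> s = 2 / (1 + s\<^sup>2) * Im (S' (ang s))"
proof -
  have "(tau2 \<sigma> has_real_derivative Im ((2 / (1 + s\<^sup>2)) *\<^sub>R S' (ang s))) (at s)"
    using has_field_derivative_Im[OF tau_deriv] by (simp add: tau2_def[abs_def])
  then show ?thesis unfolding tau2'_def by (simp add: DERIV_imp_deriv)
qed

text \<open>The term subtracted in \<open>k1\<close> is real and drops out of the imaginary part;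
  the factor in front is the derivative of \<open>ang\<close>.\<close>

lemma Im_k1_eq: "Im (k1 \<sigma> t s) = 2 / (1 + s\<^sup>2) * Re (K (\<lambda>z. of_real (- 1 / (norm z)\<^sup>2)) (ang t) (ang s))"
proof -
  have "Im ((r *\<^sub>R a) / b) = r * Im (a / b)" for r :: real and a b :: complex
  proof -
    have "(r *\<^sub>R a) / b = r *\<^sub>R (a / b)" by (simp add: scaleR_conv_of_real)
    then show ?thesis by simp
  qed
  then show ?thesis unfolding Im_kC_eq_K[symmetric] by (simp add: k1_def kC_def tau'_eq tau_eq)
qed

lemma k2_eq: "k2 \<sigma> t s = - of_real (1 / (1 + s\<^sup>2)) * K (\<lambda>z. - 1 / z\<^sup>2) (ang t) (ang s)"
proof -
  \<comment> \<open>The identity includes the diagonal \<open>v = 0\<close>, where every quotient is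
    0.\<close>
  have gen: "(of_real (2 * d) * a) * y / (2 * v\<^sup>2) - (of_real (2 * d) * b) / (2 * v) = - of_real d * ((b * v - y * a) / v\<^sup>2)"
    for d :: real and a b v y :: complex
    by (cases "v = 0") (simp_all add: field_simps power2_eq_square)
  have "k2 \<sigma> t s = (of_real (2 * (1 / (1 + s\<^sup>2))) * S' (ang s)) * of_real (Im (S (ang s) - S (ang t))) / (2 * (S (ang s) - S (ang t))\<^sup>2)
     - (of_real (2 * (1 / (1 + s\<^sup>2))) * of_real (Im (S' (ang s)))) / (2 * (S (ang s) - S (ang t)))"
    by (simp add: k2_def tau'_eq tau2'_eq tau_eq tau2_def scaleR_conv_of_real)
  also have "\<dots> = - of_real (1 / (1 + s\<^sup>2)) * kE (S (ang t)) (ang s)"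
    unfolding gen kE_def ..
  finally show ?thesis by (simp only: kE_eq_K)
qed

lemma solves_integral_system_iff:
  assumes p1: "\<And>x. \<phi>1 (x + 2 * pi) = \<phi>1 x" "continuous_on UNIV \<phi>1" and p3: "\<And>x. \<phi>3 (x + 2 * pi) = \<phi>3 x" "continuous_on UNIV \<phi>3"
    and g: "\<And>s. g1 (Some s) = \<phi>1 (ang s)" "\<And>s. g3 (Some s) = \<phi>3 (ang s)"
  shows "solves_integral_system \<sigma> u1 u3 g1 g3 \<longleftrightarrow>
    (\<forall>s. L1 \<phi>1 \<phi>3 (ang s) = u1 (zet (S (ang s))) \<and> L3 \<phi>1 \<phi>3 (ang s) = u3 (zet (S (ang s))))"
proof -
  let ?m1 = "\<lambda>z::complex. - 1 / z\<^sup>2" and ?m2 = "\<lambda>z::complex. of_real (- 1 / (norm z)\<^sup>2) :: complex"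
  let ?A1 = "\<lambda>t. Re (T (\<lambda>x. of_real (\<phi>1 x)) ?m2 (ang t))" and ?A3 = "\<lambda>t. Re (T (\<lambda>x. of_real (\<phi>3 x)) ?m2 (ang t))"
  let ?R1 = "\<lambda>t. Re (T (\<lambda>x. of_real (\<phi>1 x)) ?m1 (ang t))" and ?R3 = "\<lambda>t. Re (T (\<lambda>x. of_real (\<phi>3 x)) ?m1 (ang t))"
  let ?I1 = "\<lambda>t. Im (T (\<lambda>x. of_real (\<phi>1 x)) ?m1 (ang t))" and ?I3 = "\<lambda>t. Im (T (\<lambda>x. of_real (\<phi>3 x)) ?m1 (ang t))"
  note a1 = integral_ang_kernel[of ?m2 \<phi>1, OF good_multiplier_norm p1] and a3 = integral_ang_kernel[of ?m2 \<phi>3, OF good_multiplier_norm p3]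
  note b1 = integral_ang_kernel[of ?m1 \<phi>1, OF good_multiplier_square p1] and b3 = integral_ang_kernel[of ?m1 \<phi>3, OF good_multiplier_square p3]
  have Rek2: "Re (k2 \<sigma> t s) = - (1 / 2) * (2 / (1 + s\<^sup>2) * Re (K ?m1 (ang t) (ang s)))"
    and Imk2: "Im (k2 \<sigma> t s) = - (1 / 2) * (2 / (1 + s\<^sup>2) * Im (K ?m1 (ang t) (ang s)))" for t s
    unfolding k2_eq by simp_all
  have i1: "(\<lambda>s. g1 (Some s) * (Im (k1 \<sigma> t s) + 2 * Re (k2 \<sigma> t s))) =
     (\<lambda>s. 2 / (1 + s\<^sup>2) * (\<phi>1 (ang s) * Re (K ?m2 (ang t) (ang s))) - 2 / (1 + s\<^sup>2) * (\<phi>1 (ang s) * Re (K ?m1 (ang t) (ang s))))" for t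
    unfolding g Im_k1_eq Rek2 by (rule ext) (simp add: algebra_simps)
  have i2: "(\<lambda>s. g3 (Some s) * Im (k2 \<sigma> t s)) = (\<lambda>s. - (1 / 2) * (2 / (1 + s\<^sup>2) * (\<phi>3 (ang s) * Im (K ?m1 (ang t) (ang s)))))" for t
    unfolding g Imk2 by (rule ext) (simp add: algebra_simps)
  have i3: "(\<lambda>s. g1 (Some s) * Im (k2 \<sigma> t s)) = (\<lambda>s. - (1 / 2) * (2 / (1 + s\<^sup>2) * (\<phi>1 (ang s) * Im (K ?m1 (ang t) (ang s)))))" for t
    unfolding g Imk2 by (rule ext) (simp add: algebra_simps)
  have i4: "(\<lambda>s. g3 (Some s) * (Im (k1 \<sigma> t s) - 2 * Re (k2 \<sigma> t s))) =
     (\<lambda>s. 2 / (1 + s\<^sup>2) * (\<phi>3 (ang s) * Re (K ?m2 (ang t) (ang s))) + 2 / (1 + s\<^sup>2) * (\<phi>3 (ang s) * Re (K ?m1 (ang t) (ang s))))" for t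
    unfolding g Im_k1_eq Rek2 by (rule ext) (simp add: algebra_simps)
  have "integrable lborel (\<lambda>s. g1 (Some s) * (Im (k1 \<sigma> t s) + 2 * Re (k2 \<sigma> t s)))"
    "integrable lborel (\<lambda>s. g3 (Some s) * Im (k2 \<sigma> t s))"
    "integrable lborel (\<lambda>s. g1 (Some s) * Im (k2 \<sigma> t s))"
    "integrable lborel (\<lambda>s. g3 (Some s) * (Im (k1 \<sigma> t s) - 2 * Re (k2 \<sigma> t s)))" for t
    unfolding i1 i2 i3 i4
    by (intro Bochner_Integration.integrable_diff Bochner_Integration.integrable_add integrable_mult_right a1(1) a3(1) b1(1,3) b3(1,3))+
  note int = this
  have e1: "(LINT s|lborel. g1 (Some s) * (Im (k1 \<sigma> t s) + 2 * Re (k2 \<sigma> t s))) = ?A1 t - ?R1 t" for t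
    unfolding i1 by (subst Bochner_Integration.integral_diff[OF a1(1) b1(1)]) (simp only: a1(2) b1(2))
  have e2: "(LINT s|lborel. g3 (Some s) * Im (k2 \<sigma> t s)) = - (1 / 2) * ?I3 t" for t
    unfolding i2 by (subst integral_mult_right_zero) (simp only: b3(4))
  have e3: "(LINT s|lborel. g1 (Some s) * Im (k2 \<sigma> t s)) = - (1 / 2) * ?I1 t" for t
    unfolding i3 by (subst integral_mult_right_zero) (simp only: b1(4))
  have e4: "(LINT s|lborel. g3 (Some s) * (Im (k1 \<sigma> t s) - 2 * Re (k2 \<sigma> t s))) = ?A3 t + ?R3 t" for t
    unfolding i4 by (subst Bochner_Integration.integral_add[OF a3(1) b3(1)]) (simp only: a3(2) b3(2))
  have l1: "1 / 2 * \<phi>1 (ang t) + 1 / (2 * pi) * (?A1 t - ?R1 t) - 1 / pi * (- (1 / 2) * ?I3 t) = L1 \<phi>1 \<phi>3 (ang t)" for t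
    unfolding L1_def by (simp add: field_simps)
  have l3: "1 / 2 * \<phi>3 (ang t) - 1 / pi * (- (1 / 2) * ?I1 t) + 1 / (2 * pi) * (?A3 t + ?R3 t) = L3 \<phi>1 \<phi>3 (ang t)" for t
    unfolding L3_def by (simp add: field_simps)
  show ?thesis
    unfolding solves_integral_system_def e1 e2 e3 e4 unfolding g l1 l3 tau_tilde_def tau_eq
    using int[unfolded g] by simp
qed

text \<open>In terms of the lift the integrand is \<open>h'\<close> times a periodic function of
  \<open>h\<close>, and \<open>h\<close> advances by exactly one period, so the parametrization
  disappears from the value.\<close>

lemma cauchy_type_integral_eq:
  assumes curve: "smooth_jordan_curve \<gamma>" "positively_oriented_boundary D \<gamma>"
    and cont: "continuous_on UNIV (\<lambda>x. \<phi>1 (zet (S x)))" "continuous_on UNIV (\<lambda>x. \<phi>3 (zet (S x)))" and z: "z \<in> D"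
  shows "cauchy_type_integral \<gamma> \<phi>1 \<phi>3 (zet z) = \<Psi> (\<lambda>x. \<phi>1 (zet (S x))) (\<lambda>x. \<phi>3 (zet (S x))) z"
proof -
  obtain \<gamma>' where \<gamma>: "simple_path \<gamma>" "pathfinish \<gamma> = pathstart \<gamma>" "continuous_on {0..1} \<gamma>'"
    "\<And>t. t \<in> {0..1} \<Longrightarrow> (\<gamma> has_vector_derivative \<gamma>' t) (at t within {0..1})"
    using curve(1) unfolding smooth_jordan_curve_def by blast
  have or: "path_image \<gamma> = frontier D" "\<And>z. z \<in> D \<Longrightarrow> winding_number \<gamma> z = 1"
    using curve(2) unfolding positively_oriented_boundary_def by auto
  obtain h h' where h: "\<And>t. t \<in> {0..1} \<Longrightarrow> \<gamma> t = S (h t)" "continuous_on {0..1} h"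
    "\<And>t. t \<in> {0..1} \<Longrightarrow> (h has_field_derivative h' t) (at t within {0..1})"
    "\<And>t. t \<in> {0..1} \<Longrightarrow> \<gamma>' t = h' t *\<^sub>R S' (h t)" "h 1 = h 0 + 2 * pi"
    using reparametrization[OF simple_path_imp_path[OF \<gamma>(1)] \<gamma>(2) or(1) \<gamma>(3,4) or(2)] by blast
  have zS: "z \<notin> range S" using z D_disjoint by blast
  let ?F = "\<lambda>x. (of_real (\<phi>1 (zet (S x))), of_real (\<phi>3 (zet (S x)))) \<odot> pinv (S x - z) \<odot> zet (S' x)"
  have cF: "continuous_on UNIV ?F"
    by (rule continuous_cauchy_integrand[of "\<lambda>x. \<phi>1 (zet (S x))" "\<lambda>x. \<phi>3 (zet (S x))"]) (use cont zS in \<open>auto simp: S_periodic\<close>)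
  have perF: "?F (x + 2 * pi) = ?F x" for x by (simp add: S_periodic S'_periodic)
  have eq: "((\<phi>1 ((zet \<circ> \<gamma>) t) *\<^sub>R e1 + \<phi>3 ((zet \<circ> \<gamma>) t) *\<^sub>R e2) \<odot> binv ((zet \<circ> \<gamma>) t - zet z)) \<odot> vector_derivative (zet \<circ> \<gamma>) (at t within {0..1})
     = h' t *\<^sub>R ?F (h t)" if t: "t \<in> {0..1}" for t
  proof -
    have "((\<lambda>t. zet (\<gamma> t)) has_vector_derivative zet (\<gamma>' t)) (at t within {0..1})"
      by (rule bounded_linear.has_vector_derivative[OF linear_conv_bounded_linear[THEN iffD1, OF linear_zet] \<gamma>(4)[OF t]])
    then have "vector_derivative (zet \<circ> \<gamma>) (at t within {0..1}) = zet (\<gamma>' t)"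
      using vector_derivative_within_cbox[of 0 1 t "zet \<circ> \<gamma>" "zet (\<gamma>' t)"] t by (simp add: o_def)
    also have "\<dots> = h' t *\<^sub>R zet (S' (h t))" by (simp add: h(4)[OF t] linear_scale[OF linear_zet])
    finally have vd: "vector_derivative (zet \<circ> \<gamma>) (at t within {0..1}) = h' t *\<^sub>R zet (S' (h t))" .
    have "S (h t) - z \<noteq> 0" using zS by auto
    then have "binv ((zet \<circ> \<gamma>) t - zet z) = pinv (S (h t) - z)"
      using h(1)[OF t] by (simp add: zet_diff[symmetric] binv_zet)
    moreover have "\<phi>1 ((zet \<circ> \<gamma>) t) *\<^sub>R e1 + \<phi>3 ((zet \<circ> \<gamma>) t) *\<^sub>R e2 = (of_real (\<phi>1 (zet (S (h t)))), of_real (\<phi>3 (zet (S (h t)))))"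
      using h(1)[OF t] by (simp add: e1_def e2_def scaleR_conv_of_real)
    ultimately show ?thesis unfolding vd bmult_scaleR_right by simp
  qed
  obtain R where R: "\<And>t. t \<in> {0..1} \<Longrightarrow> \<bar>h t\<bar> \<le> R"
  proof -
    have "bounded (h ` {0..1})" by (rule compact_imp_bounded[OF compact_continuous_image[OF h(2)]]) simp
    then obtain B where "\<And>y. y \<in> h ` {0..1} \<Longrightarrow> norm y \<le> B" unfolding bounded_iff by blast
    then show ?thesis using that[of B] by simp
  qed
  have "((\<lambda>t. h' t *\<^sub>R ?F (h t)) has_integral (integral {h 0..h 1} ?F - integral {h 1..h 0} ?F)) {0..1}"
  proof (rule has_integral_substitution_general[where s = "{}" and c = "- R" and d = R])
    have "h t \<in> {- R..R}" if "t \<in> {0..1}" for t using R[OF that] by (simp add: abs_le_iff minus_le_iff)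
    then show "h ` {0..1} \<subseteq> {- R..R}" by blast
    show "continuous_on {- R..R} ?F" by (rule continuous_on_subset[OF cF]) simp
  qed (use h in auto)
  then have "integral {0..1} (\<lambda>t. h' t *\<^sub>R ?F (h t)) = integral {h 0..h 1} ?F - integral {h 1..h 0} ?F"
    by (rule integral_unique)
  also have "\<dots> = integral {h 0..h 0 + 2 * pi} ?F" by (simp add: h(5))
  also have "\<dots> = integral {0..2 * pi} ?F" by (rule periodic_integral_eq[of ?F, OF perF cF])
  finally have "integral {0..1} (\<lambda>t. h' t *\<^sub>R ?F (h t)) = integral {0..2 * pi} ?F" .
  moreover have "bcontour_integral (zet \<circ> \<gamma>) (\<lambda>\<tau>. (\<phi>1 \<tau> *\<^sub>R e1 + \<phi>3 \<tau> *\<^sub>R e2) \<odot> binv (\<tau> - zet z))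
     = integral {0..1} (\<lambda>t. h' t *\<^sub>R ?F (h t))"
    unfolding bcontour_integral_def by (rule Henstock_Kurzweil_Integration.integral_cong) (rule eq)
  ultimately show ?thesis unfolding cauchy_type_integral_def \<Psi>_def by simp
qed

end

section \<open>The equivalence of the three solvability statements\<close>

lemma dini_linear_combination:
  fixes f g :: "'a::metric_space \<Rightarrow> real"
  assumes "dini A f" "dini A g"
  shows "dini A (\<lambda>x. a * f x + b * g x)"
proof (rule dini_combine[OF assms, of "\<bar>a\<bar>" "\<bar>b\<bar>"])
  fix p q
  have "(a * f p + b * g p) - (a * f q + b * g q) = a * (f p - f q) + b * (g p - g q)" by (simp add: algebra_simps)
  then show "dist (a * f p + b * g p) (a * f q + b * g q) \<le> \<bar>a\<bar> * dist (f p) (f q) + \<bar>b\<bar> * dist (g p) (g q)"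
    unfolding dist_real_def by (metis abs_mult abs_triangle_ineq)
qed auto

lemma dini_Re: "dini A (\<lambda>x. Re (f x))" and dini_Im: "dini A (\<lambda>x. Im (f x))" if "dini A f"
proof -
  show "dini A (\<lambda>x. Re (f x))"
    by (rule dini_combine[OF that that, of 1 0])
       (auto simp: dist_norm abs_Re_le_cmod intro: order_trans[OF _ abs_Re_le_cmod] simp flip: minus_complex.sel)
  show "dini A (\<lambda>x. Im (f x))"
    by (rule dini_combine[OF that that, of 1 0])
       (auto simp: dist_norm abs_Im_le_cmod intro: order_trans[OF _ abs_Im_le_cmod] simp flip: minus_complex.sel)
qed

lemma dini_cong:
  assumes "dini A f" "\<And>x. x \<in> A \<Longrightarrow> f x = g x"
  shows "dini A g"
  by (rule dini_combine[OF assms(1,1), of 1 0]) (auto simp: assms(2)[symmetric])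

locale boundary_problem = conformal_boundary +
  fixes \<gamma> :: "real \<Rightarrow> complex" and u1 u3 :: "biharm \<Rightarrow> real"
  assumes curve: "smooth_jordan_curve \<gamma>" "positively_oriented_boundary D \<gamma>"
    and data: "dini (bd_zeta D) u1" "dini (bd_zeta D) u3"
begin

definition on_circle :: "(biharm \<Rightarrow> real) \<Rightarrow> real \<Rightarrow> real" where
  "on_circle \<phi> x = \<phi> (zet (S x))"

lemma on_circle_periodic: "on_circle \<phi> (x + 2 * pi) = on_circle \<phi> x"
  by (simp add: on_circle_def S_periodic)

lemma dini_on_circle_iff: "dini UNIV (on_circle \<phi>) \<longleftrightarrow> dini (bd_zeta D) \<phi>"
  using dini_on_circle[of \<phi>] dini_on_boundary[of \<phi>] by (auto simp: on_circle_def[abs_def])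

text \<open>The equations at all angles, hence also at angle 0, which corresponds to the point at
  infinity of the line.\<close>

definition matches :: "(real \<Rightarrow> real) \<Rightarrow> (real \<Rightarrow> real) \<Rightarrow> bool" where
  "matches \<phi>1 \<phi>3 \<longleftrightarrow> (\<forall>t. L1 \<phi>1 \<phi>3 t = on_circle u1 t \<and> L3 \<phi>1 \<phi>3 t = on_circle u3 t)"

lemma S_islimpt: "at (S t) within D \<noteq> bot"
proof -
  have "S t \<in> closure D" "S t \<notin> D" using D_cases by auto
  then have "S t islimpt D" by (simp add: closure_def)
  then show ?thesis by (simp add: trivial_limit_within)
qed

lemma tendsto_U1: "(f \<longlongrightarrow> a) F \<Longrightarrow> ((\<lambda>x. U1 (f x)) \<longlongrightarrow> U1 a) F" and tendsto_U3: "(f \<longlongrightarrow> a) F \<Longrightarrow> ((\<lambda>x. U3 (f x)) \<longlongrightarrow> U3 a) F"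
  unfolding U1_def U3_def by (intro tendsto_intros; assumption)+

text \<open>The Cauchy type integral has boundary values in any case, namely \<open>L1\<close> and
  \<open>L3\<close>. Since every boundary point is a limit point of \<open>D\<close>, these limits
  are unique and the problem becomes an equation.\<close>

lemma solves_13_iff_matches:
  assumes per: "\<And>x. \<phi>1 (x + 2 * pi) = \<phi>1 x" "\<And>x. \<phi>3 (x + 2 * pi) = \<phi>3 x"
    and dini: "dini UNIV \<phi>1" "dini UNIV \<phi>3" and \<Phi>: "\<And>z. z \<in> D \<Longrightarrow> \<Phi> (zet z) = \<Psi> \<phi>1 \<phi>3 z"
  shows "solves_13 D u1 u3 \<Phi> \<longleftrightarrow> matches \<phi>1 \<phi>3"
proof -
  note cont = dini_cont[where ?\<phi>1.0 = \<phi>1 and ?\<phi>3.0 = \<phi>3, OF per dini]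
  have "monogenic_on (zet ` D) (\<lambda>\<zeta>. \<Psi> \<phi>1 \<phi>3 (inv zet \<zeta>))"
    using \<Psi>_monogenic[where ?\<phi>1.0 = \<phi>1 and ?\<phi>3.0 = \<phi>3, OF per cont] D_disjoint
    unfolding monogenic_on_zet_iff by blast
  then have mono: "monogenic_on (D_zeta D) \<Phi>"
    unfolding D_zeta_def by (rule monogenic_on_cong[OF D_open, rotated]) (simp add: inv_f_f[OF inj_zet] \<Phi>)
  have "((\<lambda>z. \<Phi> (zet z)) \<longlongrightarrow> \<Psi>in \<phi>1 \<phi>3 (S t)) (at (S t) within D)" for t
  proof -
    have "(\<Psi>in \<phi>1 \<phi>3 \<longlongrightarrow> \<Psi>in \<phi>1 \<phi>3 (S t)) (at (S t) within D)"
      using isCont_\<Psi>in[where ?\<phi>1.0 = \<phi>1 and ?\<phi>3.0 = \<phi>3, OF per dini, of t]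
      unfolding isCont_def by (rule tendsto_within_subset) simp
    then show ?thesis
      by (rule Lim_transform_eventually)
         (auto simp: eventually_at_filter \<Phi> \<Psi>_eq_in[where ?\<phi>1.0 = \<phi>1 and ?\<phi>3.0 = \<phi>3, OF per dini])
  qed
  then have l: "((\<lambda>z. U1 (\<Phi> (zet z))) \<longlongrightarrow> L1 \<phi>1 \<phi>3 t) (at (S t) within D)"
    "((\<lambda>z. U3 (\<Phi> (zet z))) \<longlongrightarrow> L3 \<phi>1 \<phi>3 t) (at (S t) within D)" for t
    using tendsto_U1 tendsto_U3 U_\<Psi>in[where ?\<phi>1.0 = \<phi>1 and ?\<phi>3.0 = \<phi>3, OF per dini, of t] by metis+
  have lim_iff: "(f \<longlongrightarrow> a) (at (S t) within D) \<longleftrightarrow> b = a" if "(f \<longlongrightarrow> b) (at (S t) within D)" for f and a b :: real and t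
  proof
    show "b = a" if "(f \<longlongrightarrow> a) (at (S t) within D)" by (rule tendsto_unique[OF S_islimpt \<open>(f \<longlongrightarrow> b) _\<close> that])
  qed (use that in simp)
  show ?thesis
    unfolding solves_13_def matches_def on_circle_def bd_zeta_S using mono
    by (simp add: D_zeta_def tendsto_zet_within_iff lim_iff[OF l(1)] lim_iff[OF l(2)])
qed

lemma cauchy_eq:
  assumes "dini (bd_zeta D) \<phi>1" "dini (bd_zeta D) \<phi>3" "z \<in> D"
  shows "cauchy_type_integral \<gamma> \<phi>1 \<phi>3 (zet z) = \<Psi> (on_circle \<phi>1) (on_circle \<phi>3) z"
proof -
  have "continuous_on UNIV (on_circle \<phi>)" if "dini (bd_zeta D) \<phi>" for \<phi>
    using that unfolding dini_on_circle_iff[symmetric]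
    by (rule uniformly_continuous_imp_continuous[OF dini_imp_uniformly_continuous_on])
  then show ?thesis
    using cauchy_type_integral_eq[OF curve _ _ assms(3), of \<phi>1 \<phi>3] assms(1,2) by (simp add: on_circle_def[abs_def])
qed

definition cauchy_solution where
  "cauchy_solution \<longleftrightarrow> (\<exists>\<Phi> \<phi>1 \<phi>3. solves_13 D u1 u3 \<Phi> \<and> dini (bd_zeta D) \<phi>1 \<and> dini (bd_zeta D) \<phi>3 \<and>
     (\<forall>\<zeta>\<in>D_zeta D. \<Phi> \<zeta> = cauchy_type_integral \<gamma> \<phi>1 \<phi>3 \<zeta>))"

lemma cauchy_solution_iff:
  "cauchy_solution \<longleftrightarrow> (\<exists>\<phi>1 \<phi>3. dini (bd_zeta D) \<phi>1 \<and> dini (bd_zeta D) \<phi>3 \<and> matches (on_circle \<phi>1) (on_circle \<phi>3))"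
proof -
  have iff: "solves_13 D u1 u3 \<Phi> \<longleftrightarrow> matches (on_circle \<phi>1) (on_circle \<phi>3)"
    if d: "dini (bd_zeta D) \<phi>1" "dini (bd_zeta D) \<phi>3" and e: "\<forall>\<zeta>\<in>D_zeta D. \<Phi> \<zeta> = cauchy_type_integral \<gamma> \<phi>1 \<phi>3 \<zeta>" for \<Phi> \<phi>1 \<phi>3
  proof (rule solves_13_iff_matches)
    show "\<Phi> (zet z) = \<Psi> (on_circle \<phi>1) (on_circle \<phi>3) z" if "z \<in> D" for z
      using e that cauchy_eq[OF d that] by (simp add: D_zeta_def)
  qed (use d dini_on_circle_iff on_circle_periodic in auto)
  show ?thesis
  proof
    assume "cauchy_solution"
    then show "\<exists>\<phi>1 \<phi>3. dini (bd_zeta D) \<phi>1 \<and> dini (bd_zeta D) \<phi>3 \<and> matches (on_circle \<phi>1) (on_circle \<phi>3)"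
      unfolding cauchy_solution_def using iff by blast
  next
    assume "\<exists>\<phi>1 \<phi>3. dini (bd_zeta D) \<phi>1 \<and> dini (bd_zeta D) \<phi>3 \<and> matches (on_circle \<phi>1) (on_circle \<phi>3)"
    then obtain \<phi>1 \<phi>3 where *: "dini (bd_zeta D) \<phi>1" "dini (bd_zeta D) \<phi>3" "matches (on_circle \<phi>1) (on_circle \<phi>3)" by blast
    then have "solves_13 D u1 u3 (cauchy_type_integral \<gamma> \<phi>1 \<phi>3)" using iff[OF *(1,2)] by blast
    then show "cauchy_solution" unfolding cauchy_solution_def using * by blast
  qed
qed

text \<open>A continuous solution of the system is a combination of the data and of images of the weakly singular
  operators, hence satisfies a Dini condition.\<close>

lemma dini_if_L_eq:
  assumes p1: "\<And>x. \<phi>1 (x + 2 * pi) = \<phi>1 x" "continuous_on UNIV \<phi>1" and p3: "\<And>x. \<phi>3 (x + 2 * pi) = \<phi>3 x" "continuous_on UNIV \<phi>3"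
    and eq: "\<And>s. L1 \<phi>1 \<phi>3 (ang s) = on_circle u1 (ang s)" "\<And>s. L3 \<phi>1 \<phi>3 (ang s) = on_circle u3 (ang s)"
  shows "dini UNIV \<phi>1" "dini UNIV \<phi>3" "matches \<phi>1 \<phi>3"
proof -
  let ?m1 = "\<lambda>z::complex. - 1 / z\<^sup>2" and ?m2 = "\<lambda>z::complex. of_real (- 1 / (norm z)\<^sup>2) :: complex"
  let ?A1 = "T (\<lambda>x. of_real (\<phi>1 x)) ?m2" and ?A3 = "T (\<lambda>x. of_real (\<phi>3 x)) ?m2"
  let ?B1 = "T (\<lambda>x. of_real (\<phi>1 x)) ?m1" and ?B3 = "T (\<lambda>x. of_real (\<phi>3 x)) ?m1"
  have q: "(of_real (\<phi>1 (x + 2 * pi)) :: complex) = of_real (\<phi>1 x)" "(of_real (\<phi>3 (x + 2 * pi)) :: complex) = of_real (\<phi>3 x)" for x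
    by (simp_all add: p1 p3)
  have c: "continuous_on UNIV (\<lambda>x. of_real (\<phi>1 x) :: complex)" "continuous_on UNIV (\<lambda>x. of_real (\<phi>3 x) :: complex)"
    by (intro continuous_intros p1 p3)+
  have dT: "dini UNIV ?A1" "dini UNIV ?A3" "dini UNIV ?B1" "dini UNIV ?B3"
    by (rule dini_T; rule good_multiplier_norm good_multiplier_square q c)+
  have perT: "?A1 (t + 2 * pi) = ?A1 t" "?A3 (t + 2 * pi) = ?A3 t" "?B1 (t + 2 * pi) = ?B1 t" "?B3 (t + 2 * pi) = ?B3 t" for t
    by (rule T_periodic; rule q)+
  define N1 where "N1 = (\<lambda>t. 1 / (2 * pi) * (Re (?A1 t) - Re (?B1 t) + Im (?B3 t)))"
  define N3 where "N3 = (\<lambda>t. 1 / (2 * pi) * (Im (?B1 t) + Re (?A3 t) + Re (?B3 t)))"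
  have L: "L1 \<phi>1 \<phi>3 t = \<phi>1 t / 2 + N1 t" "L3 \<phi>1 \<phi>3 t = \<phi>3 t / 2 + N3 t" for t
    by (simp_all add: L1_def L3_def N1_def N3_def)
  have dN: "dini UNIV N1" "dini UNIV N3"
  proof -
    have "dini UNIV (\<lambda>t. (1 / (2 * pi)) * ((1 * Re (?A1 t) + (-1) * Re (?B1 t))) + (1 / (2 * pi)) * Im (?B3 t))"
      by (intro dini_linear_combination dini_Re dini_Im dT)
    then show "dini UNIV N1" by (simp add: N1_def[abs_def] algebra_simps)
    have "dini UNIV (\<lambda>t. (1 / (2 * pi)) * ((1 * Im (?B1 t) + 1 * Re (?A3 t))) + (1 / (2 * pi)) * Re (?B3 t))"
      by (intro dini_linear_combination dini_Re dini_Im dT)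
    then show "dini UNIV N3" by (simp add: N3_def[abs_def] algebra_simps)
  qed
  have perN: "N1 (t + 2 * pi) = N1 t" "N3 (t + 2 * pi) = N3 t" for t by (simp_all only: N1_def N3_def perT)
  have du: "dini UNIV (on_circle u1)" "dini UNIV (on_circle u3)" using data by (simp_all add: dini_on_circle_iff)
  have all: "\<phi> t / 2 + N t = on_circle u t"
    if \<phi>: "\<And>x. \<phi> (x + 2 * pi) = \<phi> x" "continuous_on UNIV \<phi>" and N: "\<And>x. N (x + 2 * pi) = N x" "dini UNIV N"
      and u: "dini UNIV (on_circle u)" and e: "\<And>s. \<phi> (ang s) / 2 + N (ang s) = on_circle u (ang s)" for \<phi> N u t
  proof -
    \<comment> \<open>The equation holds on the open interval \<open>range ang\<close>. As a closed
      condition it extends to the end points, which stand for infinity, and then by periodicity to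
      all angles.\<close>
    let ?Z = "{x. \<phi> x / 2 + N x = on_circle u x}"
    have "continuous_on UNIV N" "continuous_on UNIV (on_circle u)"
      using N(2) u dini_imp_uniformly_continuous_on uniformly_continuous_imp_continuous by blast+
    then have "closed ?Z" by (intro closed_Collect_eq continuous_intros \<phi>) auto
    moreover have "{0<..<2 * pi} \<subseteq> ?Z" using e unfolding range_ang[symmetric] by blast
    ultimately have "closure {0<..<2 * pi} \<subseteq> ?Z" by (intro closure_minimal)
    then have Z: "{0..2 * pi} \<subseteq> ?Z" by (simp add: closure_greaterThanLessThan)
    define d where "d = (\<lambda>x. \<phi> x / 2 + N x - on_circle u x)"
    have "d (x + 2 * pi) = d x" for x by (simp add: d_def \<phi> N on_circle_periodic)
    then obtain k :: int where "t + of_int k * (2 * pi) \<in> {pi - pi..pi + pi}" "d (t + of_int k * (2 * pi)) = d t"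
      using periodic_reduce[of d] by metis
    moreover from this(1) have "d (t + of_int k * (2 * pi)) = 0" using Z by (auto simp: d_def)
    ultimately show ?thesis by (simp add: d_def)
  qed
  have a1: "\<phi>1 t / 2 + N1 t = on_circle u1 t" for t
    by (rule all[OF p1 perN(1) dN(1) du(1)]) (use eq(1) L in simp)
  have a3: "\<phi>3 t / 2 + N3 t = on_circle u3 t" for t
    by (rule all[OF p3 perN(2) dN(2) du(2)]) (use eq(2) L in simp)
  show "dini UNIV \<phi>1"
    by (rule dini_cong[OF dini_linear_combination[OF du(1) dN(1), of 2 "-2"]]) (simp add: a1[symmetric])
  show "dini UNIV \<phi>3"
    by (rule dini_cong[OF dini_linear_combination[OF du(2) dN(2), of 2 "-2"]]) (simp add: a3[symmetric])
  show "matches \<phi>1 \<phi>3" by (simp add: matches_def L a1 a3)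
qed

lemma integral_system_iff_cauchy_solution:
  "(\<exists>g1\<in>C_Rbar. \<exists>g3\<in>C_Rbar. solves_integral_system \<sigma> u1 u3 g1 g3) \<longleftrightarrow> cauchy_solution"
proof
  assume "\<exists>g1\<in>C_Rbar. \<exists>g3\<in>C_Rbar. solves_integral_system \<sigma> u1 u3 g1 g3"
  then obtain g1 g3 where g: "g1 \<in> C_Rbar" "g3 \<in> C_Rbar" and sys: "solves_integral_system \<sigma> u1 u3 g1 g3" by blast
  note c = circ_continuous[OF g(1)] circ_continuous[OF g(2)]
  have "L1 (circ g1) (circ g3) (ang s) = on_circle u1 (ang s)" "L3 (circ g1) (circ g3) (ang s) = on_circle u3 (ang s)" for s
    using sys solves_integral_system_iff[of "circ g1" "circ g3" g1 g3 u1 u3, OF circ_periodic c(1) circ_periodic c(2) circ_ang[symmetric] circ_ang[symmetric]]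
    by (simp_all add: on_circle_def)
  note d = dini_if_L_eq[of "circ g1" "circ g3", OF circ_periodic c(1) circ_periodic c(2) this]
  \<comment> \<open>A periodic function of the angle becomes a function on the boundary by choosing
    any angle of the point; two such angles differ by whole periods.\<close>
  define \<phi> where "\<phi> g p = circ g (SOME x. zet (S x) = p)" for g p
  have "on_circle (\<phi> g) x = circ g x" for g x
  proof -
    let ?y = "SOME y. zet (S y) = zet (S x)"
    have "zet (S ?y) = zet (S x)" by (rule someI[of _ x]) simp
    then obtain k :: int where "?y = x + of_int k * (2 * pi)" using S_inj by auto
    then show ?thesis
      using periodic_int[of "circ g" "2 * pi" x k, OF circ_periodic] by (simp add: on_circle_def \<phi>_def)
  qed
  then have "on_circle (\<phi> g) = circ g" for g by (rule ext)
  then show "cauchy_solution" unfolding cauchy_solution_iff using d by (metis dini_on_circle_iff)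
next
  assume "cauchy_solution"
  then obtain \<phi>1 \<phi>3 where d: "dini (bd_zeta D) \<phi>1" "dini (bd_zeta D) \<phi>3" and m: "matches (on_circle \<phi>1) (on_circle \<phi>3)"
    unfolding cauchy_solution_iff by blast
  define g where "g \<phi> = case_option (on_circle \<phi> 0) (\<lambda>s. on_circle \<phi> (ang s))" for \<phi>
  have c: "continuous_on UNIV (on_circle \<phi>)" if "dini (bd_zeta D) \<phi>" for \<phi>
    using that unfolding dini_on_circle_iff[symmetric]
    by (rule uniformly_continuous_imp_continuous[OF dini_imp_uniformly_continuous_on])
  have "g \<phi>1 \<in> C_Rbar" "g \<phi>3 \<in> C_Rbar"
    unfolding g_def
    by (rule C_Rbar_of_circle[OF on_circle_periodic c[OF d(1)]], rule C_Rbar_of_circle[OF on_circle_periodic c[OF d(2)]])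
  moreover have "solves_integral_system \<sigma> u1 u3 (g \<phi>1) (g \<phi>3)"
    using solves_integral_system_iff[of "on_circle \<phi>1" "on_circle \<phi>3" "g \<phi>1" "g \<phi>3" u1 u3,
        OF on_circle_periodic c[OF d(1)] on_circle_periodic c[OF d(2)]] m
    by (simp add: g_def matches_def on_circle_def)
  ultimately show "\<exists>g1\<in>C_Rbar. \<exists>g3\<in>C_Rbar. solves_integral_system \<sigma> u1 u3 g1 g3" by blast
qed

definition conjugate_solution where
  "conjugate_solution \<longleftrightarrow> (\<exists>\<Phi>. solves_13 D u1 u3 \<Phi> \<and> continuous_on (closure (D_zeta D)) \<Phi> \<and>
     (\<exists>\<Phi>s. solves_conj_24 D \<Phi> \<Phi>s \<and> dini (bd_zeta D) (\<lambda>\<zeta>. U1 (\<Phi>s \<zeta>)) \<and> dini (bd_zeta D) (\<lambda>\<zeta>. U3 (\<Phi>s \<zeta>))))"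

lemma complement_D_zeta: "mu - D_zeta D = zet ` (- D)" "mu - closure (D_zeta D) = zet ` (- closure D)"
  unfolding closure_D_zeta by (auto simp: mu_eq D_zeta_def)

lemma monogenic_on_zet_subset: "monogenic_on (zet ` X) f \<Longrightarrow> Y \<subseteq> X \<Longrightarrow> monogenic_on (zet ` Y) f"
  unfolding monogenic_on_zet_iff by blast

lemma conjugate_solution_if_cauchy_solution:
  assumes "cauchy_solution"
  shows "conjugate_solution"
proof -
  obtain \<phi>1 \<phi>3 where d: "dini (bd_zeta D) \<phi>1" "dini (bd_zeta D) \<phi>3" and m: "matches (on_circle \<phi>1) (on_circle \<phi>3)"
    using assms unfolding cauchy_solution_iff by blast
  let ?f1 = "on_circle \<phi>1" and ?f3 = "on_circle \<phi>3"
  have df: "dini UNIV ?f1" "dini UNIV ?f3" using d by (simp_all add: dini_on_circle_iff)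
  note facts = on_circle_periodic[of \<phi>1] on_circle_periodic[of \<phi>3] df
  note cont = dini_cont[where ?\<phi>1.0 = ?f1 and ?\<phi>3.0 = ?f3, OF facts]
  define \<Phi> where "\<Phi> = (\<lambda>\<zeta>. \<Psi>in ?f1 ?f3 (inv zet \<zeta>))"
  define \<Phi>s where "\<Phi>s = (\<lambda>\<zeta>. \<Psi>out ?f1 ?f3 (inv zet \<zeta>))"
  have \<Phi>: "\<Phi> (zet z) = \<Psi>in ?f1 ?f3 z" and \<Phi>s: "\<Phi>s (zet z) = \<Psi>out ?f1 ?f3 z" for z
    by (simp_all add: \<Phi>_def \<Phi>s_def inv_f_f[OF inj_zet])
  have jump: "\<Phi> (zet (S t)) - \<Phi>s (zet (S t)) = (of_real (?f1 t), of_real (?f3 t))" for t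
    unfolding \<Phi> \<Phi>s by (rule \<Psi>_jump[where ?\<phi>1.0 = ?f1 and ?\<phi>3.0 = ?f3, OF facts])
  have sol: "solves_13 D u1 u3 \<Phi>"
    using m by (subst solves_13_iff_matches[where ?\<phi>1.0 = ?f1 and ?\<phi>3.0 = ?f3, OF facts])
      (simp_all add: \<Phi> \<Psi>_eq_in[where ?\<phi>1.0 = ?f1 and ?\<phi>3.0 = ?f3, OF facts])
  have contin: "continuous_on (closure (D_zeta D)) \<Phi>"
    unfolding closure_D_zeta continuous_on_zet_image_iff \<Phi>
    by (rule continuous_on_\<Psi>in[where ?\<phi>1.0 = ?f1 and ?\<phi>3.0 = ?f3, OF facts])
  have "solves_conj_24 D \<Phi> \<Phi>s"
    unfolding solves_conj_24_def complement_D_zeta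
  proof (intro conjI)
    show "continuous_on (zet ` (- D)) \<Phi>s"
      unfolding continuous_on_zet_image_iff \<Phi>s by (rule continuous_on_\<Psi>out[where ?\<phi>1.0 = ?f1 and ?\<phi>3.0 = ?f3, OF facts])
    have "monogenic_on (zet ` (- closure D)) (\<lambda>\<zeta>. \<Psi> ?f1 ?f3 (inv zet \<zeta>))"
      using \<Psi>_monogenic[where ?\<phi>1.0 = ?f1 and ?\<phi>3.0 = ?f3, OF facts(1,2) cont] D_cases(2)
      unfolding monogenic_on_zet_iff by blast
    then show "monogenic_on (zet ` (- closure D)) \<Phi>s"
    proof (rule monogenic_on_cong[rotated 2])
      show "\<Psi> ?f1 ?f3 (inv zet (zet z)) = \<Phi>s (zet z)" if "z \<in> - closure D" for z
        using that by (simp add: inv_f_f[OF inj_zet] \<Phi>s \<Psi>_eq_out[where ?\<phi>1.0 = ?f1 and ?\<phi>3.0 = ?f3, OF facts])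
    qed (simp add: open_Compl)
    show "(\<Phi>s \<longlongrightarrow> 0) (inf at_infinity (principal mu))"
      unfolding tendsto_zet_infinity_iff
    proof (rule Lim_transform_eventually[OF \<Psi>_tendsto_0[where ?\<phi>1.0 = ?f1 and ?\<phi>3.0 = ?f3, OF facts]])
      obtain B where B: "\<And>z. z \<in> closure D \<Longrightarrow> norm z \<le> B"
        using bounded_closure[OF D(4)] unfolding bounded_iff by blast
      have "\<Psi> ?f1 ?f3 z = \<Phi>s (zet z)" if "B + 1 \<le> norm z" for z
        unfolding \<Phi>s using B[of z] that by (intro \<Psi>_eq_out[where ?\<phi>1.0 = ?f1 and ?\<phi>3.0 = ?f3, OF facts]) force
      then show "\<forall>\<^sub>F z in at_infinity. \<Psi> ?f1 ?f3 z = \<Phi>s (zet z)" unfolding eventually_at_infinity by blast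
    qed
    show "\<forall>\<zeta>\<in>bd_zeta D. U2 (\<Phi>s \<zeta>) = U2 (\<Phi> \<zeta>) \<and> U4 (\<Phi>s \<zeta>) = U4 (\<Phi> \<zeta>)"
    proof
      fix \<zeta> assume "\<zeta> \<in> bd_zeta D"
      then obtain t where t: "\<zeta> = zet (S t)" by (auto simp: bd_zeta_S)
      show "U2 (\<Phi>s \<zeta>) = U2 (\<Phi> \<zeta>) \<and> U4 (\<Phi>s \<zeta>) = U4 (\<Phi> \<zeta>)"
        using jump[of t] unfolding t U2_def U4_def by (auto simp: prod_eq_iff complex_eq_iff)
    qed
  qed
  \<comment> \<open>On the boundary \<open>\<Phi>s\<close> is \<open>\<Phi>\<close> minus the jump,
    so its first and third components are the data minus the densities; both of these satisfy the
    Dini condition.\<close>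
  moreover have U: "U1 (\<Phi>s (zet (S t))) = 1 * u1 (zet (S t)) + (-1) * \<phi>1 (zet (S t))"
    "U3 (\<Phi>s (zet (S t))) = 1 * u3 (zet (S t)) + (-1) * \<phi>3 (zet (S t))" for t
  proof -
    have "U1 (\<Phi> (zet (S t))) = u1 (zet (S t))" "U3 (\<Phi> (zet (S t))) = u3 (zet (S t))"
      using m U_\<Psi>in[where ?\<phi>1.0 = ?f1 and ?\<phi>3.0 = ?f3, OF facts, of t] by (simp_all add: \<Phi> matches_def on_circle_def)
    then show "U1 (\<Phi>s (zet (S t))) = 1 * u1 (zet (S t)) + (-1) * \<phi>1 (zet (S t))"
      "U3 (\<Phi>s (zet (S t))) = 1 * u3 (zet (S t)) + (-1) * \<phi>3 (zet (S t))"
      using jump[of t] by (auto simp: U1_def U3_def prod_eq_iff complex_eq_iff on_circle_def)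
  qed
  moreover have "dini (bd_zeta D) (\<lambda>\<zeta>. U1 (\<Phi>s \<zeta>))"
    by (rule dini_cong[OF dini_linear_combination[OF data(1) d(1), of 1 "-1"]]) (auto simp: bd_zeta_S U)
  moreover have "dini (bd_zeta D) (\<lambda>\<zeta>. U3 (\<Phi>s \<zeta>))"
    by (rule dini_cong[OF dini_linear_combination[OF data(2) d(2), of 1 "-1"]]) (auto simp: bd_zeta_S U)
  ultimately show ?thesis unfolding conjugate_solution_def using sol contin by blast
qed

text \<open>The differences between the given functions and the two branches of the Cauchy type integral of their
  jump glue to a function which vanishes by Liouville's theorem.\<close>

lemma cauchy_solution_if_conjugate_solution:
  assumes "conjugate_solution"
  shows "cauchy_solution"
proof -
  obtain \<Phi> \<Phi>s where sol: "solves_13 D u1 u3 \<Phi>" and contin: "continuous_on (closure (D_zeta D)) \<Phi>"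
    and conj: "solves_conj_24 D \<Phi> \<Phi>s" and dU: "dini (bd_zeta D) (\<lambda>\<zeta>. U1 (\<Phi>s \<zeta>))" "dini (bd_zeta D) (\<lambda>\<zeta>. U3 (\<Phi>s \<zeta>))"
    using assms unfolding conjugate_solution_def by blast
  define \<phi>1 where "\<phi>1 = (\<lambda>\<zeta>. 1 * u1 \<zeta> + (-1) * U1 (\<Phi>s \<zeta>))"
  define \<phi>3 where "\<phi>3 = (\<lambda>\<zeta>. 1 * u3 \<zeta> + (-1) * U3 (\<Phi>s \<zeta>))"
  have d: "dini (bd_zeta D) \<phi>1" "dini (bd_zeta D) \<phi>3"
    unfolding \<phi>1_def \<phi>3_def by (intro dini_linear_combination data dU)+
  let ?f1 = "on_circle \<phi>1" and ?f3 = "on_circle \<phi>3"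
  have df: "dini UNIV ?f1" "dini UNIV ?f3" using d by (simp_all add: dini_on_circle_iff)
  note facts = on_circle_periodic[of \<phi>1] on_circle_periodic[of \<phi>3] df
  note cont = dini_cont[where ?\<phi>1.0 = ?f1 and ?\<phi>3.0 = ?f3, OF facts]
  have c\<Phi>: "continuous_on (closure D) (\<lambda>z. \<Phi> (zet z))"
    using contin unfolding closure_D_zeta continuous_on_zet_image_iff .
  have c\<Phi>s: "continuous_on (- D) (\<lambda>z. \<Phi>s (zet z))"
    using conj unfolding solves_conj_24_def complement_D_zeta continuous_on_zet_image_iff by blast
  have U: "U1 (\<Phi> (zet (S t))) = u1 (zet (S t))" "U3 (\<Phi> (zet (S t))) = u3 (zet (S t))" for t
  proof -
    have "S t \<in> closure D" using D_cases(2) by blast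
    then have "((\<lambda>z. \<Phi> (zet z)) \<longlongrightarrow> \<Phi> (zet (S t))) (at (S t) within D)"
      using c\<Phi> closure_subset unfolding continuous_on_def by (meson tendsto_within_subset)
    from tendsto_U1[OF this] tendsto_U3[OF this]
    have "((\<lambda>z. U1 (\<Phi> (zet z))) \<longlongrightarrow> U1 (\<Phi> (zet (S t)))) (at (S t) within D)"
      "((\<lambda>z. U3 (\<Phi> (zet z))) \<longlongrightarrow> U3 (\<Phi> (zet (S t)))) (at (S t) within D)" .
    moreover have "((\<lambda>z. U1 (\<Phi> (zet z))) \<longlongrightarrow> u1 (zet (S t))) (at (S t) within D)"
      "((\<lambda>z. U3 (\<Phi> (zet z))) \<longlongrightarrow> u3 (zet (S t))) (at (S t) within D)"
      using sol unfolding solves_13_def D_zeta_def bd_zeta_S by (auto simp: tendsto_zet_within_iff)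
    ultimately show "U1 (\<Phi> (zet (S t))) = u1 (zet (S t))" "U3 (\<Phi> (zet (S t))) = u3 (zet (S t))"
      using tendsto_unique[OF S_islimpt] by blast+
  qed
  \<comment> \<open>The densities are chosen so that the real components of
    \<open>\<Phi> - \<Phi>s\<close> equal the jump of the Cauchy type integral; the imaginary
    components of \<open>\<Phi> - \<Phi>s\<close> vanish by the conjugated problem.\<close>
  have jump: "\<Phi> (zet (S t)) - \<Psi>in ?f1 ?f3 (S t) = \<Phi>s (zet (S t)) - \<Psi>out ?f1 ?f3 (S t)" for t
  proof -
    have "zet (S t) \<in> bd_zeta D" by (auto simp: bd_zeta_S)
    then have "U2 (\<Phi>s (zet (S t))) = U2 (\<Phi> (zet (S t)))" "U4 (\<Phi>s (zet (S t))) = U4 (\<Phi> (zet (S t)))"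
      using conj unfolding solves_conj_24_def by blast+
    then have "\<Phi> (zet (S t)) - \<Phi>s (zet (S t)) = (of_real (?f1 t), of_real (?f3 t))"
      using U[of t] by (auto simp: U1_def U2_def U3_def U4_def prod_eq_iff complex_eq_iff on_circle_def \<phi>1_def \<phi>3_def)
    also have "\<dots> = \<Psi>in ?f1 ?f3 (S t) - \<Psi>out ?f1 ?f3 (S t)"
      by (rule \<Psi>_jump[where ?\<phi>1.0 = ?f1 and ?\<phi>3.0 = ?f3, OF facts, symmetric])
    finally show ?thesis by (simp add: algebra_simps)
  qed
  \<comment> \<open>On the curve both branches have the same value, so \<open>W\<close> is
    continuous on each of the closed sets \<open>closure D\<close> and \<open>- D\<close>, and hence
    on the whole plane.\<close>
  define W where "W = (\<lambda>\<zeta>. if inv zet \<zeta> \<in> closure D then \<Phi> \<zeta> - \<Psi>in ?f1 ?f3 (inv zet \<zeta>) else \<Phi>s \<zeta> - \<Psi>out ?f1 ?f3 (inv zet \<zeta>))"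
  have W: "W (zet z) = (if z \<in> closure D then \<Phi> (zet z) - \<Psi>in ?f1 ?f3 z else \<Phi>s (zet z) - \<Psi>out ?f1 ?f3 z)" for z
    by (simp add: W_def inv_f_f[OF inj_zet])
  have Wout: "W (zet z) = \<Phi>s (zet z) - \<Psi>out ?f1 ?f3 z" if "z \<notin> D" for z
    using that jump D_cases(1)[of z] by (auto simp: W)
  have "W (zet z) = 0" for z
  proof (rule eq_0_if_monogenic_off_curve[of W "range S" S "2 * pi" M])
    have "continuous_on (closure D \<union> - D) (\<lambda>z. W (zet z))"
    proof (rule continuous_on_closed_Un)
      have "continuous_on (closure D) (\<lambda>z. \<Phi> (zet z) - \<Psi>in ?f1 ?f3 z)"
        by (intro continuous_intros c\<Phi> continuous_on_\<Psi>in[where ?\<phi>1.0 = ?f1 and ?\<phi>3.0 = ?f3, OF facts])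
      then show "continuous_on (closure D) (\<lambda>z. W (zet z))"
        by (rule continuous_on_eq) (simp add: W)
      have "continuous_on (- D) (\<lambda>z. \<Phi>s (zet z) - \<Psi>out ?f1 ?f3 z)"
        by (intro continuous_intros c\<Phi>s continuous_on_\<Psi>out[where ?\<phi>1.0 = ?f1 and ?\<phi>3.0 = ?f3, OF facts])
      then show "continuous_on (- D) (\<lambda>z. W (zet z))"
        by (rule continuous_on_eq) (simp add: Wout)
    qed (use D_open in auto)
    moreover have "closure D \<union> - D = UNIV" using closure_subset[of D] by auto
    ultimately show "continuous_on UNIV (\<lambda>z. W (zet z))" by simp
    have m\<Psi>: "monogenic_on (zet ` (- range S)) (\<lambda>\<zeta>. \<Psi> ?f1 ?f3 (inv zet \<zeta>))"
      by (rule \<Psi>_monogenic[where ?\<phi>1.0 = ?f1 and ?\<phi>3.0 = ?f3, OF facts(1,2) cont])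
    have sub: "D \<subseteq> - range S" "- closure D \<subseteq> - range S" using D_disjoint D_cases(2) by auto
    have m1: "monogenic_on (zet ` D) W"
    proof (rule monogenic_on_cong[OF D_open])
      show "monogenic_on (zet ` D) (\<lambda>\<zeta>. \<Phi> \<zeta> - \<Psi> ?f1 ?f3 (inv zet \<zeta>))"
        by (rule monogenic_on_diff[OF _ monogenic_on_zet_subset[OF m\<Psi> sub(1)]])
           (use sol in \<open>simp add: solves_13_def D_zeta_def\<close>)
      show "\<Phi> (zet z) - \<Psi> ?f1 ?f3 (inv zet (zet z)) = W (zet z)" if "z \<in> D" for z
        using that closure_subset[of D] by (auto simp: W inv_f_f[OF inj_zet] \<Psi>_eq_in[where ?\<phi>1.0 = ?f1 and ?\<phi>3.0 = ?f3, OF facts])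
    qed
    have m2: "monogenic_on (zet ` (- closure D)) W"
    proof (rule monogenic_on_cong)
      show "monogenic_on (zet ` (- closure D)) (\<lambda>\<zeta>. \<Phi>s \<zeta> - \<Psi> ?f1 ?f3 (inv zet \<zeta>))"
        by (rule monogenic_on_diff[OF _ monogenic_on_zet_subset[OF m\<Psi> sub(2)]])
           (use conj in \<open>simp add: solves_conj_24_def complement_D_zeta\<close>)
      show "\<Phi>s (zet z) - \<Psi> ?f1 ?f3 (inv zet (zet z)) = W (zet z)" if "z \<in> - closure D" for z
        using that by (auto simp: W inv_f_f[OF inj_zet] \<Psi>_eq_out[where ?\<phi>1.0 = ?f1 and ?\<phi>3.0 = ?f3, OF facts])
    qed (simp add: open_Compl)
    have "- range S = D \<union> - closure D" using sub D_cases(1) by blast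
    then show "monogenic_on (zet ` (- range S)) W" using m1 m2 unfolding monogenic_on_zet_iff by (metis UnE)
    show "range S = S ` {0..2 * pi}" by (rule dini_curve.range_S[OF dini_curve_axioms])
    show "M-lipschitz_on {0..2 * pi} S"
      by (rule lipschitz_onI) (use S_upper M_pos in \<open>auto simp: dist_norm\<close>)
    have "((\<lambda>z. \<Phi>s (zet z) - \<Psi> ?f1 ?f3 z) \<longlongrightarrow> 0 - 0) at_infinity"
      by (intro tendsto_diff \<Psi>_tendsto_0[where ?\<phi>1.0 = ?f1 and ?\<phi>3.0 = ?f3, OF facts])
         (use conj in \<open>auto simp: solves_conj_24_def tendsto_zet_infinity_iff\<close>)
    then have "((\<lambda>z. \<Phi>s (zet z) - \<Psi> ?f1 ?f3 z) \<longlongrightarrow> 0) at_infinity" by simp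
    then show "((\<lambda>z. W (zet z)) \<longlongrightarrow> 0) at_infinity"
    proof (rule Lim_transform_eventually)
      obtain B where B: "\<And>z. z \<in> closure D \<Longrightarrow> norm z \<le> B"
        using bounded_closure[OF D(4)] unfolding bounded_iff by blast
      have "\<Phi>s (zet z) - \<Psi> ?f1 ?f3 z = W (zet z)" if "B + 1 \<le> norm z" for z
      proof -
        have "z \<notin> closure D" using B[of z] that by force
        then show ?thesis by (simp add: W \<Psi>_eq_out[where ?\<phi>1.0 = ?f1 and ?\<phi>3.0 = ?f3, OF facts])
      qed
      then show "\<forall>\<^sub>F z in at_infinity. \<Phi>s (zet z) - \<Psi> ?f1 ?f3 z = W (zet z)" unfolding eventually_at_infinity by blast
    qed
  qed simp
  then have "\<Phi> (zet z) = \<Psi> ?f1 ?f3 z" if "z \<in> D" for z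
    using that closure_subset[of D] W[of z] by (auto simp: \<Psi>_eq_in[where ?\<phi>1.0 = ?f1 and ?\<phi>3.0 = ?f3, OF facts])
  then have "\<forall>\<zeta>\<in>D_zeta D. \<Phi> \<zeta> = cauchy_type_integral \<gamma> \<phi>1 \<phi>3 \<zeta>"
    using cauchy_eq[OF d] by (auto simp: D_zeta_def)
  then show ?thesis unfolding cauchy_solution_def using sol d by blast
qed

end

theorem theorem7p5:
  fixes D :: "complex set"
    and \<gamma> :: "real \<Rightarrow> complex"
    and \<sigma> \<sigma>' :: "complex \<Rightarrow> complex"
    and u1 u3 :: "biharm \<Rightarrow> real"
  assumes domain: "open D" "connected D" "D \<noteq> {}" "bounded D"
    and curve: "smooth_jordan_curve \<gamma>" "positively_oriented_boundary D \<gamma>"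
    and conformal: "conformal_disk_map D \<sigma>"
    and contour_derivative:
      "\<And>T. T \<in> sphere 0 1 \<Longrightarrow> (\<sigma> has_field_derivative \<sigma>' T) (at T within sphere 0 1)"
      "continuous_on (sphere 0 1) \<sigma>'"
      "\<And>T. T \<in> sphere 0 1 \<Longrightarrow> \<sigma>' T \<noteq> 0"
    and log_dini:
      "(\<integral>\<^sup>+\<eta>\<in>{0<..2}. (modulus (sphere 0 1) \<sigma>' \<eta> / ennreal \<eta> * ennreal (ln (3 / \<eta>))) \<partial>lborel) < \<infinity>"
    and data: "dini (bd_zeta D) u1" "dini (bd_zeta D) u3"
  shows
    "((\<exists>g1\<in>C_Rbar. \<exists>g3\<in>C_Rbar. solves_integral_system \<sigma> u1 u3 g1 g3)
        \<longleftrightarrow>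
      (\<exists>\<Phi> \<phi>1 \<phi>3. solves_13 D u1 u3 \<Phi> \<and>
         dini (bd_zeta D) \<phi>1 \<and> dini (bd_zeta D) \<phi>3 \<and>
         (\<forall>\<zeta>\<in>D_zeta D. \<Phi> \<zeta> = cauchy_type_integral \<gamma> \<phi>1 \<phi>3 \<zeta>)))
     \<and>
     ((\<exists>\<Phi> \<phi>1 \<phi>3. solves_13 D u1 u3 \<Phi> \<and>
         dini (bd_zeta D) \<phi>1 \<and> dini (bd_zeta D) \<phi>3 \<and>
         (\<forall>\<zeta>\<in>D_zeta D. \<Phi> \<zeta> = cauchy_type_integral \<gamma> \<phi>1 \<phi>3 \<zeta>))
        \<longleftrightarrow>
      (\<exists>\<Phi>. solves_13 D u1 u3 \<Phi> \<and> continuous_on (closure (D_zeta D)) \<Phi> \<and>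
         (\<exists>\<Phi>s. solves_conj_24 D \<Phi> \<Phi>s \<and>
            dini (bd_zeta D) (\<lambda>\<zeta>. U1 (\<Phi>s \<zeta>)) \<and>
            dini (bd_zeta D) (\<lambda>\<zeta>. U3 (\<Phi>s \<zeta>)))))"
proof -
  obtain \<rho> where "homeomorphism (cball 0 1) (closure D) \<sigma> \<rho>"
    using conformal unfolding conformal_disk_map_def by blast
  with assms interpret boundary_problem D \<sigma> \<sigma>' \<rho> \<gamma> u1 u3
    by unfold_locales (auto simp: conformal_disk_map_def)
  show ?thesis
    using integral_system_iff_cauchy_solution conjugate_solution_if_cauchy_solution cauchy_solution_if_conjugate_solution
    unfolding cauchy_solution_def conjugate_solution_def by blast
qed

end
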